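(* Let $k\ge 1$, and let $\mathcal{D}$ be a finitely cocomplete pointed category with finite products. Then the $k$-dimensional Segal construction $S_{\oplus}^{\langle k\rangle}(\mathcal{D})$ is a lower $(2k-1)$-Segal category. In particular, $S_{\oplus}^{\langle k\rangle}(\mathcal{D})$ is fully $2k$-Segal.
   Context: **Higher Segal conditions.** Let $[n]=\{0,1,\dots,n\}$ and $I\subseteq [n]$. A gap of $I$ is an element $j\in[n]\setminus I$; it is even (resp. odd) if $\#\{i\in I\mid i>j\}$ is even (resp. odd). $I$ is called even (resp. odd) if all its gaps are even (resp. odd). For $n\ge d\ge 0$, let $\mathcal{L}([n],d)$ (resp. $\mathcal{U}([n],d)$) be the poset, under inclusion, of all nonempty subsets $J\subseteq[n]$ contained in some even (resp. odd) subset $I\subseteq[n]$ with $\#I=d+1$. For a simplicial object $X$ and a nonempty finite linearly ordered set $I$, write $X_I$ for the value of $X$ on $I$ (so $X_I\cong X_{\#I-1}$). $X$ is lower $d$-Segal if for every $n\ge d$ the natural map $X_n\to\varprojlim_{I\in\mathcal{L}([n],d)}X_I$ is an equivalence; upper $d$-Segal if for every $n\ge d$ the natural map $X_n\to\varprojlim_{I\in\mathcal{U}([n],d)}X_I$ is an equivalence; fully $d$-Segal if both hold. A lower/upper/fully $d$-Segal category is a simplicial object in small categories with this property, where equivalence means equivalence of categories and limits are taken in the homotopy-invariant sense (pseudo-limits of categories). **Segal construction.** Let $\mathcal{D}$ be a pointed category with finite products. For a finite pointed set $T$, let $\mathcal{P}(T)$ be the poset of pointed subsets of $T$. A functor $\mathcal{F}:\mathcal{P}(T)^{\mathrm{op}}\to\mathcal{D}$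 is a sheaf if for every pointed subset $U\subseteq T$ the canonical map $\mathcal{F}(U)\to\prod_{u\in U\setminus\{*\}}\mathcal{F}(\{*,u\})$ is an isomorphism; $\mathrm{Sh}(T,\mathcal{D})$ is the full subcategory of such presheaves. A pointed map $\rho:T\to T'$ induces $\rho^{\times}:\mathcal{P}(T')\to\mathcal{P}(T)$, $U\mapsto\rho^{-1}(U\setminus\{*\})\amalg\{*\}$, and $\rho_*:\mathrm{Sh}(T,\mathcal{D})\to\mathrm{Sh}(T',\mathcal{D})$, $\mathcal{F}\mapsto\mathcal{F}\circ\rho^{\times}$, making $\mathrm{Sh}(-,\mathcal{D})$ a covariant functor from finite pointed sets to small categories. For $k\ge1$ let $S^k=\Delta^k/\partial\Delta^k$, viewed as a simplicial finite pointed set. The $k$-dimensional Segal construction is the simplicial category $S_{\oplus}^{\langle k\rangle}(\mathcal{D})=\mathrm{Sh}(S^k,\mathcal{D})$, with $n$-cells $\mathrm{Sh}(S^k_n,\mathcal{D})$. *)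

theory Defs
  imports Main "HOL-Library.FuncSet"
begin

section \<open>Categories, functors, natural transformations\<close>

text \<open>
  A category has explicit carrier sets of objects and arrows, so it is automatically small.
  \<open>Comp C g f\<close> is the composite "\<open>g\<close> after \<open>f\<close>".
\<close>

record ('o, 'a) cat =
  Obj :: "'o set"
  Arr :: "'a set"
  Dom :: "'a \<Rightarrow> 'o"
  Cod :: "'a \<Rightarrow> 'o"
  Ident :: "'o \<Rightarrow> 'a"
  Comp :: "'a \<Rightarrow> 'a \<Rightarrow> 'a"

definition hom :: "('o, 'a) cat \<Rightarrow> 'o \<Rightarrow> 'o \<Rightarrow> 'a set" where
  "hom C x y = {f \<in> Arr C. Dom C f = x \<and> Cod C f = y}"

locale category =
  fixes C :: "('o, 'a) cat"
  assumes Dom_in: "f \<in> Arr C \<Longrightarrow> Dom C f \<in> Obj C"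
    and Cod_in: "f \<in> Arr C \<Longrightarrow> Cod C f \<in> Obj C"
    and Ident_in: "x \<in> Obj C \<Longrightarrow> Ident C x \<in> hom C x x"
    and Comp_in: "\<lbrakk>f \<in> Arr C; g \<in> Arr C; Dom C g = Cod C f\<rbrakk>
      \<Longrightarrow> Comp C g f \<in> hom C (Dom C f) (Cod C g)"
    and Comp_Ident_right: "f \<in> Arr C \<Longrightarrow> Comp C f (Ident C (Dom C f)) = f"
    and Comp_Ident_left: "f \<in> Arr C \<Longrightarrow> Comp C (Ident C (Cod C f)) f = f"
    and Comp_assoc: "\<lbrakk>f \<in> Arr C; g \<in> Arr C; h \<in> Arr C; Dom C g = Cod C f; Dom C h = Cod C g\<rbrakk>
      \<Longrightarrow> Comp C h (Comp C g f) = Comp C (Comp C h g) f"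

definition is_iso :: "('o, 'a) cat \<Rightarrow> 'a \<Rightarrow> bool" where
  "is_iso C f \<longleftrightarrow> f \<in> Arr C \<and>
     (\<exists>g \<in> hom C (Cod C f) (Dom C f).
        Comp C g f = Ident C (Dom C f) \<and> Comp C f g = Ident C (Cod C f))"

definition op_cat :: "('o, 'a) cat \<Rightarrow> ('o, 'a) cat" where
  "op_cat C = \<lparr>Obj = Obj C, Arr = Arr C, Dom = Cod C, Cod = Dom C, Ident = Ident C,
     Comp = (\<lambda>g f. Comp C f g)\<rparr>"

definition full_subcat :: "('o, 'a) cat \<Rightarrow> ('o \<Rightarrow> bool) \<Rightarrow> ('o, 'a) cat" where
  "full_subcat C P = C\<lparr>Obj := {x \<in> Obj C. P x}, Arr := {f \<in> Arr C. P (Dom C f) \<and> P (Cod C f)}\<rparr>"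

text \<open>The poset of sets \<open>P\<close> under inclusion; the arrow \<open>U \<subseteq> V\<close> is the pair \<open>(U, V)\<close>.\<close>

definition subset_cat :: "'x set set \<Rightarrow> ('x set, 'x set \<times> 'x set) cat" where
  "subset_cat P = \<lparr>Obj = P, Arr = {(U, V). U \<in> P \<and> V \<in> P \<and> U \<subseteq> V}, Dom = fst, Cod = snd,
     Ident = (\<lambda>U. (U, U)), Comp = (\<lambda>g f. (fst f, snd g))\<rparr>"

text \<open>
  The maps of a functor are extensional (\<^term>\<open>undefined\<close> outside the carriers), so that equality
  of functors in HOL is equality of functors; likewise for natural transformations.
\<close>

record ('o, 'a, 'p, 'b) fctr =
  omap :: "'o \<Rightarrow> 'p"
  amap :: "'a \<Rightarrow> 'b"

definition is_functor :: "('o, 'a) cat \<Rightarrow> ('p, 'b) cat \<Rightarrow> ('o, 'a, 'p, 'b) fctr \<Rightarrow> bool" where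
  "is_functor C D F \<longleftrightarrow> category C \<and> category D \<and>
     omap F \<in> Obj C \<rightarrow>\<^sub>E Obj D \<and> amap F \<in> Arr C \<rightarrow>\<^sub>E Arr D \<and>
     (\<forall>f \<in> Arr C. amap F f \<in> hom D (omap F (Dom C f)) (omap F (Cod C f))) \<and>
     (\<forall>x \<in> Obj C. amap F (Ident C x) = Ident D (omap F x)) \<and>
     (\<forall>f \<in> Arr C. \<forall>g \<in> Arr C. Dom C g = Cod C f \<longrightarrow>
        amap F (Comp C g f) = Comp D (amap F g) (amap F f))"

definition id_fctr :: "('o, 'a) cat \<Rightarrow> ('o, 'a, 'o, 'a) fctr" where
  "id_fctr C = \<lparr>omap = restrict id (Obj C), amap = restrict id (Arr C)\<rparr>"

text \<open>\<open>comp_fctr C G F\<close> is "\<open>G\<close> after \<open>F\<close>", where \<open>C\<close> is the source of \<open>F\<close>.\<close>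

definition comp_fctr ::
  "('o, 'a) cat \<Rightarrow> ('p, 'b, 'q, 'c) fctr \<Rightarrow> ('o, 'a, 'p, 'b) fctr \<Rightarrow> ('o, 'a, 'q, 'c) fctr" where
  "comp_fctr C G F = \<lparr>omap = compose (Obj C) (omap G) (omap F), amap = compose (Arr C) (amap G) (amap F)\<rparr>"

definition nat_trans ::
  "('o, 'a) cat \<Rightarrow> ('p, 'b) cat \<Rightarrow> ('o, 'a, 'p, 'b) fctr \<Rightarrow> ('o, 'a, 'p, 'b) fctr \<Rightarrow> ('o \<Rightarrow> 'b) \<Rightarrow> bool"
where
  "nat_trans C D F G \<eta> \<longleftrightarrow> is_functor C D F \<and> is_functor C D G \<and>
     \<eta> \<in> (\<Pi>\<^sub>E x \<in> Obj C. hom D (omap F x) (omap G x)) \<and>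
     (\<forall>f \<in> Arr C. Comp D (\<eta> (Cod C f)) (amap F f) = Comp D (amap G f) (\<eta> (Dom C f)))"

definition naturally_isomorphic ::
  "('o, 'a) cat \<Rightarrow> ('p, 'b) cat \<Rightarrow> ('o, 'a, 'p, 'b) fctr \<Rightarrow> ('o, 'a, 'p, 'b) fctr \<Rightarrow> bool" where
  "naturally_isomorphic C D F G \<longleftrightarrow> (\<exists>\<eta>. nat_trans C D F G \<eta> \<and> (\<forall>x \<in> Obj C. is_iso D (\<eta> x)))"

definition is_equivalence :: "('o, 'a) cat \<Rightarrow> ('p, 'b) cat \<Rightarrow> ('o, 'a, 'p, 'b) fctr \<Rightarrow> bool" where
  "is_equivalence C D F \<longleftrightarrow> is_functor C D F \<and>
     (\<exists>G. is_functor D C G \<and>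
        naturally_isomorphic C C (id_fctr C) (comp_fctr C G F) \<and>
        naturally_isomorphic D D (comp_fctr D F G) (id_fctr D))"

definition functor_cat ::
  "('o, 'a) cat \<Rightarrow> ('p, 'b) cat \<Rightarrow>
   (('o, 'a, 'p, 'b) fctr, ('o, 'a, 'p, 'b) fctr \<times> ('o, 'a, 'p, 'b) fctr \<times> ('o \<Rightarrow> 'b)) cat" where
  "functor_cat C D = \<lparr>
     Obj = {F. is_functor C D F},
     Arr = {(F, G, \<eta>). nat_trans C D F G \<eta>},
     Dom = (\<lambda>(F, G, \<eta>). F),
     Cod = (\<lambda>(F, G, \<eta>). G),
     Ident = (\<lambda>F. (F, F, \<lambda>x \<in> Obj C. Ident D (omap F x))),
     Comp = (\<lambda>(G', H, \<theta>) (F, G, \<eta>). (F, H, \<lambda>x \<in> Obj C. Comp D (\<theta> x) (\<eta> x)))\<rparr>"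

text \<open>The (1-)category of small categories and functors.\<close>

definition Cat :: "(('o, 'a) cat, ('o, 'a) cat \<times> ('o, 'a) cat \<times> ('o, 'a, 'o, 'a) fctr) cat" where
  "Cat = \<lparr>
     Obj = {C. category C},
     Arr = {(C, D, F). is_functor C D F},
     Dom = (\<lambda>(C, D, F). C),
     Cod = (\<lambda>(C, D, F). D),
     Ident = (\<lambda>C. (C, C, id_fctr C)),
     Comp = (\<lambda>(D', E, G) (C, D, F). (C, E, comp_fctr C G F))\<rparr>"

text \<open>The underlying functor of an arrow of \<^term>\<open>Cat\<close>.\<close>

abbreviation fctr_of ::
  "('o, 'a) cat \<times> ('o, 'a) cat \<times> ('o, 'a, 'o, 'a) fctr \<Rightarrow> ('o, 'a, 'o, 'a) fctr" where
  "fctr_of u \<equiv> snd (snd u)"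


section \<open>Limits and colimits\<close>

definition is_product ::
  "('o, 'a) cat \<Rightarrow> 'i set \<Rightarrow> ('i \<Rightarrow> 'o) \<Rightarrow> 'o \<Rightarrow> ('i \<Rightarrow> 'a) \<Rightarrow> bool" where
  "is_product C I x p \<pi> \<longleftrightarrow> p \<in> Obj C \<and> (\<forall>i \<in> I. \<pi> i \<in> hom C p (x i)) \<and>
     (\<forall>q \<in> Obj C. \<forall>f. (\<forall>i \<in> I. f i \<in> hom C q (x i)) \<longrightarrow>
        (\<exists>!h. h \<in> hom C q p \<and> (\<forall>i \<in> I. Comp C (\<pi> i) h = f i)))"

definition has_finite_products :: "('o, 'a) cat \<Rightarrow> bool" where
  "has_finite_products C \<longleftrightarrow>
     (\<forall>(I :: nat set) x. finite I \<and> x \<in> I \<rightarrow> Obj C \<longrightarrow> (\<exists>p \<pi>. is_product C I x p \<pi>))"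

definition is_cocone ::
  "('i, 'u) cat \<Rightarrow> ('o, 'a) cat \<Rightarrow> ('i, 'u, 'o, 'a) fctr \<Rightarrow> 'o \<Rightarrow> ('i \<Rightarrow> 'a) \<Rightarrow> bool" where
  "is_cocone J C F c \<iota> \<longleftrightarrow> c \<in> Obj C \<and> (\<forall>i \<in> Obj J. \<iota> i \<in> hom C (omap F i) c) \<and>
     (\<forall>u \<in> Arr J. Comp C (\<iota> (Cod J u)) (amap F u) = \<iota> (Dom J u))"

definition is_colimit ::
  "('i, 'u) cat \<Rightarrow> ('o, 'a) cat \<Rightarrow> ('i, 'u, 'o, 'a) fctr \<Rightarrow> 'o \<Rightarrow> ('i \<Rightarrow> 'a) \<Rightarrow> bool" where
  "is_colimit J C F c \<iota> \<longleftrightarrow> is_cocone J C F c \<iota> \<and>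
     (\<forall>d \<kappa>. is_cocone J C F d \<kappa> \<longrightarrow>
        (\<exists>!h. h \<in> hom C c d \<and> (\<forall>i \<in> Obj J. Comp C h (\<iota> i) = \<kappa> i)))"

text \<open>
  Every finite category is isomorphic to one whose objects and arrows are natural numbers, so no
  finite diagram shape is excluded.
\<close>

definition finitely_cocomplete :: "('o, 'a) cat \<Rightarrow> bool" where
  "finitely_cocomplete C \<longleftrightarrow>
     (\<forall>(J :: (nat, nat) cat) F. finite (Obj J) \<and> finite (Arr J) \<and> is_functor J C F \<longrightarrow>
        (\<exists>c \<iota>. is_colimit J C F c \<iota>))"

definition is_zero_object :: "('o, 'a) cat \<Rightarrow> 'o \<Rightarrow> bool" where
  "is_zero_object C z \<longleftrightarrow> z \<in> Obj C \<and>
     (\<forall>x \<in> Obj C. (\<exists>!f. f \<in> hom C z x) \<and> (\<exists>!f. f \<in> hom C x z))"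

definition pointed_category :: "('o, 'a) cat \<Rightarrow> bool" where
  "pointed_category C \<longleftrightarrow> category C \<and> (\<exists>z. is_zero_object C z)"

text \<open>
  The pseudo-limit of a functor \<open>G\<close> from \<open>I\<close> to \<^term>\<open>Cat\<close>: an object is a family
  \<open>x i\<close> in \<open>G i\<close> together with isomorphisms \<open>\<phi> u : G u (x i) \<rightarrow> x j\<close> for \<open>u : i \<rightarrow> j\<close>, coherent
  with respect to identities and composition; an arrow is a family of arrows \<open>x i \<rightarrow> y i\<close>
  commuting with these isomorphisms.
\<close>

definition pslim_object ::
  "('i, 'u) cat \<Rightarrow> ('i, 'u, ('o, 'a) cat, ('o, 'a) cat \<times> ('o, 'a) cat \<times> ('o, 'a, 'o, 'a) fctr) fctr \<Rightarrow>
   ('i \<Rightarrow> 'o) \<times> ('u \<Rightarrow> 'a) \<Rightarrow> bool" where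
  "pslim_object I G = (\<lambda>(x, \<phi>).
     x \<in> (\<Pi>\<^sub>E i \<in> Obj I. Obj (omap G i)) \<and>
     \<phi> \<in> (\<Pi>\<^sub>E u \<in> Arr I. hom (omap G (Cod I u))
            (omap (fctr_of (amap G u)) (x (Dom I u))) (x (Cod I u))) \<and>
     (\<forall>u \<in> Arr I. is_iso (omap G (Cod I u)) (\<phi> u)) \<and>
     (\<forall>i \<in> Obj I. \<phi> (Ident I i) = Ident (omap G i) (x i)) \<and>
     (\<forall>u \<in> Arr I. \<forall>v \<in> Arr I. Dom I v = Cod I u \<longrightarrow>
        \<phi> (Comp I v u) = Comp (omap G (Cod I v)) (\<phi> v) (amap (fctr_of (amap G v)) (\<phi> u))))"

definition pslim_arrow ::
  "('i, 'u) cat \<Rightarrow> ('i, 'u, ('o, 'a) cat, ('o, 'a) cat \<times> ('o, 'a) cat \<times> ('o, 'a, 'o, 'a) fctr) fctr \<Rightarrow>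
   ('i \<Rightarrow> 'o) \<times> ('u \<Rightarrow> 'a) \<Rightarrow> ('i \<Rightarrow> 'o) \<times> ('u \<Rightarrow> 'a) \<Rightarrow> ('i \<Rightarrow> 'a) \<Rightarrow> bool" where
  "pslim_arrow I G = (\<lambda>(x, \<phi>) (y, \<psi>) f.
     f \<in> (\<Pi>\<^sub>E i \<in> Obj I. hom (omap G i) (x i) (y i)) \<and>
     (\<forall>u \<in> Arr I. Comp (omap G (Cod I u)) (f (Cod I u)) (\<phi> u) =
        Comp (omap G (Cod I u)) (\<psi> u) (amap (fctr_of (amap G u)) (f (Dom I u)))))"

definition pseudo_limit ::
  "('i, 'u) cat \<Rightarrow> ('i, 'u, ('o, 'a) cat, ('o, 'a) cat \<times> ('o, 'a) cat \<times> ('o, 'a, 'o, 'a) fctr) fctr \<Rightarrow>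
   (('i \<Rightarrow> 'o) \<times> ('u \<Rightarrow> 'a),
    (('i \<Rightarrow> 'o) \<times> ('u \<Rightarrow> 'a)) \<times> (('i \<Rightarrow> 'o) \<times> ('u \<Rightarrow> 'a)) \<times> ('i \<Rightarrow> 'a)) cat" where
  "pseudo_limit I G = \<lparr>
     Obj = {X. pslim_object I G X},
     Arr = {(X, Y, f). pslim_object I G X \<and> pslim_object I G Y \<and> pslim_arrow I G X Y f},
     Dom = (\<lambda>(X, Y, f). X),
     Cod = (\<lambda>(X, Y, f). Y),
     Ident = (\<lambda>X. (X, X, \<lambda>i \<in> Obj I. Ident (omap G i) (fst X i))),
     Comp = (\<lambda>(Y', Z, g) (X, Y, f). (X, Z, \<lambda>i \<in> Obj I. Comp (omap G i) (g i) (f i)))\<rparr>"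

text \<open>
  The functor from \<open>C\<close> to the pseudo-limit of \<open>G\<close> induced by a strictly commuting cone \<open>p\<close>: the
  structure isomorphisms of an object in its image are identities.
\<close>

definition pslim_comparison ::
  "('i, 'u) cat \<Rightarrow> ('i, 'u, ('o, 'a) cat, ('o, 'a) cat \<times> ('o, 'a) cat \<times> ('o, 'a, 'o, 'a) fctr) fctr \<Rightarrow>
   ('o, 'a) cat \<Rightarrow> ('i \<Rightarrow> ('o, 'a, 'o, 'a) fctr) \<Rightarrow>
   ('o, 'a, ('i \<Rightarrow> 'o) \<times> ('u \<Rightarrow> 'a),
    (('i \<Rightarrow> 'o) \<times> ('u \<Rightarrow> 'a)) \<times> (('i \<Rightarrow> 'o) \<times> ('u \<Rightarrow> 'a)) \<times> ('i \<Rightarrow> 'a)) fctr" where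
  "pslim_comparison I G C p =
     (let ob = (\<lambda>c. (\<lambda>i \<in> Obj I. omap (p i) c,
                     \<lambda>u \<in> Arr I. Ident (omap G (Cod I u)) (omap (p (Cod I u)) c)))
      in \<lparr>omap = restrict ob (Obj C),
          amap = (\<lambda>f \<in> Arr C. (ob (Dom C f), ob (Cod C f), \<lambda>i \<in> Obj I. amap (p i) f))\<rparr>)"


section \<open>Simplicial categories and the higher Segal conditions\<close>

text \<open>The object \<open>n\<close> stands for the ordinal \<open>{0, \<dots>, n}\<close>.\<close>

definition Delta :: "(nat, nat \<times> nat \<times> (nat \<Rightarrow> nat)) cat" where
  "Delta = \<lparr>
     Obj = UNIV,
     Arr = {(m, n, \<theta>). \<theta> \<in> {..m} \<rightarrow>\<^sub>E {..n} \<and> mono_on {..m} \<theta>},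
     Dom = (\<lambda>(m, n, \<theta>). m),
     Cod = (\<lambda>(m, n, \<theta>). n),
     Ident = (\<lambda>n. (n, n, restrict id {..n})),
     Comp = (\<lambda>(m', n, \<theta>) (l, m, \<phi>). (l, n, compose {..l} \<theta> \<phi>))\<rparr>"

type_synonym ('o, 'a) simpl_cat =
  "(nat, nat \<times> nat \<times> (nat \<Rightarrow> nat),
    ('o, 'a) cat, ('o, 'a) cat \<times> ('o, 'a) cat \<times> ('o, 'a, 'o, 'a) fctr) fctr"

definition simplicial_category :: "('o, 'a) simpl_cat \<Rightarrow> bool" where
  "simplicial_category X \<longleftrightarrow> is_functor (op_cat Delta) Cat X"

text \<open>
  For finite nonempty sets \<open>J \<subseteq> K\<close> of naturals, the monotone map
  \<open>[#J - 1] \<cong> J \<subseteq> K \<cong> [#K - 1]\<close>: it sends \<open>i\<close> to the position in \<open>K\<close> of the \<open>i\<close>-th element of \<open>J\<close>.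
\<close>

definition face_arrow :: "nat set \<Rightarrow> nat set \<Rightarrow> nat \<times> nat \<times> (nat \<Rightarrow> nat)" where
  "face_arrow J K = (card J - 1, card K - 1,
     \<lambda>i \<in> {..card J - 1}. card {y \<in> K. y < sorted_list_of_set J ! i})"

text \<open>
  For a set \<open>P\<close> of finite nonempty sets of naturals, the functor from \<open>P\<close> (opposite of inclusion) to
  (opposite) \<^term>\<open>Delta\<close> whose composite with \<open>X\<close> is the diagram of the \<open>X_J\<close>, \<open>J \<in> P\<close>.
\<close>

definition face_fctr ::
  "nat set set \<Rightarrow> (nat set, nat set \<times> nat set, nat, nat \<times> nat \<times> (nat \<Rightarrow> nat)) fctr" where
  "face_fctr P = \<lparr>omap = (\<lambda>J \<in> P. card J - 1),
     amap = (\<lambda>(J, K) \<in> Arr (subset_cat P). face_arrow J K)\<rparr>"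

definition segal_condition :: "('o, 'a) simpl_cat \<Rightarrow> nat \<Rightarrow> nat set set \<Rightarrow> bool" where
  "segal_condition X n P =
     (let I = op_cat (subset_cat P); G = comp_fctr I X (face_fctr P)
      in is_equivalence (omap X n) (pseudo_limit I G)
           (pslim_comparison I G (omap X n) (\<lambda>J. fctr_of (amap X (face_arrow J {..n})))))"

definition even_subset :: "nat \<Rightarrow> nat set \<Rightarrow> bool" where
  "even_subset n I \<longleftrightarrow> I \<subseteq> {..n} \<and> (\<forall>j \<in> {..n} - I. even (card {i \<in> I. i > j}))"

definition odd_subset :: "nat \<Rightarrow> nat set \<Rightarrow> bool" where
  "odd_subset n I \<longleftrightarrow> I \<subseteq> {..n} \<and> (\<forall>j \<in> {..n} - I. odd (card {i \<in> I. i > j}))"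

definition lower_poset :: "nat \<Rightarrow> nat \<Rightarrow> nat set set" where
  "lower_poset n d = {J. J \<noteq> {} \<and> (\<exists>I. even_subset n I \<and> card I = d + 1 \<and> J \<subseteq> I)}"

definition upper_poset :: "nat \<Rightarrow> nat \<Rightarrow> nat set set" where
  "upper_poset n d = {J. J \<noteq> {} \<and> (\<exists>I. odd_subset n I \<and> card I = d + 1 \<and> J \<subseteq> I)}"

definition lower_segal_category :: "nat \<Rightarrow> ('o, 'a) simpl_cat \<Rightarrow> bool" where
  "lower_segal_category d X \<longleftrightarrow>
     simplicial_category X \<and> (\<forall>n \<ge> d. segal_condition X n (lower_poset n d))"

definition upper_segal_category :: "nat \<Rightarrow> ('o, 'a) simpl_cat \<Rightarrow> bool" where
  "upper_segal_category d X \<longleftrightarrow>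
     simplicial_category X \<and> (\<forall>n \<ge> d. segal_condition X n (upper_poset n d))"

definition fully_segal_category :: "nat \<Rightarrow> ('o, 'a) simpl_cat \<Rightarrow> bool" where
  "fully_segal_category d X \<longleftrightarrow> lower_segal_category d X \<and> upper_segal_category d X"


section \<open>Finite pointed sets and the simplicial sphere\<close>

text \<open>A pointed set is a pair of its carrier and its base point.\<close>

definition FinSet_ptd ::
  "('t set \<times> 't, ('t set \<times> 't) \<times> ('t set \<times> 't) \<times> ('t \<Rightarrow> 't)) cat" where
  "FinSet_ptd = \<lparr>
     Obj = {T. finite (fst T) \<and> snd T \<in> fst T},
     Arr = {(S, T, \<rho>). finite (fst S) \<and> snd S \<in> fst S \<and> finite (fst T) \<and> snd T \<in> fst T \<and>
              \<rho> \<in> fst S \<rightarrow>\<^sub>E fst T \<and> \<rho> (snd S) = snd T},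
     Dom = (\<lambda>(S, T, \<rho>). S),
     Cod = (\<lambda>(S, T, \<rho>). T),
     Ident = (\<lambda>T. (T, T, restrict id (fst T))),
     Comp = (\<lambda>(S', T, \<sigma>) (R, S, \<rho>). (R, T, compose (fst R) \<sigma> \<rho>))\<rparr>"

definition simplices :: "nat \<Rightarrow> nat \<Rightarrow> (nat \<Rightarrow> nat) set" where
  "simplices k n = {f \<in> {..n} \<rightarrow>\<^sub>E {..k}. mono_on {..n} f}"

definition boundary_simplices :: "nat \<Rightarrow> nat \<Rightarrow> (nat \<Rightarrow> nat) set" where
  "boundary_simplices k n = {f \<in> simplices k n. f ` {..n} \<noteq> {..k}}"

text \<open>
  The quotient map from the simplices of \<open>\<Delta>\<^sup>k\<close> to those of \<open>\<Delta>\<^sup>k / \<partial>\<Delta>\<^sup>k\<close>; the collapsed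
  boundary is the base point \<^term>\<open>None\<close>.
\<close>

definition collapse :: "nat \<Rightarrow> nat \<Rightarrow> (nat \<Rightarrow> nat) \<Rightarrow> (nat \<Rightarrow> nat) option" where
  "collapse k n f = (if f \<in> boundary_simplices k n then None else Some f)"

definition sphere_cells :: "nat \<Rightarrow> nat \<Rightarrow> (nat \<Rightarrow> nat) option set \<times> (nat \<Rightarrow> nat) option" where
  "sphere_cells k n = (insert None (collapse k n ` simplices k n), None)"

definition sphere_map ::
  "nat \<Rightarrow> nat \<times> nat \<times> (nat \<Rightarrow> nat) \<Rightarrow> (nat \<Rightarrow> nat) option \<Rightarrow> (nat \<Rightarrow> nat) option" where
  "sphere_map k = (\<lambda>(m, n, \<theta>). \<lambda>s \<in> fst (sphere_cells k n).
     case s of None \<Rightarrow> None | Some f \<Rightarrow> collapse k m (compose {..m} f \<theta>))"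

text \<open>The simplicial pointed set \<open>S\<^sup>k\<close>, a functor from the opposite of \<^term>\<open>Delta\<close>.\<close>

definition sphere ::
  "nat \<Rightarrow> (nat, nat \<times> nat \<times> (nat \<Rightarrow> nat), (nat \<Rightarrow> nat) option set \<times> (nat \<Rightarrow> nat) option,
    ((nat \<Rightarrow> nat) option set \<times> (nat \<Rightarrow> nat) option) \<times>
    ((nat \<Rightarrow> nat) option set \<times> (nat \<Rightarrow> nat) option) \<times>
    ((nat \<Rightarrow> nat) option \<Rightarrow> (nat \<Rightarrow> nat) option)) fctr" where
  "sphere k = \<lparr>omap = sphere_cells k,
     amap = (\<lambda>\<theta> \<in> Arr Delta.
       (sphere_cells k (Cod Delta \<theta>), sphere_cells k (Dom Delta \<theta>), sphere_map k \<theta>))\<rparr>"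


section \<open>The Segal construction\<close>

definition pointed_subsets :: "'t set \<times> 't \<Rightarrow> 't set set" where
  "pointed_subsets T = {U. U \<subseteq> fst T \<and> snd T \<in> U}"

abbreviation presheaf_shape :: "'t set \<times> 't \<Rightarrow> ('t set, 't set \<times> 't set) cat" where
  "presheaf_shape T \<equiv> op_cat (subset_cat (pointed_subsets T))"

type_synonym ('t, 'o, 'a) presheaf = "('t set, 't set \<times> 't set, 'o, 'a) fctr"

text \<open>
  As \<open>D\<close> has no chosen products, the canonical map \<open>h\<close> is taken into some product; the condition
  does not depend on which one.
\<close>

definition is_sheaf :: "('o, 'a) cat \<Rightarrow> 't set \<times> 't \<Rightarrow> ('t, 'o, 'a) presheaf \<Rightarrow> bool" where
  "is_sheaf D T F \<longleftrightarrow> is_functor (presheaf_shape T) D F \<and>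
     (\<forall>U \<in> pointed_subsets T. \<exists>p \<pi> h.
        is_product D (U - {snd T}) (\<lambda>u. omap F {snd T, u}) p \<pi> \<and>
        h \<in> hom D (omap F U) p \<and>
        (\<forall>u \<in> U - {snd T}. Comp D (\<pi> u) h = amap F ({snd T, u}, U)) \<and>
        is_iso D h)"

type_synonym ('t, 'o, 'a) presheaf_map =
  "('t, 'o, 'a) presheaf \<times> ('t, 'o, 'a) presheaf \<times> ('t set \<Rightarrow> 'a)"

definition Sh ::
  "('o, 'a) cat \<Rightarrow> 't set \<times> 't \<Rightarrow> (('t, 'o, 'a) presheaf, ('t, 'o, 'a) presheaf_map) cat" where
  "Sh D T = full_subcat (functor_cat (presheaf_shape T) D) (is_sheaf D T)"

definition ptd_preimage :: "'t set \<times> 't \<Rightarrow> 't set \<times> 't \<Rightarrow> ('t \<Rightarrow> 't) \<Rightarrow> 't set \<Rightarrow> 't set" where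
  "ptd_preimage S T \<rho> U = insert (snd S) {s \<in> fst S. \<rho> s \<in> U - {snd T}}"

definition preimage_fctr ::
  "'t set \<times> 't \<Rightarrow> 't set \<times> 't \<Rightarrow> ('t \<Rightarrow> 't) \<Rightarrow> ('t set, 't set \<times> 't set, 't set, 't set \<times> 't set) fctr"
where
  "preimage_fctr S T \<rho> = \<lparr>omap = restrict (ptd_preimage S T \<rho>) (Obj (presheaf_shape T)),
     amap = (\<lambda>(U, V) \<in> Arr (presheaf_shape T). (ptd_preimage S T \<rho> U, ptd_preimage S T \<rho> V))\<rparr>"

definition sheaf_push ::
  "('o, 'a) cat \<Rightarrow> 't set \<times> 't \<Rightarrow> 't set \<times> 't \<Rightarrow> ('t \<Rightarrow> 't) \<Rightarrow>
   (('t, 'o, 'a) presheaf, ('t, 'o, 'a) presheaf_map,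
    ('t, 'o, 'a) presheaf, ('t, 'o, 'a) presheaf_map) fctr" where
  "sheaf_push D S T \<rho> =
     (let ob = (\<lambda>F. comp_fctr (presheaf_shape T) F (preimage_fctr S T \<rho>))
      in \<lparr>omap = restrict ob (Obj (Sh D S)),
          amap = (\<lambda>(F, G, \<eta>) \<in> Arr (Sh D S).
            (ob F, ob G, compose (Obj (presheaf_shape T)) \<eta> (ptd_preimage S T \<rho>)))\<rparr>)"

text \<open>The covariant functor \<open>T \<mapsto> Sh(T, D)\<close> from finite pointed sets to categories.\<close>

definition Sh_fctr ::
  "('o, 'a) cat \<Rightarrow>
   ('t set \<times> 't, ('t set \<times> 't) \<times> ('t set \<times> 't) \<times> ('t \<Rightarrow> 't),
    (('t, 'o, 'a) presheaf, ('t, 'o, 'a) presheaf_map) cat,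
    (('t, 'o, 'a) presheaf, ('t, 'o, 'a) presheaf_map) cat \<times>
    (('t, 'o, 'a) presheaf, ('t, 'o, 'a) presheaf_map) cat \<times>
    (('t, 'o, 'a) presheaf, ('t, 'o, 'a) presheaf_map,
     ('t, 'o, 'a) presheaf, ('t, 'o, 'a) presheaf_map) fctr) fctr" where
  "Sh_fctr D = \<lparr>omap = restrict (Sh D) (Obj FinSet_ptd),
     amap = (\<lambda>(S, T, \<rho>) \<in> Arr FinSet_ptd. (Sh D S, Sh D T, sheaf_push D S T \<rho>))\<rparr>"

definition segal_construction ::
  "nat \<Rightarrow> ('o, 'a) cat \<Rightarrow>
   (((nat \<Rightarrow> nat) option, 'o, 'a) presheaf, ((nat \<Rightarrow> nat) option, 'o, 'a) presheaf_map) simpl_cat" where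
  "segal_construction k D = comp_fctr (op_cat Delta) (Sh_fctr D) (sphere k)"

end

(*
  A point of S^k_n other than the base point is a monotone surjection [n] -> [k], that is, a choice
  of k jumps. Restricting to a subset J of [n] only remembers in which box (a i, b i] between
  consecutive elements of J the i-th jump lies. A sheaf on S^k_n is a product of its values at
  single jump sequences, so objects and arrows of the pseudo-limit have to be reconstructed from
  their values at boxes that shrink to points. Such a value splits as a product whenever a splitting
  point can be added to the ends of the box without leaving the poset, and the reconstruction is
  well defined because any two admissible splittings of a box are connected by common refinements.
  The connectedness comes from a count: J is in the poset exactly if it is covered, up to the extreme
  element in the even case, by k pairs of consecutive numbers, and k boxes leave enough room in such a
  covering.
*)
theory Submission
  imports Defs
begin

section \<open>Categories and functors\<close>

text \<open>The obstacle is that an object of the pseudo-limit has no value at a single jump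
  sequence \<open>t\<close>: it only has values at boxes, one for each \<open>J\<close>, identified
  by coherent isomorphisms. For fixed \<open>t\<close> these values form a diagram over the
  \<open>J\<close> that do not send \<open>t\<close> to the base point, ordered by inclusion, with
  arrows towards smaller boxes; an arrow is invertible whenever the box does not change. The value
  at \<open>t\<close> is read off at a \<open>J\<close> whose box is just \<open>t\<close>, and what
  has to be constructed is a cocone from the whole diagram to it, since its components are to become
  the projections of a product. Existence of the cocone goes by induction on the number of jump
  sequences in the box and is the only place where connectedness of the splittings enters.
  Uniqueness of such cocones, which needs only that some splitting exists, is what glues morphisms.
  The count itself is done for an abstract cost function, because the three posets (lower
  \<open>2k-1\<close>, lower \<open>2k\<close>, upper \<open>2k\<close>) differ only in whether
  \<open>0\<close> or \<open>n\<close> may be covered for free.\<close>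

context category
begin

text \<open>The category axioms are restated over \<open>hom\<close>, so that composability becomes
  a chain of memberships that compose by resolution, instead of equations between domains and
  codomains.\<close>

lemma comp_hom: "\<lbrakk>f \<in> hom C x y; g \<in> hom C y z\<rbrakk> \<Longrightarrow> Comp C g f \<in> hom C x z"
  using Comp_in[of f g] by (auto simp: hom_def)

lemma comp_assoc:
  "\<lbrakk>f \<in> hom C x y; g \<in> hom C y z; h \<in> hom C z w\<rbrakk> \<Longrightarrow> Comp C h (Comp C g f) = Comp C (Comp C h g) f"
  using Comp_assoc[of f g h] by (auto simp: hom_def)

lemma comp_id_right: "f \<in> hom C x y \<Longrightarrow> Comp C f (Ident C x) = f"
  using Comp_Ident_right[of f] by (auto simp: hom_def)

lemma comp_id_left: "f \<in> hom C x y \<Longrightarrow> Comp C (Ident C y) f = f"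
  using Comp_Ident_left[of f] by (auto simp: hom_def)

lemma hom_obj: "f \<in> hom C x y \<Longrightarrow> x \<in> Obj C \<and> y \<in> Obj C"
  using Dom_in[of f] Cod_in[of f] by (auto simp: hom_def)

lemma isoI:
  "\<lbrakk>f \<in> hom C x y; g \<in> hom C y x; Comp C g f = Ident C x; Comp C f g = Ident C y\<rbrakk> \<Longrightarrow> is_iso C f"
  unfolding is_iso_def by (auto simp: hom_def)

lemma isoE:
  assumes "is_iso C f" "f \<in> hom C x y"
  obtains g where "g \<in> hom C y x" "Comp C g f = Ident C x" "Comp C f g = Ident C y" "is_iso C g"
  using assms unfolding is_iso_def by (auto simp: hom_def)

lemma iso_id: "x \<in> Obj C \<Longrightarrow> is_iso C (Ident C x)"
  using Ident_in[of x] comp_id_right[of "Ident C x" x x] by (intro isoI[of _ x x "Ident C x"]) auto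

lemma iso_comp:
  assumes "is_iso C f" "f \<in> hom C x y" "is_iso C g" "g \<in> hom C y z"
  shows "is_iso C (Comp C g f)"
proof -
  from assms(1,2) obtain f' where f': "f' \<in> hom C y x" "Comp C f' f = Ident C x" "Comp C f f' = Ident C y"
    by (rule isoE)
  from assms(3,4) obtain g' where g': "g' \<in> hom C z y" "Comp C g' g = Ident C y" "Comp C g g' = Ident C z"
    by (rule isoE)
  have gf: "Comp C g f \<in> hom C x z" and f'g': "Comp C f' g' \<in> hom C z x"
    using assms f' g' comp_hom by blast+
  have "Comp C (Comp C f' g') (Comp C g f) = Comp C f' (Comp C (Comp C g' g) f)"
    using comp_assoc[OF gf g'(1) f'(1)] comp_assoc[OF assms(2,4) g'(1)] by simp
  also have "\<dots> = Ident C x" using g' f' comp_id_left[OF assms(2)] by simp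
  finally have 1: "Comp C (Comp C f' g') (Comp C g f) = Ident C x" .
  have "Comp C (Comp C g f) (Comp C f' g') = Comp C g (Comp C (Comp C f f') g')"
    using comp_assoc[OF f'g' assms(2,4)] comp_assoc[OF g'(1) f'(1) assms(2)] by simp
  also have "\<dots> = Ident C z" using g' f' comp_id_left[OF g'(1)] by simp
  finally show ?thesis using isoI[OF gf f'g' 1] by simp
qed

lemma iso_cancel_right:
  assumes "is_iso C e" "e \<in> hom C w x" "f \<in> hom C x y" "g \<in> hom C x y" "Comp C f e = Comp C g e"
  shows "f = g"
proof -
  from assms(1,2) obtain e' where e': "e' \<in> hom C x w" "Comp C e e' = Ident C x" by (rule isoE)
  have "f = Comp C (Comp C f e) e'"
    using comp_assoc[OF e'(1) assms(2,3)] e' comp_id_right[OF assms(3)] by simp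
  also have "\<dots> = g"
    using comp_assoc[OF e'(1) assms(2,4)] e' comp_id_right[OF assms(4)] assms(5) by simp
  finally show ?thesis .
qed

lemma iso_cancel_left:
  assumes "is_iso C e" "e \<in> hom C y z" "f \<in> hom C x y" "g \<in> hom C x y" "Comp C e f = Comp C e g"
  shows "f = g"
proof -
  from assms(1,2) obtain e' where e': "e' \<in> hom C z y" "Comp C e' e = Ident C y" by (rule isoE)
  have "f = Comp C e' (Comp C e f)"
    using comp_assoc[OF assms(3,2) e'(1)] e' comp_id_left[OF assms(3)] by simp
  also have "\<dots> = g"
    using comp_assoc[OF assms(4,2) e'(1)] e' comp_id_left[OF assms(4)] assms(5) by simp
  finally show ?thesis .
qed

end

lemma categoryI:
  assumes "\<And>f. f \<in> Arr C \<Longrightarrow> Dom C f \<in> Obj C \<and> Cod C f \<in> Obj C"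
    and "\<And>x. x \<in> Obj C \<Longrightarrow> Ident C x \<in> hom C x x"
    and "\<And>f g x y z. \<lbrakk>f \<in> hom C x y; g \<in> hom C y z\<rbrakk> \<Longrightarrow> Comp C g f \<in> hom C x z"
    and "\<And>f x y. f \<in> hom C x y \<Longrightarrow> Comp C f (Ident C x) = f"
    and "\<And>f x y. f \<in> hom C x y \<Longrightarrow> Comp C (Ident C y) f = f"
    and "\<And>f g h x y z w. \<lbrakk>f \<in> hom C x y; g \<in> hom C y z; h \<in> hom C z w\<rbrakk>
      \<Longrightarrow> Comp C h (Comp C g f) = Comp C (Comp C h g) f"
  shows "category C"
  by unfold_locales (use assms in \<open>auto simp: hom_def\<close>)

lemma is_functorI:
  assumes "category C" "category D"
    and "omap F \<in> extensional (Obj C)" "amap F \<in> extensional (Arr C)"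
    and ob: "\<And>x. x \<in> Obj C \<Longrightarrow> omap F x \<in> Obj D"
    and ar: "\<And>f. f \<in> Arr C \<Longrightarrow> amap F f \<in> hom D (omap F (Dom C f)) (omap F (Cod C f))"
    and "\<And>x. x \<in> Obj C \<Longrightarrow> amap F (Ident C x) = Ident D (omap F x)"
    and "\<And>f g. \<lbrakk>f \<in> Arr C; g \<in> Arr C; Dom C g = Cod C f\<rbrakk>
        \<Longrightarrow> amap F (Comp C g f) = Comp D (amap F g) (amap F f)"
  shows "is_functor C D F"
  unfolding is_functor_def using assms by (auto simp: PiE_def hom_def)

lemma is_functorD:
  assumes "is_functor C D F"
  shows "category C" "category D" "omap F \<in> extensional (Obj C)" "amap F \<in> extensional (Arr C)"
    "x \<in> Obj C \<Longrightarrow> omap F x \<in> Obj D"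
    "f \<in> hom C x y \<Longrightarrow> amap F f \<in> hom D (omap F x) (omap F y)"
    "x \<in> Obj C \<Longrightarrow> amap F (Ident C x) = Ident D (omap F x)"
    "\<lbrakk>f \<in> hom C x y; g \<in> hom C y z\<rbrakk> \<Longrightarrow> amap F (Comp C g f) = Comp D (amap F g) (amap F f)"
  using assms unfolding is_functor_def by (auto simp: PiE_def hom_def)

lemma functor_eqI:
  fixes F G :: "('o, 'a, 'p, 'b) fctr"
  assumes "omap F \<in> extensional (Obj C)" "amap F \<in> extensional (Arr C)"
    "omap G \<in> extensional (Obj C)" "amap G \<in> extensional (Arr C)"
    and "\<And>x. x \<in> Obj C \<Longrightarrow> omap F x = omap G x"
    and "\<And>f. f \<in> Arr C \<Longrightarrow> amap F f = amap G f"
  shows "F = G"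
proof -
  have "omap F = omap G" "amap F = amap G"
    using assms by (auto intro: extensionalityI)
  then show ?thesis by simp
qed

lemma comp_fctr_simps [simp]:
  "x \<in> Obj C \<Longrightarrow> omap (comp_fctr C G F) x = omap G (omap F x)"
  "f \<in> Arr C \<Longrightarrow> amap (comp_fctr C G F) f = amap G (amap F f)"
  by (simp_all add: comp_fctr_def compose_eq)

lemma comp_fctr_ext [simp]:
  "omap (comp_fctr C G F) \<in> extensional (Obj C)" "amap (comp_fctr C G F) \<in> extensional (Arr C)"
  by (simp_all add: comp_fctr_def compose_def)

lemma is_functor_comp:
  assumes F: "is_functor C D F" and G: "is_functor D E G"
  shows "is_functor C E (comp_fctr C G F)"
proof -
  interpret C: category C using F by (rule is_functorD)
  show ?thesis
  proof (rule is_functorI)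
    show "category C" "category E" using F G is_functorD by blast+
    fix x assume x: "x \<in> Obj C"
    show "omap (comp_fctr C G F) x \<in> Obj E"
      using x is_functorD(5)[OF G] is_functorD(5)[OF F] by simp
    show "amap (comp_fctr C G F) (Ident C x) = Ident E (omap (comp_fctr C G F) x)"
      using x C.Ident_in[OF x] is_functorD(5,7)[OF F x] is_functorD(7)[OF G]
      by (simp add: hom_def)
  next
    fix f assume f: "f \<in> Arr C"
    then have f': "f \<in> hom C (Dom C f) (Cod C f)" by (simp add: hom_def)
    show "amap (comp_fctr C G F) f
        \<in> hom E (omap (comp_fctr C G F) (Dom C f)) (omap (comp_fctr C G F) (Cod C f))"
      using f C.Dom_in C.Cod_in is_functorD(6)[OF G is_functorD(6)[OF F f']] by simp
    fix g assume g: "g \<in> Arr C" "Dom C g = Cod C f"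
    then have g': "g \<in> hom C (Cod C f) (Cod C g)" by (simp add: hom_def)
    show "amap (comp_fctr C G F) (Comp C g f)
        = Comp E (amap (comp_fctr C G F) g) (amap (comp_fctr C G F) f)"
      using f g C.comp_hom[OF f' g'] is_functorD(8)[OF F f' g']
        is_functorD(8)[OF G is_functorD(6)[OF F f'] is_functorD(6)[OF F g']]
      by (simp add: hom_def)
  qed auto
qed

lemma comp_fctr_assoc:
  assumes F: "is_functor C D F" and G: "is_functor D E G"
  shows "comp_fctr C H (comp_fctr C G F) = comp_fctr C (comp_fctr D H G) F"
proof (rule functor_eqI)
  fix f assume f: "f \<in> Arr C"
  then have "amap F f \<in> Arr D"
    using is_functorD(6)[OF F, of f "Dom C f" "Cod C f"] by (simp add: hom_def)
  then show "amap (comp_fctr C H (comp_fctr C G F)) f = amap (comp_fctr C (comp_fctr D H G) F) f"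
    using f by simp
qed (use is_functorD(5)[OF F] in auto)

lemma is_functor_id:
  assumes "category C"
  shows "is_functor C C (id_fctr C)"
proof -
  interpret category C by fact
  show ?thesis
    by (rule is_functorI)
      (use Dom_in Cod_in Ident_in comp_hom in \<open>auto simp: id_fctr_def assms hom_def\<close>)
qed

lemma comp_fctr_id:
  assumes F: "is_functor C D F"
  shows "comp_fctr C F (id_fctr C) = F" "comp_fctr C (id_fctr D) F = F"
proof -
  show "comp_fctr C F (id_fctr C) = F"
    by (rule functor_eqI[of _ C]) (use is_functorD[OF F] in \<open>auto simp: id_fctr_def\<close>)
  show "comp_fctr C (id_fctr D) F = F"
  proof (rule functor_eqI[of _ C])
    fix f assume f: "f \<in> Arr C"
    then have "amap F f \<in> Arr D"
      using is_functorD(6)[OF F, of f "Dom C f" "Cod C f"] by (simp add: hom_def)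
    then show "amap (comp_fctr C (id_fctr D) F) f = amap F f"
      using f by (simp add: id_fctr_def)
  qed (use is_functorD[OF F] in \<open>auto simp: id_fctr_def\<close>)
qed

lemma category_Cat: "category (Cat :: (('o, 'a) cat, _) cat)"
  by (rule categoryI)
    (auto simp: Cat_def hom_def is_functor_id is_functor_comp comp_fctr_id comp_fctr_assoc
      dest: is_functorD(1,2))

lemma op_cat_simps [simp]:
  "Obj (op_cat C) = Obj C" "Arr (op_cat C) = Arr C" "Dom (op_cat C) = Cod C" "Cod (op_cat C) = Dom C"
  "Ident (op_cat C) = Ident C" "Comp (op_cat C) g f = Comp C f g" "hom (op_cat C) x y = hom C y x"
  by (auto simp: op_cat_def hom_def)

lemma category_op: "category C \<Longrightarrow> category (op_cat C)"
  by (rule categoryI)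
    (auto simp: category.comp_hom category.comp_id_left category.comp_id_right category.Dom_in
      category.Cod_in category.Ident_in category.comp_assoc)

lemma subset_cat_simps [simp]:
  "Obj (subset_cat Q) = Q" "Dom (subset_cat Q) = fst" "Cod (subset_cat Q) = snd"
  "Ident (subset_cat Q) U = (U, U)" "Comp (subset_cat Q) g f = (fst f, snd g)"
  "(U, V) \<in> Arr (subset_cat Q) \<longleftrightarrow> U \<in> Q \<and> V \<in> Q \<and> U \<subseteq> V"
  by (auto simp: subset_cat_def)

lemma subset_cat_hom [simp]:
  "f \<in> hom (subset_cat Q) U V \<longleftrightarrow> f = (U, V) \<and> U \<in> Q \<and> V \<in> Q \<and> U \<subseteq> V"
  by (cases f) (auto simp: hom_def)

lemma category_subset_cat: "category (subset_cat Q)"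
proof (rule categoryI)
  fix f assume "f \<in> Arr (subset_cat Q)"
  then show "Dom (subset_cat Q) f \<in> Obj (subset_cat Q) \<and> Cod (subset_cat Q) f \<in> Obj (subset_cat Q)"
    by (cases f) auto
qed auto

section \<open>Functor categories\<close>

lemma nat_transD:
  assumes "nat_trans C D F G \<eta>"
  shows "is_functor C D F" "is_functor C D G" "\<eta> \<in> extensional (Obj C)"
    "x \<in> Obj C \<Longrightarrow> \<eta> x \<in> hom D (omap F x) (omap G x)"
    "f \<in> hom C x y \<Longrightarrow> Comp D (\<eta> y) (amap F f) = Comp D (amap G f) (\<eta> x)"
  using assms unfolding nat_trans_def hom_def by (auto simp: PiE_iff)

lemma nat_transI:
  assumes "is_functor C D F" "is_functor C D G" "\<eta> \<in> extensional (Obj C)"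
    "\<And>x. x \<in> Obj C \<Longrightarrow> \<eta> x \<in> hom D (omap F x) (omap G x)"
    "\<And>f. f \<in> Arr C \<Longrightarrow> Comp D (\<eta> (Cod C f)) (amap F f) = Comp D (amap G f) (\<eta> (Dom C f))"
  shows "nat_trans C D F G \<eta>"
  using assms unfolding nat_trans_def by (auto simp: PiE_def)

lemma nat_trans_id: 
  assumes F: "is_functor C D F"
  shows "nat_trans C D F F (\<lambda>x \<in> Obj C. Ident D (omap F x))"
proof -
  interpret C: category C using F by (rule is_functorD)
  interpret D: category D using F by (rule is_functorD)
  show ?thesis
  proof (rule nat_transI)
    fix f assume f: "f \<in> Arr C"
    then have "amap F f \<in> hom D (omap F (Dom C f)) (omap F (Cod C f))"
      by (intro is_functorD(6)[OF F]) (simp add: hom_def)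
    then show "Comp D ((\<lambda>x \<in> Obj C. Ident D (omap F x)) (Cod C f)) (amap F f)
        = Comp D (amap F f) ((\<lambda>x \<in> Obj C. Ident D (omap F x)) (Dom C f))"
      using f C.Dom_in C.Cod_in by (simp add: D.comp_id_left D.comp_id_right)
  qed (use F is_functorD(5)[OF F] D.Ident_in in auto)
qed

lemma nat_trans_comp:
  assumes \<eta>: "nat_trans C D F G \<eta>" and \<theta>: "nat_trans C D G H \<theta>"
  shows "nat_trans C D F H (\<lambda>x \<in> Obj C. Comp D (\<theta> x) (\<eta> x))"
proof -
  note F = nat_transD(1)[OF \<eta>] and G = nat_transD(2)[OF \<eta>] and H = nat_transD(2)[OF \<theta>]
  interpret C: category C using F by (rule is_functorD)
  interpret D: category D using F by (rule is_functorD)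
  show ?thesis
  proof (rule nat_transI)
    fix f assume f: "f \<in> Arr C"
    let ?x = "Dom C f" and ?y = "Cod C f"
    have f': "f \<in> hom C ?x ?y" using f by (simp add: hom_def)
    have xy: "?x \<in> Obj C" "?y \<in> Obj C" using f C.Dom_in C.Cod_in by auto
    note Ff = is_functorD(6)[OF F f'] and Gf = is_functorD(6)[OF G f'] and Hf = is_functorD(6)[OF H f']
    have "Comp D (Comp D (\<theta> ?y) (\<eta> ?y)) (amap F f) = Comp D (\<theta> ?y) (Comp D (amap G f) (\<eta> ?x))"
      using D.comp_assoc[OF Ff nat_transD(4)[OF \<eta> xy(2)] nat_transD(4)[OF \<theta> xy(2)]]
        nat_transD(5)[OF \<eta> f'] by simp
    also have "\<dots> = Comp D (amap H f) (Comp D (\<theta> ?x) (\<eta> ?x))"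
      using D.comp_assoc[OF nat_transD(4)[OF \<eta> xy(1)] Gf nat_transD(4)[OF \<theta> xy(2)]]
        D.comp_assoc[OF nat_transD(4)[OF \<eta> xy(1)] nat_transD(4)[OF \<theta> xy(1)] Hf]
        nat_transD(5)[OF \<theta> f'] by simp
    finally show "Comp D ((\<lambda>x \<in> Obj C. Comp D (\<theta> x) (\<eta> x)) ?y) (amap F f)
        = Comp D (amap H f) ((\<lambda>x \<in> Obj C. Comp D (\<theta> x) (\<eta> x)) ?x)"
      using xy by simp
  qed (use F H nat_transD(4)[OF \<eta>] nat_transD(4)[OF \<theta>] in \<open>auto intro: D.comp_hom\<close>)
qed

lemma functor_cat_simps [simp]:
  "F \<in> Obj (functor_cat C D) \<longleftrightarrow> is_functor C D F"
  "(F, G, \<eta>) \<in> Arr (functor_cat C D) \<longleftrightarrow> nat_trans C D F G \<eta>"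
  "Dom (functor_cat C D) (F, G, \<eta>) = F" "Cod (functor_cat C D) (F, G, \<eta>) = G"
  "Ident (functor_cat C D) F = (F, F, \<lambda>x \<in> Obj C. Ident D (omap F x))"
  "Comp (functor_cat C D) (G', H, \<theta>) (F, G, \<eta>) = (F, H, \<lambda>x \<in> Obj C. Comp D (\<theta> x) (\<eta> x))"
  by (auto simp: functor_cat_def)

lemma functor_cat_hom:
  "f \<in> hom (functor_cat C D) F G \<longleftrightarrow> (\<exists>\<eta>. f = (F, G, \<eta>) \<and> nat_trans C D F G \<eta>)"
  by (cases f) (auto simp: hom_def)

lemma category_functor_cat:
  assumes "category D"
  shows "category (functor_cat C D)"
proof -
  interpret D: category D by fact
  show ?thesis
  proof (rule categoryI)
    fix f assume "f \<in> Arr (functor_cat C D)"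
    then show "Dom (functor_cat C D) f \<in> Obj (functor_cat C D) \<and> Cod (functor_cat C D) f \<in> Obj (functor_cat C D)"
      by (cases f) (auto dest: nat_transD(1,2))
  next
    fix f F G assume "f \<in> hom (functor_cat C D) F G"
    then obtain \<eta> where f: "f = (F, G, \<eta>)" and \<eta>: "nat_trans C D F G \<eta>" by (auto simp: functor_cat_hom)
    have *: "is_functor C D F" "is_functor C D G" using \<eta> by (auto dest: nat_transD)
    show "Comp (functor_cat C D) f (Ident (functor_cat C D) F) = f"
      using f nat_transD(3)[OF \<eta>] D.comp_id_right[OF nat_transD(4)[OF \<eta>]]
      by (auto simp: fun_eq_iff extensional_def)
    show "Comp (functor_cat C D) (Ident (functor_cat C D) G) f = f"
      using f nat_transD(3)[OF \<eta>] D.comp_id_left[OF nat_transD(4)[OF \<eta>]]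
      by (auto simp: fun_eq_iff extensional_def)
  next
    fix f g h F G H K
    assume "f \<in> hom (functor_cat C D) F G" "g \<in> hom (functor_cat C D) G H" "h \<in> hom (functor_cat C D) H K"
    then obtain \<eta> \<theta> \<kappa> where *: "f = (F, G, \<eta>)" "g = (G, H, \<theta>)" "h = (H, K, \<kappa>)"
      and nt: "nat_trans C D F G \<eta>" "nat_trans C D G H \<theta>" "nat_trans C D H K \<kappa>"
      by (auto simp: functor_cat_hom)
    have "Comp D (\<kappa> x) (Comp D (\<theta> x) (\<eta> x)) = Comp D (Comp D (\<kappa> x) (\<theta> x)) (\<eta> x)" if "x \<in> Obj C" for x
      using that by (intro D.comp_assoc[OF nat_transD(4)[OF nt(1)] nat_transD(4)[OF nt(2)] nat_transD(4)[OF nt(3)]])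
    then show "Comp (functor_cat C D) h (Comp (functor_cat C D) g f)
        = Comp (functor_cat C D) (Comp (functor_cat C D) h g) f"
      by (auto simp: * intro: restrict_ext)
  qed (auto simp: functor_cat_hom nat_trans_id nat_trans_comp)
qed

lemma full_subcat_simps [simp]:
  "x \<in> Obj (full_subcat C Q) \<longleftrightarrow> x \<in> Obj C \<and> Q x"
  "f \<in> Arr (full_subcat C Q) \<longleftrightarrow> f \<in> Arr C \<and> Q (Dom C f) \<and> Q (Cod C f)"
  "Dom (full_subcat C Q) = Dom C" "Cod (full_subcat C Q) = Cod C"
  "Ident (full_subcat C Q) = Ident C" "Comp (full_subcat C Q) = Comp C"
  "f \<in> hom (full_subcat C Q) x y \<longleftrightarrow> f \<in> hom C x y \<and> Q x \<and> Q y"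
  by (auto simp: full_subcat_def hom_def)

lemma category_full_subcat: "category C \<Longrightarrow> category (full_subcat C Q)"
  by (rule categoryI)
    (auto simp: category.comp_hom category.comp_id_left category.comp_id_right category.Dom_in
      category.Cod_in category.Ident_in category.comp_assoc)

lemma is_iso_full_subcat:
  "is_iso (full_subcat C Q) f \<longleftrightarrow> is_iso C f \<and> Q (Dom C f) \<and> Q (Cod C f)"
  by (auto simp: is_iso_def)

text \<open>Pointwise inverses are automatically natural: both legs of the square for the inverse
  agree after precomposition with the invertible \<open>\<eta> x\<close>.\<close>

lemma is_iso_functor_cat:
  assumes \<eta>: "nat_trans C D F G \<eta>"
  shows "is_iso (functor_cat C D) (F, G, \<eta>) \<longleftrightarrow> (\<forall>x \<in> Obj C. is_iso D (\<eta> x))"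
proof
  note F = nat_transD(1)[OF \<eta>] and G = nat_transD(2)[OF \<eta>]
  interpret C: category C using F by (rule is_functorD)
  interpret D: category D using F by (rule is_functorD)
  interpret FD: category "functor_cat C D" by (rule category_functor_cat) (rule D.category_axioms)
  have hom: "(F, G, \<eta>) \<in> hom (functor_cat C D) F G" using \<eta> by (simp add: functor_cat_hom)
  {
    assume "is_iso (functor_cat C D) (F, G, \<eta>)"
    then obtain g where g: "g \<in> hom (functor_cat C D) G F"
      "Comp (functor_cat C D) g (F, G, \<eta>) = Ident (functor_cat C D) F"
      "Comp (functor_cat C D) (F, G, \<eta>) g = Ident (functor_cat C D) G"
      using hom by (rule FD.isoE)
    then obtain \<theta> where \<theta>: "g = (G, F, \<theta>)" "nat_trans C D G F \<theta>" by (auto simp: functor_cat_hom)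
    show "\<forall>x \<in> Obj C. is_iso D (\<eta> x)"
    proof
      fix x assume x: "x \<in> Obj C"
      show "is_iso D (\<eta> x)"
        using g \<theta> x
        by (intro D.isoI[OF nat_transD(4)[OF \<eta> x] nat_transD(4)[OF \<theta>(2) x]])
          (auto simp: fun_eq_iff dest!: spec[of _ x])
    qed
  }
  {
    assume iso: "\<forall>x \<in> Obj C. is_iso D (\<eta> x)"
    have "\<forall>x \<in> Obj C. \<exists>g. g \<in> hom D (omap G x) (omap F x) \<and> Comp D g (\<eta> x) = Ident D (omap F x)
        \<and> Comp D (\<eta> x) g = Ident D (omap G x)"
      using iso nat_transD(4)[OF \<eta>] by (metis D.isoE)
    then obtain \<theta>' where \<theta>': "\<And>x. x \<in> Obj C \<Longrightarrow> \<theta>' x \<in> hom D (omap G x) (omap F x)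
      \<and> Comp D (\<theta>' x) (\<eta> x) = Ident D (omap F x) \<and> Comp D (\<eta> x) (\<theta>' x) = Ident D (omap G x)"
      by metis
    define \<theta> where "\<theta> = restrict \<theta>' (Obj C)"
    have \<theta>: "\<theta> x \<in> hom D (omap G x) (omap F x)" "Comp D (\<theta> x) (\<eta> x) = Ident D (omap F x)"
      "Comp D (\<eta> x) (\<theta> x) = Ident D (omap G x)" if "x \<in> Obj C" for x
      using \<theta>'[OF that] that by (auto simp: \<theta>_def)
    have nt: "nat_trans C D G F \<theta>"
    proof (rule nat_transI)
      fix f assume "f \<in> Arr C"
      then have f: "f \<in> hom C (Dom C f) (Cod C f)" by (simp add: hom_def)
      define x y where "x = Dom C f" and "y = Cod C f"
      have xy: "x \<in> Obj C" "y \<in> Obj C" and f: "f \<in> hom C x y"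
        using C.hom_obj[OF f] f by (auto simp: x_def y_def)
      note Ff = is_functorD(6)[OF F f] and Gf = is_functorD(6)[OF G f]
      note \<eta>x = nat_transD(4)[OF \<eta> xy(1)] and \<eta>y = nat_transD(4)[OF \<eta> xy(2)]
      have "Comp D (Comp D (\<theta> y) (amap G f)) (\<eta> x) = Comp D (\<theta> y) (Comp D (\<eta> y) (amap F f))"
        using D.comp_assoc[OF \<eta>x Gf \<theta>(1)[OF xy(2)]] nat_transD(5)[OF \<eta> f] by simp
      also have "\<dots> = amap F f"
        using D.comp_assoc[OF Ff \<eta>y \<theta>(1)[OF xy(2)]] \<theta>(2)[OF xy(2)] D.comp_id_left[OF Ff] by simp
      also have "\<dots> = Comp D (Comp D (amap F f) (\<theta> x)) (\<eta> x)"
        using D.comp_assoc[OF \<eta>x \<theta>(1)[OF xy(1)] Ff] \<theta>(2)[OF xy(1)] D.comp_id_right[OF Ff] by simp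
      finally show "Comp D (\<theta> (Cod C f)) (amap G f) = Comp D (amap F f) (\<theta> (Dom C f))"
        using D.iso_cancel_right[OF _ \<eta>x D.comp_hom[OF Gf \<theta>(1)[OF xy(2)]] D.comp_hom[OF \<theta>(1)[OF xy(1)] Ff]]
          iso xy by (auto simp: x_def y_def)
    qed (use F G \<theta> in \<open>auto simp: \<theta>_def\<close>)
    show "is_iso (functor_cat C D) (F, G, \<eta>)"
      by (rule FD.isoI[OF hom, of "(G, F, \<theta>)"])
        (use nt \<theta> in \<open>auto simp: functor_cat_hom fun_eq_iff\<close>)
  }
qed

section \<open>Equivalences and pseudo-limits\<close>

text \<open>The definition of equivalence asks for a quasi-inverse with two natural isomorphisms,
  whereas descent yields these three properties. The quasi-inverse is chosen objectwise; its laws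
  are checked after applying \<open>F\<close>, using faithfulness.\<close>

lemma is_equivalenceI:
  assumes F: "is_functor C D F"
    and faithful: "\<And>x y f g. \<lbrakk>f \<in> hom C x y; g \<in> hom C x y; amap F f = amap F g\<rbrakk> \<Longrightarrow> f = g"
    and full: "\<And>x y h. \<lbrakk>x \<in> Obj C; y \<in> Obj C; h \<in> hom D (omap F x) (omap F y)\<rbrakk>
      \<Longrightarrow> \<exists>f \<in> hom C x y. amap F f = h"
    and es: "\<And>d. d \<in> Obj D \<Longrightarrow> \<exists>c \<in> Obj C. \<exists>e \<in> hom D (omap F c) d. is_iso D e"
  shows "is_equivalence C D F"
proof -
  interpret C: category C using F by (rule is_functorD)
  interpret D: category D using F by (rule is_functorD)
  note Fo = is_functorD(5)[OF F] and Fh = is_functorD(6)[OF F]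
    and Fi = is_functorD(7)[OF F] and Fc = is_functorD(8)[OF F]
  have "\<forall>d \<in> Obj D. \<exists>c e e'. c \<in> Obj C \<and> e \<in> hom D (omap F c) d \<and> is_iso D e \<and> e' \<in> hom D d (omap F c)
      \<and> Comp D e' e = Ident D (omap F c) \<and> Comp D e e' = Ident D d"
    using es by (meson D.isoE)
  then obtain c e e' where ce: "\<And>d. d \<in> Obj D \<Longrightarrow> c d \<in> Obj C \<and> e d \<in> hom D (omap F (c d)) d
      \<and> is_iso D (e d) \<and> e' d \<in> hom D d (omap F (c d))
      \<and> Comp D (e' d) (e d) = Ident D (omap F (c d)) \<and> Comp D (e d) (e' d) = Ident D d"
    by metis
  have c: "d \<in> Obj D \<Longrightarrow> c d \<in> Obj C" and e: "d \<in> Obj D \<Longrightarrow> e d \<in> hom D (omap F (c d)) d"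
    and e_iso: "d \<in> Obj D \<Longrightarrow> is_iso D (e d)" and e': "d \<in> Obj D \<Longrightarrow> e' d \<in> hom D d (omap F (c d))"
    and e'e: "d \<in> Obj D \<Longrightarrow> Comp D (e' d) (e d) = Ident D (omap F (c d))"
    and ee': "d \<in> Obj D \<Longrightarrow> Comp D (e d) (e' d) = Ident D d" for d
    using ce by auto
  \<comment> \<open>Conjugating \<open>h\<close> by the chosen isomorphisms gives an arrow between
    objects in the image of \<open>F\<close>, which fullness lifts; \<open>eg\<close> below is the
    resulting naturality of \<open>e\<close>.\<close>
  have "\<forall>h \<in> Arr D. \<exists>f \<in> hom C (c (Dom D h)) (c (Cod D h)).
      amap F f = Comp D (e' (Cod D h)) (Comp D h (e (Dom D h)))"
  proof
    fix h assume h: "h \<in> Arr D"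
    then have "h \<in> hom D (Dom D h) (Cod D h)" by (simp add: hom_def)
    then show "\<exists>f \<in> hom C (c (Dom D h)) (c (Cod D h)).
        amap F f = Comp D (e' (Cod D h)) (Comp D h (e (Dom D h)))"
      using D.Dom_in[OF h] D.Cod_in[OF h] c e e' by (intro full D.comp_hom) auto
  qed
  then obtain g where g: "\<And>h x y. h \<in> hom D x y \<Longrightarrow> g h \<in> hom C (c x) (c y)
      \<and> amap F (g h) = Comp D (e' y) (Comp D h (e x))"
    by (auto simp: hom_def Ball_def Bex_def) metis
  define G where "G = \<lparr>omap = restrict c (Obj D), amap = restrict g (Arr D)\<rparr>"
  have Go: "omap G d = c d" if "d \<in> Obj D" for d using that by (simp add: G_def)
  have Ga: "amap G h = g h" if "h \<in> hom D x y" for h x y using that by (simp add: G_def hom_def)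
  have eg: "Comp D (e y) (amap F (g h)) = Comp D h (e x)" if h: "h \<in> hom D x y" for h x y
  proof -
    have xy: "x \<in> Obj D" "y \<in> Obj D" using D.hom_obj[OF h] by auto
    show ?thesis
      using g[OF h] D.comp_assoc[OF D.comp_hom[OF e[OF xy(1)] h] e'[OF xy(2)] e[OF xy(2)]]
        ee'[OF xy(2)] D.comp_id_left[OF D.comp_hom[OF e[OF xy(1)] h]] by simp
  qed
  have G: "is_functor D C G"
  proof (rule is_functorI)
    fix d assume d: "d \<in> Obj D"
    note i = D.Ident_in[OF d]
    show "omap G d \<in> Obj C" using d c by (simp add: Go)
    have "amap F (g (Ident D d)) = amap F (Ident C (c d))"
      using g[OF i] D.comp_id_left[OF e[OF d]] e'e[OF d] Fi[OF c[OF d]] by simp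
    then have "g (Ident D d) = Ident C (c d)"
      using faithful g[OF i] C.Ident_in[OF c[OF d]] by blast
    then show "amap G (Ident D d) = Ident C (omap G d)"
      using d i by (simp add: Go Ga)
  next
    fix h assume h: "h \<in> Arr D"
    then have h': "h \<in> hom D (Dom D h) (Cod D h)" by (simp add: hom_def)
    show "amap G h \<in> hom C (omap G (Dom D h)) (omap G (Cod D h))"
      using g[OF h'] Ga[OF h'] D.hom_obj[OF h'] by (simp add: Go)
    fix k assume k: "k \<in> Arr D" "Dom D k = Cod D h"
    define x y z where "x = Dom D h" and "y = Cod D h" and "z = Cod D k"
    have h': "h \<in> hom D x y" and k': "k \<in> hom D y z" using h k by (auto simp: hom_def x_def y_def z_def)
    have xyz: "x \<in> Obj D" "y \<in> Obj D" "z \<in> Obj D" using D.hom_obj[OF h'] D.hom_obj[OF k'] by auto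
    note gh = conjunct1[OF g[OF h']] and gk = conjunct1[OF g[OF k']]
    note kh = D.comp_hom[OF h' k']
    have "Comp D (e z) (amap F (Comp C (g k) (g h))) = Comp D (Comp D (e z) (amap F (g k))) (amap F (g h))"
      using Fc[OF gh gk] D.comp_assoc[OF Fh[OF gh] Fh[OF gk] e[OF xyz(3)]] by simp
    also have "\<dots> = Comp D k (Comp D (e y) (amap F (g h)))"
      using eg[OF k'] D.comp_assoc[OF Fh[OF gh] e[OF xyz(2)] k'] by simp
    also have "\<dots> = Comp D (e z) (amap F (g (Comp D k h)))"
      using eg[OF h'] eg[OF kh] D.comp_assoc[OF e[OF xyz(1)] h' k'] by simp
    finally have "amap F (Comp C (g k) (g h)) = amap F (g (Comp D k h))"
      using D.iso_cancel_left[OF e_iso e Fh[OF C.comp_hom[OF gh gk]] Fh[OF conjunct1[OF g[OF kh]]]] xyz by blast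
    then have "Comp C (g k) (g h) = g (Comp D k h)"
      using faithful C.comp_hom[OF gh gk] g[OF kh] by blast
    then show "amap G (Comp D k h) = Comp C (amap G k) (amap G h)"
      using Ga h' k' kh by simp
  qed (auto simp: G_def D.category_axioms C.category_axioms)
  have "naturally_isomorphic D D (comp_fctr D F G) (id_fctr D)"
    unfolding naturally_isomorphic_def
  proof (intro exI conjI ballI)
    show "nat_trans D D (comp_fctr D F G) (id_fctr D) (restrict e (Obj D))"
    proof (rule nat_transI)
      fix h assume h: "h \<in> Arr D"
      then have h': "h \<in> hom D (Dom D h) (Cod D h)" by (simp add: hom_def)
      show "Comp D (restrict e (Obj D) (Cod D h)) (amap (comp_fctr D F G) h)
          = Comp D (amap (id_fctr D) h) (restrict e (Obj D) (Dom D h))"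
        using eg[OF h'] D.hom_obj[OF h'] Ga[OF h'] h by (simp add: id_fctr_def)
    qed (use is_functor_comp[OF G F] is_functor_id[OF D.category_axioms] e in \<open>auto simp: Go id_fctr_def\<close>)
  qed (use e_iso in simp)
  moreover have "naturally_isomorphic C C (id_fctr C) (comp_fctr C G F)"
  proof -
    \<comment> \<open>The unit at \<open>x\<close> is a lift of \<open>e'\<close>, and its inverse
      will be a lift of \<open>e\<close>; that they are mutually inverse is seen after applying
      \<open>F\<close>.\<close>
    have "\<forall>x \<in> Obj C. \<exists>f \<in> hom C x (c (omap F x)). amap F f = e' (omap F x)"
      using full Fo c e' by blast
    then obtain n where n: "\<And>x. x \<in> Obj C \<Longrightarrow> n x \<in> hom C x (c (omap F x)) \<and> amap F (n x) = e' (omap F x)"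
      by metis
    show ?thesis unfolding naturally_isomorphic_def
    proof (intro exI conjI ballI)
      show "nat_trans C C (id_fctr C) (comp_fctr C G F) (restrict n (Obj C))"
      proof (rule nat_transI)
        fix f assume f: "f \<in> Arr C"
        define x y where "x = Dom C f" and "y = Cod C f"
        have f': "f \<in> hom C x y" using f by (simp add: hom_def x_def y_def)
        have xy: "x \<in> Obj C" "y \<in> Obj C" using C.hom_obj[OF f'] by auto
        note nx = conjunct1[OF n[OF xy(1)]] and ny = conjunct1[OF n[OF xy(2)]]
        note gF = conjunct1[OF g[OF Fh[OF f']]]
        note Fx = Fo[OF xy(1)] and Fy = Fo[OF xy(2)]
        note gnx = C.comp_hom[OF nx gF]
        have "Comp D (e (omap F y)) (amap F (Comp C (g (amap F f)) (n x)))
            = Comp D (Comp D (e (omap F y)) (amap F (g (amap F f)))) (e' (omap F x))"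
          using Fc[OF nx gF] n[OF xy(1)] D.comp_assoc[OF e'[OF Fx] Fh[OF gF] e[OF Fy]] by simp
        also have "\<dots> = Comp D (amap F f) (Comp D (e (omap F x)) (e' (omap F x)))"
          using eg[OF Fh[OF f']] D.comp_assoc[OF e'[OF Fx] e[OF Fx] Fh[OF f']] by simp
        also have "\<dots> = amap F f" using ee'[OF Fx] D.comp_id_right[OF Fh[OF f']] by simp
        also have "\<dots> = Comp D (Comp D (e (omap F y)) (e' (omap F y))) (amap F f)"
          using ee'[OF Fy] D.comp_id_left[OF Fh[OF f']] by simp
        also have "\<dots> = Comp D (e (omap F y)) (amap F (Comp C (n y) f))"
          using Fc[OF f' ny] n[OF xy(2)] D.comp_assoc[OF Fh[OF f'] e'[OF Fy] e[OF Fy]] by simp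
        finally have "amap F (Comp C (g (amap F f)) (n x)) = amap F (Comp C (n y) f)"
          by (rule D.iso_cancel_left[OF e_iso[OF Fy] e[OF Fy] Fh[OF gnx] Fh[OF C.comp_hom[OF f' ny]]])
        then have "Comp C (g (amap F f)) (n x) = Comp C (n y) f"
          by (rule faithful[OF gnx C.comp_hom[OF f' ny]])
        then show "Comp C (restrict n (Obj C) (Cod C f)) (amap (id_fctr C) f)
            = Comp C (amap (comp_fctr C G F) f) (restrict n (Obj C) (Dom C f))"
          using f xy Ga[OF Fh[OF f']] by (simp add: id_fctr_def x_def y_def)
      qed (use is_functor_comp[OF F G] is_functor_id[OF C.category_axioms] n Fo in \<open>auto simp: Go id_fctr_def\<close>)
    next
      fix x assume x: "x \<in> Obj C"
      note Fx = Fo[OF x]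
      obtain m where m: "m \<in> hom C (c (omap F x)) x" "amap F m = e (omap F x)"
        using full[OF c[OF Fx] x e[OF Fx]] by auto
      note nx = conjunct1[OF n[OF x]]
      have "Comp C m (n x) = Ident C x"
        using Fc[OF nx m(1)] m(2) n[OF x] ee'[OF Fx] Fi[OF x]
        by (intro faithful[OF C.comp_hom[OF nx m(1)] C.Ident_in[OF x]]) simp
      moreover have "Comp C (n x) m = Ident C (c (omap F x))"
        using Fc[OF m(1) nx] m(2) n[OF x] e'e[OF Fx] Fi[OF c[OF Fx]]
        by (intro faithful[OF C.comp_hom[OF m(1) nx] C.Ident_in[OF c[OF Fx]]]) simp
      ultimately show "is_iso C (restrict n (Obj C) x)"
        using C.isoI[OF nx m(1)] x by simp
    qed
  qed
  ultimately show ?thesis using F G unfolding is_equivalence_def by blast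
qed

section \<open>Pseudo-limits of categories and strictly commuting cones\<close>

lemma Cat_functorD:
  assumes "is_functor I Cat G"
  shows "i \<in> Obj I \<Longrightarrow> category (omap G i)"
    "u \<in> hom I i j \<Longrightarrow> is_functor (omap G i) (omap G j) (fctr_of (amap G u))"
    "i \<in> Obj I \<Longrightarrow> fctr_of (amap G (Ident I i)) = id_fctr (omap G i)"
    "\<lbrakk>u \<in> hom I i j; v \<in> hom I j k\<rbrakk> \<Longrightarrow> fctr_of (amap G (Comp I v u))
      = comp_fctr (omap G i) (fctr_of (amap G v)) (fctr_of (amap G u))"
proof -
  show "i \<in> Obj I \<Longrightarrow> category (omap G i)"
    using is_functorD(5)[OF assms] by (simp add: Cat_def)
  have tr: "amap G u = (omap G i, omap G j, fctr_of (amap G u)) \<and>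
      is_functor (omap G i) (omap G j) (fctr_of (amap G u))" if "u \<in> hom I i j" for u i j
    using is_functorD(6)[OF assms that] by (cases "amap G u") (auto simp: Cat_def hom_def)
  then show "u \<in> hom I i j \<Longrightarrow> is_functor (omap G i) (omap G j) (fctr_of (amap G u))" by blast
  show "i \<in> Obj I \<Longrightarrow> fctr_of (amap G (Ident I i)) = id_fctr (omap G i)"
    using is_functorD(7)[OF assms] by (simp add: Cat_def)
  assume u: "u \<in> hom I i j" and v: "v \<in> hom I j k"
  obtain U V where "amap G u = (omap G i, omap G j, U)" "amap G v = (omap G j, omap G k, V)"
    using tr[OF u] tr[OF v] by metis
  then show "fctr_of (amap G (Comp I v u))
      = comp_fctr (omap G i) (fctr_of (amap G v)) (fctr_of (amap G u))"
    using is_functorD(8)[OF assms u v] by (simp add: Cat_def)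
qed

lemma pslim_objectD:
  assumes "pslim_object I G (x, \<phi>)"
  shows "x \<in> extensional (Obj I)" "\<phi> \<in> extensional (Arr I)" "i \<in> Obj I \<Longrightarrow> x i \<in> Obj (omap G i)"
    "u \<in> hom I i j \<Longrightarrow> \<phi> u \<in> hom (omap G j) (omap (fctr_of (amap G u)) (x i)) (x j)"
    "u \<in> hom I i j \<Longrightarrow> is_iso (omap G j) (\<phi> u)"
    "i \<in> Obj I \<Longrightarrow> \<phi> (Ident I i) = Ident (omap G i) (x i)"
    "\<lbrakk>u \<in> hom I i j; v \<in> hom I j k\<rbrakk>
      \<Longrightarrow> \<phi> (Comp I v u) = Comp (omap G k) (\<phi> v) (amap (fctr_of (amap G v)) (\<phi> u))"
  using assms unfolding pslim_object_def by (auto simp: PiE_iff hom_def)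

lemma pslim_objectI:
  assumes "x \<in> extensional (Obj I)" "\<phi> \<in> extensional (Arr I)" "\<And>i. i \<in> Obj I \<Longrightarrow> x i \<in> Obj (omap G i)"
    "\<And>u i j. u \<in> hom I i j \<Longrightarrow> \<phi> u \<in> hom (omap G j) (omap (fctr_of (amap G u)) (x i)) (x j)"
    "\<And>u i j. u \<in> hom I i j \<Longrightarrow> is_iso (omap G j) (\<phi> u)"
    "\<And>i. i \<in> Obj I \<Longrightarrow> \<phi> (Ident I i) = Ident (omap G i) (x i)"
    "\<And>u v i j k. \<lbrakk>u \<in> hom I i j; v \<in> hom I j k\<rbrakk>
      \<Longrightarrow> \<phi> (Comp I v u) = Comp (omap G k) (\<phi> v) (amap (fctr_of (amap G v)) (\<phi> u))"
  shows "pslim_object I G (x, \<phi>)"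
  using assms unfolding pslim_object_def by (auto simp: PiE_iff hom_def)

lemma pslim_arrowD:
  assumes "pslim_arrow I G (x, \<phi>) (y, \<psi>) f"
  shows "f \<in> extensional (Obj I)" "i \<in> Obj I \<Longrightarrow> f i \<in> hom (omap G i) (x i) (y i)"
    "u \<in> hom I i j \<Longrightarrow> Comp (omap G j) (f j) (\<phi> u)
      = Comp (omap G j) (\<psi> u) (amap (fctr_of (amap G u)) (f i))"
  using assms unfolding pslim_arrow_def by (auto simp: PiE_iff hom_def)

lemma pslim_arrowI:
  assumes "f \<in> extensional (Obj I)" "\<And>i. i \<in> Obj I \<Longrightarrow> f i \<in> hom (omap G i) (x i) (y i)"
    "\<And>u i j. u \<in> hom I i j \<Longrightarrow> Comp (omap G j) (f j) (\<phi> u)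
      = Comp (omap G j) (\<psi> u) (amap (fctr_of (amap G u)) (f i))"
  shows "pslim_arrow I G (x, \<phi>) (y, \<psi>) f"
  using assms unfolding pslim_arrow_def by (auto simp: PiE_iff hom_def)

lemma pseudo_limit_simps [simp]:
  "X \<in> Obj (pseudo_limit I G) \<longleftrightarrow> pslim_object I G X"
  "(X, Y, f) \<in> Arr (pseudo_limit I G) \<longleftrightarrow> pslim_object I G X \<and> pslim_object I G Y \<and> pslim_arrow I G X Y f"
  "Dom (pseudo_limit I G) (X, Y, f) = X" "Cod (pseudo_limit I G) (X, Y, f) = Y"
  "Ident (pseudo_limit I G) X = (X, X, \<lambda>i \<in> Obj I. Ident (omap G i) (fst X i))"
  "Comp (pseudo_limit I G) (Y', Z, g) (X, Y, f) = (X, Z, \<lambda>i \<in> Obj I. Comp (omap G i) (g i) (f i))"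
  by (auto simp: pseudo_limit_def)

lemma pseudo_limit_hom:
  "f \<in> hom (pseudo_limit I G) X Y \<longleftrightarrow>
    (\<exists>h. f = (X, Y, h) \<and> pslim_object I G X \<and> pslim_object I G Y \<and> pslim_arrow I G X Y h)"
  by (cases f) (auto simp: hom_def)

text \<open>A name for the object map that \<open>pslim_comparison\<close> keeps local in a
  \<open>let\<close>.\<close>

definition cone_object ::
  "('i, 'u) cat \<Rightarrow> ('i, 'u, ('o, 'a) cat, ('o, 'a) cat \<times> ('o, 'a) cat \<times> ('o, 'a, 'o, 'a) fctr) fctr \<Rightarrow>
    ('i \<Rightarrow> ('o, 'a, 'o, 'a) fctr) \<Rightarrow> 'o \<Rightarrow> ('i \<Rightarrow> 'o) \<times> ('u \<Rightarrow> 'a)" where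
  "cone_object I G p c =
    (\<lambda>i \<in> Obj I. omap (p i) c, \<lambda>u \<in> Arr I. Ident (omap G (Cod I u)) (omap (p (Cod I u)) c))"

context
  fixes I :: "('i, 'u) cat"
    and G :: "('i, 'u, ('o, 'a) cat, ('o, 'a) cat \<times> ('o, 'a) cat \<times> ('o, 'a, 'o, 'a) fctr) fctr"
  assumes I: "category I" and G: "is_functor I Cat G"
begin

interpretation I: category I by (rule I)

lemma pslim_arrow_id:
  assumes X: "pslim_object I G (x, \<phi>)"
  shows "pslim_arrow I G (x, \<phi>) (x, \<phi>) (\<lambda>i \<in> Obj I. Ident (omap G i) (x i))"
proof (rule pslim_arrowI)
  fix u i j assume u: "u \<in> hom I i j"
  have ij: "i \<in> Obj I" "j \<in> Obj I" using I.hom_obj[OF u] by auto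
  interpret Gj: category "omap G j" by (rule Cat_functorD(1)[OF G ij(2)])
  note \<phi> = pslim_objectD(4)[OF X u]
  show "Comp (omap G j) ((\<lambda>i \<in> Obj I. Ident (omap G i) (x i)) j) (\<phi> u)
      = Comp (omap G j) (\<phi> u) (amap (fctr_of (amap G u)) ((\<lambda>i \<in> Obj I. Ident (omap G i) (x i)) i))"
    using ij Gj.comp_id_left[OF \<phi>] Gj.comp_id_right[OF \<phi>]
      is_functorD(7)[OF Cat_functorD(2)[OF G u] pslim_objectD(3)[OF X ij(1)]] by simp
qed (use category.Ident_in[OF Cat_functorD(1)[OF G]] pslim_objectD(3)[OF X] in auto)

lemma pslim_arrow_comp:
  assumes X: "pslim_object I G (x, \<phi>)" and Y: "pslim_object I G (y, \<psi>)" and Z: "pslim_object I G (z, \<chi>)"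
    and f: "pslim_arrow I G (x, \<phi>) (y, \<psi>) f" and g: "pslim_arrow I G (y, \<psi>) (z, \<chi>) g"
  shows "pslim_arrow I G (x, \<phi>) (z, \<chi>) (\<lambda>i \<in> Obj I. Comp (omap G i) (g i) (f i))"
proof (rule pslim_arrowI)
  fix u i j assume u: "u \<in> hom I i j"
  have ij: "i \<in> Obj I" "j \<in> Obj I" using I.hom_obj[OF u] by auto
  interpret Gj: category "omap G j" by (rule Cat_functorD(1)[OF G ij(2)])
  note U = Cat_functorD(2)[OF G u]
  note fi = pslim_arrowD(2)[OF f ij(1)] and fj = pslim_arrowD(2)[OF f ij(2)]
    and gi = pslim_arrowD(2)[OF g ij(1)] and gj = pslim_arrowD(2)[OF g ij(2)]
  note Ufi = is_functorD(6)[OF U fi] and Ugi = is_functorD(6)[OF U gi]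
  note \<phi> = pslim_objectD(4)[OF X u] and \<psi> = pslim_objectD(4)[OF Y u] and \<chi> = pslim_objectD(4)[OF Z u]
  let ?U = "amap (fctr_of (amap G u))" and ?C = "Comp (omap G j)"
  have "?C (?C (g j) (f j)) (\<phi> u) = ?C (?C (g j) (\<psi> u)) (?U (f i))"
    using Gj.comp_assoc[OF \<phi> fj gj] Gj.comp_assoc[OF Ufi \<psi> gj] pslim_arrowD(3)[OF f u] by simp
  also have "\<dots> = ?C (\<chi> u) (?U (Comp (omap G i) (g i) (f i)))"
    using pslim_arrowD(3)[OF g u] Gj.comp_assoc[OF Ufi Ugi \<chi>] is_functorD(8)[OF U fi gi] by simp
  finally show "?C ((\<lambda>i \<in> Obj I. Comp (omap G i) (g i) (f i)) j) (\<phi> u)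
      = ?C (\<chi> u) (?U ((\<lambda>i \<in> Obj I. Comp (omap G i) (g i) (f i)) i))"
    using ij by simp
qed (use category.comp_hom[OF Cat_functorD(1)[OF G] pslim_arrowD(2)[OF f] pslim_arrowD(2)[OF g]] in auto)

lemma category_pseudo_limit: "category (pseudo_limit I G)"
proof (rule categoryI)
  fix f assume "f \<in> Arr (pseudo_limit I G)"
  then show "Dom (pseudo_limit I G) f \<in> Obj (pseudo_limit I G) \<and> Cod (pseudo_limit I G) f \<in> Obj (pseudo_limit I G)"
    by (cases f) auto
next
  fix X assume "X \<in> Obj (pseudo_limit I G)"
  then show "Ident (pseudo_limit I G) X \<in> hom (pseudo_limit I G) X X"
    by (cases X) (auto simp: pseudo_limit_hom pslim_arrow_id)
next
  fix f g X Y Z assume "f \<in> hom (pseudo_limit I G) X Y" "g \<in> hom (pseudo_limit I G) Y Z"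
  then show "Comp (pseudo_limit I G) g f \<in> hom (pseudo_limit I G) X Z"
    by (cases X; cases Y; cases Z) (auto simp: pseudo_limit_hom intro: pslim_arrow_comp)
next
  fix f X Y assume "f \<in> hom (pseudo_limit I G) X Y"
  then obtain x \<phi> y \<psi> h where *: "X = (x, \<phi>)" "Y = (y, \<psi>)" "f = (X, Y, h)"
    and h: "pslim_arrow I G (x, \<phi>) (y, \<psi>) h"
    by (cases X; cases Y) (auto simp: pseudo_limit_hom)
  have "(\<lambda>i \<in> Obj I. Comp (omap G i) (h i) (Ident (omap G i) (x i))) = h"
    "(\<lambda>i \<in> Obj I. Comp (omap G i) (Ident (omap G i) (y i)) (h i)) = h"
    using pslim_arrowD(1)[OF h] category.comp_id_right[OF Cat_functorD(1)[OF G] pslim_arrowD(2)[OF h]]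
      category.comp_id_left[OF Cat_functorD(1)[OF G] pslim_arrowD(2)[OF h]]
    by (auto intro!: extensionalityI[of _ "Obj I"])
  then show "Comp (pseudo_limit I G) f (Ident (pseudo_limit I G) X) = f"
    "Comp (pseudo_limit I G) (Ident (pseudo_limit I G) Y) f = f"
    by (simp_all add: * cong: restrict_cong)
next
  fix f g h X Y Z W
  assume "f \<in> hom (pseudo_limit I G) X Y" "g \<in> hom (pseudo_limit I G) Y Z" "h \<in> hom (pseudo_limit I G) Z W"
  then obtain x \<phi> y \<psi> z \<chi> w \<omega> f' g' h' where *: "X = (x, \<phi>)" "Y = (y, \<psi>)" "Z = (z, \<chi>)" "W = (w, \<omega>)"
    "f = (X, Y, f')" "g = (Y, Z, g')" "h = (Z, W, h')"
    and f': "pslim_arrow I G (x, \<phi>) (y, \<psi>) f'" and g': "pslim_arrow I G (y, \<psi>) (z, \<chi>) g'"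
    and h': "pslim_arrow I G (z, \<chi>) (w, \<omega>) h'"
    by (cases X; cases Y; cases Z; cases W) (auto simp: pseudo_limit_hom)
  have "Comp (omap G i) (h' i) (Comp (omap G i) (g' i) (f' i)) = Comp (omap G i) (Comp (omap G i) (h' i) (g' i)) (f' i)"
    if "i \<in> Obj I" for i
    using category.comp_assoc[OF Cat_functorD(1)[OF G that]] pslim_arrowD(2)[OF f' that]
      pslim_arrowD(2)[OF g' that] pslim_arrowD(2)[OF h' that] by blast
  then show "Comp (pseudo_limit I G) h (Comp (pseudo_limit I G) g f)
      = Comp (pseudo_limit I G) (Comp (pseudo_limit I G) h g) f"
    by (auto simp: * intro: restrict_ext)
qed

text \<open>Componentwise inverses respect the structure isomorphisms: after composing on the left
  with the invertible \<open>f j\<close>, this becomes the compatibility of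
  \<open>f\<close>.\<close>

lemma is_iso_pseudo_limit:
  assumes X: "pslim_object I G (x, \<phi>)" and Y: "pslim_object I G (y, \<psi>)"
    and f: "pslim_arrow I G (x, \<phi>) (y, \<psi>) f" and iso: "\<And>i. i \<in> Obj I \<Longrightarrow> is_iso (omap G i) (f i)"
  shows "is_iso (pseudo_limit I G) ((x, \<phi>), (y, \<psi>), f)"
proof -
  interpret PL: category "pseudo_limit I G" by (rule category_pseudo_limit)
  have "\<forall>i \<in> Obj I. \<exists>g. g \<in> hom (omap G i) (y i) (x i) \<and> Comp (omap G i) g (f i) = Ident (omap G i) (x i)
      \<and> Comp (omap G i) (f i) g = Ident (omap G i) (y i)"
    using iso pslim_arrowD(2)[OF f] category.isoE[OF Cat_functorD(1)[OF G]] by metis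
  then obtain g' where g': "\<And>i. i \<in> Obj I \<Longrightarrow> g' i \<in> hom (omap G i) (y i) (x i)
      \<and> Comp (omap G i) (g' i) (f i) = Ident (omap G i) (x i) \<and> Comp (omap G i) (f i) (g' i) = Ident (omap G i) (y i)"
    by metis
  define g where "g = restrict g' (Obj I)"
  have g: "g i \<in> hom (omap G i) (y i) (x i)" "Comp (omap G i) (g i) (f i) = Ident (omap G i) (x i)"
    "Comp (omap G i) (f i) (g i) = Ident (omap G i) (y i)" if "i \<in> Obj I" for i
    using g'[OF that] that by (auto simp: g_def)
  have "pslim_arrow I G (y, \<psi>) (x, \<phi>) g"
  proof (rule pslim_arrowI)
    fix u i j assume u: "u \<in> hom I i j"
    have ij: "i \<in> Obj I" "j \<in> Obj I" using I.hom_obj[OF u] by auto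
    interpret Gi: category "omap G i" by (rule Cat_functorD(1)[OF G ij(1)])
    interpret Gj: category "omap G j" by (rule Cat_functorD(1)[OF G ij(2)])
    note U = Cat_functorD(2)[OF G u]
    note fi = pslim_arrowD(2)[OF f ij(1)] and fj = pslim_arrowD(2)[OF f ij(2)]
    note gi = g(1)[OF ij(1)] and gj = g(1)[OF ij(2)]
    note Ufi = is_functorD(6)[OF U fi] and Ugi = is_functorD(6)[OF U gi]
    note \<phi> = pslim_objectD(4)[OF X u] and \<psi> = pslim_objectD(4)[OF Y u]
    let ?U = "amap (fctr_of (amap G u))" and ?C = "Comp (omap G j)"
    have "?C (f j) (?C (\<phi> u) (?U (g i))) = ?C (?C (\<psi> u) (?U (f i))) (?U (g i))"
      using Gj.comp_assoc[OF Ugi \<phi> fj] pslim_arrowD(3)[OF f u] by simp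
    also have "\<dots> = ?C (\<psi> u) (?U (Comp (omap G i) (f i) (g i)))"
      using Gj.comp_assoc[OF Ugi Ufi \<psi>] is_functorD(8)[OF U gi fi] by simp
    also have "\<dots> = \<psi> u"
      using g(3)[OF ij(1)] is_functorD(7)[OF U pslim_objectD(3)[OF Y ij(1)]] Gj.comp_id_right[OF \<psi>] by simp
    also have "\<dots> = ?C (f j) (?C (g j) (\<psi> u))"
      using Gj.comp_assoc[OF \<psi> gj fj] g(3)[OF ij(2)] Gj.comp_id_left[OF \<psi>] by simp
    finally show "?C (g j) (\<psi> u) = ?C (\<phi> u) (?U (g i))"
      using Gj.iso_cancel_left[OF iso[OF ij(2)] fj Gj.comp_hom[OF Ugi \<phi>] Gj.comp_hom[OF \<psi> gj]] by simp
  qed (use g in \<open>auto simp: g_def\<close>)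
  then show ?thesis
    using X Y f g by (intro PL.isoI[of _ "(x, \<phi>)" "(y, \<psi>)" "((y, \<psi>), (x, \<phi>), g)"])
      (auto simp: pseudo_limit_hom intro!: restrict_ext)
qed

context
  fixes C :: "('o, 'a) cat" and p
  assumes C: "category C"
    and p: "\<And>i. i \<in> Obj I \<Longrightarrow> is_functor C (omap G i) (p i)"
    and cone: "\<And>u i j. u \<in> hom I i j \<Longrightarrow> comp_fctr C (fctr_of (amap G u)) (p i) = p j"
begin

interpretation C: category C by (rule C)

lemma pslim_comparison_simps:
  "c \<in> Obj C \<Longrightarrow> omap (pslim_comparison I G C p) c = cone_object I G p c"
  "f \<in> hom C c d \<Longrightarrow> amap (pslim_comparison I G C p) f = (cone_object I G p c, cone_object I G p d, \<lambda>i \<in> Obj I. amap (p i) f)"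
  by (auto simp: pslim_comparison_def cone_object_def Let_def hom_def)

lemma cone_omap:
  assumes "u \<in> hom I i j" "c \<in> Obj C"
  shows "omap (fctr_of (amap G u)) (omap (p i) c) = omap (p j) c"
  using comp_fctr_simps(1)[OF assms(2), of "fctr_of (amap G u)" "p i"] cone[OF assms(1)] by simp

lemma cone_amap:
  assumes "u \<in> hom I i j" "f \<in> hom C c d"
  shows "amap (fctr_of (amap G u)) (amap (p i) f) = amap (p j) f"
  using comp_fctr_simps(2)[of f C "fctr_of (amap G u)" "p i"] cone[OF assms(1)] assms(2) by (simp add: hom_def)

lemma pslim_cone_object:
  assumes c: "c \<in> Obj C"
  shows "pslim_object I G (cone_object I G p c)"
  unfolding cone_object_def
proof (rule pslim_objectI)
  fix i assume i: "i \<in> Obj I"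
  show "(\<lambda>i \<in> Obj I. omap (p i) c) i \<in> Obj (omap G i)"
    using i is_functorD(5)[OF p[OF i] c] by simp
  show "(\<lambda>u \<in> Arr I. Ident (omap G (Cod I u)) (omap (p (Cod I u)) c)) (Ident I i)
      = Ident (omap G i) ((\<lambda>i \<in> Obj I. omap (p i) c) i)"
    using i I.Ident_in[OF i] by (simp add: hom_def)
next
  fix u i j assume u: "u \<in> hom I i j"
  have ij: "i \<in> Obj I" "j \<in> Obj I" "u \<in> Arr I" "Cod I u = j" using I.hom_obj[OF u] u by (auto simp: hom_def)
  interpret Gj: category "omap G j" by (rule Cat_functorD(1)[OF G ij(2)])
  note pc = is_functorD(5)[OF p[OF ij(2)] c]
  show "(\<lambda>u \<in> Arr I. Ident (omap G (Cod I u)) (omap (p (Cod I u)) c)) u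
      \<in> hom (omap G j) (omap (fctr_of (amap G u)) ((\<lambda>i \<in> Obj I. omap (p i) c) i)) ((\<lambda>i \<in> Obj I. omap (p i) c) j)"
    using ij cone_omap[OF u c] Gj.Ident_in[OF pc] by simp
  show "is_iso (omap G j) ((\<lambda>u \<in> Arr I. Ident (omap G (Cod I u)) (omap (p (Cod I u)) c)) u)"
    using ij Gj.iso_id[OF pc] by simp
  fix v k assume v: "v \<in> hom I j k"
  have k: "k \<in> Obj I" "v \<in> Arr I" "Cod I v = k" using I.hom_obj[OF v] v by (auto simp: hom_def)
  have vu: "Comp I v u \<in> Arr I" "Cod I (Comp I v u) = k"
    using I.comp_hom[OF u v] by (auto simp: hom_def)
  interpret Gk: category "omap G k" by (rule Cat_functorD(1)[OF G k(1)])
  show "(\<lambda>u \<in> Arr I. Ident (omap G (Cod I u)) (omap (p (Cod I u)) c)) (Comp I v u)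
      = Comp (omap G k) ((\<lambda>u \<in> Arr I. Ident (omap G (Cod I u)) (omap (p (Cod I u)) c)) v)
        (amap (fctr_of (amap G v)) ((\<lambda>u \<in> Arr I. Ident (omap G (Cod I u)) (omap (p (Cod I u)) c)) u))"
    using ij k vu is_functorD(7)[OF Cat_functorD(2)[OF G v] pc] cone_omap[OF v c]
      Gk.comp_id_left[OF Gk.Ident_in[OF is_functorD(5)[OF p[OF k(1)] c]]] by simp
qed auto

lemma pslim_cone_arrow:
  assumes f: "f \<in> hom C c d"
  shows "pslim_arrow I G (cone_object I G p c) (cone_object I G p d) (\<lambda>i \<in> Obj I. amap (p i) f)"
  unfolding cone_object_def
proof (rule pslim_arrowI)
  fix u i j assume u: "u \<in> hom I i j"
  have ij: "i \<in> Obj I" "j \<in> Obj I" "u \<in> Arr I" "Cod I u = j" using I.hom_obj[OF u] u by (auto simp: hom_def)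
  interpret Gj: category "omap G j" by (rule Cat_functorD(1)[OF G ij(2)])
  note pf = is_functorD(6)[OF p[OF ij(2)] f]
  show "Comp (omap G j) ((\<lambda>i \<in> Obj I. amap (p i) f) j)
        ((\<lambda>u \<in> Arr I. Ident (omap G (Cod I u)) (omap (p (Cod I u)) c)) u)
      = Comp (omap G j) ((\<lambda>u \<in> Arr I. Ident (omap G (Cod I u)) (omap (p (Cod I u)) d)) u)
        (amap (fctr_of (amap G u)) ((\<lambda>i \<in> Obj I. amap (p i) f) i))"
    using ij cone_amap[OF u f] Gj.comp_id_left[OF pf] Gj.comp_id_right[OF pf] by simp
qed (use is_functorD(6)[OF p f] in auto)

lemma is_functor_pslim_comparison: "is_functor C (pseudo_limit I G) (pslim_comparison I G C p)"
proof (rule is_functorI)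
  fix c assume c: "c \<in> Obj C"
  show "omap (pslim_comparison I G C p) c \<in> Obj (pseudo_limit I G)"
    using c by (simp add: pslim_comparison_simps pslim_cone_object)
  have "(\<lambda>i \<in> Obj I. amap (p i) (Ident C c)) = (\<lambda>i \<in> Obj I. Ident (omap G i) (fst (cone_object I G p c) i))"
    using is_functorD(7)[OF p c] by (auto simp: cone_object_def)
  then show "amap (pslim_comparison I G C p) (Ident C c)
      = Ident (pseudo_limit I G) (omap (pslim_comparison I G C p) c)"
    using c by (simp add: pslim_comparison_simps(1) pslim_comparison_simps(2)[OF C.Ident_in])
next
  fix f assume f: "f \<in> Arr C"
  then have f': "f \<in> hom C (Dom C f) (Cod C f)" by (simp add: hom_def)
  show "amap (pslim_comparison I G C p) f \<in> hom (pseudo_limit I G)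
      (omap (pslim_comparison I G C p) (Dom C f)) (omap (pslim_comparison I G C p) (Cod C f))"
    using C.hom_obj[OF f'] pslim_cone_arrow[OF f']
    by (simp add: pslim_comparison_simps(1) pslim_comparison_simps(2)[OF f'] pseudo_limit_hom pslim_cone_object)
  fix g assume g: "g \<in> Arr C" "Dom C g = Cod C f"
  then have g': "g \<in> hom C (Cod C f) (Cod C g)" by (simp add: hom_def)
  show "amap (pslim_comparison I G C p) (Comp C g f)
      = Comp (pseudo_limit I G) (amap (pslim_comparison I G C p) g) (amap (pslim_comparison I G C p) f)"
    using is_functorD(8)[OF p f' g']
    by (auto simp: pslim_comparison_simps(2)[OF f'] pslim_comparison_simps(2)[OF g']
      pslim_comparison_simps(2)[OF C.comp_hom[OF f' g']] intro: restrict_ext)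
qed (auto simp: C category_pseudo_limit pslim_comparison_def Let_def)

end

end

section \<open>Products\<close>

lemma is_productD:
  assumes "is_product C I x p \<pi>"
  shows "p \<in> Obj C" "i \<in> I \<Longrightarrow> \<pi> i \<in> hom C p (x i)"
    "\<lbrakk>q \<in> Obj C; \<And>i. i \<in> I \<Longrightarrow> f i \<in> hom C q (x i)\<rbrakk>
      \<Longrightarrow> \<exists>h. h \<in> hom C q p \<and> (\<forall>i \<in> I. Comp C (\<pi> i) h = f i)"
  using assms unfolding is_product_def by blast+

lemma is_product_cong:
  assumes "is_product C I x p \<pi>" "I = J" "\<And>i. i \<in> I \<Longrightarrow> x i = y i" "\<And>i. i \<in> I \<Longrightarrow> \<pi> i = \<rho> i"
  shows "is_product C J y p \<rho>"
  using assms unfolding is_product_def by simp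

context category
begin

lemma is_productI:
  assumes "p \<in> Obj C" "\<And>i. i \<in> I \<Longrightarrow> \<pi> i \<in> hom C p (x i)"
    "\<And>q f. \<lbrakk>q \<in> Obj C; \<And>i. i \<in> I \<Longrightarrow> f i \<in> hom C q (x i)\<rbrakk>
      \<Longrightarrow> \<exists>h. h \<in> hom C q p \<and> (\<forall>i \<in> I. Comp C (\<pi> i) h = f i)"
    "\<And>q h h'. \<lbrakk>h \<in> hom C q p; h' \<in> hom C q p; \<And>i. i \<in> I \<Longrightarrow> Comp C (\<pi> i) h = Comp C (\<pi> i) h'\<rbrakk> \<Longrightarrow> h = h'"
  shows "is_product C I x p \<pi>"
  unfolding is_product_def
proof (intro conjI ballI allI impI)
  fix q f assume q: "q \<in> Obj C" and f: "\<forall>i \<in> I. f i \<in> hom C q (x i)"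
  then obtain h where h: "h \<in> hom C q p" "\<forall>i \<in> I. Comp C (\<pi> i) h = f i"
    using assms(3)[of q f] by blast
  show "\<exists>!h. h \<in> hom C q p \<and> (\<forall>i \<in> I. Comp C (\<pi> i) h = f i)"
  proof (rule ex1I[of _ h])
    show "h \<in> hom C q p \<and> (\<forall>i \<in> I. Comp C (\<pi> i) h = f i)" using h by blast
    fix h' assume "h' \<in> hom C q p \<and> (\<forall>i \<in> I. Comp C (\<pi> i) h' = f i)"
    then show "h' = h" using h assms(4)[of h' q h] by simp
  qed
qed (use assms in auto)

lemma product_eqI:
  assumes P: "is_product C I x p \<pi>" and h: "h \<in> hom C q p" "h' \<in> hom C q p"
    and eq: "\<And>i. i \<in> I \<Longrightarrow> Comp C (\<pi> i) h = Comp C (\<pi> i) h'"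
  shows "h = h'"
proof -
  have q: "q \<in> Obj C" using hom_obj[OF h(1)] by simp
  have "\<forall>i \<in> I. Comp C (\<pi> i) h \<in> hom C q (x i)" using comp_hom[OF h(1)] is_productD(2)[OF P] by blast
  moreover have "(\<forall>i \<in> I. f i \<in> hom C q (x i)) \<longrightarrow>
      (\<exists>!k. k \<in> hom C q p \<and> (\<forall>i \<in> I. Comp C (\<pi> i) k = f i))" for f
    using P q unfolding is_product_def by simp
  ultimately have "\<exists>!k. k \<in> hom C q p \<and> (\<forall>i \<in> I. Comp C (\<pi> i) k = Comp C (\<pi> i) h)"
    by (rule mp[rotated])
  then obtain k where *: "\<forall>l. l \<in> hom C q p \<and> (\<forall>i \<in> I. Comp C (\<pi> i) l = Comp C (\<pi> i) h) \<longrightarrow> l = k"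
    unfolding Ex1_def by (elim exE conjE)
  have "h = k" using * h by simp
  moreover have "h' = k" using * h eq by simp
  ultimately show ?thesis by simp
qed

lemma is_product_iso:
  assumes P: "is_product C I x p \<pi>" and h: "is_iso C h" "h \<in> hom C q p"
  shows "is_product C I x q (\<lambda>i. Comp C (\<pi> i) h)"
proof (rule is_productI)
  obtain g where g: "g \<in> hom C p q" "Comp C g h = Ident C q" "Comp C h g = Ident C p"
    using h by (rule isoE)
  show "q \<in> Obj C" using hom_obj[OF h(2)] by simp
  show "Comp C (\<pi> i) h \<in> hom C q (x i)" if "i \<in> I" for i
    using comp_hom[OF h(2) is_productD(2)[OF P that]] .
  show "\<exists>k. k \<in> hom C r q \<and> (\<forall>i \<in> I. Comp C (Comp C (\<pi> i) h) k = f i)"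
    if r: "r \<in> Obj C" and f: "\<And>i. i \<in> I \<Longrightarrow> f i \<in> hom C r (x i)" for r f
  proof -
    obtain k where k: "k \<in> hom C r p" "\<forall>i \<in> I. Comp C (\<pi> i) k = f i"
      using is_productD(3)[OF P r, of f] f by blast
    have gk: "Comp C g k \<in> hom C r q" using comp_hom[OF k(1) g(1)] .
    have "Comp C h (Comp C g k) = k"
      using comp_assoc[OF k(1) g(1) h(2)] g(3) comp_id_left[OF k(1)] by simp
    then have "Comp C (Comp C (\<pi> i) h) (Comp C g k) = f i" if "i \<in> I" for i
      using comp_assoc[OF gk h(2) is_productD(2)[OF P that]] k(2) that by simp
    then show ?thesis using gk by blast
  qed
  show "k = k'" if k: "k \<in> hom C r q" and k': "k' \<in> hom C r q"
    and eq: "\<And>i. i \<in> I \<Longrightarrow> Comp C (Comp C (\<pi> i) h) k = Comp C (Comp C (\<pi> i) h) k'" for r k k'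
  proof (rule iso_cancel_left[OF h k k'], rule product_eqI[OF P])
    show "Comp C h k \<in> hom C r p" "Comp C h k' \<in> hom C r p" using k k' h comp_hom by blast+
    show "Comp C (\<pi> i) (Comp C h k) = Comp C (\<pi> i) (Comp C h k')" if "i \<in> I" for i
      using eq[OF that] comp_assoc[OF k h(2) is_productD(2)[OF P that]]
        comp_assoc[OF k' h(2) is_productD(2)[OF P that]] by simp
  qed
qed

lemma product_comparison_iso:
  assumes P: "is_product C I x p \<pi>" and Q: "is_product C I x q \<rho>"
    and h: "h \<in> hom C q p" and eq: "\<And>i. i \<in> I \<Longrightarrow> Comp C (\<pi> i) h = \<rho> i"
  shows "is_iso C h"
proof -
  have p: "p \<in> Obj C" and q: "q \<in> Obj C" using P Q by (auto dest: is_productD(1))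
  obtain g where g: "g \<in> hom C p q" "\<forall>i \<in> I. Comp C (\<rho> i) g = \<pi> i"
    using is_productD(3)[OF Q p, of \<pi>] is_productD(2)[OF P] by blast
  have "Comp C h g = Ident C p"
  proof (rule product_eqI[OF P])
    show "Comp C (\<pi> i) (Comp C h g) = Comp C (\<pi> i) (Ident C p)" if i: "i \<in> I" for i
      using comp_assoc[OF g(1) h is_productD(2)[OF P i]] eq[OF i] g(2) i comp_id_right[OF is_productD(2)[OF P i]]
      by simp
  qed (use comp_hom[OF g(1) h] Ident_in[OF p] in auto)
  moreover have "Comp C g h = Ident C q"
  proof (rule product_eqI[OF Q])
    show "Comp C (\<rho> i) (Comp C g h) = Comp C (\<rho> i) (Ident C q)" if i: "i \<in> I" for i
      using comp_assoc[OF h g(1) is_productD(2)[OF Q i]] eq[OF i] g(2) i comp_id_right[OF is_productD(2)[OF Q i]]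
      by simp
  qed (use comp_hom[OF h g(1)] Ident_in[OF q] in auto)
  ultimately show ?thesis using isoI[OF h g(1)] by simp
qed

text \<open>\<open>has_finite_products\<close> quantifies over index sets of naturals, so a product
  over \<open>I\<close> is carried over from \<open>{0..<card I}\<close> along a bijection.\<close>

lemma ex_product:
  assumes fp: "has_finite_products C" and "finite I" and x: "\<And>i. i \<in> I \<Longrightarrow> x i \<in> Obj C"
  shows "\<exists>p \<pi>. is_product C I x p \<pi>"
proof -
  define N where "N = {0..<card I}"
  obtain e where e: "bij_betw e N I"
    using ex_bij_betw_nat_finite[OF \<open>finite I\<close>] unfolding N_def by (elim exE)
  have N: "finite N" "bij_betw e N I" using e by (simp_all add: N_def)
  define d where "d = inv_into N e"
  have d: "bij_betw d I N" using N(2) by (simp add: d_def bij_betw_inv_into)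
  have ed: "e (d i) = i" if "i \<in> I" for i
    using that N(2) by (simp add: d_def bij_betw_inv_into_right)
  have de: "d (e n) = n" if "n \<in> N" for n
    using that N(2) by (simp add: d_def bij_betw_inv_into_left)
  have "x \<circ> e \<in> N \<rightarrow> Obj C" using x N(2) by (auto simp: bij_betw_def)
  then obtain p \<pi> where P: "is_product C N (x \<circ> e) p \<pi>"
    using fp[unfolded has_finite_products_def, rule_format, of N "x \<circ> e"] N(1) by auto
  have "is_product C I x p (\<pi> \<circ> d)"
  proof (rule is_productI)
    show "p \<in> Obj C" using is_productD(1)[OF P] .
    show "(\<pi> \<circ> d) i \<in> hom C p (x i)" if "i \<in> I" for i
      using is_productD(2)[OF P, of "d i"] that d ed[OF that] by (auto simp: bij_betw_def)
    show "\<exists>h. h \<in> hom C q p \<and> (\<forall>i \<in> I. Comp C ((\<pi> \<circ> d) i) h = f i)"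
      if q: "q \<in> Obj C" and f: "\<And>i. i \<in> I \<Longrightarrow> f i \<in> hom C q (x i)" for q f
    proof -
      have "\<exists>h. h \<in> hom C q p \<and> (\<forall>n \<in> N. Comp C (\<pi> n) h = f (e n))"
        using f N(2) by (intro is_productD(3)[OF P q]) (auto simp: bij_betw_def)
      then obtain h where h: "h \<in> hom C q p" "\<forall>n \<in> N. Comp C (\<pi> n) h = f (e n)" by (elim exE conjE)
      have "d i \<in> N" if "i \<in> I" for i using d that by (auto simp: bij_betw_def)
      then have "\<forall>i \<in> I. Comp C ((\<pi> \<circ> d) i) h = f i" using h(2) ed by simp
      then show ?thesis using h(1) by (intro exI[of _ h] conjI)
    qed
    show "h = h'" if "h \<in> hom C q p" "h' \<in> hom C q p"
      and eq: "\<And>i. i \<in> I \<Longrightarrow> Comp C ((\<pi> \<circ> d) i) h = Comp C ((\<pi> \<circ> d) i) h'" for q h h'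
    proof (rule product_eqI[OF P that(1,2)])
      show "Comp C (\<pi> n) h = Comp C (\<pi> n) h'" if "n \<in> N" for n
        using eq[OF bij_betwE[OF N(2), rule_format, OF that]] de[OF that] by simp
    qed
  qed
  then show ?thesis by blast
qed

text \<open>\<open>f\<close> sorts the factors into groups indexed by \<open>K\<close>. Empty groups
  are allowed; their product is a terminal object.\<close>

lemma product_of_products:
  assumes P: "is_product C K x p \<pi>" and f: "f ` I \<subseteq> K"
    and R: "\<And>k. k \<in> K \<Longrightarrow> is_product C {i \<in> I. f i = k} y (x k) (\<rho> k)"
  shows "is_product C I y p (\<lambda>i. Comp C (\<rho> (f i) i) (\<pi> (f i)))"
proof (rule is_productI)
  show "p \<in> Obj C" using is_productD(1)[OF P] .
  have \<rho>: "\<rho> (f i) i \<in> hom C (x (f i)) (y i)" and \<pi>: "\<pi> (f i) \<in> hom C p (x (f i))" if "i \<in> I" for i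
    using is_productD(2)[OF R, of "f i" i] is_productD(2)[OF P, of "f i"] f that by auto
  then show "Comp C (\<rho> (f i) i) (\<pi> (f i)) \<in> hom C p (y i)" if "i \<in> I" for i
    using comp_hom that by blast
  show "\<exists>h. h \<in> hom C q p \<and> (\<forall>i \<in> I. Comp C (Comp C (\<rho> (f i) i) (\<pi> (f i))) h = g i)"
    if q: "q \<in> Obj C" and g: "\<And>i. i \<in> I \<Longrightarrow> g i \<in> hom C q (y i)" for q g
  proof -
    have "\<forall>k \<in> K. \<exists>h. h \<in> hom C q (x k) \<and> (\<forall>i \<in> {i \<in> I. f i = k}. Comp C (\<rho> k i) h = g i)"
      using g by (intro ballI is_productD(3)[OF R q]) auto
    then obtain h where h: "\<And>k. k \<in> K \<Longrightarrow> h k \<in> hom C q (x k)"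
      "\<And>i. i \<in> I \<Longrightarrow> Comp C (\<rho> (f i) i) (h (f i)) = g i"
      using f by (simp add: image_subset_iff) metis
    obtain l where l: "l \<in> hom C q p" "\<forall>k \<in> K. Comp C (\<pi> k) l = h k"
      using is_productD(3)[OF P q, of h] h(1) by blast
    have "Comp C (Comp C (\<rho> (f i) i) (\<pi> (f i))) l = g i" if "i \<in> I" for i
      using comp_assoc[OF l(1) \<pi>[OF that] \<rho>[OF that]] l(2) h(2)[OF that] f that by auto
    then show ?thesis using l(1) by blast
  qed
  show "h = h'" if h: "h \<in> hom C q p" "h' \<in> hom C q p"
    and eq: "\<And>i. i \<in> I \<Longrightarrow> Comp C (Comp C (\<rho> (f i) i) (\<pi> (f i))) h = Comp C (Comp C (\<rho> (f i) i) (\<pi> (f i))) h'" for q h h'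
  proof (rule product_eqI[OF P h])
    fix k assume k: "k \<in> K"
    note \<pi>k = is_productD(2)[OF P k]
    show "Comp C (\<pi> k) h = Comp C (\<pi> k) h'"
    proof (rule product_eqI[OF R[OF k]])
      show "Comp C (\<pi> k) h \<in> hom C q (x k)" "Comp C (\<pi> k) h' \<in> hom C q (x k)"
        using h comp_hom \<pi>k by blast+
      show "Comp C (\<rho> k i) (Comp C (\<pi> k) h) = Comp C (\<rho> k i) (Comp C (\<pi> k) h')"
        if "i \<in> {i \<in> I. f i = k}" for i
        using that eq[of i] \<rho>[of i] comp_assoc[OF h(1) \<pi>k, of "\<rho> k i"] comp_assoc[OF h(2) \<pi>k, of "\<rho> k i"] by auto
    qed
  qed
qed

text \<open>The converse grouping: a map into the group at \<open>k\<close> is tested against the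
  projections \<open>\<rho> k\<close>, and for these the universal property of the total product is
  available.\<close>

lemma product_regroup:
  assumes P: "is_product C I y p \<tau>" and f: "f ` I \<subseteq> K"
    and R: "\<And>k. k \<in> K \<Longrightarrow> is_product C {i \<in> I. f i = k} y (x k) (\<rho> k)"
    and \<pi>: "\<And>k. k \<in> K \<Longrightarrow> \<pi> k \<in> hom C p (x k)"
    and eq: "\<And>i. i \<in> I \<Longrightarrow> Comp C (\<rho> (f i) i) (\<pi> (f i)) = \<tau> i"
  shows "is_product C K x p \<pi>"
proof (rule is_productI)
  show "p \<in> Obj C" using is_productD(1)[OF P] .
  have \<rho>: "\<rho> (f i) i \<in> hom C (x (f i)) (y i)" if "i \<in> I" for i
    using is_productD(2)[OF R, of "f i" i] f that by auto
  show "\<pi> k \<in> hom C p (x k)" if "k \<in> K" for k using \<pi>[OF that] .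
  show "\<exists>h. h \<in> hom C q p \<and> (\<forall>k \<in> K. Comp C (\<pi> k) h = g k)"
    if q: "q \<in> Obj C" and g: "\<And>k. k \<in> K \<Longrightarrow> g k \<in> hom C q (x k)" for q g
  proof -
    have "\<exists>h. h \<in> hom C q p \<and> (\<forall>i \<in> I. Comp C (\<tau> i) h = Comp C (\<rho> (f i) i) (g (f i)))"
      using f g \<rho> by (intro is_productD(3)[OF P q]) (auto intro: comp_hom)
    then obtain h where h: "h \<in> hom C q p" "\<And>i. i \<in> I \<Longrightarrow> Comp C (\<tau> i) h = Comp C (\<rho> (f i) i) (g (f i))"
      by blast
    have "Comp C (\<pi> k) h = g k" if k: "k \<in> K" for k
    proof (rule product_eqI[OF R[OF k]])
      show "Comp C (\<pi> k) h \<in> hom C q (x k)" using h(1) comp_hom \<pi>[OF k] by blast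
      show "g k \<in> hom C q (x k)" using g[OF k] .
      show "Comp C (\<rho> k i) (Comp C (\<pi> k) h) = Comp C (\<rho> k i) (g k)" if "i \<in> {i \<in> I. f i = k}" for i
        using that eq[of i] h(2)[of i] \<rho>[of i] comp_assoc[OF h(1) \<pi>[OF k], of "\<rho> k i"] by auto
    qed
    then show ?thesis using h(1) by blast
  qed
  show "h = h'" if h: "h \<in> hom C q p" "h' \<in> hom C q p"
    and eq': "\<And>k. k \<in> K \<Longrightarrow> Comp C (\<pi> k) h = Comp C (\<pi> k) h'" for q h h'
  proof (rule product_eqI[OF P h])
    fix i assume i: "i \<in> I"
    then have fi: "f i \<in> K" using f by auto
    show "Comp C (\<tau> i) h = Comp C (\<tau> i) h'"
      using comp_assoc[OF h(1) \<pi>[OF fi] \<rho>[OF i]] comp_assoc[OF h(2) \<pi>[OF fi] \<rho>[OF i]] eq[OF i] eq'[OF fi] by simp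
  qed
qed

end

section \<open>Sheaves on finite pointed sets\<close>

lemma presheafD:
  assumes F: "is_functor (op_cat (subset_cat Q)) D F"
  shows "U \<in> Q \<Longrightarrow> omap F U \<in> Obj D"
    "\<lbrakk>U \<in> Q; V \<in> Q; U \<subseteq> V\<rbrakk> \<Longrightarrow> amap F (U, V) \<in> hom D (omap F V) (omap F U)"
    "U \<in> Q \<Longrightarrow> amap F (U, U) = Ident D (omap F U)"
    "\<lbrakk>U \<in> Q; V \<in> Q; W \<in> Q; U \<subseteq> V; V \<subseteq> W\<rbrakk> \<Longrightarrow> Comp D (amap F (U, V)) (amap F (V, W)) = amap F (U, W)"
  using is_functorD(5)[OF F, of U] is_functorD(6)[OF F, of "(U, V)" V U] is_functorD(7)[OF F, of U]
    is_functorD(8)[OF F, of "(V, W)" W V "(U, V)" U]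
  by auto

lemma presheafI:
  assumes "category D" "omap F \<in> extensional Q" "amap F \<in> extensional (Arr (subset_cat Q))"
    and "\<And>U. U \<in> Q \<Longrightarrow> omap F U \<in> Obj D"
    and "\<And>U V. \<lbrakk>U \<in> Q; V \<in> Q; U \<subseteq> V\<rbrakk> \<Longrightarrow> amap F (U, V) \<in> hom D (omap F V) (omap F U)"
    and "\<And>U. U \<in> Q \<Longrightarrow> amap F (U, U) = Ident D (omap F U)"
    and "\<And>U V W. \<lbrakk>U \<in> Q; V \<in> Q; W \<in> Q; U \<subseteq> V; V \<subseteq> W\<rbrakk>
      \<Longrightarrow> Comp D (amap F (U, V)) (amap F (V, W)) = amap F (U, W)"
  shows "is_functor (op_cat (subset_cat Q)) D F"
  by (rule is_functorI) (use assms category_op[OF category_subset_cat] in auto)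

lemma presheaf_mapD:
  assumes "nat_trans (op_cat (subset_cat Q)) D F G \<eta>"
  shows "U \<in> Q \<Longrightarrow> \<eta> U \<in> hom D (omap F U) (omap G U)"
    "\<lbrakk>U \<in> Q; V \<in> Q; U \<subseteq> V\<rbrakk> \<Longrightarrow> Comp D (\<eta> U) (amap F (U, V)) = Comp D (amap G (U, V)) (\<eta> V)"
  using nat_transD(4)[OF assms, of U] nat_transD(5)[OF assms, of "(U, V)" V U] by auto

lemma presheaf_mapI:
  assumes "is_functor (op_cat (subset_cat Q)) D F" "is_functor (op_cat (subset_cat Q)) D G"
    and "\<eta> \<in> extensional Q" "\<And>U. U \<in> Q \<Longrightarrow> \<eta> U \<in> hom D (omap F U) (omap G U)"
    and "\<And>U V. \<lbrakk>U \<in> Q; V \<in> Q; U \<subseteq> V\<rbrakk> \<Longrightarrow> Comp D (\<eta> U) (amap F (U, V)) = Comp D (amap G (U, V)) (\<eta> V)"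
  shows "nat_trans (op_cat (subset_cat Q)) D F G \<eta>"
  by (rule nat_transI) (use assms in auto)

lemma pointed_pair [simp]: "U \<in> pointed_subsets T \<Longrightarrow> u \<in> U \<Longrightarrow> {snd T, u} \<in> pointed_subsets T"
  by (auto simp: pointed_subsets_def)

lemma pointed_pair_sub: "U \<in> pointed_subsets T \<Longrightarrow> u \<in> U \<Longrightarrow> {snd T, u} \<subseteq> U"
  by (auto simp: pointed_subsets_def)

text \<open>Removes the auxiliary product from the sheaf condition: the restrictions to two-element
  pointed subsets are themselves the projections. In one direction the isomorphism \<open>h\<close>
  transports the product structure; in the other \<open>F\<close> at \<open>U\<close> with the
  identity as \<open>h\<close> is a witness.\<close>

lemma is_sheaf_iff:
  "is_sheaf D T F \<longleftrightarrow> is_functor (presheaf_shape T) D F \<and>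
    (\<forall>U \<in> pointed_subsets T. is_product D (U - {snd T}) (\<lambda>u. omap F {snd T, u}) (omap F U) (\<lambda>u. amap F ({snd T, u}, U)))"
proof (cases "is_functor (presheaf_shape T) D F")
  case F: True
  interpret D: category D using F by (rule is_functorD)
  have "(\<exists>p \<pi> h. is_product D (U - {snd T}) (\<lambda>u. omap F {snd T, u}) p \<pi> \<and> h \<in> hom D (omap F U) p \<and>
        (\<forall>u \<in> U - {snd T}. Comp D (\<pi> u) h = amap F ({snd T, u}, U)) \<and> is_iso D h)
    \<longleftrightarrow> is_product D (U - {snd T}) (\<lambda>u. omap F {snd T, u}) (omap F U) (\<lambda>u. amap F ({snd T, u}, U))"
    (is "?L \<longleftrightarrow> ?R") if U: "U \<in> pointed_subsets T" for U
  proof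
    assume ?L
    then show ?R by (elim exE conjE) (rule is_product_cong[OF D.is_product_iso], auto)
  next
    assume ?R
    moreover have "Comp D (amap F ({snd T, u}, U)) (Ident D (omap F U)) = amap F ({snd T, u}, U)" if "u \<in> U" for u
      using D.comp_id_right presheafD(2)[OF F pointed_pair[OF U that] U pointed_pair_sub[OF U that]] by blast
    moreover have "Ident D (omap F U) \<in> hom D (omap F U) (omap F U)" "is_iso D (Ident D (omap F U))"
      using presheafD(1)[OF F U] D.Ident_in D.iso_id by auto
    ultimately show ?L by (metis DiffD1)
  qed
  then show ?thesis using F by (simp add: is_sheaf_def)
qed (auto simp: is_sheaf_def)

lemma is_sheafD:
  assumes "is_sheaf D T F"
  shows "is_functor (presheaf_shape T) D F"
    "U \<in> pointed_subsets T \<Longrightarrow>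
      is_product D (U - {snd T}) (\<lambda>u. omap F {snd T, u}) (omap F U) (\<lambda>u. amap F ({snd T, u}, U))"
  using assms by (auto simp: is_sheaf_iff)

lemma Sh_obj [simp]: "F \<in> Obj (Sh D T) \<longleftrightarrow> is_sheaf D T F"
  by (auto simp: Sh_def is_sheaf_def)

lemma Sh_hom:
  "f \<in> hom (Sh D T) F G \<longleftrightarrow>
    (\<exists>\<eta>. f = (F, G, \<eta>) \<and> is_sheaf D T F \<and> is_sheaf D T G \<and> nat_trans (presheaf_shape T) D F G \<eta>)"
  by (auto simp: Sh_def functor_cat_hom)

lemma Sh_simps [simp]:
  "(F, G, \<eta>) \<in> Arr (Sh D T) \<longleftrightarrow> is_sheaf D T F \<and> is_sheaf D T G \<and> nat_trans (presheaf_shape T) D F G \<eta>"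
  "Dom (Sh D T) (F, G, \<eta>) = F" "Cod (Sh D T) (F, G, \<eta>) = G"
  "Ident (Sh D T) F = (F, F, \<lambda>U \<in> pointed_subsets T. Ident D (omap F U))"
  "Comp (Sh D T) (G', H, \<theta>) (F, G, \<eta>) = (F, H, \<lambda>U \<in> pointed_subsets T. Comp D (\<theta> U) (\<eta> U))"
  by (auto simp: Sh_def)

lemma category_Sh: "category D \<Longrightarrow> category (Sh D T)"
  unfolding Sh_def by (intro category_full_subcat category_functor_cat)

lemma is_iso_Sh:
  assumes "is_sheaf D T F" "is_sheaf D T G" "nat_trans (presheaf_shape T) D F G \<eta>"
  shows "is_iso (Sh D T) (F, G, \<eta>) \<longleftrightarrow> (\<forall>U \<in> pointed_subsets T. is_iso D (\<eta> U))"
  using assms is_iso_functor_cat[OF assms(3)] by (simp add: Sh_def is_iso_full_subcat)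

lemma ptd_preimage_in [simp]:
  "snd S \<in> fst S \<Longrightarrow> ptd_preimage S T \<rho> U \<in> pointed_subsets S"
  by (auto simp: ptd_preimage_def pointed_subsets_def)

lemma ptd_preimage_mono: "U \<subseteq> V \<Longrightarrow> ptd_preimage S T \<rho> U \<subseteq> ptd_preimage S T \<rho> V"
  by (auto simp: ptd_preimage_def)

text \<open>The object map of \<open>sheaf_push\<close>, which is local to its definition.\<close>

definition push_presheaf where
  "push_presheaf S T \<rho> F = comp_fctr (presheaf_shape T) F (preimage_fctr S T \<rho>)"

lemma push_presheaf_simps [simp]:
  "U \<in> pointed_subsets T \<Longrightarrow> omap (push_presheaf S T \<rho> F) U = omap F (ptd_preimage S T \<rho> U)"
  "\<lbrakk>U \<in> pointed_subsets T; V \<in> pointed_subsets T; U \<subseteq> V\<rbrakk> \<Longrightarrow>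
    amap (push_presheaf S T \<rho> F) (U, V) = amap F (ptd_preimage S T \<rho> U, ptd_preimage S T \<rho> V)"
  by (simp_all add: push_presheaf_def preimage_fctr_def)

lemma push_presheaf_ext [simp]:
  "omap (push_presheaf S T \<rho> F) \<in> extensional (pointed_subsets T)"
  "amap (push_presheaf S T \<rho> F) \<in> extensional (Arr (subset_cat (pointed_subsets T)))"
  using comp_fctr_ext[of "presheaf_shape T" F "preimage_fctr S T \<rho>"] by (simp_all add: push_presheaf_def)

lemma is_functor_push:
  assumes "snd S \<in> fst S" and F: "is_functor (presheaf_shape S) D F"
  shows "is_functor (presheaf_shape T) D (push_presheaf S T \<rho> F)"
  by (rule presheafI) (use assms is_functorD(2)[OF F] presheafD[OF F] ptd_preimage_mono[of _ _ S T \<rho>] in auto)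

text \<open>On the preimage of \<open>U\<close> the sheaf \<open>F\<close> is a product over single
  points of \<open>S\<close>; grouping these by their image under \<open>\<rho>\<close> exhibits it
  as a product over the points of \<open>U\<close>.\<close>

lemma is_sheaf_push:
  assumes S: "snd S \<in> fst S" and F: "is_sheaf D S F"
  shows "is_sheaf D T (push_presheaf S T \<rho> F)"
  unfolding is_sheaf_iff
proof (intro conjI ballI)
  note F' = is_sheafD(1)[OF F]
  interpret D: category D using F' by (rule is_functorD)
  show "is_functor (presheaf_shape T) D (push_presheaf S T \<rho> F)" using is_functor_push[OF S F'] .
  fix U assume U: "U \<in> pointed_subsets T"
  let ?pre = "ptd_preimage S T \<rho>" and ?s = "snd S" and ?t = "snd T"
  have pair: "?pre {?t, k} \<in> pointed_subsets S" "?pre U \<in> pointed_subsets S"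
    "?pre {?t, k} \<subseteq> ?pre U" if "k \<in> U" for k
    using ptd_preimage_in[OF S] ptd_preimage_mono[OF pointed_pair_sub[OF U that]] by auto
  have fib: "{i \<in> ?pre U - {?s}. \<rho> i = k} = ?pre {?t, k} - {?s}" if "k \<in> U - {?t}" for k
    using that by (auto simp: ptd_preimage_def)
  have P: "is_product D (U - {?t}) (\<lambda>u. omap F (?pre {?t, u})) (omap F (?pre U)) (\<lambda>u. amap F (?pre {?t, u}, ?pre U))"
  proof (rule D.product_regroup[where \<rho> = "\<lambda>k s. amap F ({?s, s}, ?pre {?t, k})" and f = \<rho>])
    show "is_product D (?pre U - {?s}) (\<lambda>u. omap F {?s, u}) (omap F (?pre U)) (\<lambda>u. amap F ({?s, u}, ?pre U))"
      by (rule is_sheafD(2)[OF F ptd_preimage_in[OF S]])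
    show "\<rho> ` (?pre U - {?s}) \<subseteq> U - {?t}" by (auto simp: ptd_preimage_def)
    show "is_product D {i \<in> ?pre U - {?s}. \<rho> i = k} (\<lambda>u. omap F {?s, u}) (omap F (?pre {?t, k}))
        (\<lambda>s. amap F ({?s, s}, ?pre {?t, k}))" if "k \<in> U - {?t}" for k
      using is_sheafD(2)[OF F ptd_preimage_in[OF S]] fib[OF that] by simp
    show "amap F (?pre {?t, k}, ?pre U) \<in> hom D (omap F (?pre U)) (omap F (?pre {?t, k}))" if "k \<in> U - {?t}" for k
      using that pair by (intro presheafD(2)[OF F']) auto
    show "Comp D (amap F ({?s, i}, ?pre {?t, \<rho> i})) (amap F (?pre {?t, \<rho> i}, ?pre U)) = amap F ({?s, i}, ?pre U)"
      if i: "i \<in> ?pre U - {?s}" for i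
    proof -
      have \<rho>i: "\<rho> i \<in> U" and i': "i \<in> ?pre {?t, \<rho> i}" using i by (auto simp: ptd_preimage_def)
      show ?thesis
        using pair[OF \<rho>i] pointed_pair[OF pair(1)[OF \<rho>i] i'] pointed_pair_sub[OF pair(1)[OF \<rho>i] i']
        by (intro presheafD(4)[OF F'])
    qed
  qed
  show "is_product D (U - {?t}) (\<lambda>u. omap (push_presheaf S T \<rho> F) {?t, u}) (omap (push_presheaf S T \<rho> F) U)
      (\<lambda>u. amap (push_presheaf S T \<rho> F) ({?t, u}, U))"
    unfolding push_presheaf_simps(1)[OF U]
    by (rule is_product_cong[OF P]) (use U pointed_pair_sub[OF U] in auto)
qed

lemma nat_trans_push:
  assumes S: "snd S \<in> fst S" and \<eta>: "nat_trans (presheaf_shape S) D F G \<eta>"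
  shows "nat_trans (presheaf_shape T) D (push_presheaf S T \<rho> F) (push_presheaf S T \<rho> G)
    (\<lambda>U \<in> pointed_subsets T. \<eta> (ptd_preimage S T \<rho> U))"
  by (rule presheaf_mapI)
    (use is_functor_push[OF S nat_transD(1)[OF \<eta>]] is_functor_push[OF S nat_transD(2)[OF \<eta>]]
      presheaf_mapD[OF \<eta>] S ptd_preimage_mono[of _ _ S T \<rho>] in simp_all)

lemma sheaf_push_simps:
  "is_sheaf D S F \<Longrightarrow> omap (sheaf_push D S T \<rho>) F = push_presheaf S T \<rho> F"
  "(F, G, \<eta>) \<in> Arr (Sh D S) \<Longrightarrow> amap (sheaf_push D S T \<rho>) (F, G, \<eta>) =
    (push_presheaf S T \<rho> F, push_presheaf S T \<rho> G, \<lambda>U \<in> pointed_subsets T. \<eta> (ptd_preimage S T \<rho> U))"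
  by (auto simp: sheaf_push_def Let_def push_presheaf_def compose_def)

lemma sheaf_push_ext [simp]:
  "omap (sheaf_push D S T \<rho>) \<in> extensional (Obj (Sh D S))"
  "amap (sheaf_push D S T \<rho>) \<in> extensional (Arr (Sh D S))"
  by (simp_all add: sheaf_push_def Let_def)

lemma is_functor_sheaf_push:
  assumes D: "category D" and S: "snd S \<in> fst S"
  shows "is_functor (Sh D S) (Sh D T) (sheaf_push D S T \<rho>)"
proof (rule is_functorI)
  fix f assume f: "f \<in> Arr (Sh D S)"
  obtain F G \<eta> where f': "f = (F, G, \<eta>)" by (cases f)
  show "amap (sheaf_push D S T \<rho>) f \<in> hom (Sh D T) (omap (sheaf_push D S T \<rho>) (Dom (Sh D S) f))
      (omap (sheaf_push D S T \<rho>) (Cod (Sh D S) f))"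
    using f by (auto simp: f' sheaf_push_simps Sh_hom intro!: nat_trans_push[OF S] is_sheaf_push[OF S])
  fix g assume g: "g \<in> Arr (Sh D S)" "Dom (Sh D S) g = Cod (Sh D S) f"
  obtain H \<theta> where g': "g = (G, H, \<theta>)" using g(2) f' by (cases g) auto
  have "(F, H, \<lambda>U \<in> pointed_subsets S. Comp D (\<theta> U) (\<eta> U)) \<in> Arr (Sh D S)"
    using f g nat_trans_comp[of "presheaf_shape S" D F G \<eta> H \<theta>] by (simp add: f' g')
  then show "amap (sheaf_push D S T \<rho>) (Comp (Sh D S) g f)
      = Comp (Sh D T) (amap (sheaf_push D S T \<rho>) g) (amap (sheaf_push D S T \<rho>) f)"
    using f g S by (auto simp: f' g' sheaf_push_simps intro!: restrict_ext)
next
  fix F assume F: "F \<in> Obj (Sh D S)"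
  then have "(F, F, \<lambda>U \<in> pointed_subsets S. Ident D (omap F U)) \<in> Arr (Sh D S)"
    using nat_trans_id[OF is_sheafD(1)] by simp
  then show "amap (sheaf_push D S T \<rho>) (Ident (Sh D S) F) = Ident (Sh D T) (omap (sheaf_push D S T \<rho>) F)"
    using F S by (auto simp: sheaf_push_simps intro!: restrict_ext)
qed (auto simp: sheaf_push_simps category_Sh[OF D] is_sheaf_push[OF S])

lemma category_FinSet_ptd: "category FinSet_ptd"
  by (rule categoryI)
    (auto simp: FinSet_ptd_def hom_def compose_def PiE_iff extensional_def restrict_def fun_eq_iff)

lemma FinSet_ptd_hom:
  "f \<in> hom FinSet_ptd S T \<longleftrightarrow> (\<exists>\<rho>. f = (S, T, \<rho>) \<and> finite (fst S) \<and> snd S \<in> fst S \<and>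
    finite (fst T) \<and> snd T \<in> fst T \<and> \<rho> \<in> fst S \<rightarrow>\<^sub>E fst T \<and> \<rho> (snd S) = snd T)"
  by (cases f) (auto simp: FinSet_ptd_def hom_def)

lemma ptd_preimage_id:
  "U \<in> pointed_subsets T \<Longrightarrow> ptd_preimage T T (restrict id (fst T)) U = U"
  by (auto simp: ptd_preimage_def pointed_subsets_def)

text \<open>A point that \<open>\<rho>\<close> sends to the base point is excluded on both sides,
  because \<open>\<sigma>\<close> keeps the base point.\<close>

lemma ptd_preimage_compose:
  assumes "\<rho> \<in> fst R \<rightarrow>\<^sub>E fst S" "\<sigma> (snd S) = snd T"
  shows "ptd_preimage R S \<rho> (ptd_preimage S T \<sigma> U) = ptd_preimage R T (compose (fst R) \<sigma> \<rho>) U"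
  using assms by (auto simp: ptd_preimage_def compose_def PiE_iff)

lemma push_presheaf_id:
  assumes F: "is_functor (presheaf_shape T) D F"
  shows "push_presheaf T T (restrict id (fst T)) F = F"
proof (rule functor_eqI[of _ "presheaf_shape T"])
  fix f assume "f \<in> Arr (presheaf_shape T)"
  then show "amap (push_presheaf T T (restrict id (fst T)) F) f = amap F f"
    by (cases f) (simp add: ptd_preimage_id)
qed (use is_functorD(3,4)[OF F] in \<open>auto simp: ptd_preimage_id\<close>)

lemma push_presheaf_compose:
  assumes "snd S \<in> fst S" "\<rho> \<in> fst R \<rightarrow>\<^sub>E fst S" "\<sigma> (snd S) = snd T"
  shows "push_presheaf S T \<sigma> (push_presheaf R S \<rho> F) = push_presheaf R T (compose (fst R) \<sigma> \<rho>) F"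
proof (rule functor_eqI[of _ "presheaf_shape T"])
  fix f assume "f \<in> Arr (presheaf_shape T)"
  then show "amap (push_presheaf S T \<sigma> (push_presheaf R S \<rho> F)) f
      = amap (push_presheaf R T (compose (fst R) \<sigma> \<rho>) F) f"
    using assms by (cases f) (simp add: ptd_preimage_compose ptd_preimage_mono)
qed (use assms in \<open>auto simp: ptd_preimage_compose\<close>)

lemma sheaf_push_id:
  assumes "snd T \<in> fst T"
  shows "sheaf_push D T T (restrict id (fst T)) = id_fctr (Sh D T)"
proof (rule functor_eqI[of _ "Sh D T"])
  fix f assume f: "f \<in> Arr (Sh D T)"
  obtain F G \<eta> where f': "f = (F, G, \<eta>)" by (cases f)
  have "(\<lambda>U \<in> pointed_subsets T. \<eta> (ptd_preimage T T (restrict id (fst T)) U)) = \<eta>"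
    using f nat_transD(3)[of "presheaf_shape T" D F G \<eta>]
    by (auto simp: f' ptd_preimage_id intro!: extensionalityI[of _ "pointed_subsets T"])
  then show "amap (sheaf_push D T T (restrict id (fst T))) f = amap (id_fctr (Sh D T)) f"
    using f push_presheaf_id[OF is_sheafD(1), of D T F] push_presheaf_id[OF is_sheafD(1), of D T G]
    by (simp add: f' sheaf_push_simps(2)[of F G \<eta>] id_fctr_def)
qed (auto simp: sheaf_push_simps id_fctr_def push_presheaf_id[OF is_sheafD(1)])

lemma sheaf_push_compose:
  assumes "snd R \<in> fst R" "snd S \<in> fst S" "\<rho> \<in> fst R \<rightarrow>\<^sub>E fst S" "\<sigma> (snd S) = snd T"
  shows "comp_fctr (Sh D R) (sheaf_push D S T \<sigma>) (sheaf_push D R S \<rho>) = sheaf_push D R T (compose (fst R) \<sigma> \<rho>)"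
proof (rule functor_eqI[of _ "Sh D R"])
  fix f assume f: "f \<in> Arr (Sh D R)"
  obtain F G \<eta> where f': "f = (F, G, \<eta>)" by (cases f)
  have "(push_presheaf R S \<rho> F, push_presheaf R S \<rho> G, \<lambda>U \<in> pointed_subsets S. \<eta> (ptd_preimage R S \<rho> U)) \<in> Arr (Sh D S)"
    using f by (auto simp: f' intro!: nat_trans_push[OF assms(1)] is_sheaf_push[OF assms(1)])
  then show "amap (comp_fctr (Sh D R) (sheaf_push D S T \<sigma>) (sheaf_push D R S \<rho>)) f
      = amap (sheaf_push D R T (compose (fst R) \<sigma> \<rho>)) f"
    using f assms by (auto simp: f' sheaf_push_simps push_presheaf_compose ptd_preimage_compose intro!: restrict_ext)
qed (use assms in \<open>auto simp: sheaf_push_simps push_presheaf_compose is_sheaf_push\<close>)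

lemma is_functor_Sh_fctr:
  fixes D :: "('o, 'a) cat"
  assumes D: "category D"
  shows "is_functor FinSet_ptd Cat (Sh_fctr D :: ('t set \<times> 't, _, _, _) fctr)"
proof (rule is_functorI)
  fix f :: "('t set \<times> 't) \<times> ('t set \<times> 't) \<times> ('t \<Rightarrow> 't)"
  assume "f \<in> Arr FinSet_ptd"
  then obtain R S \<rho> where f: "f = (R, S, \<rho>)" "f \<in> Arr FinSet_ptd" by (cases f)
  show "amap (Sh_fctr D) f \<in> hom Cat (omap (Sh_fctr D) (Dom FinSet_ptd f)) (omap (Sh_fctr D) (Cod FinSet_ptd f))"
    using f is_functor_sheaf_push[OF D, of R S \<rho>]
    by (simp add: Sh_fctr_def) (simp add: FinSet_ptd_def hom_def Cat_def)
  fix g :: "('t set \<times> 't) \<times> ('t set \<times> 't) \<times> ('t \<Rightarrow> 't)"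
  assume g: "g \<in> Arr FinSet_ptd" "Dom FinSet_ptd g = Cod FinSet_ptd f"
  then obtain T \<sigma> where g': "g = (S, T, \<sigma>)" using f by (cases g) (auto simp: FinSet_ptd_def)
  have gf: "Comp FinSet_ptd g f = (R, T, compose (fst R) \<sigma> \<rho>)" by (simp add: FinSet_ptd_def f g')
  have "Comp FinSet_ptd g f \<in> Arr FinSet_ptd"
    using category.comp_hom[OF category_FinSet_ptd, of f _ _ g] f(2) g by (auto simp: hom_def)
  moreover have "snd R \<in> fst R" "snd S \<in> fst S" "\<rho> \<in> fst R \<rightarrow>\<^sub>E fst S" "\<sigma> (snd S) = snd T"
    using f g by (auto simp: FinSet_ptd_def g')
  ultimately show "amap (Sh_fctr D) (Comp FinSet_ptd g f) = Comp Cat (amap (Sh_fctr D) g) (amap (Sh_fctr D) f)"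
    using f g sheaf_push_compose[of R S \<rho> \<sigma> T D] unfolding gf by (simp add: Sh_fctr_def g' Cat_def)
next
  fix T :: "'t set \<times> 't" assume T: "T \<in> Obj FinSet_ptd"
  then have "Ident FinSet_ptd T \<in> Arr FinSet_ptd"
    using category.Ident_in[OF category_FinSet_ptd T] by (simp add: hom_def)
  moreover have "Ident FinSet_ptd T = (T, T, restrict id (fst T))" by (simp add: FinSet_ptd_def)
  moreover have "snd T \<in> fst T" using T by (simp add: FinSet_ptd_def)
  ultimately show "amap (Sh_fctr D) (Ident FinSet_ptd T) = Ident Cat (omap (Sh_fctr D) T)"
    using T sheaf_push_id[of T D] by (simp add: Sh_fctr_def Cat_def)
qed (auto simp: category_FinSet_ptd category_Cat Sh_fctr_def, auto simp: Cat_def category_Sh[OF D])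

section \<open>Contractible covers\<close>

text \<open>
  Each \<open>J \<in> P\<close> partitions the pointed set \<open>A\<close> into the fibres of \<open>r J\<close>, and larger \<open>J\<close> give finer
  partitions. The blocks not containing the base point \<open>b\<close> can be cut down to single points, and any
  two ways of refining a block are related by a zigzag of inclusions.
\<close>

locale contractible_cover =
  fixes P :: "'j set set" and A :: "'t set" and b :: 't and r :: "'j set \<Rightarrow> 't \<Rightarrow> 't"
  assumes finite_A: "finite A" and b_in: "b \<in> A"
    and refine: "\<lbrakk>J \<in> P; K \<in> P; J \<subseteq> K; s \<in> A; t \<in> A; r K s = r K t\<rbrakk> \<Longrightarrow> r J s = r J t"
    and unit: "\<lbrakk>t \<in> A; t \<noteq> b\<rbrakk> \<Longrightarrow> \<exists>J \<in> P. {s \<in> A. r J s = r J t} = {t}"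
    and refinement: "\<lbrakk>J \<in> P; t \<in> A; r J t \<noteq> r J b\<rbrakk> \<Longrightarrow>
      \<exists>L \<in> P. {s \<in> A. r L s = r L t} = {s \<in> A. r J s = r J t} \<and>
        (\<forall>K \<in> P. {s \<in> A. r K s = r K t} = {s \<in> A. r J s = r J t} \<longrightarrow> L \<subseteq> K) \<and>
        ({s \<in> A. r J s = r J t} \<noteq> {t} \<longrightarrow>
          (let N = {K \<in> P. L \<subseteq> K \<and> {s \<in> A. r K s = r K t} \<noteq> {s \<in> A. r L s = r L t}}
           in N \<noteq> {} \<and> (\<forall>K \<in> N. \<forall>K' \<in> N. (K, K') \<in> {(X, Y). X \<in> N \<and> Y \<in> N \<and> (X \<subseteq> Y \<or> Y \<subseteq> X)}\<^sup>*)))"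
begin

section \<open>Blocks of the cover and their least representatives\<close>

definition block where "block J t = {s \<in> A. r J s = r J t}"

text \<open>Only where \<open>t\<close> is not identified with the base point does a sheaf on the
  quotient have a factor that knows about \<open>t\<close>.\<close>

definition around where "around t = {J \<in> P. r J t \<noteq> r J b}"

text \<open>As \<open>L \<subseteq> K\<close> refines blocks, the inequality means that the block of
  \<open>t\<close> becomes strictly smaller.\<close>

definition splits where "splits L t = {K \<in> P. L \<subseteq> K \<and> block K t \<noteq> block L t}"

lemma block_antimono: "\<lbrakk>J \<in> P; K \<in> P; J \<subseteq> K; t \<in> A\<rbrakk> \<Longrightarrow> block K t \<subseteq> block J t"
  using refine unfolding block_def by blast

lemma finite_block: "finite (block J t)"
  using finite_A by (simp add: block_def)

lemma in_block: "t \<in> A \<Longrightarrow> t \<in> block J t"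
  by (simp add: block_def)

lemma around_iff: "t \<in> A \<Longrightarrow> J \<in> around t \<longleftrightarrow> J \<in> P \<and> b \<notin> block J t"
  using b_in by (auto simp: around_def block_def)

lemma around_up: "\<lbrakk>J \<in> around t; K \<in> P; J \<subseteq> K; t \<in> A\<rbrakk> \<Longrightarrow> K \<in> around t"
  using block_antimono[of J K t] by (auto simp: around_iff)

text \<open>Packages the conclusion of \<open>refinement\<close>: \<open>L\<close> is the smallest
  member that cuts out the block \<open>B\<close>, and unless \<open>B\<close> is a point the
  members that split it further form a nonempty connected poset.\<close>

definition least_for where
  "least_for t B L \<longleftrightarrow> L \<in> P \<and> block L t = B \<and> (\<forall>K \<in> P. block K t = B \<longrightarrow> L \<subseteq> K) \<and>
    (B \<noteq> {t} \<longrightarrow> splits L t \<noteq> {} \<and> (\<forall>K \<in> splits L t. \<forall>K' \<in> splits L t.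
      (K, K') \<in> {(X, Y). X \<in> splits L t \<and> Y \<in> splits L t \<and> (X \<subseteq> Y \<or> Y \<subseteq> X)}\<^sup>*))"

lemma least_forD:
  assumes "least_for t B L"
  shows "L \<in> P" "block L t = B" "\<lbrakk>K \<in> P; block K t = B\<rbrakk> \<Longrightarrow> L \<subseteq> K"
    "B \<noteq> {t} \<Longrightarrow> \<exists>K. K \<in> splits L t"
    "\<lbrakk>B \<noteq> {t}; K \<in> splits L t; K' \<in> splits L t\<rbrakk> \<Longrightarrow>
      (K, K') \<in> {(X, Y). X \<in> splits L t \<and> Y \<in> splits L t \<and> (X \<subseteq> Y \<or> Y \<subseteq> X)}\<^sup>*"
  using assms unfolding least_for_def by (simp_all add: ex_in_conv)

lemma ex_least_for:
  assumes "t \<in> A" "J \<in> around t"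
  shows "\<exists>L. least_for t (block J t) L"
proof -
  have J: "J \<in> P" "r J t \<noteq> r J b" using assms(2) by (auto simp: around_def)
  show ?thesis
    using refinement[OF J(1) assms(1) J(2)]
    unfolding least_for_def splits_def block_def Let_def by blast
qed

lemma ex_unit:
  assumes "t \<in> A" "t \<noteq> b"
  shows "\<exists>L. least_for t {t} L"
proof -
  obtain J where J: "J \<in> P" "block J t = {t}" using unit[OF assms] by (auto simp: block_def)
  then have "J \<in> around t" using assms by (auto simp: around_iff)
  then show ?thesis using ex_least_for[OF assms(1)] J by metis
qed

end

section \<open>Cocones over the blocks that contain a fixed point\<close>

text \<open>Models the values of a family of sheaves at the blocks containing \<open>t\<close>. A
  larger index has a smaller block, whose value is to be a factor of the value at the larger block;
  so \<open>mr\<close> points from coarse to fine.\<close>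

locale cover_functor = contractible_cover P A b r + category D
  for P :: "'j set set" and A :: "'t set" and b r and D :: "('o, 'a) cat" +
  fixes t :: 't and ob :: "'j set \<Rightarrow> 'o" and mr :: "'j set \<Rightarrow> 'j set \<Rightarrow> 'a"
  assumes t: "t \<in> A" "t \<noteq> b"
    and mr_hom: "\<lbrakk>J \<in> around t; K \<in> around t; J \<subseteq> K\<rbrakk> \<Longrightarrow> mr J K \<in> hom D (ob J) (ob K)"
    and mr_id: "J \<in> around t \<Longrightarrow> mr J J = Ident D (ob J)"
    and mr_comp: "\<lbrakk>J \<in> around t; K \<in> around t; L \<in> around t; J \<subseteq> K; K \<subseteq> L\<rbrakk>
      \<Longrightarrow> Comp D (mr K L) (mr J K) = mr J L"
    and mr_iso: "\<lbrakk>J \<in> around t; K \<in> around t; J \<subseteq> K; block J t = block K t\<rbrakk> \<Longrightarrow> is_iso D (mr J K)"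
begin

lemma least_around: "\<lbrakk>J \<in> around t; least_for t (block J t) L\<rbrakk> \<Longrightarrow> L \<in> around t \<and> L \<subseteq> J \<and> block L t = block J t"
  using least_forD(1-3)[of t "block J t" L] by (simp add: around_iff t)

lemma split_around:
  assumes "L \<in> around t" "K \<in> splits L t"
  shows "K \<in> around t \<and> L \<subseteq> K \<and> K \<in> P \<and> card (block K t) < card (block L t)"
proof -
  have K: "K \<in> P" "L \<subseteq> K" "block K t \<noteq> block L t" using assms(2) by (auto simp: splits_def)
  moreover have "L \<in> P" using assms(1) by (simp add: around_def)
  ultimately have "block K t \<subset> block L t" using block_antimono t by blast
  then show ?thesis using K around_up[OF assms(1) K(1,2) t(1)] psubset_card_mono[OF finite_block] by blast
qed

lemma card_block_pos: "card (block J t) > 0"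
  using finite_block in_block[OF t(1)] by (auto simp: card_gt_0_iff)

lemma card_block_eq_1: "card (block J t) \<le> 1 \<longleftrightarrow> block J t = {t}"
proof
  assume "card (block J t) \<le> 1"
  then have "card (block J t) = 1" using card_block_pos[of J] by simp
  then obtain x where "block J t = {x}" by (rule card_1_singletonE)
  then show "block J t = {t}" using in_block[OF t(1), of J] by simp
qed simp

text \<open>Uniqueness of cocones. From \<open>J\<close> one passes to the least representative of
  its block, where \<open>mr\<close> can be cancelled, and from there into a splitting with a
  strictly smaller block. This ends at the block \<open>{t}\<close>, which \<open>L\<close>
  represents.\<close>

lemma natural_eq:
  assumes L: "least_for t {t} L"
    and q: "\<And>J. J \<in> around t \<Longrightarrow> q J \<in> hom D (ob J) z"
      "\<And>J K. \<lbrakk>J \<in> around t; K \<in> around t; J \<subseteq> K\<rbrakk> \<Longrightarrow> Comp D (q K) (mr J K) = q J"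
    and q': "\<And>J. J \<in> around t \<Longrightarrow> q' J \<in> hom D (ob J) z"
      "\<And>J K. \<lbrakk>J \<in> around t; K \<in> around t; J \<subseteq> K\<rbrakk> \<Longrightarrow> Comp D (q' K) (mr J K) = q' J"
    and eq: "q L = q' L"
  shows "J \<in> around t \<Longrightarrow> q J = q' J"
proof (induction "card (block J t)" arbitrary: J rule: less_induct)
  case less
  show ?case
  proof (cases "block J t = {t}")
    case True
    have L': "L \<in> around t" "L \<subseteq> J" "block L t = block J t"
      using least_around[OF less.prems, of L] L unfolding True by simp_all
    have "Comp D (q J) (mr L J) = Comp D (q' J) (mr L J)"
      using q(2)[OF L'(1) less.prems L'(2)] q'(2)[OF L'(1) less.prems L'(2)] eq by simp
    then show ?thesis
      by (rule iso_cancel_right[OF mr_iso[OF L'(1) less.prems L'(2,3)] mr_hom[OF L'(1) less.prems L'(2)]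
          q(1)[OF less.prems] q'(1)[OF less.prems]])
  next
    case False
    obtain L0 where L0: "least_for t (block J t) L0" using ex_least_for[OF t(1) less.prems] by blast
    have L0': "L0 \<in> around t" "L0 \<subseteq> J" "block L0 t = block J t"
      using least_around[OF less.prems L0] by auto
    obtain K where "K \<in> splits L0 t" using least_forD(4)[OF L0 False] by (elim exE)
    then have K: "K \<in> around t" "L0 \<subseteq> K" "card (block K t) < card (block J t)"
      using split_around[OF L0'(1)] L0'(3) by auto
    have "q L0 = q' L0"
      using q(2)[OF L0'(1) K(1,2)] q'(2)[OF L0'(1) K(1,2)] less.hyps[OF K(3,1)] by simp
    then have "Comp D (q J) (mr L0 J) = Comp D (q' J) (mr L0 J)"
      using q(2)[OF L0'(1) less.prems L0'(2)] q'(2)[OF L0'(1) less.prems L0'(2)] by simp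
    then show ?thesis
      by (rule iso_cancel_right[OF mr_iso[OF L0'(1) less.prems L0'(2,3)] mr_hom[OF L0'(1) less.prems L0'(2)]
          q(1)[OF less.prems] q'(1)[OF less.prems]])
  qed
qed

text \<open>On a block of size \<open>Suc n\<close> each splitting \<open>K\<close> of the least
  representative proposes a component, namely \<open>p K\<close> after \<open>mr\<close>. Comparable
  splittings propose the same map since \<open>p\<close> is already a cocone on smaller blocks, so
  connectedness makes all proposals equal.\<close>

lemma ex_natural_step:
  assumes p: "\<And>J. \<lbrakk>J \<in> around t; card (block J t) \<le> n\<rbrakk> \<Longrightarrow> p J \<in> hom D (ob J) y"
      "\<And>J K. \<lbrakk>J \<in> around t; K \<in> around t; J \<subseteq> K; card (block J t) \<le> n\<rbrakk> \<Longrightarrow> Comp D (p K) (mr J K) = p J"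
    and n: "n \<ge> 1"
  obtains p' where "\<And>J. card (block J t) \<le> n \<Longrightarrow> p' J = p J"
      "\<And>J. \<lbrakk>J \<in> around t; card (block J t) \<le> Suc n\<rbrakk> \<Longrightarrow> p' J \<in> hom D (ob J) y"
      "\<And>J K. \<lbrakk>J \<in> around t; K \<in> around t; J \<subseteq> K; card (block J t) \<le> Suc n\<rbrakk> \<Longrightarrow> Comp D (p' K) (mr J K) = p' J"
proof -
  \<comment> \<open>The choice depends on \<open>J\<close> only through its block, so indices with
    equal blocks share the same \<open>L\<close>.\<close>
  define L where "L J = (SOME L. least_for t (block J t) L)" for J
  have L: "least_for t (block J t) (L J)" if "J \<in> around t" for J
    unfolding L_def using ex_least_for[OF t(1) that] by (rule someI_ex)
  have L': "L J \<in> around t" "L J \<subseteq> J" "block (L J) t = block J t" if "J \<in> around t" for J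
    using least_around[OF that L[OF that]] by auto
  have "\<exists>h. h \<in> hom D (ob J) y \<and> (\<forall>K \<in> splits (L J) t. Comp D h (mr (L J) J) = Comp D (p K) (mr (L J) K))"
    if J: "J \<in> around t" and card: "card (block J t) = Suc n" for J
  proof -
    let ?N = "splits (L J) t"
    have "block J t \<noteq> {t}" using card n by auto
    note ne = least_forD(4)[OF L[OF J] this] and conn = least_forD(5)[OF L[OF J] this]
    have N: "K \<in> around t" "L J \<subseteq> K" "card (block K t) \<le> n" if "K \<in> ?N" for K
      using split_around[OF L'(1)[OF J] that] L'(3)[OF J] card by auto
    have adj: "Comp D (p K) (mr (L J) K) = Comp D (p K') (mr (L J) K')"
      if K: "K \<in> ?N" "K' \<in> ?N" "K \<subseteq> K'" for K K'
    proof -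
      note NK = N[OF K(1)] and NK' = N[OF K(2)]
      have "Comp D (p K) (mr (L J) K) = Comp D (Comp D (p K') (mr K K')) (mr (L J) K)"
        using p(2)[OF NK(1) NK'(1) K(3) NK(3)] by simp
      also have "\<dots> = Comp D (p K') (Comp D (mr K K') (mr (L J) K))"
        using comp_assoc[OF mr_hom[OF L'(1)[OF J] NK(1,2)] mr_hom[OF NK(1) NK'(1) K(3)] p(1)[OF NK'(1,3)]] by simp
      also have "\<dots> = Comp D (p K') (mr (L J) K')"
        using mr_comp[OF L'(1)[OF J] NK(1) NK'(1) NK(2) K(3)] by simp
      finally show ?thesis .
    qed
    have const: "Comp D (p K) (mr (L J) K) = Comp D (p K') (mr (L J) K')"
      if K: "K \<in> ?N" "K' \<in> ?N" for K K'
      using conn[OF K]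
    proof (induction rule: rtrancl_induct)
      case (step X Y)
      from step.hyps(2) have XY: "X \<in> ?N" "Y \<in> ?N" "X \<subseteq> Y \<or> Y \<subseteq> X" by simp_all
      from XY(3) have "Comp D (p X) (mr (L J) X) = Comp D (p Y) (mr (L J) Y)"
        by (rule disjE) (rule adj[OF XY(1,2)], assumption, rule adj[OF XY(2,1), symmetric])
      then show ?case using step.IH by (rule trans[rotated])
    qed simp
    \<comment> \<open>All proposals being equal, one splitting defines the component; composing with
      the inverse \<open>e\<close> of \<open>mr (L J) J\<close> moves it from \<open>L J\<close> to
      \<open>J\<close>.\<close>
    obtain K0 where K0: "K0 \<in> ?N" using ne by (elim exE)
    obtain e where e: "e \<in> hom D (ob J) (ob (L J))" "Comp D e (mr (L J) J) = Ident D (ob (L J))"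
      by (rule isoE[OF mr_iso[OF L'(1)[OF J] J L'(2,3)[OF J]] mr_hom[OF L'(1)[OF J] J L'(2)[OF J]]])
    have pm: "Comp D (p K0) (mr (L J) K0) \<in> hom D (ob (L J)) y"
      using comp_hom[OF mr_hom[OF L'(1)[OF J] N(1,2)[OF K0]] p(1)[OF N(1,3)[OF K0]]] .
    have "Comp D (Comp D (Comp D (p K0) (mr (L J) K0)) e) (mr (L J) J) = Comp D (p K0) (mr (L J) K0)"
      using comp_assoc[OF mr_hom[OF L'(1)[OF J] J L'(2)[OF J]] e(1) pm] e(2) comp_id_right[OF pm] by simp
    then show ?thesis using comp_hom[OF e(1) pm] const[OF K0] by (intro exI conjI ballI) auto
  qed
  then obtain h where h: "\<And>J. \<lbrakk>J \<in> around t; card (block J t) = Suc n\<rbrakk> \<Longrightarrow> h J \<in> hom D (ob J) y"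
    "\<And>J K. \<lbrakk>J \<in> around t; card (block J t) = Suc n; K \<in> splits (L J) t\<rbrakk>
      \<Longrightarrow> Comp D (h J) (mr (L J) J) = Comp D (p K) (mr (L J) K)"
    by metis
  define p' where "p' J = (if card (block J t) \<le> n then p J else h J)" for J
  show ?thesis
  proof (rule that)
    show "card (block J t) \<le> n \<Longrightarrow> p' J = p J" for J by (simp add: p'_def)
    show p'_hom: "p' J \<in> hom D (ob J) y" if "J \<in> around t" "card (block J t) \<le> Suc n" for J
      using that p(1) h(1) by (auto simp: p'_def)
    show "Comp D (p' K) (mr J K) = p' J"
      if JK: "J \<in> around t" "K \<in> around t" "J \<subseteq> K" "card (block J t) \<le> Suc n" for J K
    proof -
      have sub: "block K t \<subseteq> block J t"
        using JK t by (intro block_antimono) (auto simp: around_def)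
      have card_K: "card (block K t) \<le> card (block J t)" using card_mono[OF finite_block sub] .
      show ?thesis
      proof (cases "card (block J t) \<le> n")
        case True
        then show ?thesis using p(2)[OF JK(1-3)] card_K by (simp add: p'_def)
      next
        case False
        then have card_J: "card (block J t) = Suc n" using JK(4) by simp
        note LJ = L'[OF JK(1)]
        note mLJ = mr_hom[OF LJ(1) JK(1) LJ(2)]
        note mJK = mr_hom[OF JK(1-3)]
        have LK: "L J \<subseteq> K" using LJ(2) JK(3) by blast
        have p'K: "p' K \<in> hom D (ob K) y" using p'_hom JK(2,4) card_K by auto
        \<comment> \<open>If \<open>K\<close> has the same block as \<open>J\<close>, this one
          splitting determines the components at both.\<close>
        obtain X where X: "X \<in> splits (L J) t"
          using least_forD(4)[OF L[OF JK(1)]] card_J n card_block_eq_1[of J] by auto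
        have "Comp D (p' K) (mr (L J) K) = Comp D (h J) (mr (L J) J)"
        proof (cases "block K t = block J t")
          case True
          then have "L K = L J" by (simp add: L_def)
          then show ?thesis
            using h(2)[OF JK(2), of X] h(2)[OF JK(1) card_J X] X True card_J by (simp add: p'_def)
        next
          case F: False
          then have "K \<in> splits (L J) t" using JK(2) LK LJ(3) by (simp add: splits_def around_def)
          moreover have "card (block K t) \<le> n"
            using psubset_card_mono[OF finite_block psubsetI[OF sub F]] card_J by simp
          ultimately show ?thesis using h(2)[OF JK(1) card_J] by (simp add: p'_def)
        qed
        then have "Comp D (Comp D (p' K) (mr J K)) (mr (L J) J) = Comp D (h J) (mr (L J) J)"
          using comp_assoc[OF mLJ mJK p'K] mr_comp[OF LJ(1) JK(1,2) LJ(2) JK(3)] by simp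
        then have "Comp D (p' K) (mr J K) = h J"
          by (rule iso_cancel_right[OF mr_iso[OF LJ(1) JK(1) LJ(2,3)] mLJ comp_hom[OF mJK p'K] h(1)[OF JK(1) card_J]])
        then show ?thesis using False by (simp add: p'_def)
      qed
    qed
  qed
qed

text \<open>The cocone is normalised to be the identity at the representative \<open>L\<close> of
  \<open>{t}\<close>. The recursion on block size starts from the inverses of the isomorphisms
  \<open>mr L J\<close>.\<close>

lemma ex_natural:
  assumes L: "least_for t {t} L"
  obtains p where "\<And>J. J \<in> around t \<Longrightarrow> p J \<in> hom D (ob J) (ob L)"
    "\<And>J K. \<lbrakk>J \<in> around t; K \<in> around t; J \<subseteq> K\<rbrakk> \<Longrightarrow> Comp D (p K) (mr J K) = p J"
    "p L = Ident D (ob L)"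
proof -
  have L_block: "block L t = {t}" and L_in: "L \<in> around t"
    using least_forD(1,2)[OF L] t by (simp_all add: around_iff)
  \<comment> \<open>The bound is \<open>Suc n\<close> because a block contains \<open>t\<close> and
    so has at least one element.\<close>
  have "\<exists>p. (\<forall>J \<in> around t. card (block J t) \<le> Suc n \<longrightarrow> p J \<in> hom D (ob J) (ob L)) \<and>
      (\<forall>J \<in> around t. \<forall>K \<in> around t. J \<subseteq> K \<and> card (block J t) \<le> Suc n \<longrightarrow> Comp D (p K) (mr J K) = p J) \<and>
      p L = Ident D (ob L)" for n
  proof (induction n)
    case 0
    have unit: "L \<subseteq> J" "block L t = block J t" if "J \<in> around t" "card (block J t) \<le> Suc 0" for J
    proof -
      have "block J t = {t}" using that(2) card_block_eq_1[of J] by simp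
      then show "L \<subseteq> J" "block L t = block J t" using least_around[OF that(1), of L] L by simp_all
    qed
    have "\<exists>e. e \<in> hom D (ob J) (ob L) \<and> Comp D e (mr L J) = Ident D (ob L)"
      if "J \<in> around t" "card (block J t) \<le> Suc 0" for J
      by (rule isoE[OF mr_iso[OF L_in that(1) unit[OF that]] mr_hom[OF L_in that(1) unit(1)[OF that]]])
        (intro exI conjI)
    then obtain p where p: "\<And>J. \<lbrakk>J \<in> around t; card (block J t) \<le> Suc 0\<rbrakk> \<Longrightarrow> p J \<in> hom D (ob J) (ob L)"
      "\<And>J. \<lbrakk>J \<in> around t; card (block J t) \<le> Suc 0\<rbrakk> \<Longrightarrow> Comp D (p J) (mr L J) = Ident D (ob L)"
      by metis
    have "Comp D (p K) (mr J K) = p J"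
      if JK: "J \<in> around t" "K \<in> around t" "J \<subseteq> K" "card (block J t) \<le> Suc 0" for J K
    proof -
      have "block K t \<subseteq> block J t"
        using JK t by (intro block_antimono) (auto simp: around_def)
      then have card_K: "card (block K t) \<le> Suc 0"
        using card_mono[OF finite_block[of J]] JK(4) le_trans by blast
      note LJ = unit[OF JK(1,4)] and pK = p(1)[OF JK(2) card_K]
      note mLJ = mr_hom[OF L_in JK(1) LJ(1)] and mJK = mr_hom[OF JK(1-3)]
      have "Comp D (Comp D (p K) (mr J K)) (mr L J) = Comp D (p J) (mr L J)"
        using comp_assoc[OF mLJ mJK pK] mr_comp[OF L_in JK(1,2) LJ(1) JK(3)] p(2)[OF JK(1,4)] p(2)[OF JK(2) card_K]
        by simp
      then show ?thesis
        by (rule iso_cancel_right[OF mr_iso[OF L_in JK(1) LJ] mLJ comp_hom[OF mJK pK] p(1)[OF JK(1,4)]])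
    qed
    moreover have "p L = Ident D (ob L)"
      using p(1)[OF L_in] p(2)[OF L_in] mr_id[OF L_in] L_block comp_id_right[of "p L" "ob L" "ob L"] by simp
    ultimately show ?case using p(1) by (intro exI[of _ p]) simp
  next
    case (Suc n)
    then obtain p where p: "\<forall>J \<in> around t. card (block J t) \<le> Suc n \<longrightarrow> p J \<in> hom D (ob J) (ob L)"
      "\<forall>J \<in> around t. \<forall>K \<in> around t. J \<subseteq> K \<and> card (block J t) \<le> Suc n \<longrightarrow> Comp D (p K) (mr J K) = p J"
      "p L = Ident D (ob L)"
      by (elim exE conjE)
    obtain p' where p': "\<And>J. card (block J t) \<le> Suc n \<Longrightarrow> p' J = p J"
      "\<And>J. \<lbrakk>J \<in> around t; card (block J t) \<le> Suc (Suc n)\<rbrakk> \<Longrightarrow> p' J \<in> hom D (ob J) (ob L)"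
      "\<And>J K. \<lbrakk>J \<in> around t; K \<in> around t; J \<subseteq> K; card (block J t) \<le> Suc (Suc n)\<rbrakk> \<Longrightarrow> Comp D (p' K) (mr J K) = p' J"
      by (rule ex_natural_step[of "Suc n" p "ob L"]) (use p in auto)
    show ?case using p' p(3) L_block by (intro exI[of _ p']) auto
  qed
  then obtain p where p: "\<forall>J \<in> around t. card (block J t) \<le> Suc (card A) \<longrightarrow> p J \<in> hom D (ob J) (ob L)"
      "\<forall>J \<in> around t. \<forall>K \<in> around t. J \<subseteq> K \<and> card (block J t) \<le> Suc (card A) \<longrightarrow> Comp D (p K) (mr J K) = p J"
      "p L = Ident D (ob L)"
    by meson
  have "card (block J t) \<le> Suc (card A)" for J
    using card_mono[OF finite_A, of "block J t"] by (auto simp: block_def)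
  then show ?thesis using p by (intro that[of p]) simp_all
qed

end

section \<open>Descent for sheaves\<close>

lemma (in category) is_product_singleton:
  assumes "is_iso C f" "f \<in> hom C x (y i)"
  shows "is_product C {i} y x (\<lambda>_. f)"
proof (rule is_productI)
  obtain g where g: "g \<in> hom C (y i) x" "Comp C g f = Ident C x" "Comp C f g = Ident C (y i)"
    using assms by (rule isoE)
  show "x \<in> Obj C" using hom_obj[OF assms(2)] by simp
  show "\<exists>h. h \<in> hom C q x \<and> (\<forall>j \<in> {i}. Comp C f h = k j)"
    if k: "\<And>j. j \<in> {i} \<Longrightarrow> k j \<in> hom C q (y j)" for q k
  proof -
    have k': "k i \<in> hom C q (y i)" using k by simp
    have "Comp C f (Comp C g (k i)) = k i"
      using comp_assoc[OF k' g(1) assms(2)] g(3) comp_id_left[OF k'] by simp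
    then show ?thesis using comp_hom[OF k' g(1)] by auto
  qed
  show "h = h'" if "h \<in> hom C q x" "h' \<in> hom C q x" and "\<And>j. j \<in> {i} \<Longrightarrow> Comp C f h = Comp C f h'" for q h h'
    using iso_cancel_left[OF assms that(1,2)] that(3) by simp
qed (use assms in simp)

lemma (in category) iso_left_inverse:
  assumes e: "is_iso C e" "e \<in> hom C x y" and p: "p \<in> hom C y x" "Comp C p e = Ident C x"
  shows "is_iso C p"
proof -
  obtain g where g: "g \<in> hom C y x" "Comp C g e = Ident C x" "is_iso C g"
    using e by (rule isoE)
  have "p = g" by (rule iso_cancel_right[OF e p(1) g(1)]) (simp add: p(2) g(2))
  then show ?thesis using g(3) by simp
qed

text \<open>Choose a product of \<open>y\<close> over each pointed subset and let restriction be the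
  map determined by its projections; uniqueness of that map gives functoriality.\<close>

lemma (in category) ex_product_sheaf:
  assumes fp: "has_finite_products C" and T: "finite (fst T)" "snd T \<in> fst T"
    and y: "\<And>t. \<lbrakk>t \<in> fst T; t \<noteq> snd T\<rbrakk> \<Longrightarrow> y t \<in> Obj C"
  obtains F \<pi> where "is_sheaf C T F"
    "\<And>U. U \<in> pointed_subsets T \<Longrightarrow> is_product C (U - {snd T}) y (omap F U) (\<pi> U)"
    "\<And>U V t. \<lbrakk>U \<in> pointed_subsets T; V \<in> pointed_subsets T; U \<subseteq> V; t \<in> U - {snd T}\<rbrakk>
      \<Longrightarrow> Comp C (\<pi> U t) (amap F (U, V)) = \<pi> V t"
proof -
  have "\<forall>U \<in> pointed_subsets T. \<exists>p \<pi>. is_product C (U - {snd T}) y p \<pi>"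
  proof
    fix U assume "U \<in> pointed_subsets T"
    then have "U \<subseteq> fst T" by (simp add: pointed_subsets_def)
    then show "\<exists>p \<pi>. is_product C (U - {snd T}) y p \<pi>"
      using finite_subset[OF _ T(1)] y by (intro ex_product[OF fp]) auto
  qed
  then obtain Q \<pi> where Q: "\<And>U. U \<in> pointed_subsets T \<Longrightarrow> is_product C (U - {snd T}) y (Q U) (\<pi> U)"
    by metis
  note Q1 = is_productD(1)[OF Q] and Q2 = is_productD(2)[OF Q]
  have "\<exists>h. h \<in> hom C (Q V) (Q U) \<and> (\<forall>t \<in> U - {snd T}. Comp C (\<pi> U t) h = \<pi> V t)"
    if "U \<in> pointed_subsets T" "V \<in> pointed_subsets T" "U \<subseteq> V" for U V
    using that by (intro is_productD(3)[OF Q] Q1 Q2) auto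
  then obtain \<rho> where \<rho>: "\<And>U V. \<lbrakk>U \<in> pointed_subsets T; V \<in> pointed_subsets T; U \<subseteq> V\<rbrakk> \<Longrightarrow> \<rho> U V \<in> hom C (Q V) (Q U)"
    "\<And>U V t. \<lbrakk>U \<in> pointed_subsets T; V \<in> pointed_subsets T; U \<subseteq> V; t \<in> U - {snd T}\<rbrakk>
      \<Longrightarrow> Comp C (\<pi> U t) (\<rho> U V) = \<pi> V t"
    by metis
  define F where "F = \<lparr>omap = restrict Q (pointed_subsets T),
    amap = restrict (\<lambda>(U, V). \<rho> U V) (Arr (subset_cat (pointed_subsets T)))\<rparr>"
  have Fo: "omap F U = Q U" if "U \<in> pointed_subsets T" for U using that by (simp add: F_def)
  have Fa: "amap F (U, V) = \<rho> U V" if "U \<in> pointed_subsets T" "V \<in> pointed_subsets T" "U \<subseteq> V" for U V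
    using that by (simp add: F_def)
  have F: "is_functor (presheaf_shape T) C F"
  proof (rule presheafI)
    show "omap F U \<in> Obj C" if "U \<in> pointed_subsets T" for U
      using that Q1 by (simp add: Fo)
    show "amap F (U, V) \<in> hom C (omap F V) (omap F U)"
      if "U \<in> pointed_subsets T" "V \<in> pointed_subsets T" "U \<subseteq> V" for U V
      using that \<rho>(1) by (simp add: Fo Fa)
    show "amap F (U, U) = Ident C (omap F U)" if U: "U \<in> pointed_subsets T" for U
    proof -
      have "\<rho> U U = Ident C (Q U)"
        by (rule product_eqI[OF Q[OF U]])
          (use \<rho>(1)[OF U U] \<rho>(2)[OF U U] Ident_in[OF Q1[OF U]] comp_id_right[OF Q2[OF U]] in auto)
      then show ?thesis using U by (simp add: Fo Fa)
    qed
    show "Comp C (amap F (U, V)) (amap F (V, W)) = amap F (U, W)"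
      if UVW: "U \<in> pointed_subsets T" "V \<in> pointed_subsets T" "W \<in> pointed_subsets T" "U \<subseteq> V" "V \<subseteq> W" for U V W
    proof -
      have UW: "U \<subseteq> W" using UVW by blast
      note UV' = \<rho>(1)[OF UVW(1,2,4)] and VW' = \<rho>(1)[OF UVW(2,3,5)] and UW' = \<rho>(1)[OF UVW(1,3) UW]
      have "Comp C (\<rho> U V) (\<rho> V W) = \<rho> U W"
      proof (rule product_eqI[OF Q[OF UVW(1)] comp_hom[OF VW' UV'] UW'])
        fix t assume t: "t \<in> U - {snd T}"
        then have t': "t \<in> V - {snd T}" using UVW by blast
        show "Comp C (\<pi> U t) (Comp C (\<rho> U V) (\<rho> V W)) = Comp C (\<pi> U t) (\<rho> U W)"
          using comp_assoc[OF VW' UV' Q2[OF UVW(1) t]] \<rho>(2)[OF UVW(1,2,4) t] \<rho>(2)[OF UVW(2,3,5) t']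
            \<rho>(2)[OF UVW(1,3) UW t] by simp
      qed
      then show ?thesis using UVW UW by (simp add: Fa)
    qed
  qed (auto simp: F_def category_axioms)
  have "is_sheaf C T F"
    unfolding is_sheaf_iff
  proof (intro conjI ballI F)
    fix U assume U: "U \<in> pointed_subsets T"
    show "is_product C (U - {snd T}) (\<lambda>u. omap F {snd T, u}) (omap F U) (\<lambda>u. amap F ({snd T, u}, U))"
      unfolding Fo[OF U]
    proof (rule product_regroup[OF Q[OF U], where f = id and \<rho> = "\<lambda>k. \<pi> {snd T, k}"])
      fix k assume k: "k \<in> U - {snd T}"
      then have k': "k \<in> U" by simp
      note pk = pointed_pair[OF U k'] pointed_pair_sub[OF U k']
      have *: "{i \<in> U - {snd T}. id i = k} = {snd T, k} - {snd T}" using k by auto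
      show "is_product C {i \<in> U - {snd T}. id i = k} y (omap F {snd T, k}) (\<pi> {snd T, k})"
        unfolding * using Q[OF pk(1)] by (simp add: Fo[OF pk(1)])
      show "amap F ({snd T, k}, U) \<in> hom C (Q U) (omap F {snd T, k})"
        using \<rho>(1)[OF pk(1) U pk(2)] by (simp add: Fo[OF pk(1)] Fa[OF pk(1) U pk(2)])
    next
      fix i assume i: "i \<in> U - {snd T}"
      then have i': "i \<in> U" by simp
      note pi = pointed_pair[OF U i'] pointed_pair_sub[OF U i']
      show "Comp C (\<pi> {snd T, id i} i) (amap F ({snd T, id i}, U)) = \<pi> U i"
        using i \<rho>(2)[OF pi(1) U pi(2), of i] by (simp add: Fa[OF pi(1) U pi(2)])
    qed simp
  qed
  then show thesis
    by (rule that[of F \<pi>]) (simp_all add: Fo Fa Q \<rho>(2))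
qed

text \<open>Abstracts the situation in which \<open>T0\<close> consists of the
  \<open>n\<close>-cells of the sphere, \<open>T J\<close> of the cells on the face
  \<open>J\<close>, and \<open>r0\<close>, \<open>r\<close> are restriction. Surjectivity of
  \<open>r0 J\<close> lets statements about a quotient be tested on points of
  \<open>T0\<close>.\<close>

locale sheaf_cover = contractible_cover P "fst T0" "snd T0" r0 + category D
  for P :: "'j set set" and T0 :: "'t set \<times> 't" and r0 :: "'j set \<Rightarrow> 't \<Rightarrow> 't" and D :: "('o, 'a) cat" +
  fixes T :: "'j set \<Rightarrow> 't set \<times> 't" and r :: "'j set \<Rightarrow> 'j set \<Rightarrow> 't \<Rightarrow> 't"
  assumes fp: "has_finite_products D"
    and T_ptd: "J \<in> P \<Longrightarrow> snd (T J) \<in> fst (T J)"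
    and r0_fun: "J \<in> P \<Longrightarrow> r0 J \<in> fst T0 \<rightarrow>\<^sub>E fst (T J)"
    and r0_base: "J \<in> P \<Longrightarrow> r0 J (snd T0) = snd (T J)"
    and r0_surj: "J \<in> P \<Longrightarrow> r0 J ` fst T0 = fst (T J)"
    and r_base: "\<lbrakk>J \<in> P; K \<in> P; J \<subseteq> K\<rbrakk> \<Longrightarrow> r J K (snd (T K)) = snd (T J)"
    and r_r0: "\<lbrakk>J \<in> P; K \<in> P; J \<subseteq> K\<rbrakk> \<Longrightarrow> compose (fst T0) (r J K) (r0 K) = r0 J"
begin

text \<open>\<open>pre\<close> pulls subsets back to \<open>T0\<close> and \<open>pre2\<close> does
  so between two quotients. A sheaf on \<open>T J\<close> takes at \<open>pt J t\<close> the value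
  that belongs to the block of \<open>t\<close>.\<close>

abbreviation "pre J \<equiv> ptd_preimage T0 (T J) (r0 J)"
abbreviation "pre2 J K \<equiv> ptd_preimage (T K) (T J) (r J K)"
abbreviation "pt J t \<equiv> {snd (T J), r0 J t}"

lemma r_r0_eq: "\<lbrakk>J \<in> P; K \<in> P; J \<subseteq> K; s \<in> fst T0\<rbrakk> \<Longrightarrow> r J K (r0 K s) = r0 J s"
  using r_r0[of J K] by (metis compose_eq)

lemma pre_in: "pre J V \<in> pointed_subsets T0"
  by (simp add: b_in)

lemma pre2_in: "K \<in> P \<Longrightarrow> pre2 J K V \<in> pointed_subsets (T K)"
  by (simp add: T_ptd)

lemma pre_pre2: "\<lbrakk>J \<in> P; K \<in> P; J \<subseteq> K\<rbrakk> \<Longrightarrow> pre K (pre2 J K V) = pre J V"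
  using ptd_preimage_compose[of "r0 K" T0 "T K" "r J K" "T J" V] r0_fun r_base r_r0 by simp

lemma pre2_iff:
  assumes "J \<in> P" "K \<in> P" "J \<subseteq> K" "s \<in> fst T0"
  shows "r0 K s \<in> pre2 J K V \<longleftrightarrow> r0 K s = snd (T K) \<or> r0 J s \<in> V - {snd (T J)}"
  using assms r0_fun[OF assms(2)] r_r0_eq[OF assms] by (auto simp: ptd_preimage_def)

lemma pointed_surj:
  assumes "J \<in> P" "V \<in> pointed_subsets (T J)" "v \<in> V"
  obtains s where "s \<in> fst T0" "r0 J s = v"
proof -
  have "v \<in> r0 J ` fst T0" using assms r0_surj by (auto simp: pointed_subsets_def)
  then show thesis using that by blast
qed

lemma pre2_self:
  assumes J: "J \<in> P" and V: "V \<in> pointed_subsets (T J)"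
  shows "pre2 J J V = V"
proof (rule set_eqI)
  fix v
  show "v \<in> pre2 J J V \<longleftrightarrow> v \<in> V"
  proof (cases "v \<in> fst (T J)")
    case True
    then obtain s where s: "s \<in> fst T0" "v = r0 J s" using r0_surj[OF J] by blast
    then show ?thesis using pre2_iff[OF J J subset_refl s(1)] V by (auto simp: pointed_subsets_def)
  qed (use V T_ptd[OF J] in \<open>auto simp: pointed_subsets_def ptd_preimage_def\<close>)
qed

text \<open>Every element of \<open>T L\<close> is some \<open>r0 L s\<close>, and for these the
  composition law of the preimages reduces to the compatibility of \<open>r\<close> with
  \<open>r0\<close>.\<close>

lemma pre2_pre2:
  assumes J: "J \<in> P" and K: "K \<in> P" and L: "L \<in> P" and JK: "J \<subseteq> K" and KL: "K \<subseteq> L"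
  shows "pre2 K L (pre2 J K V) = pre2 J L V"
proof (rule set_eqI)
  fix v
  show "v \<in> pre2 K L (pre2 J K V) \<longleftrightarrow> v \<in> pre2 J L V"
  proof (cases "v \<in> fst (T L)")
    case True
    then obtain s where s: "s \<in> fst T0" "v = r0 L s" using r0_surj[OF L] by blast
    have JL: "J \<subseteq> L" using JK KL by blast
    have "r0 K s = snd (T K) \<Longrightarrow> r0 J s = snd (T J)"
      using r_r0_eq[OF J K JK s(1)] r_base[OF J K JK] by simp
    then show ?thesis
      using s(2) pre2_iff[OF K L KL s(1)] pre2_iff[OF J K JK s(1)] pre2_iff[OF J L JL s(1)] by auto
  qed (use T_ptd[OF L] in \<open>auto simp: ptd_preimage_def\<close>)
qed

lemma pt_in: "\<lbrakk>J \<in> P; t \<in> fst T0\<rbrakk> \<Longrightarrow> pt J t \<in> pointed_subsets (T J)"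
  using T_ptd r0_fun by (auto simp: pointed_subsets_def)

lemma pt_sub: "\<lbrakk>V \<in> pointed_subsets (T J); t \<in> pre J V; t \<noteq> snd T0\<rbrakk> \<Longrightarrow> pt J t \<subseteq> V"
  by (auto simp: pointed_subsets_def ptd_preimage_def)

lemma aroundD: "J \<in> around t \<Longrightarrow> J \<in> P \<and> r0 J t \<noteq> snd (T J)"
  by (auto simp: around_def r0_base)

lemma aroundI: "J \<in> P \<Longrightarrow> r0 J t \<noteq> snd (T J) \<Longrightarrow> J \<in> around t"
  by (auto simp: around_def r0_base)

lemma pre_aroundI: "\<lbrakk>J \<in> P; t \<in> pre J V; t \<noteq> snd T0\<rbrakk> \<Longrightarrow> t \<in> fst T0 \<and> J \<in> around t \<and> r0 J t \<in> V"
  by (auto simp: ptd_preimage_def intro: aroundI)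

lemma pre_pt: "J \<in> around t \<Longrightarrow> pre J (pt J t) = insert (snd T0) (block J t)"
  by (auto simp: ptd_preimage_def block_def dest: aroundD)

lemma pt_sub_pre2:
  assumes "J \<in> around t" "K \<in> P" "J \<subseteq> K" "t \<in> fst T0"
  shows "pt K t \<subseteq> pre2 J K (pt J t)"
  using aroundD[OF assms(1)] pre2_iff[of J K t "pt J t"] assms pre2_in[of K J "pt J t"]
  by (auto simp: pointed_subsets_def)

text \<open>If the block does not change from \<open>J\<close> to \<open>K\<close>, then only one
  point of \<open>T K\<close> lies over the image of \<open>t\<close> in \<open>T J\<close>, so no
  factor is lost when passing to \<open>K\<close>.\<close>

lemma pre2_pt_eq:
  assumes J: "J \<in> around t" and K: "K \<in> P" "J \<subseteq> K" and t: "t \<in> fst T0" and eq: "block J t = block K t"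
  shows "pre2 J K (pt J t) = pt K t"
proof
  show "pt K t \<subseteq> pre2 J K (pt J t)" using pt_sub_pre2[OF J K t] .
  show "pre2 J K (pt J t) \<subseteq> pt K t"
  proof
    fix v assume v: "v \<in> pre2 J K (pt J t)"
    obtain s where s: "s \<in> fst T0" "r0 K s = v" using pointed_surj[OF K(1) pre2_in[OF K(1)] v] .
    have "v = snd (T K) \<or> r0 J s = r0 J t"
      using v pre2_iff[OF _ K s(1), of "pt J t"] aroundD[OF J] s(2) by auto
    moreover have "r0 K s = r0 K t" if "r0 J s = r0 J t"
      using that eq s(1) by (auto simp: block_def)
    ultimately show "v \<in> pt K t" using s(2) by auto
  qed
qed

end

text \<open>
  A family of sheaves \<open>x J\<close> on the covering pointed sets with coherent isomorphisms \<open>\<psi> J K\<close> from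
  \<open>x J\<close> to the restriction of \<open>x K\<close>; these are inverse to the structure maps of a pseudo-limit object.
\<close>

locale descent_datum = sheaf_cover P T0 r0 D T r
  for P :: "'j set set" and T0 :: "'t set \<times> 't" and r0 and D :: "('o, 'a) cat" and T r +
  fixes x :: "'j set \<Rightarrow> ('t, 'o, 'a) presheaf" and \<psi> :: "'j set \<Rightarrow> 'j set \<Rightarrow> 't set \<Rightarrow> 'a"
  assumes x_sheaf: "J \<in> P \<Longrightarrow> is_sheaf D (T J) (x J)"
    and \<psi>_hom: "\<lbrakk>J \<in> P; K \<in> P; J \<subseteq> K; V \<in> pointed_subsets (T J)\<rbrakk>
      \<Longrightarrow> \<psi> J K V \<in> hom D (omap (x J) V) (omap (x K) (pre2 J K V))"
    and \<psi>_iso: "\<lbrakk>J \<in> P; K \<in> P; J \<subseteq> K; V \<in> pointed_subsets (T J)\<rbrakk> \<Longrightarrow> is_iso D (\<psi> J K V)"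
    and \<psi>_nat: "\<lbrakk>J \<in> P; K \<in> P; J \<subseteq> K; U \<in> pointed_subsets (T J); V \<in> pointed_subsets (T J); U \<subseteq> V\<rbrakk>
      \<Longrightarrow> Comp D (\<psi> J K U) (amap (x J) (U, V)) = Comp D (amap (x K) (pre2 J K U, pre2 J K V)) (\<psi> J K V)"
    and \<psi>_id: "\<lbrakk>J \<in> P; V \<in> pointed_subsets (T J)\<rbrakk> \<Longrightarrow> \<psi> J J V = Ident D (omap (x J) V)"
    and \<psi>_comp: "\<lbrakk>J \<in> P; K \<in> P; L \<in> P; J \<subseteq> K; K \<subseteq> L; V \<in> pointed_subsets (T J)\<rbrakk>
      \<Longrightarrow> Comp D (\<psi> K L (pre2 J K V)) (\<psi> J K V) = \<psi> J L V"
begin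

definition "ob t J = omap (x J) (pt J t)"

text \<open>\<open>\<psi> J K\<close> carries the value at the \<open>J\<close>-block of
  \<open>t\<close> to the value of \<open>x K\<close> on all \<open>K\<close>-blocks inside it, and
  restriction then projects to the one that contains \<open>t\<close>.\<close>

definition "mr t J K = Comp D (amap (x K) (pt K t, pre2 J K (pt J t))) (\<psi> J K (pt J t))"

lemma x_functor: "J \<in> P \<Longrightarrow> is_functor (presheaf_shape (T J)) D (x J)"
  using is_sheafD(1)[OF x_sheaf] .

lemmas x_obj = presheafD(1)[OF x_functor] and x_hom = presheafD(2)[OF x_functor]
  and x_id = presheafD(3)[OF x_functor] and x_comp = presheafD(4)[OF x_functor]

lemma
  assumes t: "t \<in> fst T0" and J: "J \<in> around t" and K: "K \<in> around t" and JK: "J \<subseteq> K"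
  shows x_pt_hom: "amap (x K) (pt K t, pre2 J K (pt J t)) \<in> hom D (omap (x K) (pre2 J K (pt J t))) (ob t K)"
    and \<psi>_pt_hom: "\<psi> J K (pt J t) \<in> hom D (ob t J) (omap (x K) (pre2 J K (pt J t)))"
proof -
  have JP: "J \<in> P" and KP: "K \<in> P" using J K aroundD by auto
  show "amap (x K) (pt K t, pre2 J K (pt J t)) \<in> hom D (omap (x K) (pre2 J K (pt J t))) (ob t K)"
    unfolding ob_def using x_hom[OF KP pt_in[OF KP t] pre2_in[OF KP] pt_sub_pre2[OF J KP JK t]] .
  show "\<psi> J K (pt J t) \<in> hom D (ob t J) (omap (x K) (pre2 J K (pt J t)))"
    unfolding ob_def using \<psi>_hom[OF JP KP JK pt_in[OF JP t]] .
qed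

text \<open>Naturality of \<open>\<psi> K L\<close> moves it past the restriction made at
  \<open>K\<close>; then the two restrictions compose in \<open>x L\<close> and the two
  \<open>\<psi>\<close> compose by the cocycle rule.\<close>

lemma mr_comp_aux:
  assumes t: "t \<in> fst T0" and J: "J \<in> around t" and K: "K \<in> around t" and L: "L \<in> around t"
    and JK: "J \<subseteq> K" and KL: "K \<subseteq> L"
  shows "Comp D (mr t K L) (mr t J K) = mr t J L"
proof -
  have P: "J \<in> P" "K \<in> P" "L \<in> P" using J K L aroundD by auto
  have JL: "J \<subseteq> L" using JK KL by blast
  let ?uJ = "pt J t" and ?uK = "pt K t" and ?uL = "pt L t"
  let ?W = "pre2 J K ?uJ" and ?W' = "pre2 J L ?uJ"
  have W: "?W \<in> pointed_subsets (T K)" and sub: "?uK \<subseteq> ?W"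
    using pre2_in[OF P(2)] pt_sub_pre2[OF J P(2) JK t] by auto
  have W': "pre2 K L ?W = ?W'" using pre2_pre2[OF P JK KL] .
  have sub': "pre2 K L ?uK \<subseteq> ?W'" using ptd_preimage_mono[OF sub] W' by blast
  note uK = pt_in[OF P(2) t] and uL = pt_in[OF P(3) t] and uJ = pt_in[OF P(1) t]
  note h1 = \<psi>_hom[OF P(1,2) JK uJ] and h2 = x_hom[OF P(2) uK W sub]
    and h3 = \<psi>_hom[OF P(2,3) KL uK] and h4 = x_hom[OF P(3) uL pre2_in[OF P(3)] pt_sub_pre2[OF K P(3) KL t]]
    and h5 = \<psi>_hom[OF P(2,3) KL W] and h6 = x_hom[OF P(3) pre2_in[OF P(3)] pre2_in[OF P(3)] sub']
  have h5': "\<psi> K L ?W \<in> hom D (omap (x K) ?W) (omap (x L) ?W')" using h5 W' by simp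
  let ?C = "Comp D" and ?a = "amap (x L) (?uL, pre2 K L ?uK)" and ?b = "\<psi> K L ?uK"
    and ?c = "amap (x K) (?uK, ?W)" and ?d = "\<psi> J K ?uJ" and ?e = "amap (x L) (pre2 K L ?uK, ?W')"
    and ?f = "\<psi> K L ?W"
  have "?C (?C ?a ?b) (?C ?c ?d) = ?C ?a (?C (?C ?b ?c) ?d)"
    using comp_assoc[OF comp_hom[OF h1 h2] h3 h4] comp_assoc[OF h1 h2 h3] by simp
  also have "?C ?b ?c = ?C ?e ?f" using \<psi>_nat[OF P(2,3) KL uK W sub] W' by simp
  also have "?C ?a (?C (?C ?e ?f) ?d) = ?C (?C ?a ?e) (?C ?f ?d)"
    using comp_assoc[OF h1 h5' h6] comp_assoc[OF comp_hom[OF h1 h5'] h6 h4] by simp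
  also have "?C ?a ?e = amap (x L) (?uL, ?W')"
    using x_comp[OF P(3) uL pre2_in[OF P(3)] pre2_in[OF P(3)] pt_sub_pre2[OF K P(3) KL t] sub'] .
  also have "?C ?f ?d = \<psi> J L ?uJ" using \<psi>_comp[OF P JK KL uJ] .
  finally show ?thesis by (simp add: mr_def)
qed

text \<open>On an unchanged block the restriction part of \<open>mr\<close> is an identity by
  \<open>pre2_pt_eq\<close>, and only the isomorphism \<open>\<psi>\<close> remains.\<close>

lemma cover_functor:
  assumes t: "t \<in> fst T0" "t \<noteq> snd T0"
  shows "cover_functor P (fst T0) (snd T0) r0 D t (ob t) (mr t)"
proof unfold_locales
  fix J K assume J: "J \<in> around t" and K: "K \<in> around t" and JK: "J \<subseteq> K"
  have P: "J \<in> P" "K \<in> P" using J K aroundD by auto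
  note a = x_pt_hom[OF t(1) J K JK] and b = \<psi>_pt_hom[OF t(1) J K JK]
  show "mr t J K \<in> hom D (ob t J) (ob t K)" unfolding mr_def using comp_hom[OF b a] .
  assume eq: "block J t = block K t"
  note p = pre2_pt_eq[OF J P(2) JK t(1) eq] and uK = pt_in[OF P(2) t(1)]
  have "is_iso D (amap (x K) (pt K t, pre2 J K (pt J t)))"
    using p x_id[OF P(2) uK] iso_id x_obj[OF P(2) uK] by simp
  then show "is_iso D (mr t J K)"
    unfolding mr_def using iso_comp[OF \<psi>_iso[OF P JK pt_in[OF P(1) t(1)]] b _ a] by blast
next
  fix J assume J: "J \<in> around t"
  then have P: "J \<in> P" using aroundD by auto
  note u = pt_in[OF P t(1)]
  show "mr t J J = Ident D (ob t J)"
    using comp_id_left[OF Ident_in[OF x_obj[OF P u]]]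
    by (simp add: mr_def ob_def pre2_self[OF P u] x_id[OF P u] \<psi>_id[OF P u])
qed (use t mr_comp_aux[OF t(1)] in auto)

lemma natural_eq:
  assumes t: "t \<in> fst T0" "t \<noteq> snd T0" and L: "least_for t {t} L"
    and q: "\<And>J. J \<in> around t \<Longrightarrow> q J \<in> hom D (ob t J) z"
      "\<And>J K. \<lbrakk>J \<in> around t; K \<in> around t; J \<subseteq> K\<rbrakk> \<Longrightarrow> Comp D (q K) (mr t J K) = q J"
    and q': "\<And>J. J \<in> around t \<Longrightarrow> q' J \<in> hom D (ob t J) z"
      "\<And>J K. \<lbrakk>J \<in> around t; K \<in> around t; J \<subseteq> K\<rbrakk> \<Longrightarrow> Comp D (q' K) (mr t J K) = q' J"
    and eq: "q L = q' L" and J: "J \<in> around t"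
  shows "q J = q' J"
proof -
  interpret F: cover_functor P "fst T0" "snd T0" r0 D t "ob t" "mr t" by (rule cover_functor[OF t])
  show ?thesis by (rule F.natural_eq[OF L q q' eq J])
qed

text \<open>The maps \<open>p t J\<close> are to become the projections from the value at the
  \<open>J\<close>-block of \<open>t\<close> to an object \<open>y t\<close> attached to the point
  \<open>t\<close> alone; \<open>p_unit\<close> is the normalisation of the cocone.\<close>

context
  fixes y :: "'t \<Rightarrow> 'o" and p :: "'t \<Rightarrow> 'j set \<Rightarrow> 'a"
  assumes p_hom: "\<And>t J. \<lbrakk>t \<in> fst T0; t \<noteq> snd T0; J \<in> around t\<rbrakk> \<Longrightarrow> p t J \<in> hom D (ob t J) (y t)"
    and p_nat: "\<And>t J K. \<lbrakk>t \<in> fst T0; t \<noteq> snd T0; J \<in> around t; K \<in> around t; J \<subseteq> K\<rbrakk>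
      \<Longrightarrow> Comp D (p t K) (mr t J K) = p t J"
    and p_unit: "\<And>t. \<lbrakk>t \<in> fst T0; t \<noteq> snd T0\<rbrakk> \<Longrightarrow>
      \<exists>L. least_for t {t} L \<and> y t = ob t L \<and> p t L = Ident D (y t)"
begin

text \<open>Candidate projection from the value at an arbitrary \<open>V\<close> to the factor at
  \<open>t\<close>: restrict to the block of \<open>t\<close>, then apply \<open>p\<close>.\<close>

definition "q J V t = Comp D (p t J) (amap (x J) (pt J t, V))"

text \<open>The sheaf condition gives a product over the points of \<open>V\<close> in
  \<open>T J\<close>, and each of these points other than the base point corresponds to one
  block.\<close>

lemma product_of_blocks:
  assumes J: "J \<in> P" and V: "V \<in> pointed_subsets (T J)"
    and blocks: "\<And>t. t \<in> pre J V - {snd T0} \<Longrightarrow> is_product D (block J t) y (ob t J) (\<lambda>s. p s J)"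
  shows "is_product D (pre J V - {snd T0}) y (omap (x J) V) (q J V)"
proof -
  have "is_product D (pre J V - {snd T0}) y (omap (x J) V)
      (\<lambda>i. Comp D (p i J) (amap (x J) ({snd (T J), r0 J i}, V)))"
  proof (rule product_of_products[where \<rho> = "\<lambda>_ s. p s J", OF is_sheafD(2)[OF x_sheaf[OF J] V]])
    show "r0 J ` (pre J V - {snd T0}) \<subseteq> V - {snd (T J)}" by (auto simp: ptd_preimage_def)
    fix v assume v: "v \<in> V - {snd (T J)}"
    then obtain s where s: "s \<in> fst T0" "r0 J s = v" using pointed_surj[OF J V, of v] by auto
    have sV: "s \<in> pre J V - {snd T0}"
      using s v r0_base[OF J] by (auto simp: ptd_preimage_def)
    have "{i \<in> pre J V - {snd T0}. r0 J i = v} = block J s"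
      using v s r0_base[OF J] by (auto simp: block_def ptd_preimage_def b_in)
    then show "is_product D {i \<in> pre J V - {snd T0}. r0 J i = v} y (omap (x J) {snd (T J), v}) (\<lambda>s. p s J)"
      using blocks[OF sV] s(2) by (simp add: ob_def)
  qed
  then show ?thesis by (rule is_product_cong) (auto simp: q_def)
qed

text \<open>Induction on the size of the block. At a point, \<open>p t J\<close> is inverse to an
  isomorphism. Otherwise the value is compared with a splitting \<open>K\<close> of the least
  representative, where the same points fall into strictly smaller blocks; the induction hypothesis
  and the sheaf condition for \<open>x K\<close> give a product, which \<open>\<psi>\<close> and
  \<open>mr\<close> carry back.\<close>

lemma block_product:
  assumes "t \<in> fst T0" "t \<noteq> snd T0" "J \<in> around t"
  shows "is_product D (block J t) y (ob t J) (\<lambda>s. p s J)"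
  using assms
proof (induction "card (block J t)" arbitrary: t J rule: less_induct)
  case less
  note t = less.prems(1,2) and J = less.prems(3)
  interpret F: cover_functor P "fst T0" "snd T0" r0 D t "ob t" "mr t" by (rule cover_functor[OF t])
  have JP: "J \<in> P" using J aroundD by blast
  show ?case
  proof (cases "block J t = {t}")
    case True
    obtain L where L: "least_for t {t} L" "y t = ob t L" "p t L = Ident D (y t)"
      using p_unit[OF t] by blast
    have L': "L \<in> around t" "L \<subseteq> J" "block L t = block J t"
      using F.least_around[OF J, of L] L(1) unfolding True by simp_all
    have "is_iso D (p t J)"
      by (rule iso_left_inverse[OF F.mr_iso[OF L'(1) J L'(2,3)] F.mr_hom[OF L'(1) J L'(2)]])
        (use p_hom[OF t J] p_nat[OF t L'(1) J L'(2)] L in simp_all)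
    from is_product_singleton[of _ _ y, OF this p_hom[OF t J]] show ?thesis
      unfolding True by (rule is_product_cong) auto
  next
    case False
    obtain L where L: "least_for t (block J t) L" using ex_least_for[OF t(1) J] by (elim exE)
    have L': "L \<in> around t" "L \<subseteq> J" "block L t = block J t"
      using F.least_around[OF J L] by simp_all
    have LP: "L \<in> P" using L'(1) aroundD by blast
    obtain K where "K \<in> splits L t" using least_forD(4)[OF L False] by (elim exE)
    note K = F.split_around[OF L'(1) this]
    have KP: "K \<in> P" and LK: "L \<subseteq> K" and Ka: "K \<in> around t" using K by auto
    let ?V = "pre2 L K (pt L t)"
    note V = pre2_in[OF KP, of L "pt L t"]
    have pre_V: "pre K ?V - {snd T0} = block J t"
    proof -
      have "snd T0 \<notin> block L t" using L'(1) t by (simp add: around_iff)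
      then show ?thesis using pre_pre2[OF LP KP LK] pre_pt[OF L'(1)] L'(3) by auto
    qed
    \<comment> \<open>Points of one block share their \<open>J\<close>- and \<open>L\<close>-data,
      so their projections can all be transported along the same maps.\<close>
    have same: "s \<in> fst T0 \<and> s \<noteq> snd T0 \<and> block J s = block J t \<and> block L s = block L t \<and>
        pt L s = pt L t \<and> pt J s = pt J t \<and> L \<in> around s \<and> J \<in> around s \<and> K \<in> around s"
      if s: "s \<in> block J t" for s
    proof -
      have sL: "s \<in> block L t" using s L'(3) by simp
      have *: "s \<in> fst T0" "r0 J s = r0 J t" "r0 L s = r0 L t" using s sL by (auto simp: block_def)
      have L_s: "L \<in> around s" using L'(1) *(3) by (auto simp: around_def)
      then have "s \<noteq> snd T0" by (auto simp: around_def)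
      moreover have "block J s = block J t" "block L s = block L t" using * by (auto simp: block_def)
      ultimately show ?thesis
        using * L_s around_up[OF L_s JP L'(2) *(1)] around_up[OF L_s KP LK *(1)] by simp
    qed
    have "is_product D (block J t) y (omap (x K) ?V) (q K ?V)"
    proof -
      have "is_product D (block K s) y (ob s K) (\<lambda>s. p s K)" if "s \<in> pre K ?V - {snd T0}" for s
      proof -
        have s: "s \<in> block J t" using that pre_V by simp
        \<comment> \<open>A \<open>K\<close>-block that filled the whole block would be the
          \<open>K\<close>-block of \<open>t\<close>, which is strictly smaller because
          \<open>K\<close> splits it.\<close>
        have "block K s \<noteq> block J t"
        proof
          assume eq: "block K s = block J t"
          then have "t \<in> block K s" using in_block[OF t(1), of J] by simp
          then have "block K s = block K t" by (simp add: block_def)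
          then show False using eq K L'(3) by simp
        qed
        moreover have "block K s \<subseteq> block J t"
          using block_antimono[OF LP KP LK, of s] same[OF s] L'(3) by auto
        ultimately have "card (block K s) < card (block J t)"
          using psubset_card_mono[OF finite_block, of "block K s" J t] by blast
        then show ?thesis by (rule less.hyps) (use same[OF s] in auto)
      qed
      from product_of_blocks[OF KP V this] show ?thesis by (simp add: pre_V)
    qed
    \<comment> \<open>Transport along \<open>\<psi> L K\<close>; the new projections are the
      \<open>p s L\<close> because \<open>p\<close> is a cocone.\<close>
    from is_product_iso[OF this \<psi>_iso[OF LP KP LK pt_in[OF LP t(1)]] \<psi>_pt_hom[OF t(1) L'(1) Ka LK]]
    have prod_L: "is_product D (block J t) y (ob t L) (\<lambda>s. p s L)"
    proof (rule is_product_cong)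
      fix s assume s: "s \<in> block J t"
      note s' = same[OF s]
      have pts: "pt L s = pt L t" and K_s: "K \<in> around s" and L_s: "L \<in> around s" and sT: "s \<in> fst T0" "s \<noteq> snd T0"
        using s' by auto
      have "Comp D (q K ?V s) (\<psi> L K (pt L t)) = Comp D (p s K) (mr s L K)"
        using comp_assoc[OF \<psi>_pt_hom[OF sT(1) L_s K_s LK] x_pt_hom[OF sT(1) L_s K_s LK] p_hom[OF sT K_s]]
        unfolding q_def mr_def pts by simp
      then show "Comp D (q K ?V s) (\<psi> L K (pt L t)) = p s L" using p_nat[OF sT L_s K_s LK] by simp
    qed auto
    note m_iso = F.mr_iso[OF L'(1) J L'(2,3)] and m_hom = F.mr_hom[OF L'(1) J L'(2)]
    obtain e where e: "e \<in> hom D (ob t J) (ob t L)" "Comp D e (mr t L J) = Ident D (ob t L)"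
      "Comp D (mr t L J) e = Ident D (ob t J)" "is_iso D e"
      using m_iso m_hom by (rule isoE)
    from is_product_iso[OF prod_L e(4,1)] show ?thesis
    proof (rule is_product_cong)
      fix s assume s: "s \<in> block J t"
      have pts: "pt L s = pt L t" "pt J s = pt J t" and J_s: "J \<in> around s" and L_s: "L \<in> around s"
        and sT: "s \<in> fst T0" "s \<noteq> snd T0"
        using same[OF s] by auto
      have ms: "mr s L J = mr t L J" and obs: "ob s J = ob t J" unfolding mr_def ob_def pts by simp_all
      have ps: "p s J \<in> hom D (ob t J) (y s)" using p_hom[OF sT J_s] obs by simp
      show "Comp D (p s L) e = p s J"
        using p_nat[OF sT L_s J_s L'(2)] comp_assoc[OF e(1) m_hom ps] e(3) comp_id_right[OF ps] ms by simp
    qed auto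
  qed
qed

lemma q_product:
  assumes J: "J \<in> P" and V: "V \<in> pointed_subsets (T J)"
  shows "is_product D (pre J V - {snd T0}) y (omap (x J) V) (q J V)"
proof (rule product_of_blocks[OF J V block_product])
  fix t assume "t \<in> pre J V - {snd T0}"
  then show "t \<in> fst T0" "t \<noteq> snd T0" "J \<in> around t" using pre_aroundI[OF J, of t V] by auto
qed

lemma q_nat:
  assumes J: "J \<in> P" and U: "U \<in> pointed_subsets (T J)" and V: "V \<in> pointed_subsets (T J)" and UV: "U \<subseteq> V"
    and t: "t \<in> pre J U - {snd T0}"
  shows "Comp D (q J U t) (amap (x J) (U, V)) = q J V t"
proof -
  have t': "t \<in> fst T0" "t \<noteq> snd T0" "J \<in> around t" using pre_aroundI[OF J, of t U] t by auto
  have u: "pt J t \<subseteq> U" using pt_sub[OF U] t by blast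
  note ptJ = pt_in[OF J t'(1)]
  show ?thesis
    unfolding q_def
    using comp_assoc[OF x_hom[OF J U V UV] x_hom[OF J ptJ U u], of "p t J" "y t"] p_hom[OF t'] x_comp[OF J ptJ U V u UV]
    by (simp add: ob_def)
qed

text \<open>Naturality of \<open>\<psi>\<close> along \<open>pt J t \<subseteq> V\<close> produces
  the map \<open>mr t J K\<close>, to which the cocone identity of \<open>p\<close> applies.\<close>

lemma q_comp:
  assumes J: "J \<in> P" and K: "K \<in> P" and JK: "J \<subseteq> K" and V: "V \<in> pointed_subsets (T J)"
    and t: "t \<in> pre J V - {snd T0}"
  shows "Comp D (q K (pre2 J K V) t) (\<psi> J K V) = q J V t"
proof -
  have t': "t \<in> fst T0" "t \<noteq> snd T0" "J \<in> around t" using pre_aroundI[OF J, of t V] t by auto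
  have Kt: "K \<in> around t" using around_up[OF t'(3) K JK t'(1)] .
  have u: "pt J t \<subseteq> V" using pt_sub[OF V] t by blast
  note ptJ = pt_in[OF J t'(1)] and ptK = pt_in[OF K t'(1)]
  note W = pre2_in[OF K, of J V] and W' = pre2_in[OF K, of J "pt J t"]
  note sub = pt_sub_pre2[OF t'(3) K JK t'(1)] and sub' = ptd_preimage_mono[OF u, of "T K" "T J" "r J K"]
  let ?C = "Comp D" and ?a = "amap (x K) (pt K t, pre2 J K (pt J t))"
    and ?b = "amap (x K) (pre2 J K (pt J t), pre2 J K V)" and ?c = "amap (x J) (pt J t, V)"
    and ?d = "\<psi> J K V" and ?e = "\<psi> J K (pt J t)"
  note a = x_hom[OF K ptK W' sub] and b = x_hom[OF K W' W sub'] and c = x_hom[OF J ptJ V u]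
    and d = \<psi>_hom[OF J K JK V] and e = \<psi>_hom[OF J K JK ptJ]
  have p: "p t K \<in> hom D (omap (x K) (pt K t)) (y t)" using p_hom[OF t'(1,2) Kt] by (simp add: ob_def)
  have "?C (q K (pre2 J K V) t) ?d = ?C (?C (p t K) (?C ?a ?b)) ?d"
    unfolding q_def using x_comp[OF K ptK W' W sub sub'] by simp
  also have "\<dots> = ?C (p t K) (?C ?a (?C ?b ?d))"
    using comp_assoc[OF d comp_hom[OF b a] p] comp_assoc[OF d b a] by simp
  also have "?C ?b ?d = ?C ?e ?c" using \<psi>_nat[OF J K JK ptJ V u] by simp
  also have "?C (p t K) (?C ?a (?C ?e ?c)) = ?C (?C (p t K) (?C ?a ?e)) ?c"
    using comp_assoc[OF c e a] comp_assoc[OF c comp_hom[OF e a] p] by simp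
  also have "?C (p t K) (?C ?a ?e) = p t J" using p_nat[OF t' Kt JK] by (simp add: mr_def)
  finally show ?thesis by (simp add: q_def)
qed

end

text \<open>The glued sheaf is the product sheaf on the objects \<open>y t\<close>. Its value at
  \<open>pre J V\<close> and the value of \<open>x J\<close> at \<open>V\<close> are products of the
  same factors, hence uniquely isomorphic, and every compatibility is tested on the projections
  \<open>q\<close>.\<close>

lemma glue:
  obtains F \<theta> where "is_sheaf D T0 F"
    "\<And>J V. \<lbrakk>J \<in> P; V \<in> pointed_subsets (T J)\<rbrakk> \<Longrightarrow> \<theta> J V \<in> hom D (omap F (pre J V)) (omap (x J) V)"
    "\<And>J V. \<lbrakk>J \<in> P; V \<in> pointed_subsets (T J)\<rbrakk> \<Longrightarrow> is_iso D (\<theta> J V)"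
    "\<And>J U V. \<lbrakk>J \<in> P; U \<in> pointed_subsets (T J); V \<in> pointed_subsets (T J); U \<subseteq> V\<rbrakk> \<Longrightarrow>
      Comp D (\<theta> J U) (amap F (pre J U, pre J V)) = Comp D (amap (x J) (U, V)) (\<theta> J V)"
    "\<And>J K V. \<lbrakk>J \<in> P; K \<in> P; J \<subseteq> K; V \<in> pointed_subsets (T J)\<rbrakk> \<Longrightarrow>
      Comp D (\<psi> J K V) (\<theta> J V) = \<theta> K (pre2 J K V)"
proof -
  have "\<exists>L. least_for t {t} L" if "t \<in> fst T0" "t \<noteq> snd T0" for t using ex_unit[OF that] .
  then obtain L where L: "\<And>t. \<lbrakk>t \<in> fst T0; t \<noteq> snd T0\<rbrakk> \<Longrightarrow> least_for t {t} (L t)" by metis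
  \<comment> \<open>The value at the point \<open>t\<close> is read off where the block of
    \<open>t\<close> is \<open>{t}\<close>.\<close>
  define y where "y t = ob t (L t)" for t
  have "\<exists>p. (\<forall>J \<in> around t. p J \<in> hom D (ob t J) (y t)) \<and>
      (\<forall>J \<in> around t. \<forall>K \<in> around t. J \<subseteq> K \<longrightarrow> Comp D (p K) (mr t J K) = p J) \<and> p (L t) = Ident D (y t)"
    if t: "t \<in> fst T0" "t \<noteq> snd T0" for t
  proof -
    interpret F: cover_functor P "fst T0" "snd T0" r0 D t "ob t" "mr t" by (rule cover_functor[OF t])
    show ?thesis unfolding y_def by (rule F.ex_natural[OF L[OF t]]) (intro exI conjI ballI impI)
  qed
  then obtain p where p: "\<And>t. \<lbrakk>t \<in> fst T0; t \<noteq> snd T0\<rbrakk> \<Longrightarrow> (\<forall>J \<in> around t. p t J \<in> hom D (ob t J) (y t)) \<and>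
      (\<forall>J \<in> around t. \<forall>K \<in> around t. J \<subseteq> K \<longrightarrow> Comp D (p t K) (mr t J K) = p t J) \<and> p t (L t) = Ident D (y t)"
    by metis
  have p_hom: "\<And>t J. \<lbrakk>t \<in> fst T0; t \<noteq> snd T0; J \<in> around t\<rbrakk> \<Longrightarrow> p t J \<in> hom D (ob t J) (y t)"
    and p_nat: "\<And>t J K. \<lbrakk>t \<in> fst T0; t \<noteq> snd T0; J \<in> around t; K \<in> around t; J \<subseteq> K\<rbrakk>
      \<Longrightarrow> Comp D (p t K) (mr t J K) = p t J"
    using p by simp_all
  have p_unit: "\<exists>L. least_for t {t} L \<and> y t = ob t L \<and> p t L = Ident D (y t)"
    if t: "t \<in> fst T0" "t \<noteq> snd T0" for t
    using p[OF t] L[OF t] by (intro exI[of _ "L t"]) (simp add: y_def)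
  have q_product: "is_product D (pre J V - {snd T0}) y (omap (x J) V) (q p J V)"
    if "J \<in> P" "V \<in> pointed_subsets (T J)" for J V
    by (rule q_product; fact p_hom p_nat p_unit that)
  have q_nat: "Comp D (q p J U t) (amap (x J) (U, V)) = q p J V t"
    if "J \<in> P" "U \<in> pointed_subsets (T J)" "V \<in> pointed_subsets (T J)" "U \<subseteq> V" "t \<in> pre J U - {snd T0}" for J U V t
    by (rule q_nat[where y = y]; fact p_hom p_nat p_unit that)
  have q_comp: "Comp D (q p K (pre2 J K V) t) (\<psi> J K V) = q p J V t"
    if "J \<in> P" "K \<in> P" "J \<subseteq> K" "V \<in> pointed_subsets (T J)" "t \<in> pre J V - {snd T0}" for J K V t
    by (rule q_comp[where y = y]; fact p_hom p_nat p_unit that)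
  have y: "y t \<in> Obj D" if t: "t \<in> fst T0" "t \<noteq> snd T0" for t
  proof -
    have "L t \<in> P" using least_forD(1)[OF L[OF t]] .
    then show ?thesis using x_obj[OF _ pt_in[OF _ t(1)]] by (simp add: y_def ob_def)
  qed
  obtain F \<pi> where F: "is_sheaf D T0 F"
    and \<pi>: "\<And>U. U \<in> pointed_subsets T0 \<Longrightarrow> is_product D (U - {snd T0}) y (omap F U) (\<pi> U)"
    and \<pi>_nat: "\<And>U V t. \<lbrakk>U \<in> pointed_subsets T0; V \<in> pointed_subsets T0; U \<subseteq> V; t \<in> U - {snd T0}\<rbrakk>
      \<Longrightarrow> Comp D (\<pi> U t) (amap F (U, V)) = \<pi> V t"
    by (rule ex_product_sheaf[where y = y, OF fp finite_A b_in]) (use y in auto)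
  note F' = is_sheafD(1)[OF F]
  have "\<exists>h. h \<in> hom D (omap F (pre J V)) (omap (x J) V) \<and> (\<forall>t \<in> pre J V - {snd T0}. Comp D (q p J V t) h = \<pi> (pre J V) t)"
    if "J \<in> P" "V \<in> pointed_subsets (T J)" for J V
    by (rule is_productD(3)[OF q_product[OF that]])
      (use presheafD(1)[OF F' pre_in] is_productD(2)[OF \<pi>[OF pre_in]] in auto)
  then obtain \<theta> where \<theta>: "\<And>J V. \<lbrakk>J \<in> P; V \<in> pointed_subsets (T J)\<rbrakk> \<Longrightarrow> \<theta> J V \<in> hom D (omap F (pre J V)) (omap (x J) V)"
    and \<theta>_q: "\<And>J V t. \<lbrakk>J \<in> P; V \<in> pointed_subsets (T J); t \<in> pre J V - {snd T0}\<rbrakk>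
      \<Longrightarrow> Comp D (q p J V t) (\<theta> J V) = \<pi> (pre J V) t"
    by metis
  show thesis
  proof (rule that[OF F \<theta>])
    show "is_iso D (\<theta> J V)" if "J \<in> P" "V \<in> pointed_subsets (T J)" for J V
      by (rule product_comparison_iso[OF q_product[OF that] \<pi>[OF pre_in] \<theta>[OF that] \<theta>_q[OF that]])
    show "Comp D (\<theta> J U) (amap F (pre J U, pre J V)) = Comp D (amap (x J) (U, V)) (\<theta> J V)"
      if J: "J \<in> P" and U: "U \<in> pointed_subsets (T J)" and V: "V \<in> pointed_subsets (T J)" and UV: "U \<subseteq> V" for J U V
    proof -
      note sub = ptd_preimage_mono[OF UV, of T0 "T J" "r0 J"]
      note a = presheafD(2)[OF F' pre_in pre_in sub] and b = x_hom[OF J U V UV]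
      show ?thesis
      proof (rule product_eqI[OF q_product[OF J U] comp_hom[OF a \<theta>[OF J U]] comp_hom[OF \<theta>[OF J V] b]])
        fix t assume t: "t \<in> pre J U - {snd T0}"
        then have t': "t \<in> pre J V - {snd T0}" using sub by blast
        note q = is_productD(2)[OF q_product[OF J U] t]
        show "Comp D (q p J U t) (Comp D (\<theta> J U) (amap F (pre J U, pre J V)))
            = Comp D (q p J U t) (Comp D (amap (x J) (U, V)) (\<theta> J V))"
          using comp_assoc[OF a \<theta>[OF J U] q] comp_assoc[OF \<theta>[OF J V] b q] \<theta>_q[OF J U t] \<theta>_q[OF J V t']
            q_nat[OF J U V UV t] \<pi>_nat[OF pre_in pre_in sub t] by simp
      qed
    qed
    show "Comp D (\<psi> J K V) (\<theta> J V) = \<theta> K (pre2 J K V)"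
      if J: "J \<in> P" and K: "K \<in> P" and JK: "J \<subseteq> K" and V: "V \<in> pointed_subsets (T J)" for J K V
    proof -
      note W = pre2_in[OF K, of J V] and pp = pre_pre2[OF J K JK, of V]
      note a = \<theta>[OF J V] and b = \<psi>_hom[OF J K JK V]
      have c: "\<theta> K (pre2 J K V) \<in> hom D (omap F (pre J V)) (omap (x K) (pre2 J K V))" using \<theta>[OF K W] pp by simp
      show ?thesis
      proof (rule product_eqI[OF q_product[OF K W] comp_hom[OF a b] c])
        fix t assume t: "t \<in> pre K (pre2 J K V) - {snd T0}"
        then have t': "t \<in> pre J V - {snd T0}" using pp by simp
        note q = is_productD(2)[OF q_product[OF K W] t]
        show "Comp D (q p K (pre2 J K V) t) (Comp D (\<psi> J K V) (\<theta> J V))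
            = Comp D (q p K (pre2 J K V) t) (\<theta> K (pre2 J K V))"
          using comp_assoc[OF a b q] q_comp[OF J K JK V t'] \<theta>_q[OF J V t'] \<theta>_q[OF K W t] pp by simp
      qed
    qed
  qed
qed

end

section \<open>Gluing of morphisms and the descent theorem\<close>

context sheaf_cover
begin

text \<open>Every two-element pointed subset of \<open>T0\<close> is pulled back from some quotient;
  this is how the cover sees individual points.\<close>

lemma pre_unit:
  assumes t: "t \<in> fst T0" "t \<noteq> snd T0" and L: "least_for t {t} L"
  shows "L \<in> around t" "L \<in> P" "pre L (pt L t) = {snd T0, t}"
proof -
  have b: "block L t = {t}" and LP: "L \<in> P" using least_forD(1,2)[OF L] by auto
  then show L_in: "L \<in> around t" using t by (simp add: around_iff)
  show "L \<in> P" by fact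
  show "pre L (pt L t) = {snd T0, t}" using pre_pt[OF L_in] b by simp
qed

lemma push_push:
  assumes "J \<in> P" "K \<in> P" "J \<subseteq> K"
  shows "push_presheaf (T K) (T J) (r J K) (push_presheaf T0 (T K) (r0 K) F) = push_presheaf T0 (T J) (r0 J) F"
  using push_presheaf_compose[of "T K" "r0 K" T0 "r J K" "T J" F] T_ptd[OF assms(2)] r0_fun[OF assms(2)]
    r_base[OF assms] r_r0[OF assms] by simp

text \<open>A map into a sheaf is determined at the two-element pointed subsets, which are preimages
  from the cover by \<open>pre_unit\<close>.\<close>

lemma sheaf_map_eqI:
  assumes G: "is_sheaf D T0 G"
    and \<eta>: "nat_trans (presheaf_shape T0) D F G \<eta>" and \<eta>': "nat_trans (presheaf_shape T0) D F G \<eta>'"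
    and eq: "\<And>J V. \<lbrakk>J \<in> P; V \<in> pointed_subsets (T J)\<rbrakk> \<Longrightarrow> \<eta> (pre J V) = \<eta>' (pre J V)"
  shows "\<eta> = \<eta>'"
proof (rule extensionalityI)
  show "\<eta> \<in> extensional (pointed_subsets T0)" "\<eta>' \<in> extensional (pointed_subsets T0)"
    using nat_transD(3)[OF \<eta>] nat_transD(3)[OF \<eta>'] by simp_all
  fix U assume U: "U \<in> pointed_subsets T0"
  show "\<eta> U = \<eta>' U"
  proof (rule product_eqI[OF is_sheafD(2)[OF G U] presheaf_mapD(1)[OF \<eta> U] presheaf_mapD(1)[OF \<eta>' U]])
    fix t assume t: "t \<in> U - {snd T0}"
    then have tU: "t \<in> U" and t': "t \<in> fst T0" "t \<noteq> snd T0" using U by (auto simp: pointed_subsets_def)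
    obtain L where L: "least_for t {t} L" using ex_unit[OF t'] by (elim exE)
    note L' = pre_unit[OF t' L]
    have "\<eta> {snd T0, t} = \<eta>' {snd T0, t}" using eq[OF L'(2) pt_in[OF L'(2) t'(1)]] L'(3) by simp
    then show "Comp D (amap G ({snd T0, t}, U)) (\<eta> U) = Comp D (amap G ({snd T0, t}, U)) (\<eta>' U)"
      using presheaf_mapD(2)[OF \<eta> pointed_pair[OF U tU] U pointed_pair_sub[OF U tU]]
        presheaf_mapD(2)[OF \<eta>' pointed_pair[OF U tU] U pointed_pair_sub[OF U tU]] by simp
  qed
qed

text \<open>Viewing a sheaf on \<open>T0\<close> as a descent datum with identity gluing makes the
  uniqueness of cocones available for gluing morphisms out of it.\<close>

lemma sheaf_descent_datum:
  assumes F: "is_sheaf D T0 F"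
  shows "descent_datum P T0 r0 D T r (\<lambda>J. push_presheaf T0 (T J) (r0 J) F) (\<lambda>J K V. Ident D (omap F (pre J V)))"
proof unfold_locales
  note F' = is_sheafD(1)[OF F]
  have o: "omap F (pre J V) \<in> Obj D" for J V by (rule presheafD(1)[OF F' pre_in])
  fix J assume J: "J \<in> P"
  show "is_sheaf D (T J) (push_presheaf T0 (T J) (r0 J) F)" using is_sheaf_push[OF b_in F] .
  {
    fix V assume "V \<in> pointed_subsets (T J)"
    then show "Ident D (omap F (pre J V)) = Ident D (omap (push_presheaf T0 (T J) (r0 J) F) V)" by simp
  }
  fix K assume K: "K \<in> P" "J \<subseteq> K"
  {
    fix V assume V: "V \<in> pointed_subsets (T J)"
    show "Ident D (omap F (pre J V)) \<in> hom D (omap (push_presheaf T0 (T J) (r0 J) F) V)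
        (omap (push_presheaf T0 (T K) (r0 K) F) (pre2 J K V))"
      using V pre2_in[OF K(1)] pre_pre2[OF J K] Ident_in[OF o] by simp
    show "is_iso D (Ident D (omap F (pre J V)))" using iso_id[OF o] .
    fix L assume L: "L \<in> P" "K \<subseteq> L"
    show "Comp D (Ident D (omap F (pre K (pre2 J K V)))) (Ident D (omap F (pre J V))) = Ident D (omap F (pre J V))"
      using pre_pre2[OF J K] comp_id_left[OF Ident_in[OF o]] by simp
  }
  fix U V assume U: "U \<in> pointed_subsets (T J)" and V: "V \<in> pointed_subsets (T J)" and UV: "U \<subseteq> V"
  note h = presheafD(2)[OF F' pre_in pre_in ptd_preimage_mono[OF UV]]
  show "Comp D (Ident D (omap F (pre J U))) (amap (push_presheaf T0 (T J) (r0 J) F) (U, V))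
      = Comp D (amap (push_presheaf T0 (T K) (r0 K) F) (pre2 J K U, pre2 J K V)) (Ident D (omap F (pre J V)))"
    using U V UV pre2_in[OF K(1)] pre_pre2[OF J K] ptd_preimage_mono[OF UV] comp_id_left[OF h] comp_id_right[OF h]
    by simp
qed

text \<open>At a point the map is \<open>\<tau>\<close> at the least representative of that point,
  and it extends to every \<open>U\<close> because \<open>G\<close> is a sheaf. That it restores all
  \<open>\<tau> J V\<close> is the content of \<open>key\<close>.\<close>

lemma sheaf_map_glue:
  assumes F: "is_sheaf D T0 F" and G: "is_sheaf D T0 G"
    and \<tau>: "\<And>J V. \<lbrakk>J \<in> P; V \<in> pointed_subsets (T J)\<rbrakk> \<Longrightarrow> \<tau> J V \<in> hom D (omap F (pre J V)) (omap G (pre J V))"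
    and \<tau>_nat: "\<And>J U V. \<lbrakk>J \<in> P; U \<in> pointed_subsets (T J); V \<in> pointed_subsets (T J); U \<subseteq> V\<rbrakk>
      \<Longrightarrow> Comp D (\<tau> J U) (amap F (pre J U, pre J V)) = Comp D (amap G (pre J U, pre J V)) (\<tau> J V)"
    and \<tau>_comp: "\<And>J K V. \<lbrakk>J \<in> P; K \<in> P; J \<subseteq> K; V \<in> pointed_subsets (T J)\<rbrakk> \<Longrightarrow> \<tau> K (pre2 J K V) = \<tau> J V"
  obtains \<eta> where "nat_trans (presheaf_shape T0) D F G \<eta>"
    "\<And>J V. \<lbrakk>J \<in> P; V \<in> pointed_subsets (T J)\<rbrakk> \<Longrightarrow> \<eta> (pre J V) = \<tau> J V"
proof -
  note F' = is_sheafD(1)[OF F] and G' = is_sheafD(1)[OF G]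
  interpret F: descent_datum P T0 r0 D T r "\<lambda>J. push_presheaf T0 (T J) (r0 J) F" "\<lambda>J K V. Ident D (omap F (pre J V))"
    by (rule sheaf_descent_datum[OF F])
  have "\<exists>L. least_for t {t} L" if "t \<in> fst T0" "t \<noteq> snd T0" for t using ex_unit[OF that] .
  then obtain L where L: "\<And>t. \<lbrakk>t \<in> fst T0; t \<noteq> snd T0\<rbrakk> \<Longrightarrow> least_for t {t} (L t)" by metis
  define e where "e t = \<tau> (L t) (pt (L t) t)" for t
  have e: "e t \<in> hom D (omap F {snd T0, t}) (omap G {snd T0, t})" if t: "t \<in> fst T0" "t \<noteq> snd T0" for t
  proof -
    note L' = pre_unit[OF t L[OF t]]
    show ?thesis using \<tau>[OF L'(2) pt_in[OF L'(2) t(1)]] L'(3) by (simp add: e_def)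
  qed
  have key: "Comp D (amap G ({snd T0, t}, pre J V)) (\<tau> J V) = Comp D (e t) (amap F ({snd T0, t}, pre J V))"
    if J: "J \<in> P" and V: "V \<in> pointed_subsets (T J)" and t: "t \<in> pre J V - {snd T0}" for J V t
  proof -
    have t': "t \<in> fst T0" "t \<noteq> snd T0" "J \<in> around t" using pre_aroundI[OF J, of t V] t by auto
    note L' = pre_unit[OF t'(1,2) L[OF t'(1,2)]]
    have s_in: "{snd T0, t} \<in> pointed_subsets T0" using pointed_pair[OF pre_in, of t J V] t by simp
    have s_sub: "{snd T0, t} \<subseteq> pre K (pt K t)" if "K \<in> around t" for K
      using pre_pt[OF that] in_block[OF t'(1)] by auto
    \<comment> \<open>Two cocones over the blocks around \<open>t\<close>: one applies
      \<open>\<tau>\<close> before projecting to \<open>t\<close>, the other projects first. They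
      agree at the representative of \<open>{t}\<close>, hence everywhere.\<close>
    let ?q = "\<lambda>K. Comp D (amap G ({snd T0, t}, pre K (pt K t))) (\<tau> K (pt K t))"
    let ?q' = "\<lambda>K. Comp D (e t) (amap F ({snd T0, t}, pre K (pt K t)))"
    have mr: "F.mr t J K = amap F (pre K (pt K t), pre J (pt J t))"
      and sub: "pre K (pt K t) \<subseteq> pre J (pt J t)"
      if JK: "J \<in> around t" "K \<in> around t" "J \<subseteq> K" for J K
    proof -
      have JP: "J \<in> P" and KP: "K \<in> P" using JK aroundD by auto
      note s = pt_sub_pre2[OF JK(1) KP JK(3) t'(1)]
      show sub: "pre K (pt K t) \<subseteq> pre J (pt J t)"
        using ptd_preimage_mono[OF s] pre_pre2[OF JP KP JK(3)] by blast
      show "F.mr t J K = amap F (pre K (pt K t), pre J (pt J t))"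
        unfolding F.mr_def
        using pt_in[OF KP t'(1)] pre2_in[OF KP] s pre_pre2[OF JP KP JK(3)]
          comp_id_right[OF presheafD(2)[OF F' pre_in pre_in sub]] by simp
    qed
    have ob: "F.ob t K = omap F (pre K (pt K t))" if "K \<in> around t" for K
      unfolding F.ob_def using pt_in[of K t] aroundD[OF that] t'(1) by simp
    have "?q J = ?q' J"
    proof (rule F.natural_eq[OF t'(1,2) L[OF t'(1,2)] _ _ _ _ _ t'(3)])
      fix J assume J: "J \<in> around t"
      have JP: "J \<in> P" using J aroundD by auto
      note uJ = pt_in[OF JP t'(1)]
      note Gs = presheafD(2)[OF G' s_in pre_in s_sub[OF J]] and Fs = presheafD(2)[OF F' s_in pre_in s_sub[OF J]]
      show "?q J \<in> hom D (F.ob t J) (omap G {snd T0, t})"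
        using comp_hom[OF \<tau>[OF JP uJ] Gs] ob[OF J] by simp
      show "?q' J \<in> hom D (F.ob t J) (omap G {snd T0, t})"
        using comp_hom[OF Fs e[OF t'(1,2)]] ob[OF J] by simp
      fix K assume K: "K \<in> around t" and JK: "J \<subseteq> K"
      have KP: "K \<in> P" using K aroundD by auto
      note uK = pt_in[OF KP t'(1)] and sub' = sub[OF J K JK] and mr' = mr[OF J K JK]
      note GsK = presheafD(2)[OF G' s_in pre_in s_sub[OF K]] and FsK = presheafD(2)[OF F' s_in pre_in s_sub[OF K]]
      note Fm = presheafD(2)[OF F' pre_in pre_in sub'] and Gm = presheafD(2)[OF G' pre_in pre_in sub']
      have "Comp D (?q K) (F.mr t J K)
          = Comp D (amap G ({snd T0, t}, pre K (pt K t))) (Comp D (\<tau> K (pt K t)) (amap F (pre K (pt K t), pre J (pt J t))))"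
        unfolding mr' using comp_assoc[OF Fm \<tau>[OF KP uK] GsK] by simp
      also have "Comp D (\<tau> K (pt K t)) (amap F (pre K (pt K t), pre J (pt J t)))
          = Comp D (amap G (pre K (pt K t), pre J (pt J t))) (\<tau> J (pt J t))"
        using \<tau>_nat[OF KP uK pre2_in[OF KP] pt_sub_pre2[OF J KP JK t'(1)]] \<tau>_comp[OF JP KP JK uJ]
          pre_pre2[OF JP KP JK] by simp
      also have "Comp D (amap G ({snd T0, t}, pre K (pt K t))) (Comp D (amap G (pre K (pt K t), pre J (pt J t))) (\<tau> J (pt J t)))
          = ?q J"
        using comp_assoc[OF \<tau>[OF JP uJ] Gm GsK] presheafD(4)[OF G' s_in pre_in pre_in s_sub[OF K] sub'] by simp
      finally show "Comp D (?q K) (F.mr t J K) = ?q J" .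
      show "Comp D (?q' K) (F.mr t J K) = ?q' J"
        unfolding mr' using comp_assoc[OF Fm FsK e[OF t'(1,2)]]
          presheafD(4)[OF F' s_in pre_in pre_in s_sub[OF K] sub'] by simp
    next
      show "?q (L t) = ?q' (L t)"
        using L'(3) e_def[of t] presheafD(3)[OF F' s_in] presheafD(3)[OF G' s_in]
          comp_id_left[OF e[OF t'(1,2)]] comp_id_right[OF e[OF t'(1,2)]] by simp
    qed
    have u: "pt J t \<subseteq> V" using pt_sub[OF V] t by blast
    note uJ = pt_in[OF J t'(1)] and sub = ptd_preimage_mono[OF u, of T0 "T J" "r0 J"]
    note Gs = presheafD(2)[OF G' s_in pre_in s_sub[OF t'(3)]] and Fs = presheafD(2)[OF F' s_in pre_in s_sub[OF t'(3)]]
    note Fm = presheafD(2)[OF F' pre_in pre_in sub] and Gm = presheafD(2)[OF G' pre_in pre_in sub]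
    have "Comp D (amap G ({snd T0, t}, pre J V)) (\<tau> J V)
        = Comp D (amap G ({snd T0, t}, pre J (pt J t))) (Comp D (amap G (pre J (pt J t), pre J V)) (\<tau> J V))"
      using comp_assoc[OF \<tau>[OF J V] Gm Gs] presheafD(4)[OF G' s_in pre_in pre_in s_sub[OF t'(3)] sub] by simp
    also have "\<dots> = Comp D (?q J) (amap F (pre J (pt J t), pre J V))"
      using \<tau>_nat[OF J uJ V u] comp_assoc[OF Fm \<tau>[OF J uJ] Gs] by simp
    also have "\<dots> = Comp D (e t) (amap F ({snd T0, t}, pre J V))"
      using \<open>?q J = ?q' J\<close> comp_assoc[OF Fm Fs e[OF t'(1,2)]] presheafD(4)[OF F' s_in pre_in pre_in s_sub[OF t'(3)] sub]
      by simp
    finally show ?thesis .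
  qed
  have ex: "\<exists>h. h \<in> hom D (omap F U) (omap G U) \<and>
      (\<forall>t \<in> U - {snd T0}. Comp D (amap G ({snd T0, t}, U)) h = Comp D (e t) (amap F ({snd T0, t}, U)))"
    if U: "U \<in> pointed_subsets T0" for U
  proof (rule is_productD(3)[OF is_sheafD(2)[OF G U] presheafD(1)[OF F' U]])
    fix t assume t: "t \<in> U - {snd T0}"
    then have tU: "t \<in> U" and t': "t \<in> fst T0" "t \<noteq> snd T0" using U by (auto simp: pointed_subsets_def)
    show "Comp D (e t) (amap F ({snd T0, t}, U)) \<in> hom D (omap F U) (omap G {snd T0, t})"
      using comp_hom[OF presheafD(2)[OF F' pointed_pair[OF U tU] U pointed_pair_sub[OF U tU]] e[OF t']] .
  qed
  then obtain h where h: "\<And>U. U \<in> pointed_subsets T0 \<Longrightarrow> h U \<in> hom D (omap F U) (omap G U)"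
    and h_e: "\<And>U t. \<lbrakk>U \<in> pointed_subsets T0; t \<in> U - {snd T0}\<rbrakk>
      \<Longrightarrow> Comp D (amap G ({snd T0, t}, U)) (h U) = Comp D (e t) (amap F ({snd T0, t}, U))"
    by metis
  define \<eta> where "\<eta> = restrict h (pointed_subsets T0)"
  show thesis
  proof (rule that)
    show "nat_trans (presheaf_shape T0) D F G \<eta>"
    proof (rule presheaf_mapI[OF F' G'])
      fix U V assume U: "U \<in> pointed_subsets T0" and V: "V \<in> pointed_subsets T0" and UV: "U \<subseteq> V"
      note Fm = presheafD(2)[OF F' U V UV] and Gm = presheafD(2)[OF G' U V UV]
      have "Comp D (h U) (amap F (U, V)) = Comp D (amap G (U, V)) (h V)"
      proof (rule product_eqI[OF is_sheafD(2)[OF G U] comp_hom[OF Fm h[OF U]] comp_hom[OF h[OF V] Gm]])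
        fix t assume t: "t \<in> U - {snd T0}"
        then have tU: "t \<in> U" and tV: "t \<in> V - {snd T0}" and t': "t \<in> fst T0" "t \<noteq> snd T0"
          using U UV by (auto simp: pointed_subsets_def)
        note s_in = pointed_pair[OF U tU] and s_sub = pointed_pair_sub[OF U tU]
        note Gs = presheafD(2)[OF G' s_in U s_sub] and Fs = presheafD(2)[OF F' s_in U s_sub]
        show "Comp D (amap G ({snd T0, t}, U)) (Comp D (h U) (amap F (U, V)))
            = Comp D (amap G ({snd T0, t}, U)) (Comp D (amap G (U, V)) (h V))"
          using comp_assoc[OF Fm h[OF U] Gs] comp_assoc[OF h[OF V] Gm Gs] h_e[OF U t] h_e[OF V tV]
            comp_assoc[OF Fm Fs e[OF t']] presheafD(4)[OF F' s_in U V s_sub UV]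
            presheafD(4)[OF G' s_in U V s_sub UV] by simp
      qed
      then show "Comp D (\<eta> U) (amap F (U, V)) = Comp D (amap G (U, V)) (\<eta> V)" using U V by (simp add: \<eta>_def)
    qed (use h in \<open>auto simp: \<eta>_def\<close>)
    show "\<eta> (pre J V) = \<tau> J V" if J: "J \<in> P" and V: "V \<in> pointed_subsets (T J)" for J V
    proof -
      have "h (pre J V) = \<tau> J V"
        by (rule product_eqI[OF is_sheafD(2)[OF G pre_in] h[OF pre_in] \<tau>[OF J V]])
          (simp add: h_e[OF pre_in] key[OF J V])
      then show ?thesis by (simp add: \<eta>_def b_in)
    qed
  qed
qed

text \<open>Faithfulness is \<open>sheaf_map_eqI\<close>, fullness is \<open>sheaf_map_glue\<close>
  and essential surjectivity is \<open>glue\<close>; the rest translates between the triples in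
  \<open>Cat\<close> and \<open>Sh\<close> and their components.\<close>

lemma descent:
  fixes G :: "('j set, 'j set \<times> 'j set, (('t, 'o, 'a) presheaf, ('t, 'o, 'a) presheaf_map) cat, _) fctr"
  defines "I \<equiv> op_cat (subset_cat P)"
  assumes G: "is_functor I Cat G"
    and Go: "\<And>J. J \<in> P \<Longrightarrow> omap G J = Sh D (T J)"
    and Ga: "\<And>J K. \<lbrakk>J \<in> P; K \<in> P; J \<subseteq> K\<rbrakk> \<Longrightarrow> fctr_of (amap G (J, K)) = sheaf_push D (T K) (T J) (r J K)"
    and Q: "\<And>J. J \<in> P \<Longrightarrow> Q J = sheaf_push D T0 (T J) (r0 J)"
  shows "is_equivalence (Sh D T0) (pseudo_limit I G) (pslim_comparison I G (Sh D T0) Q)"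
proof -
  have I: "category I" unfolding I_def by (rule category_op[OF category_subset_cat])
  have hom_I: "u \<in> hom I K J \<longleftrightarrow> u = (J, K) \<and> J \<in> P \<and> K \<in> P \<and> J \<subseteq> K" for u J K by (simp add: I_def)
  have Obj_I: "Obj I = P" by (simp add: I_def)
  have Comp_I: "Comp I v u = (fst v, snd u)" for u v by (simp add: I_def)
  note Sh0 = category_Sh[OF category_axioms, of T0]
  have Qf: "is_functor (Sh D T0) (omap G J) (Q J)" if "J \<in> Obj I" for J
    using that is_functor_sheaf_push[OF category_axioms b_in] by (simp add: Obj_I Go Q)
  have cone: "comp_fctr (Sh D T0) (fctr_of (amap G u)) (Q K) = Q J" if "u \<in> hom I K J" for u K J
    using that r0_fun r_base T_ptd r_r0 sheaf_push_compose[OF b_in, of "T K" "r0 K" "r J K" "T J" D]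
    by (auto simp: hom_I Q Ga)
  note cmp = is_functor_pslim_comparison[OF I G Sh0 Qf cone]
  let ?C = "pslim_comparison I G (Sh D T0) Q"
  let ?co = "cone_object I G Q"
  have cmp_o: "omap ?C F = ?co F" if "is_sheaf D T0 F" for F
    by (rule pslim_comparison_simps(1)[OF I G Sh0 Qf cone]) (use that in auto)
  have cmp_a: "amap ?C (F, H, \<eta>) = (?co F, ?co H, \<lambda>J \<in> P. (push_presheaf T0 (T J) (r0 J) F,
      push_presheaf T0 (T J) (r0 J) H, \<lambda>V \<in> pointed_subsets (T J). \<eta> (pre J V)))"
    if "(F, H, \<eta>) \<in> hom (Sh D T0) F H" for F H \<eta>
  proof -
    have "(F, H, \<eta>) \<in> Arr (Sh D T0)" using that by (simp add: hom_def)
    moreover have "amap ?C (F, H, \<eta>) = (?co F, ?co H, \<lambda>J \<in> Obj I. amap (Q J) (F, H, \<eta>))"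
      by (rule pslim_comparison_simps(2)[OF I G Sh0 Qf cone]) (use that in auto)
    ultimately show ?thesis
      by (auto simp: Obj_I Q sheaf_push_simps(2) intro!: restrict_ext)
  qed
  have co: "?co F = (\<lambda>J \<in> P. push_presheaf T0 (T J) (r0 J) F,
      \<lambda>(J, K) \<in> Arr (subset_cat P). Ident (Sh D (T J)) (push_presheaf T0 (T J) (r0 J) F))"
    if "is_sheaf D T0 F" for F
    using that unfolding cone_object_def
    by (auto simp: I_def Q Go sheaf_push_simps(1) intro!: restrict_ext)
  show ?thesis
  proof (rule is_equivalenceI[OF cmp])
    fix F H f g assume f: "f \<in> hom (Sh D T0) F H" and g: "g \<in> hom (Sh D T0) F H" and eq: "amap ?C f = amap ?C g"
    obtain \<eta> \<eta>' where f': "f = (F, H, \<eta>)" and g': "g = (F, H, \<eta>')" and H: "is_sheaf D T0 H"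
      and nt: "nat_trans (presheaf_shape T0) D F H \<eta>" "nat_trans (presheaf_shape T0) D F H \<eta>'"
      using f g by (auto simp: Sh_hom)
    have "\<eta> (pre J V) = \<eta>' (pre J V)" if J: "J \<in> P" and V: "V \<in> pointed_subsets (T J)" for J V
    proof -
      have "(\<lambda>V \<in> pointed_subsets (T J). \<eta> (pre J V)) = (\<lambda>V \<in> pointed_subsets (T J). \<eta>' (pre J V))"
        using fun_cong[OF arg_cong[OF eq, of "\<lambda>x. snd (snd x)"], of J] J cmp_a[of F H \<eta>] cmp_a[of F H \<eta>'] f g
        by (simp add: f' g')
      from fun_cong[OF this, of V] V show ?thesis by simp
    qed
    then have "\<eta> = \<eta>'" by (rule sheaf_map_eqI[OF H nt])
    then show "f = g" by (simp add: f' g')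
  next
    fix F H h assume F: "F \<in> Obj (Sh D T0)" and H: "H \<in> Obj (Sh D T0)"
      and h: "h \<in> hom (pseudo_limit I G) (omap ?C F) (omap ?C H)"
    have F: "is_sheaf D T0 F" and H: "is_sheaf D T0 H" using F H by auto
    obtain k where h': "h = (?co F, ?co H, k)" and k: "pslim_arrow I G (?co F) (?co H) k"
      using h cmp_o[OF F] cmp_o[OF H] by (auto simp: pseudo_limit_hom)
    note kD = pslim_arrowD[OF k[unfolded co[OF F] co[OF H]]]
    let ?F = "\<lambda>J. push_presheaf T0 (T J) (r0 J) F" and ?H = "\<lambda>J. push_presheaf T0 (T J) (r0 J) H"
    have k_hom: "k J \<in> hom (Sh D (T J)) (?F J) (?H J)" if "J \<in> P" for J
      using kD(2)[of J] that by (simp add: Obj_I Go)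
    define \<tau> where "\<tau> J = snd (snd (k J))" for J
    have k': "k J = (?F J, ?H J, \<tau> J)" and nt: "nat_trans (presheaf_shape (T J)) D (?F J) (?H J) (\<tau> J)"
      if "J \<in> P" for J
      using k_hom[OF that] by (auto simp: \<tau>_def Sh_hom)
    have \<tau>: "\<tau> J V \<in> hom D (omap F (pre J V)) (omap H (pre J V))" if "J \<in> P" "V \<in> pointed_subsets (T J)" for J V
      using presheaf_mapD(1)[OF nt[OF that(1)] that(2)] that(2) by simp
    have \<tau>_nat: "Comp D (\<tau> J U) (amap F (pre J U, pre J V)) = Comp D (amap H (pre J U, pre J V)) (\<tau> J V)"
      if "J \<in> P" "U \<in> pointed_subsets (T J)" "V \<in> pointed_subsets (T J)" "U \<subseteq> V" for J U V
      using presheaf_mapD(2)[OF nt[OF that(1)] that(2-4)] that by simp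
    \<comment> \<open>Objects in the image of the comparison have identity structure maps, so the
      compatibility square of \<open>k\<close> says that \<open>k J\<close> is the pushforward of
      \<open>k K\<close>.\<close>
    have \<tau>_comp: "\<tau> K (pre2 J K V) = \<tau> J V"
      if J: "J \<in> P" and K: "K \<in> P" and JK: "J \<subseteq> K" and V: "V \<in> pointed_subsets (T J)" for J K V
    proof -
      interpret SJ: category "Sh D (T J)" by (rule category_Sh[OF category_axioms])
      have u: "(J, K) \<in> hom I K J" using J K JK by (simp add: hom_I)
      have kK: "k K \<in> Arr (Sh D (T K))" using k_hom[OF K] by (simp add: hom_def)
      have pk: "amap (sheaf_push D (T K) (T J) (r J K)) (k K) = (?F J, ?H J, \<lambda>V \<in> pointed_subsets (T J). \<tau> K (pre2 J K V))"
        using kK k'[OF K] by (simp add: sheaf_push_simps(2) push_push[OF J K JK])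
      then have pk_hom: "amap (sheaf_push D (T K) (T J) (r J K)) (k K) \<in> hom (Sh D (T J)) (?F J) (?H J)"
        using is_functorD(6)[OF is_functor_sheaf_push[OF category_axioms T_ptd[OF K]] k_hom[OF K], of "T J" "r J K"]
        by (auto simp: hom_def)
      have "Comp (Sh D (T J)) (k J) (Ident (Sh D (T J)) (?F J))
          = Comp (Sh D (T J)) (Ident (Sh D (T J)) (?H J)) (amap (sheaf_push D (T K) (T J) (r J K)) (k K))"
        using kD(3)[OF u] J K JK by (simp del: Sh_simps add: Go Ga)
      then have "k J = amap (sheaf_push D (T K) (T J) (r J K)) (k K)"
        using SJ.comp_id_right[OF k_hom[OF J]] SJ.comp_id_left[OF pk_hom] by simp
      then have "\<tau> J = (\<lambda>V \<in> pointed_subsets (T J). \<tau> K (pre2 J K V))" using pk k'[OF J] by simp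
      then show ?thesis using V by simp
    qed
    obtain \<eta> where \<eta>: "nat_trans (presheaf_shape T0) D F H \<eta>"
      "\<And>J V. \<lbrakk>J \<in> P; V \<in> pointed_subsets (T J)\<rbrakk> \<Longrightarrow> \<eta> (pre J V) = \<tau> J V"
      by (rule sheaf_map_glue[OF F H, of \<tau>]) (use \<tau> \<tau>_nat \<tau>_comp in auto)
    have f: "(F, H, \<eta>) \<in> hom (Sh D T0) F H" using F H \<eta>(1) by (simp add: Sh_hom)
    have "(\<lambda>J \<in> P. (?F J, ?H J, \<lambda>V \<in> pointed_subsets (T J). \<eta> (pre J V))) = k"
    proof (rule extensionalityI[of _ P])
      show "k \<in> extensional P" using kD(1) by (simp add: Obj_I)
      fix J assume J: "J \<in> P"
      have "(\<lambda>V \<in> pointed_subsets (T J). \<eta> (pre J V)) = \<tau> J"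
        by (rule extensionalityI[of _ "pointed_subsets (T J)"])
          (use \<eta>(2)[OF J] nat_transD(3)[OF nt[OF J]] in auto)
      then show "(\<lambda>J \<in> P. (?F J, ?H J, \<lambda>V \<in> pointed_subsets (T J). \<eta> (pre J V))) J = k J"
        using J k'[OF J] by simp
    qed simp
    then have "amap ?C (F, H, \<eta>) = h" using cmp_a[OF f] h' by simp
    then show "\<exists>f \<in> hom (Sh D T0) F H. amap ?C f = h" using f by blast
  next
    fix X assume "X \<in> Obj (pseudo_limit I G)"
    then obtain x \<phi> where X: "X = (x, \<phi>)" and obj: "pslim_object I G (x, \<phi>)" by (cases X) auto
    note oD = pslim_objectD[OF obj]
    have x: "is_sheaf D (T J) (x J)" if "J \<in> P" for J
      using oD(3)[of J] that by (simp add: Obj_I Go)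
    \<comment> \<open>The structure maps of a pseudo-limit object go from the pushforward of
      \<open>x K\<close> to \<open>x J\<close>, opposite to the \<open>\<psi>\<close> of a descent
      datum, and have to be inverted.\<close>
    define \<beta> where "\<beta> J K = snd (snd (\<phi> (J, K)))" for J K
    have \<phi>: "\<phi> (J, K) = (push_presheaf (T K) (T J) (r J K) (x K), x J, \<beta> J K)"
        "nat_trans (presheaf_shape (T J)) D (push_presheaf (T K) (T J) (r J K) (x K)) (x J) (\<beta> J K)"
        "\<forall>V \<in> pointed_subsets (T J). is_iso D (\<beta> J K V)"
      if J: "J \<in> P" and K: "K \<in> P" and JK: "J \<subseteq> K" for J K
    proof -
      have u: "(J, K) \<in> hom I K J" using that by (simp add: hom_I)
      have "\<phi> (J, K) \<in> hom (Sh D (T J)) (push_presheaf (T K) (T J) (r J K) (x K)) (x J)"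
        using oD(4)[OF u] by (simp add: Go[OF J] Ga[OF J K JK] sheaf_push_simps(1)[OF x[OF K]])
      then show 1: "\<phi> (J, K) = (push_presheaf (T K) (T J) (r J K) (x K), x J, \<beta> J K)"
        and 2: "nat_trans (presheaf_shape (T J)) D (push_presheaf (T K) (T J) (r J K) (x K)) (x J) (\<beta> J K)"
        by (auto simp: Sh_hom \<beta>_def)
      show "\<forall>V \<in> pointed_subsets (T J). is_iso D (\<beta> J K V)"
        using oD(5)[OF u] is_iso_Sh[OF is_sheaf_push[OF T_ptd[OF K] x[OF K]] x[OF J] 2] by (simp add: Go[OF J] 1)
    qed
    have \<beta>_hom: "\<beta> J K V \<in> hom D (omap (x K) (pre2 J K V)) (omap (x J) V)"
      if "J \<in> P" "K \<in> P" "J \<subseteq> K" "V \<in> pointed_subsets (T J)" for J K V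
      using presheaf_mapD(1)[OF \<phi>(2)[OF that(1-3)] that(4)] that(4) by simp
    have \<beta>_nat: "Comp D (\<beta> J K U) (amap (x K) (pre2 J K U, pre2 J K V)) = Comp D (amap (x J) (U, V)) (\<beta> J K V)"
      if "J \<in> P" "K \<in> P" "J \<subseteq> K" "U \<in> pointed_subsets (T J)" "V \<in> pointed_subsets (T J)" "U \<subseteq> V" for J K U V
      using presheaf_mapD(2)[OF \<phi>(2)[OF that(1-3)] that(4-6)] that(4-6) by simp
    have \<beta>_id: "\<beta> J J V = Ident D (omap (x J) V)" if "J \<in> P" "V \<in> pointed_subsets (T J)" for J V
      using oD(6)[of J] \<phi>(1)[OF that(1,1) subset_refl] that by (simp add: I_def Go)
    have \<beta>_comp: "\<beta> J L V = Comp D (\<beta> J K V) (\<beta> K L (pre2 J K V))"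
      if J: "J \<in> P" and K: "K \<in> P" and L: "L \<in> P" and JK: "J \<subseteq> K" and KL: "K \<subseteq> L"
        and V: "V \<in> pointed_subsets (T J)" for J K L V
    proof -
      have u: "(K, L) \<in> hom I L K" and v: "(J, K) \<in> hom I K J" using that by (simp_all add: hom_I)
      have JL: "J \<subseteq> L" using JK KL by blast
      have "\<phi> (K, L) \<in> Arr (Sh D (T K))"
        using oD(4)[OF u] by (simp add: Go[OF K] hom_def)
      then show ?thesis
        using oD(7)[OF u v] V
        by (simp add: Comp_I Go[OF J] Ga[OF J K JK] \<phi>(1)[OF J L JL] \<phi>(1)[OF J K JK] \<phi>(1)[OF K L KL] sheaf_push_simps(2))
    qed
    have "\<exists>g. g \<in> hom D (omap (x J) V) (omap (x K) (pre2 J K V)) \<and> Comp D g (\<beta> J K V) = Ident D (omap (x K) (pre2 J K V))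
        \<and> Comp D (\<beta> J K V) g = Ident D (omap (x J) V) \<and> is_iso D g"
      if "J \<in> P" "K \<in> P" "J \<subseteq> K" "V \<in> pointed_subsets (T J)" for J K V
      by (rule isoE[OF _ \<beta>_hom[OF that]]) (use \<phi>(3)[OF that(1-3)] that(4) in auto)
    then obtain \<psi> where \<psi>: "\<And>J K V. \<lbrakk>J \<in> P; K \<in> P; J \<subseteq> K; V \<in> pointed_subsets (T J)\<rbrakk> \<Longrightarrow>
        \<psi> J K V \<in> hom D (omap (x J) V) (omap (x K) (pre2 J K V)) \<and> Comp D (\<psi> J K V) (\<beta> J K V) = Ident D (omap (x K) (pre2 J K V))
        \<and> Comp D (\<beta> J K V) (\<psi> J K V) = Ident D (omap (x J) V) \<and> is_iso D (\<psi> J K V)"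
      by metis
    have \<psi>_hom: "\<psi> J K V \<in> hom D (omap (x J) V) (omap (x K) (pre2 J K V))"
      and \<psi>\<beta>: "Comp D (\<psi> J K V) (\<beta> J K V) = Ident D (omap (x K) (pre2 J K V))"
      and \<beta>\<psi>: "Comp D (\<beta> J K V) (\<psi> J K V) = Ident D (omap (x J) V)"
      if "J \<in> P" "K \<in> P" "J \<subseteq> K" "V \<in> pointed_subsets (T J)" for J K V
      using \<psi>[OF that] by auto
    interpret X: descent_datum P T0 r0 D T r x \<psi>
    proof unfold_locales
      fix J assume J: "J \<in> P"
      show "is_sheaf D (T J) (x J)" using x[OF J] .
      note xJ = is_sheafD(1)[OF x[OF J]]
      {
        fix V assume V: "V \<in> pointed_subsets (T J)"
        show "\<psi> J J V = Ident D (omap (x J) V)"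
          using \<beta>\<psi>[OF J J subset_refl V] \<beta>_id[OF J V] \<psi>_hom[OF J J subset_refl V] pre2_self[OF J V]
            comp_id_left[OF \<psi>_hom[OF J J subset_refl V]] by simp
      }
      fix K assume K: "K \<in> P" and JK: "J \<subseteq> K"
      note xK = is_sheafD(1)[OF x[OF K]]
      {
        fix V assume V: "V \<in> pointed_subsets (T J)"
        show "\<psi> J K V \<in> hom D (omap (x J) V) (omap (x K) (pre2 J K V))" "is_iso D (\<psi> J K V)"
          using \<psi>[OF J K JK V] by auto
        fix L assume L: "L \<in> P" and KL: "K \<subseteq> L"
        have JL: "J \<subseteq> L" using JK KL by blast
        note W = pre2_in[OF K, of J V] and pp = pre2_pre2[OF J K L JK KL, of V]
        have \<psi>': "\<psi> K L (pre2 J K V) \<in> hom D (omap (x K) (pre2 J K V)) (omap (x L) (pre2 J L V))"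
          and \<beta>': "\<beta> K L (pre2 J K V) \<in> hom D (omap (x L) (pre2 J L V)) (omap (x K) (pre2 J K V))"
          using \<psi>_hom[OF K L KL W] \<beta>_hom[OF K L KL W] pp by simp_all
        note \<psi>JK = \<psi>_hom[OF J K JK V] and \<beta>JK = \<beta>_hom[OF J K JK V] and \<beta>JL = \<beta>_hom[OF J L JL V]
          and \<psi>JL = \<psi>_hom[OF J L JL V]
        \<comment> \<open>The cocycle rule for the inverses, obtained by cancelling the invertible
          \<open>\<beta> J L V\<close>.\<close>
        have "Comp D (\<beta> J L V) (Comp D (\<psi> K L (pre2 J K V)) (\<psi> J K V))
            = Comp D (\<beta> J K V) (Comp D (Comp D (\<beta> K L (pre2 J K V)) (\<psi> K L (pre2 J K V))) (\<psi> J K V))"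
          using \<beta>_comp[OF J K L JK KL V] comp_assoc[OF comp_hom[OF \<psi>JK \<psi>'] \<beta>' \<beta>JK] comp_assoc[OF \<psi>JK \<psi>' \<beta>'] by simp
        also have "\<dots> = Comp D (\<beta> J L V) (\<psi> J L V)"
          using \<beta>\<psi>[OF K L KL W] comp_id_left[OF \<psi>JK] \<beta>\<psi>[OF J K JK V] \<beta>\<psi>[OF J L JL V] by simp
        finally show "Comp D (\<psi> K L (pre2 J K V)) (\<psi> J K V) = \<psi> J L V"
          using iso_cancel_left[OF _ \<beta>JL comp_hom[OF \<psi>JK \<psi>'] \<psi>JL] \<phi>(3)[OF J L JL] V by blast
      }
      fix U V assume U: "U \<in> pointed_subsets (T J)" and V: "V \<in> pointed_subsets (T J)" and UV: "U \<subseteq> V"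
      note sub = ptd_preimage_mono[OF UV, of "T K" "T J" "r J K"]
      note a = presheafD(2)[OF xJ U V UV] and b = presheafD(2)[OF xK pre2_in[OF K] pre2_in[OF K] sub]
      note \<psi>U = \<psi>_hom[OF J K JK U] and \<psi>V = \<psi>_hom[OF J K JK V] and \<beta>U = \<beta>_hom[OF J K JK U] and \<beta>V = \<beta>_hom[OF J K JK V]
      have "Comp D (\<beta> J K U) (Comp D (\<psi> J K U) (amap (x J) (U, V))) = amap (x J) (U, V)"
        using comp_assoc[OF a \<psi>U \<beta>U] \<beta>\<psi>[OF J K JK U] comp_id_left[OF a] by simp
      also have "\<dots> = Comp D (Comp D (amap (x J) (U, V)) (\<beta> J K V)) (\<psi> J K V)"
        using comp_assoc[OF \<psi>V \<beta>V a] \<beta>\<psi>[OF J K JK V] comp_id_right[OF a] by simp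
      also have "\<dots> = Comp D (\<beta> J K U) (Comp D (amap (x K) (pre2 J K U, pre2 J K V)) (\<psi> J K V))"
        using \<beta>_nat[OF J K JK U V UV] comp_assoc[OF \<psi>V b \<beta>U] by simp
      finally show "Comp D (\<psi> J K U) (amap (x J) (U, V)) = Comp D (amap (x K) (pre2 J K U, pre2 J K V)) (\<psi> J K V)"
        using iso_cancel_left[OF _ \<beta>U comp_hom[OF a \<psi>U] comp_hom[OF \<psi>V b]] \<phi>(3)[OF J K JK] U by blast
    qed
    obtain F \<theta> where F: "is_sheaf D T0 F"
      and \<theta>: "\<And>J V. \<lbrakk>J \<in> P; V \<in> pointed_subsets (T J)\<rbrakk> \<Longrightarrow> \<theta> J V \<in> hom D (omap F (pre J V)) (omap (x J) V)"
      and \<theta>_iso: "\<And>J V. \<lbrakk>J \<in> P; V \<in> pointed_subsets (T J)\<rbrakk> \<Longrightarrow> is_iso D (\<theta> J V)"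
      and \<theta>_nat: "\<And>J U V. \<lbrakk>J \<in> P; U \<in> pointed_subsets (T J); V \<in> pointed_subsets (T J); U \<subseteq> V\<rbrakk> \<Longrightarrow>
        Comp D (\<theta> J U) (amap F (pre J U, pre J V)) = Comp D (amap (x J) (U, V)) (\<theta> J V)"
      and \<theta>_comp: "\<And>J K V. \<lbrakk>J \<in> P; K \<in> P; J \<subseteq> K; V \<in> pointed_subsets (T J)\<rbrakk> \<Longrightarrow>
        Comp D (\<psi> J K V) (\<theta> J V) = \<theta> K (pre2 J K V)"
      by (rule X.glue) blast
    let ?F = "\<lambda>J. push_presheaf T0 (T J) (r0 J) F"
    define k where "k = (\<lambda>J \<in> P. (?F J, x J, \<lambda>V \<in> pointed_subsets (T J). \<theta> J V))"
    have nt: "nat_trans (presheaf_shape (T J)) D (?F J) (x J) (\<lambda>V \<in> pointed_subsets (T J). \<theta> J V)" if J: "J \<in> P" for J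
      by (rule presheaf_mapI[OF is_functor_push[OF b_in is_sheafD(1)[OF F]] is_sheafD(1)[OF x[OF J]]])
        (use \<theta>[OF J] \<theta>_nat[OF J] in auto)
    have k_hom: "k J \<in> hom (Sh D (T J)) (?F J) (x J)" if "J \<in> P" for J
      using that nt[OF that] is_sheaf_push[OF b_in F] x[OF that] by (simp add: k_def Sh_hom)
    have arrow: "pslim_arrow I G (?co F) (x, \<phi>) k"
      unfolding co[OF F]
    proof (rule pslim_arrowI)
      show "k \<in> extensional (Obj I)" by (simp add: k_def Obj_I)
      show "k J \<in> hom (omap G J) ((\<lambda>J \<in> P. ?F J) J) (x J)" if "J \<in> Obj I" for J
        using k_hom that by (simp add: Obj_I Go)
      fix u K J assume u: "u \<in> hom I K J"
      then have u': "u = (J, K)" and J: "J \<in> P" and K: "K \<in> P" and JK: "J \<subseteq> K" by (auto simp: hom_I)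
      interpret SJ: category "Sh D (T J)" by (rule category_Sh[OF category_axioms])
      have kK: "k K \<in> Arr (Sh D (T K))" using k_hom[OF K] by (simp add: hom_def)
      have pk: "amap (sheaf_push D (T K) (T J) (r J K)) (k K) = (?F J, push_presheaf (T K) (T J) (r J K) (x K),
          \<lambda>V \<in> pointed_subsets (T J). \<theta> K (pre2 J K V))"
        using kK K T_ptd[OF K] by (auto simp: k_def sheaf_push_simps(2) push_push[OF J K JK] intro!: restrict_ext)
      \<comment> \<open>As the cone object has identity structure maps, its compatibility square
        reduces to this equation at each \<open>V\<close>.\<close>
      have "Comp D (\<beta> J K V) (\<theta> K (pre2 J K V)) = \<theta> J V" if V: "V \<in> pointed_subsets (T J)" for V
        using \<theta>_comp[OF J K JK V] comp_assoc[OF \<theta>[OF J V] \<psi>_hom[OF J K JK V] \<beta>_hom[OF J K JK V]]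
          \<beta>\<psi>[OF J K JK V] comp_id_left[OF \<theta>[OF J V]] by simp
      then have "Comp (Sh D (T J)) (\<phi> (J, K)) (amap (sheaf_push D (T K) (T J) (r J K)) (k K)) = k J"
        unfolding pk using J by (auto simp: \<phi>(1)[OF J K JK] k_def intro!: restrict_ext)
      then show "Comp (omap G J) (k J) ((\<lambda>(J, K) \<in> Arr (subset_cat P). Ident (Sh D (T J)) (?F J)) u)
          = Comp (omap G J) (\<phi> u) (amap (fctr_of (amap G u)) (k K))"
        using SJ.comp_id_right[OF k_hom[OF J]] J K JK by (simp del: Sh_simps add: u' Go Ga)
    qed
    have co_obj: "pslim_object I G (?co F)"
      using is_functorD(5)[OF cmp, of F] F cmp_o[OF F] by simp
    have "is_iso (pseudo_limit I G) (?co F, (x, \<phi>), k)"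
    proof -
      have "is_iso (omap G J) (k J)" if "J \<in> Obj I" for J
        using that is_iso_Sh[OF is_sheaf_push[OF b_in F] x nt] \<theta>_iso by (simp add: Obj_I Go k_def)
      then show ?thesis
        using is_iso_pseudo_limit[OF I G, of "fst (?co F)" "snd (?co F)" x \<phi> k] co_obj obj arrow by simp
    qed
    moreover have "(?co F, (x, \<phi>), k) \<in> hom (pseudo_limit I G) (omap ?C F) X"
      using co_obj obj arrow by (simp add: pseudo_limit_hom cmp_o[OF F] X)
    ultimately show "\<exists>c \<in> Obj (Sh D T0). \<exists>e \<in> hom (pseudo_limit I G) (omap ?C c) X. is_iso (pseudo_limit I G) e"
      using F by (intro bexI[of _ F] bexI[of _ "(?co F, (x, \<phi>), k)"]) auto
  qed
qed

end

section \<open>Covering sets of naturals by pairs of consecutive elements\<close>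

text \<open>\<open>C\<close> lists the lower elements of the pairs
  \<open>{c, Suc c}\<close>.\<close>

definition pair_cost :: "nat set \<Rightarrow> nat" where
  "pair_cost J = (LEAST j. \<exists>C. finite C \<and> card C = j \<and> J \<subseteq> C \<union> Suc ` C)"

lemma pair_cost_le: "\<lbrakk>finite C; J \<subseteq> C \<union> Suc ` C\<rbrakk> \<Longrightarrow> pair_cost J \<le> card C"
  unfolding pair_cost_def by (rule Least_le) blast

lemma pair_cost_cover:
  assumes "finite J"
  obtains C where "finite C" "card C = pair_cost J" "J \<subseteq> C \<union> Suc ` C"
proof -
  have "\<exists>C. finite C \<and> card C = pair_cost J \<and> J \<subseteq> C \<union> Suc ` C"
    unfolding pair_cost_def by (rule LeastI[of _ "card J"]) (use assms in blast)
  then show thesis using that by blast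
qed

lemma pair_cost_mono:
  assumes "finite B" "A \<subseteq> B"
  shows "pair_cost A \<le> pair_cost B"
proof -
  obtain C where C: "finite C" "card C = pair_cost B" "B \<subseteq> C \<union> Suc ` C"
    using pair_cost_cover[OF assms(1)] .
  then show ?thesis using pair_cost_le[of C A] assms(2) by (metis subset_trans)
qed

lemma pair_cost_Un:
  assumes "finite A" "finite B"
  shows "pair_cost (A \<union> B) \<le> pair_cost A + pair_cost B"
proof -
  obtain C where C: "finite C" "card C = pair_cost A" "A \<subseteq> C \<union> Suc ` C"
    using pair_cost_cover[OF assms(1)] .
  obtain E where E: "finite E" "card E = pair_cost B" "B \<subseteq> E \<union> Suc ` E"
    using pair_cost_cover[OF assms(2)] .
  have "pair_cost (A \<union> B) \<le> card (C \<union> E)"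
    using C E by (intro pair_cost_le) auto
  then show ?thesis using card_Un_le[of C E] C(2) E(2) by linarith
qed

lemma pair_cost_pair: "A \<subseteq> {x, Suc x} \<Longrightarrow> pair_cost A \<le> 1"
  using pair_cost_le[of "{x}" A] by (auto simp: insert_commute)

text \<open>No consecutive pair meets both sets, so a cover of the union falls apart into disjoint
  covers.\<close>

lemma pair_cost_separated:
  assumes "finite A" "finite B" and sep: "\<And>x y. \<lbrakk>x \<in> A; y \<in> B\<rbrakk> \<Longrightarrow> Suc x < y"
  shows "pair_cost A + pair_cost B \<le> pair_cost (A \<union> B)"
proof -
  have fin: "finite (A \<union> B)" using assms by simp
  obtain C where C: "finite C" "card C = pair_cost (A \<union> B)" "A \<union> B \<subseteq> C \<union> Suc ` C"
    by (rule pair_cost_cover[OF fin])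
  define CA where "CA = {c \<in> C. c \<in> A \<or> Suc c \<in> A}"
  define CB where "CB = {c \<in> C. c \<in> B \<or> Suc c \<in> B}"
  have "pair_cost A \<le> card CA" "pair_cost B \<le> card CB"
    using C by (auto intro!: pair_cost_le simp: CA_def CB_def)
  moreover have "CA \<inter> CB = {}"
    using sep by (fastforce simp: CA_def CB_def)
  then have "card CA + card CB = card (CA \<union> CB)"
    using C(1) by (intro card_Un_disjoint[symmetric]) (auto simp: CA_def CB_def)
  moreover have "card (CA \<union> CB) \<le> card C" using C(1) by (intro card_mono) (auto simp: CA_def CB_def)
  ultimately show ?thesis using C(2) by linarith
qed

text \<open>
  The boxes \<open>(a i, b i]\<close>, \<open>1 \<le> i \<le> k\<close>, are disjoint and ordered; \<open>ends\<close> is the smallest set seeing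
  them all. A box with \<open>a i + 1 < b i\<close> can be split at the points strictly between its ends.
\<close>

locale box_chain =
  fixes a b :: "nat \<Rightarrow> nat" and k :: nat and c :: "nat set \<Rightarrow> nat"
  assumes ab: "\<lbrakk>1 \<le> i; i \<le> k\<rbrakk> \<Longrightarrow> a i < b i"
    and ba: "\<lbrakk>1 \<le> i; i < k\<rbrakk> \<Longrightarrow> b i \<le> a (Suc i)"
    and c_mono: "\<lbrakk>finite B; A \<subseteq> B\<rbrakk> \<Longrightarrow> c A \<le> c B"
    and c_Un: "\<lbrakk>finite A; finite B\<rbrakk> \<Longrightarrow> c (A \<union> B) \<le> c A + c B"
    and c_pair: "A \<subseteq> {x, Suc x} \<Longrightarrow> c A \<le> 1"
    and c_sep: "\<lbrakk>finite A; finite B; \<And>x y. \<lbrakk>x \<in> A; y \<in> B\<rbrakk> \<Longrightarrow> Suc x < y\<rbrakk> \<Longrightarrow> c A + c B \<le> c (A \<union> B)"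
begin

section \<open>Connectedness of the admissible splitting points of a chain of boxes\<close>

definition "ends = a ` {1..k} \<union> b ` {1..k}"
definition "Lo i = {x \<in> ends. x \<le> a i}"
definition "Hi i = {x \<in> ends. b i \<le> x}"
definition "wide i \<longleftrightarrow> 1 \<le> i \<and> i \<le> k \<and> Suc (a i) < b i"
text \<open>The points at which some box can be split within the budget \<open>k\<close>.\<close>

definition "cuts = {m. (\<exists>i. 1 \<le> i \<and> i \<le> k \<and> a i < m \<and> m < b i) \<and> c (insert m ends) \<le> k}"
text \<open>The part left of box \<open>j\<close> can absorb the first interior point without
  another pair. Such a point is compatible with all cuts further right, which makes it a hub for
  connecting them; \<open>free_right\<close> is the mirror image.\<close>

definition "free_left j \<longleftrightarrow> c (insert (Suc (a j)) (Lo j)) \<le> c (Lo j)"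
definition "free_right j \<longleftrightarrow> c (insert (b j - 1) (Hi j)) \<le> c (Hi j)"
text \<open>Two splittings with an admissible common refinement.\<close>

definition "linked = {(x, y). x \<in> cuts \<and> y \<in> cuts \<and> c (insert x (insert y ends)) \<le> k}"

lemma fin [simp]: "finite ends" "finite (Lo i)" "finite (Hi i)"
  by (simp_all add: ends_def Lo_def Hi_def)

lemma b_le_a: "\<lbrakk>1 \<le> i; i < j; j \<le> k\<rbrakk> \<Longrightarrow> b i \<le> a j"
proof (induction j)
  case (Suc j)
  show ?case
  proof (cases "i = j")
    case False
    then have "b i \<le> a j" "a j < b j" "b j \<le> a (Suc j)" using Suc ab ba by auto
    then show ?thesis by linarith
  qed (use Suc ba in auto)
qed simp

lemma a_mono: "\<lbrakk>1 \<le> i; i \<le> j; j \<le> k\<rbrakk> \<Longrightarrow> a i \<le> a j"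
  using b_le_a[of i j] ab[of i] by (cases "i = j") auto

lemma b_mono: "\<lbrakk>1 \<le> i; i \<le> j; j \<le> k\<rbrakk> \<Longrightarrow> b i \<le> b j"
  using b_le_a[of i j] ab[of j] by (cases "i = j") auto

lemma ends_split:
  assumes "1 \<le> i" "i \<le> k"
  shows "ends = Lo i \<union> Hi i"
proof -
  have "x \<le> a i \<or> b i \<le> x" if x: "x \<in> ends" for x
  proof -
    obtain j where j: "1 \<le> j" "j \<le> k" "x = a j \<or> x = b j" using x by (auto simp: ends_def)
    then show ?thesis
      using a_mono[of j i] b_le_a[of j i] b_le_a[of i j] b_mono[of i j] ab[of j] assms
      by (cases j i rule: linorder_cases) auto
  qed
  then show ?thesis by (auto simp: Lo_def Hi_def)
qed

lemma Lo_1: "1 \<le> k \<Longrightarrow> Lo 1 \<subseteq> {a 1}"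
  using a_mono[of 1] b_mono[of 1] ab[of 1] by (fastforce simp: Lo_def ends_def)

lemma Hi_k: "1 \<le> k \<Longrightarrow> Hi k \<subseteq> {b k}"
  using a_mono[of _ k] b_mono[of _ k] ab[of k] by (fastforce simp: Hi_def ends_def)

lemma Lo_Suc:
  assumes "1 \<le> i" "i < k"
  shows "Lo (Suc i) \<subseteq> Lo i \<union> {b i, a (Suc i)}"
proof
  fix x assume x: "x \<in> Lo (Suc i)"
  then obtain j where j: "1 \<le> j" "j \<le> k" "x = a j \<or> x = b j" by (auto simp: Lo_def ends_def)
  have "x \<le> a (Suc i)" "x \<in> ends" using x by (auto simp: Lo_def)
  consider "j \<le> i" | "j = Suc i" | "Suc i < j" by linarith
  then show "x \<in> Lo i \<union> {b i, a (Suc i)}"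
  proof cases
    case 1
    then show ?thesis using j \<open>x \<in> ends\<close> a_mono[of j i] b_le_a[of j i] assms
      by (cases "j = i") (auto simp: Lo_def)
  next
    case 2
    then show ?thesis using j \<open>x \<le> a (Suc i)\<close> ab[of j] by auto
  next
    case 3
    then have "b (Suc i) \<le> a j" "a (Suc i) < b (Suc i)" "a j < b j" using j assms b_le_a[of "Suc i" j] ab by auto
    then show ?thesis using j \<open>x \<le> a (Suc i)\<close> by auto
  qed
qed

lemma Hi_Suc:
  assumes "1 \<le> i" "i < k"
  shows "Hi i \<subseteq> Hi (Suc i) \<union> {b i, a (Suc i)}"
proof
  fix x assume x: "x \<in> Hi i"
  then obtain j where j: "1 \<le> j" "j \<le> k" "x = a j \<or> x = b j" by (auto simp: Hi_def ends_def)
  have "b i \<le> x" "x \<in> ends" using x by (auto simp: Hi_def)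
  consider "j < i" | "j = i" | "j = Suc i" | "Suc i < j" by linarith
  then show "x \<in> Hi (Suc i) \<union> {b i, a (Suc i)}"
  proof cases
    case 1
    then have "b j \<le> a i" "a i < b i" "a j < b j" using j assms b_le_a[of j i] ab by auto
    then show ?thesis using j \<open>b i \<le> x\<close> by auto
  next
    case 2
    then show ?thesis using j \<open>b i \<le> x\<close> ab[of i] assms by auto
  next
    case 3
    then show ?thesis using j \<open>x \<in> ends\<close> by (auto simp: Hi_def)
  next
    case 4
    then show ?thesis using j \<open>x \<in> ends\<close> b_le_a[of "Suc i" j] b_mono[of "Suc i" j] by (auto simp: Hi_def)
  qed
qed

text \<open>One pair per box suffices. A new box is paid for by the pair starting at its left end.
  The right end \<open>b i\<close> of the previous box is \<open>Suc (a i)\<close>, already covered,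
  if that box is narrow; if it is wide, not being free means that \<open>Lo i\<close> alone needs
  one pair less, and the pair saved pays for \<open>b i\<close>.\<close>

lemma cost_left:
  assumes "1 \<le> i" "i \<le> k" and "\<And>j. \<lbrakk>wide j; j < i\<rbrakk> \<Longrightarrow> \<not> free_left j"
  shows "c (insert (Suc (a i)) (Lo i)) \<le> i"
  using assms
proof (induction i rule: nat_induct_at_least)
  case base
  then show ?case using c_pair[of "insert (Suc (a 1)) (Lo 1)" "a 1"] Lo_1 by auto
next
  case (Suc i)
  have ik: "1 \<le> i" "i < k" using Suc by auto
  have IH: "c (insert (Suc (a i)) (Lo i)) \<le> i" using Suc by auto
  let ?p = "{a (Suc i), Suc (a (Suc i))}"
  have p: "c ?p \<le> 1" using c_pair by blast
  show ?case
  proof (cases "wide i")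
    case True
    then have "c (Lo i) < c (insert (Suc (a i)) (Lo i))" using Suc.prems(2)[of i] by (simp add: free_left_def)
    then have Lo: "c (Lo i) + 1 \<le> i" using IH by linarith
    have "c (insert (Suc (a (Suc i))) (Lo (Suc i))) \<le> c ((Lo i \<union> {b i}) \<union> ?p)"
      using Lo_Suc[OF ik] by (intro c_mono) auto
    also have "\<dots> \<le> (c (Lo i) + c {b i}) + c ?p"
      using c_Un[of "Lo i \<union> {b i}" ?p] c_Un[of "Lo i" "{b i}"] by simp
    also have "\<dots> \<le> Suc i" using Lo p c_pair[of "{b i}" "b i"] by simp
    finally show ?thesis .
  next
    case False
    then have "b i = Suc (a i)" using ab[of i] ik by (auto simp: wide_def)
    then have "c (insert (Suc (a (Suc i))) (Lo (Suc i))) \<le> c (insert (Suc (a i)) (Lo i) \<union> ?p)"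
      using Lo_Suc[OF ik] by (intro c_mono) auto
    also have "\<dots> \<le> Suc i" using c_Un[of "insert (Suc (a i)) (Lo i)" ?p] IH p by simp
    finally show ?thesis .
  qed
qed

text \<open>Mirror image of \<open>cost_left\<close>, by induction downwards from \<open>k\<close>;
  the bound is the number of boxes from \<open>i\<close> to \<open>k\<close>.\<close>

lemma cost_right:
  assumes "i \<le> k" "1 \<le> i" and "\<And>j. \<lbrakk>wide j; i < j\<rbrakk> \<Longrightarrow> \<not> free_right j"
  shows "c (insert (b i - 1) (Hi i)) \<le> Suc (k - i)"
  using assms
proof (induction i rule: inc_induct)
  case base
  have k: "1 \<le> k" using base.prems(1) .
  have "Suc (b k - 1) = b k" using ab[of k] k by simp
  then have "insert (b k - 1) (Hi k) \<subseteq> {b k - 1, Suc (b k - 1)}" using Hi_k[OF k] by auto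
  from c_pair[OF this] show ?case by simp
next
  case (step i)
  have ik: "1 \<le> i" "i < k" using step by auto
  have IH: "c (insert (b (Suc i) - 1) (Hi (Suc i))) \<le> Suc (k - Suc i)" using step by auto
  let ?p = "{b i - 1, b i}"
  have p: "c ?p \<le> 1" using c_pair[of ?p "b i - 1"] ab[of i] ik by auto
  show ?case
  proof (cases "wide (Suc i)")
    case True
    then have "c (Hi (Suc i)) < c (insert (b (Suc i) - 1) (Hi (Suc i)))"
      using step.prems(2)[of "Suc i"] by (simp add: free_right_def)
    then have Hi: "c (Hi (Suc i)) \<le> k - Suc i" using IH by linarith
    have "c (insert (b i - 1) (Hi i)) \<le> c ((Hi (Suc i) \<union> {a (Suc i)}) \<union> ?p)"
      using Hi_Suc[OF ik] by (intro c_mono) auto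
    also have "\<dots> \<le> (c (Hi (Suc i)) + c {a (Suc i)}) + c ?p"
      using c_Un[of "Hi (Suc i) \<union> {a (Suc i)}" ?p] c_Un[of "Hi (Suc i)" "{a (Suc i)}"] by simp
    also have "\<dots> \<le> Suc (k - i)" using Hi p c_pair[of "{a (Suc i)}" "a (Suc i)"] ik by simp
    finally show ?thesis .
  next
    case False
    then have "b (Suc i) - 1 = a (Suc i)" using ab[of "Suc i"] ik by (auto simp: wide_def)
    then have "c (insert (b i - 1) (Hi i)) \<le> c (insert (b (Suc i) - 1) (Hi (Suc i)) \<union> ?p)"
      using Hi_Suc[OF ik] by (intro c_mono) auto
    also have "\<dots> \<le> c (insert (b (Suc i) - 1) (Hi (Suc i))) + c ?p" by (intro c_Un) auto
    also have "\<dots> \<le> Suc (k - Suc i) + 1" using IH p by (rule add_mono)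
    also have "\<dots> = Suc (k - i)" using ik by simp
    finally show ?thesis .
  qed
qed

end

locale coverable_box_chain = box_chain +
  assumes c_ends: "c ends \<le> k"
begin

lemma wide_interior: "wide j \<Longrightarrow> a j < Suc (a j) \<and> Suc (a j) < b j \<and> a j < b j - 1 \<and> b j - 1 < b j"
  by (auto simp: wide_def)

text \<open>A wide box leaves a gap of at least two between the ends on its two sides, so
  \<open>c_sep\<close> applies.\<close>

lemma separated:
  assumes "wide j"
  shows "c (Lo j) + c (Hi j) \<le> c ends"
proof -
  have "c (Lo j) + c (Hi j) \<le> c (Lo j \<union> Hi j)"
    by (rule c_sep) (use assms in \<open>auto simp: Lo_def Hi_def wide_def\<close>)
  then show ?thesis using ends_split[of j] assms by (simp add: wide_def)
qed

lemma free_left_cut: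
  assumes "wide j" "free_left j"
  shows "Suc (a j) \<in> cuts"
proof -
  have "insert (Suc (a j)) ends = insert (Suc (a j)) (Lo j) \<union> Hi j"
    using ends_split[of j] assms(1) by (auto simp: wide_def)
  then have "c (insert (Suc (a j)) ends) \<le> c (insert (Suc (a j)) (Lo j)) + c (Hi j)"
    using c_Un[of "insert (Suc (a j)) (Lo j)" "Hi j"] by simp
  then have "c (insert (Suc (a j)) ends) \<le> k"
    using assms separated[of j] c_ends by (simp add: free_left_def)
  then show ?thesis using assms(1) wide_interior[of j] by (auto simp: cuts_def wide_def intro!: exI[of _ j])
qed

lemma free_right_cut:
  assumes "wide j" "free_right j"
  shows "b j - 1 \<in> cuts"
proof -
  have "insert (b j - 1) ends = Lo j \<union> insert (b j - 1) (Hi j)"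
    using ends_split[of j] assms(1) by (auto simp: wide_def)
  then have "c (insert (b j - 1) ends) \<le> c (Lo j) + c (insert (b j - 1) (Hi j))"
    using c_Un[of "Lo j" "insert (b j - 1) (Hi j)"] by simp
  then have "c (insert (b j - 1) ends) \<le> k"
    using assms separated[of j] c_ends by (simp add: free_right_def)
  then show ?thesis using assms(1) wide_interior[of j] by (auto simp: cuts_def wide_def intro!: exI[of _ j])
qed

text \<open>For a cut \<open>m\<close> beyond \<open>Suc (a j)\<close> the gap after
  \<open>a j\<close> separates the cost of \<open>Lo j\<close> from that of \<open>Hi j\<close> with
  \<open>m\<close>, and on the left side the new point costs nothing.\<close>

lemma free_left_linked:
  assumes j: "wide j" "free_left j" and m: "m \<in> cuts" "Suc (a j) \<le> m"
  shows "(Suc (a j), m) \<in> linked"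
proof -
  have "c (insert (Suc (a j)) (insert m ends)) \<le> k"
  proof (cases "m = Suc (a j)")
    case True
    then show ?thesis using m by (simp add: cuts_def)
  next
    case False
    have eq: "insert (Suc (a j)) (insert m ends) = insert (Suc (a j)) (Lo j) \<union> insert m (Hi j)"
      "insert m ends = Lo j \<union> insert m (Hi j)"
      using ends_split[of j] j(1) by (auto simp: wide_def)
    have "c (Lo j) + c (insert m (Hi j)) \<le> c (insert m ends)"
      unfolding eq(2) using j(1) m(2) False by (intro c_sep) (auto simp: wide_def Lo_def Hi_def)
    moreover have "c (insert (Suc (a j)) (insert m ends)) \<le> c (insert (Suc (a j)) (Lo j)) + c (insert m (Hi j))"
      unfolding eq(1) by (intro c_Un) auto
    ultimately show ?thesis using j(2) m(1) by (simp add: free_left_def cuts_def)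
  qed
  then show ?thesis using free_left_cut[OF j] m(1) by (simp add: linked_def)
qed

lemma free_right_linked:
  assumes j: "wide j" "free_right j" and m: "m \<in> cuts" "m \<le> b j - 1"
  shows "(b j - 1, m) \<in> linked"
proof -
  have "c (insert (b j - 1) (insert m ends)) \<le> k"
  proof (cases "m = b j - 1")
    case True
    then show ?thesis using m by (simp add: cuts_def)
  next
    case False
    have eq: "insert (b j - 1) (insert m ends) = insert m (Lo j) \<union> insert (b j - 1) (Hi j)"
      "insert m ends = insert m (Lo j) \<union> Hi j"
      using ends_split[of j] j(1) by (auto simp: wide_def)
    have "c (insert m (Lo j)) + c (Hi j) \<le> c (insert m ends)"
      unfolding eq(2) using j(1) m(2) False by (intro c_sep) (auto simp: wide_def Lo_def Hi_def)
    moreover have "c (insert (b j - 1) (insert m ends)) \<le> c (insert m (Lo j)) + c (insert (b j - 1) (Hi j))"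
      unfolding eq(1) by (intro c_Un) auto
    ultimately show ?thesis using j(2) m(1) by (simp add: free_right_def cuts_def)
  qed
  then show ?thesis using free_right_cut[OF j] m(1) by (simp add: linked_def)
qed

lemma linked_sym: "(x, y) \<in> linked \<Longrightarrow> (y, x) \<in> linked"
  by (auto simp: linked_def insert_commute)

lemma
  assumes "wide i" "\<And>j. \<lbrakk>wide j; j \<le> i\<rbrakk> \<Longrightarrow> \<not> free_left j"
  shows cost_Lo: "Suc (c (Lo i)) \<le> i" and cost_Lo_insert: "c (insert (Suc (a i)) (Lo i)) \<le> i"
proof -
  show *: "c (insert (Suc (a i)) (Lo i)) \<le> i" using assms by (intro cost_left) (auto simp: wide_def)
  have "c (Lo i) < c (insert (Suc (a i)) (Lo i))" using assms(2)[OF assms(1)] by (simp add: free_left_def)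
  then show "Suc (c (Lo i)) \<le> i" using * by linarith
qed

lemma cost_Hi:
  assumes "wide i" "\<And>j. \<lbrakk>wide j; i \<le> j\<rbrakk> \<Longrightarrow> \<not> free_right j"
  shows "c (Hi i) \<le> k - i"
proof -
  have *: "c (insert (b i - 1) (Hi i)) \<le> Suc (k - i)" using assms by (intro cost_right) (auto simp: wide_def)
  have "c (Hi i) < c (insert (b i - 1) (Hi i))" using assms(2)[OF assms(1)] by (simp add: free_right_def)
  then show ?thesis using * by linarith
qed

text \<open>The left part with \<open>Suc (a i)\<close> costs at most \<open>i\<close> and the right
  part at most \<open>k - i\<close>.\<close>

lemma cut_if_not_free:
  assumes i: "wide i" and l: "\<And>j. \<lbrakk>wide j; j \<le> i\<rbrakk> \<Longrightarrow> \<not> free_left j"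
    and r: "\<And>j. \<lbrakk>wide j; i \<le> j\<rbrakk> \<Longrightarrow> \<not> free_right j"
  shows "Suc (a i) \<in> cuts"
proof -
  have "insert (Suc (a i)) ends = insert (Suc (a i)) (Lo i) \<union> Hi i"
    using ends_split[of i] i by (auto simp: wide_def)
  then have "c (insert (Suc (a i)) ends) \<le> c (insert (Suc (a i)) (Lo i)) + c (Hi i)"
    using c_Un[of "insert (Suc (a i)) (Lo i)" "Hi i"] by simp
  also have "\<dots> \<le> i + (k - i)" using cost_Lo_insert[OF i l] cost_Hi[OF i r] by (intro add_mono) auto
  also have "\<dots> = k" using i by (simp add: wide_def)
  finally show ?thesis using i wide_interior[OF i] by (auto simp: cuts_def wide_def intro!: exI[of _ i])
qed

text \<open>Either some wide box has a free end, and the adjacent interior point is a cut, or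
  nothing is free and the count applies to box \<open>i\<close>.\<close>

lemma ex_cut:
  assumes "wide i"
  shows "cuts \<noteq> {}"
  using cut_if_not_free[OF assms] free_left_cut free_right_cut by blast

lemma cost_UN_pairs: "finite S \<Longrightarrow> c (\<Union>j \<in> S. {a j, Suc (a j)}) \<le> card S + c {}"
proof (induction S rule: finite_induct)
  case (insert x S)
  have "c ({a x, Suc (a x)} \<union> (\<Union>j \<in> S. {a j, Suc (a j)})) \<le> c {a x, Suc (a x)} + c (\<Union>j \<in> S. {a j, Suc (a j)})"
    using insert.hyps by (intro c_Un) auto
  then show ?case using insert c_pair[of "{a x, Suc (a x)}" "a x"] by simp
qed simp

text \<open>Two empty sets are separated, so twice the cost is at most the cost.\<close>

lemma c_empty: "c {} = 0"
  using c_sep[of "{}" "{}"] by simp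

text \<open>A free end to the left of both cuts, or to the right of both, is linked to each of them.
  Otherwise the counting bounds hold left of \<open>m\<close> and right of \<open>m'\<close>. A wide
  box strictly between would then contain a cut, and in the remaining cases the budget suffices for
  both points.\<close>

lemma consecutive_cuts_linked:
  assumes m: "m \<in> cuts" and m': "m' \<in> cuts" and less: "m < m'"
    and gap: "\<And>x. x \<in> cuts \<Longrightarrow> x \<le> m \<or> m' \<le> x"
  shows "(m, m') \<in> linked\<^sup>*"
proof -
  obtain i where i: "1 \<le> i" "i \<le> k" "a i < m" "m < b i" using m by (auto simp: cuts_def)
  obtain i' where i': "1 \<le> i'" "i' \<le> k" "a i' < m'" "m' < b i'" using m' by (auto simp: cuts_def)
  have wi: "wide i" and wi': "wide i'" using i i' by (auto simp: wide_def)
  have "i \<le> i'"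
  proof (rule ccontr)
    assume "\<not> i \<le> i'"
    then have "b i' \<le> a i" using b_le_a[of i' i] i i' by simp
    then show False using i i' less by simp
  qed
  show ?thesis
  proof (cases "(\<exists>j. wide j \<and> free_left j \<and> Suc (a j) \<le> m) \<or> (\<exists>j. wide j \<and> free_right j \<and> m' \<le> b j - 1)")
    case True
    then obtain x where "(x, m) \<in> linked" "(x, m') \<in> linked"
      using free_left_linked[OF _ _ m] free_left_linked[OF _ _ m'] free_right_linked[OF _ _ m]
        free_right_linked[OF _ _ m'] less by (elim disjE exE conjE) (metis le_trans less_imp_le)+
    then show ?thesis using linked_sym by (meson converse_rtrancl_into_rtrancl r_into_rtrancl)
  next
    case False
    have L: "\<not> free_left j" if "wide j" "j \<le> i" for j
      using False that a_mono[of j i] i by (auto simp: wide_def)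
    have R: "\<not> free_right j" if "wide j" "i' \<le> j" for j
      using False that b_mono[of i' j] i' by (auto simp: wide_def)
    consider (same) "i = i'" | (between) j where "i < j" "j < i'" "wide j"
      | (adjacent) "i < i'" "\<And>j. \<lbrakk>i < j; j < i'\<rbrakk> \<Longrightarrow> \<not> wide j"
      using \<open>i \<le> i'\<close> by (cases "i = i'") auto
    then show ?thesis
    proof cases
      case same
      have "c ends \<le> c (Lo i) + c (Hi i)" using c_Un[of "Lo i" "Hi i"] ends_split[OF i(1,2)] by simp
      moreover have "Suc (c (Lo i)) \<le> i" by (rule cost_Lo[OF wi L])
      moreover have "c (Hi i) \<le> k - i" using cost_Hi[OF wi' R] same by simp
      ultimately have slack: "Suc (c ends) \<le> k" using i(2) by linarith
      have two: "c (insert m (insert (Suc m) ends)) \<le> k"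
        using c_Un[of "{m, Suc m}" ends] c_pair[of "{m, Suc m}" m] slack by simp
      have "c (insert (Suc m) ends) \<le> c (insert m (insert (Suc m) ends))" by (intro c_mono) auto
      then have "Suc m \<in> cuts" using two i i' same less by (auto simp: cuts_def intro!: exI[of _ i])
      then have "m' = Suc m" using gap[of "Suc m"] less by simp
      then show ?thesis using two m m' by (auto simp: linked_def)
    next
      case between
      \<comment> \<open>A free end of a box strictly between would give a cut between
        \<open>m\<close> and \<open>m'\<close>. So nothing is free on either side of
        \<open>j\<close>, and the count itself produces a cut in box \<open>j\<close>, which is
        equally impossible.\<close>
      have inside: "m < Suc (a j) \<and> Suc (a j) < m' \<and> m < b j - 1 \<and> b j - 1 < m'"
        if "i < j" "j < i'" "wide j" for j
        using b_le_a[of i j] b_le_a[of j i'] i i' that by (auto simp: wide_def)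
      have "\<not> free_left l" if "wide l" "l \<le> j" for l
        using L[of l] free_left_cut[of l] gap[of "Suc (a l)"] inside[of l] that between by (cases "l \<le> i") auto
      moreover have "\<not> free_right l" if "wide l" "j \<le> l" for l
        using R[of l] free_right_cut[of l] gap[of "b l - 1"] inside[of l] that between by (cases "i' \<le> l") auto
      ultimately have "Suc (a j) \<in> cuts" using between by (intro cut_if_not_free) auto
      then show ?thesis using gap[of "Suc (a j)"] inside[OF between] by auto
    next
      case adjacent
      \<comment> \<open>All boxes strictly between are narrow. One pair at the right end of box
        \<open>i\<close> and one at the left end of each box \<open>j\<close> with
        \<open>i < j \<le> i'\<close> cover all ends in between and both new points. With at most
        \<open>i - 1\<close> pairs on the left and \<open>k - i'\<close> on the right the total is
        at most \<open>k\<close>.\<close>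
      define mid where "mid = {b i - 1, Suc (b i - 1)} \<union> (\<Union>j \<in> {i<..i'}. {a j, Suc (a j)})"
      have fin_mid: "finite mid" by (simp add: mid_def)
      have "c mid \<le> c {b i - 1, Suc (b i - 1)} + c (\<Union>j \<in> {i<..i'}. {a j, Suc (a j)})"
        unfolding mid_def by (intro c_Un) auto
      also have "\<dots> \<le> 1 + (i' - i)"
        using cost_UN_pairs[of "{i<..i'}"] c_pair[of "{b i - 1, Suc (b i - 1)}" "b i - 1"] by (simp add: c_empty)
      finally have c_mid: "c mid \<le> 1 + (i' - i)" .
      have "insert (b i - 1) (insert (Suc (a i')) ends) \<subseteq> (Lo i \<union> Hi i') \<union> mid"
      proof -
        have "x \<in> (Lo i \<union> Hi i') \<union> mid" if x: "x \<in> ends" for x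
        proof -
          obtain j where j: "1 \<le> j" "j \<le> k" "x = a j \<or> x = b j" using x by (auto simp: ends_def)
          consider "j < i" | "j = i" | "i < j" "j < i'" | "j = i'" "i < i'" | "i' < j" using adjacent(1) by linarith
          then show ?thesis
          proof cases
            case 1
            then show ?thesis using j x i a_mono[of j i] b_le_a[of j i] by (auto simp: Lo_def)
          next
            case 2
            then show ?thesis using j x i ab[of i] by (auto simp: Lo_def mid_def)
          next
            case 3
            then have "b j = Suc (a j)" using adjacent(2)[of j] ab[of j] j by (auto simp: wide_def)
            then show ?thesis using j 3 by (auto simp: mid_def)
          next
            case 4
            then show ?thesis using j x by (auto simp: Hi_def mid_def)
          next
            case 5
            then show ?thesis using j x i' b_mono[of i' j] b_le_a[of i' j] by (auto simp: Hi_def)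
          qed
        qed
        then show ?thesis using adjacent(1) by (auto simp: mid_def)
      qed
      then have "c (insert (b i - 1) (insert (Suc (a i')) ends)) \<le> c ((Lo i \<union> Hi i') \<union> mid)"
        using fin_mid by (intro c_mono) auto
      also have "\<dots> \<le> (c (Lo i) + c (Hi i')) + c mid"
        using c_Un[of "Lo i \<union> Hi i'" mid] c_Un[of "Lo i" "Hi i'"] fin_mid by simp
      also have "\<dots> \<le> k"
        using cost_Lo[OF wi L] cost_Hi[OF wi' R] c_mid i'(2) adjacent(1) by linarith
      finally have two: "c (insert (b i - 1) (insert (Suc (a i')) ends)) \<le> k" .
      have "c (insert (b i - 1) ends) \<le> c (insert (b i - 1) (insert (Suc (a i')) ends))"
        "c (insert (Suc (a i')) ends) \<le> c (insert (b i - 1) (insert (Suc (a i')) ends))"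
        by (intro c_mono; auto)+
      then have cuts: "b i - 1 \<in> cuts" "Suc (a i') \<in> cuts"
        using two wide_interior[OF wi] wide_interior[OF wi'] i i' by (auto simp: cuts_def)
      have "b i - 1 < m'" "m < Suc (a i')" using b_le_a[of i i'] adjacent(1) i i' by auto
      \<comment> \<open>A cut in box \<open>i\<close> is at most \<open>b i - 1\<close> and a cut in
        box \<open>i'\<close> at least \<open>Suc (a i')\<close>, so consecutiveness leaves no other
        possibility.\<close>
      then have "m = b i - 1" "m' = Suc (a i')"
        using gap[OF cuts(1)] gap[OF cuts(2)] i i' by auto
      then show ?thesis using two cuts by (auto simp: linked_def)
    qed
  qed
qed

lemma finite_cuts: "finite cuts"
  by (rule finite_subset[of _ "\<Union>i \<in> {1..k}. {a i<..<b i}"]) (auto simp: cuts_def)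

text \<open>Each cut is joined to its predecessor, hence to the least cut.\<close>

lemma cuts_connected:
  assumes "m \<in> cuts" "m' \<in> cuts"
  shows "(m, m') \<in> linked\<^sup>*"
proof -
  have from_min: "(Min cuts, m) \<in> linked\<^sup>*" if "m \<in> cuts" for m
    using that
  proof (induction m rule: less_induct)
    case (less m)
    show ?case
    proof (cases "m = Min cuts")
      case False
      let ?S = "{x \<in> cuts. x < m}"
      have "Min cuts \<in> cuts" "Min cuts \<le> m" using less.prems finite_cuts by (auto intro: Min_in)
      then have S: "finite ?S" "?S \<noteq> {}" using False finite_cuts by auto
      then have x: "Max ?S \<in> cuts" "Max ?S < m" using Max_in[OF S] by auto
      have "y \<le> Max ?S \<or> m \<le> y" if "y \<in> cuts" for y
        using Max_ge[OF S(1), of y] that by (cases "y < m") auto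
      then have "(Max ?S, m) \<in> linked\<^sup>*" using consecutive_cuts_linked[OF x(1) less.prems x(2)] by blast
      then show ?thesis using less.IH[OF x(2,1)] by simp
    qed simp
  qed
  have "sym (linked\<^sup>*)" using linked_sym by (intro sym_rtrancl symI)
  then show ?thesis using from_min[OF assms(1)] from_min[OF assms(2)] by (meson rtrancl_trans symD)
qed

end

section \<open>Monotone surjections and their restrictions\<close>

definition surjections :: "nat \<Rightarrow> nat \<Rightarrow> (nat \<Rightarrow> nat) set" where
  "surjections k n = {f \<in> simplices k n. f ` {..n} = {..k}}"

lemma surjectionsD:
  assumes "f \<in> surjections k n"
  shows "f \<in> extensional {..n}" "x \<le> n \<Longrightarrow> f x \<le> k" "\<lbrakk>x \<le> y; y \<le> n\<rbrakk> \<Longrightarrow> f x \<le> f y" "f ` {..n} = {..k}"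
  using assms by (auto simp: surjections_def simplices_def PiE_iff mono_on_def)

lemma surjectionsI:
  assumes "f \<in> extensional {..n}" "\<And>x. x \<le> n \<Longrightarrow> f x \<le> k" "\<And>x y. \<lbrakk>x \<le> y; y \<le> n\<rbrakk> \<Longrightarrow> f x \<le> f y"
    "{..k} \<subseteq> f ` {..n}"
  shows "f \<in> surjections k n"
  using assms by (auto simp: surjections_def simplices_def PiE_iff mono_on_def)

text \<open>The cells with the same restriction to the face \<open>J\<close> as \<open>f\<close>,
  when \<open>f\<close> remains onto there.\<close>

definition fibre :: "nat \<Rightarrow> nat \<Rightarrow> nat set \<Rightarrow> (nat \<Rightarrow> nat) \<Rightarrow> (nat \<Rightarrow> nat) set" where
  "fibre k n J f = {g \<in> surjections k n. \<forall>x \<in> J. g x = f x}"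

text \<open>The \<open>i\<close>-th jump of \<open>f\<close>, the first argument with value at least
  \<open>i\<close>, lies after \<open>lo f J i\<close> and not after \<open>hi f J i\<close>; these
  are the ends of its box as seen from \<open>J\<close>.\<close>

definition lo :: "(nat \<Rightarrow> nat) \<Rightarrow> nat set \<Rightarrow> nat \<Rightarrow> nat" where
  "lo f J i = Max {x \<in> J. f x < i}"

definition hi :: "(nat \<Rightarrow> nat) \<Rightarrow> nat set \<Rightarrow> nat \<Rightarrow> nat" where
  "hi f J i = Min {x \<in> J. i \<le> f x}"

definition box_ends :: "nat \<Rightarrow> (nat \<Rightarrow> nat) \<Rightarrow> nat set \<Rightarrow> nat set" where
  "box_ends k f J = lo f J ` {1..k} \<union> hi f J ` {1..k}"

text \<open>Being onto on \<open>J\<close> says that the restriction of \<open>f\<close> to the face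
  is not the base point; it also guarantees that every box has both ends in
  \<open>J\<close>.\<close>

locale visible =
  fixes k n :: nat and f :: "nat \<Rightarrow> nat" and J :: "nat set"
  assumes k: "1 \<le> k" and f: "f \<in> surjections k n" and J: "J \<subseteq> {..n}" and onto: "f ` J = {..k}"
begin

lemma finite_J: "finite J" using J finite_subset by blast

lemma attained: "i \<le> k \<Longrightarrow> \<exists>x \<in> J. f x = i"
  using onto by (metis atMost_iff imageE)

context
  fixes i assumes i: "1 \<le> i" "i \<le> k"
begin

lemma lo_props: "lo f J i \<in> J" "f (lo f J i) < i" "\<lbrakk>x \<in> J; f x < i\<rbrakk> \<Longrightarrow> x \<le> lo f J i"
proof -
  obtain y where y: "y \<in> J" "f y = i - 1" using attained[OF le_trans[OF diff_le_self i(2)], of 1] by blast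
  have S: "finite {x \<in> J. f x < i}" "{x \<in> J. f x < i} \<noteq> {}" using finite_J y i by auto
  from Max_in[OF S] show "lo f J i \<in> J" "f (lo f J i) < i" by (auto simp: lo_def)
  show "\<lbrakk>x \<in> J; f x < i\<rbrakk> \<Longrightarrow> x \<le> lo f J i" using Max_ge[OF S(1)] by (simp add: lo_def)
qed

lemma hi_props: "hi f J i \<in> J" "i \<le> f (hi f J i)" "\<lbrakk>x \<in> J; i \<le> f x\<rbrakk> \<Longrightarrow> hi f J i \<le> x"
proof -
  obtain y where y: "y \<in> J" "f y = i" using attained[of i] i by auto
  have S: "finite {x \<in> J. i \<le> f x}" "{x \<in> J. i \<le> f x} \<noteq> {}" using finite_J y by auto
  from Min_in[OF S] show "hi f J i \<in> J" "i \<le> f (hi f J i)" by (auto simp: hi_def)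
  show "\<lbrakk>x \<in> J; i \<le> f x\<rbrakk> \<Longrightarrow> hi f J i \<le> x" using Min_le[OF S(1)] by (simp add: hi_def)
qed

lemma lo_hi_le: "lo f J i \<le> n" "hi f J i \<le> n"
  using lo_props(1) hi_props(1) J by auto

lemma f_lo: "f (lo f J i) = i - 1"
proof -
  obtain y where y: "y \<in> J" "f y = i - 1" using attained[OF le_trans[OF diff_le_self i(2)], of 1] by blast
  then have "y \<le> lo f J i" using lo_props(3)[of y] i by simp
  then have "f y \<le> f (lo f J i)" using surjectionsD(3)[OF f] lo_hi_le by blast
  then show ?thesis using y lo_props(2) by simp
qed

lemma f_hi: "f (hi f J i) = i"
proof -
  obtain y where y: "y \<in> J" "f y = i" using attained[of i] i by auto
  then have "hi f J i \<le> y" "y \<le> n" using hi_props(3)[of y] J by auto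
  then have "f (hi f J i) \<le> f y" using surjectionsD(3)[OF f] by blast
  then show ?thesis using y hi_props(2) by simp
qed

lemma lo_less_hi: "lo f J i < hi f J i"
proof (rule ccontr)
  assume "\<not> lo f J i < hi f J i"
  then have "f (hi f J i) \<le> f (lo f J i)" using surjectionsD(3)[OF f] lo_hi_le(1) by auto
  then show False using f_lo f_hi i by simp
qed

lemma outside: "x \<in> J \<Longrightarrow> x \<le> lo f J i \<or> hi f J i \<le> x"
  using lo_props(3) hi_props(3) by (cases "f x < i") auto

text \<open>Moves the \<open>i\<close>-th jump to an extreme position in its box: the value
  \<open>i\<close> inside makes it as early as possible, the value \<open>i - 1\<close> as late as
  possible.\<close>

lemma vary:
  assumes v: "v = i - 1 \<or> v = i"
  defines "g \<equiv> (\<lambda>x. if lo f J i < x \<and> x < hi f J i then v else f x)"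
  shows "g \<in> fibre k n J f"
proof -
  have mid: "i - 1 \<le> f x \<and> f x \<le> i" if "lo f J i \<le> x" "x \<le> hi f J i" for x
  proof -
    have "x \<le> n" using that lo_hi_le by simp
    then have "f (lo f J i) \<le> f x" "f x \<le> f (hi f J i)" using surjectionsD(3)[OF f] that lo_hi_le by blast+
    then show ?thesis using f_lo f_hi by simp
  qed
  have agree: "g x = f x" if "x \<in> J" for x using outside[OF that] by (auto simp: g_def)
  have "g \<in> surjections k n"
  proof (rule surjectionsI)
    show "g \<in> extensional {..n}"
      using surjectionsD(1)[OF f] lo_hi_le by (auto simp: g_def extensional_def)
    show "g x \<le> k" if "x \<le> n" for x using surjectionsD(2)[OF f that] v i by (auto simp: g_def)
    show "g x \<le> g y" if xy: "x \<le> y" "y \<le> n" for x y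
    proof -
      have 1: "f x \<le> f y" using surjectionsD(3)[OF f xy] .
      have 2: "f x \<le> i - 1" if "x \<le> lo f J i" using surjectionsD(3)[OF f that lo_hi_le(1)] f_lo by simp
      have 3: "i \<le> f y" if "hi f J i \<le> y" using surjectionsD(3)[OF f that xy(2)] f_hi by simp
      show ?thesis using 1 2 3 v xy by (auto simp: g_def)
    qed
    have "f ` J = g ` J" using agree by auto
    then show "{..k} \<subseteq> g ` {..n}" using onto J by auto
  qed
  then show ?thesis using agree by (simp add: fibre_def)
qed

end

lemma hi_le_lo:
  assumes "1 \<le> i" "i < k"
  shows "hi f J i \<le> lo f J (Suc i)"
  using assms hi_props(1)[of i] f_hi[of i] lo_props(3)[of "Suc i" "hi f J i"] by simp

text \<open>With \<open>i = f x\<close>, a point outside all box interiors lies between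
  \<open>hi f J i\<close> and \<open>lo f J (Suc i)\<close>, where \<open>g\<close> is known, and
  monotonicity squeezes \<open>g x\<close>. For the values \<open>0\<close> and \<open>k\<close> one
  of the two bounds is trivial.\<close>

lemma agree_outside:
  assumes g: "g \<in> surjections k n" and ends: "\<And>x. x \<in> box_ends k f J \<Longrightarrow> g x = f x"
    and x: "x \<le> n" "\<And>i. \<lbrakk>1 \<le> i; i \<le> k\<rbrakk> \<Longrightarrow> x \<le> lo f J i \<or> hi f J i \<le> x"
  shows "g x = f x"
proof (rule antisym)
  have fx: "f x \<le> k" using surjectionsD(2)[OF f x(1)] .
  show "f x \<le> g x"
  proof (cases "f x = 0")
    case False
    let ?i = "f x"
    have i: "1 \<le> ?i" "?i \<le> k" using False fx by auto
    have "\<not> x \<le> lo f J ?i"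
    proof
      assume "x \<le> lo f J ?i"
      then have "f x \<le> f (lo f J ?i)" using surjectionsD(3)[OF f] lo_hi_le(1)[OF i] by blast
      then show False using f_lo[OF i] i by simp
    qed
    then have "hi f J ?i \<le> x" using x(2)[OF i] by simp
    then have "g (hi f J ?i) \<le> g x" using surjectionsD(3)[OF g] x(1) by blast
    moreover have "g (hi f J ?i) = ?i" using ends[of "hi f J ?i"] f_hi[OF i] i by (simp add: box_ends_def)
    ultimately show ?thesis by simp
  qed simp
  show "g x \<le> f x"
  proof (cases "f x = k")
    case True
    then show ?thesis using surjectionsD(2)[OF g x(1)] by simp
  next
    case False
    let ?i = "Suc (f x)"
    have i: "1 \<le> ?i" "?i \<le> k" using False fx by auto
    have "\<not> hi f J ?i \<le> x"
    proof
      assume "hi f J ?i \<le> x"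
      then have "f (hi f J ?i) \<le> f x" using surjectionsD(3)[OF f] x(1) by blast
      then show False using f_hi[OF i] by simp
    qed
    then have "x \<le> lo f J ?i" using x(2)[OF i] by simp
    then have "g x \<le> g (lo f J ?i)" using surjectionsD(3)[OF g] lo_hi_le(1)[OF i] by blast
    moreover have "g (lo f J ?i) = f x" using ends[of "lo f J ?i"] f_lo[OF i] i by (simp add: box_ends_def)
    ultimately show ?thesis by simp
  qed
qed

lemma box_ends_sub: "box_ends k f J \<subseteq> J"
  using lo_props(1) hi_props(1) by (auto simp: box_ends_def)

lemma fibre_box_ends: "fibre k n (box_ends k f J) f = fibre k n J f"
proof
  show "fibre k n J f \<subseteq> fibre k n (box_ends k f J) f" using box_ends_sub by (auto simp: fibre_def)
  show "fibre k n (box_ends k f J) f \<subseteq> fibre k n J f"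
  proof
    fix g assume "g \<in> fibre k n (box_ends k f J) f"
    then have g: "g \<in> surjections k n" "\<And>x. x \<in> box_ends k f J \<Longrightarrow> g x = f x" by (auto simp: fibre_def)
    have "g x = f x" if "x \<in> J" for x
      by (rule agree_outside[OF g(1)]) (use g(2) outside that J in auto)
    then show "g \<in> fibre k n J f" using g(1) by (simp add: fibre_def)
  qed
qed

text \<open>By \<open>agree_outside\<close>, points that avoid the box interiors impose no new
  condition.\<close>

lemma fibre_unsplit:
  assumes K: "K \<subseteq> {..n}" "box_ends k f J \<subseteq> K"
    and unsplit: "\<And>x i. \<lbrakk>x \<in> K; 1 \<le> i; i \<le> k\<rbrakk> \<Longrightarrow> x \<le> lo f J i \<or> hi f J i \<le> x"
  shows "fibre k n K f = fibre k n J f"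
proof -
  have "fibre k n (box_ends k f J) f \<subseteq> fibre k n K f"
  proof
    fix g assume g: "g \<in> fibre k n (box_ends k f J) f"
    then have gS: "g \<in> surjections k n" by (simp add: fibre_def)
    have "g x = f x" if x: "x \<in> K" for x
    proof (rule agree_outside[OF gS])
      show "g z = f z" if "z \<in> box_ends k f J" for z using g that by (simp add: fibre_def)
      show "x \<le> n" using subsetD[OF K(1) x] by simp
      show "x \<le> lo f J i \<or> hi f J i \<le> x" if "1 \<le> i" "i \<le> k" for i using unsplit[OF x that] .
    qed
    then show "g \<in> fibre k n K f" using gS by (simp add: fibre_def)
  qed
  moreover have "fibre k n K f \<subseteq> fibre k n (box_ends k f J) f"
    using subsetD[OF K(2)] by (simp add: fibre_def subset_iff)
  ultimately show ?thesis using fibre_box_ends by simp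
qed

lemma onto_box_ends: "f ` box_ends k f J = {..k}"
proof
  show "f ` box_ends k f J \<subseteq> {..k}" using box_ends_sub onto by blast
  show "{..k} \<subseteq> f ` box_ends k f J"
  proof
    fix i assume i: "i \<in> {..k}"
    show "i \<in> f ` box_ends k f J"
    proof (cases "i = 0")
      case True
      then have "i = f (lo f J 1)" using f_lo[of 1] k by simp
      then show ?thesis using k by (auto simp: box_ends_def)
    next
      case False
      then have "i = f (hi f J i)" using f_hi[of i] i by simp
      then show ?thesis using False i by (auto simp: box_ends_def)
    qed
  qed
qed

end

lemma fibre_all:
  assumes f: "f \<in> surjections k n"
  shows "fibre k n {..n} f = {f}"
proof -
  have "g = f" if "g \<in> fibre k n {..n} f" for g
    by (rule extensionalityI[of _ "{..n}"]) (use that surjectionsD(1) f in \<open>auto simp: fibre_def\<close>)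
  then show ?thesis using f by (auto simp: fibre_def)
qed

text \<open>The fibre determines the extreme positions of each jump. If \<open>lo f K i\<close> lay
  strictly inside the box of \<open>J\<close>, the earliest jump from \<open>vary\<close> would
  change the value there and leave the fibre of \<open>K\<close>; the latest jump treats
  \<open>hi\<close>.\<close>

lemma fibre_ends_le:
  assumes J: "visible k n f J" and K: "visible k n f K" and sub: "fibre k n J f \<subseteq> fibre k n K f"
    and i: "1 \<le> i" "i \<le> k"
  shows "lo f K i \<le> lo f J i" "hi f J i \<le> hi f K i"
proof -
  interpret J: visible k n f J by (rule J)
  interpret K: visible k n f K by (rule K)
  have "(\<lambda>x. if lo f J i < x \<and> x < hi f J i then i else f x) \<in> fibre k n K f" using J.vary[OF i] sub by blast
  then have "\<not> (lo f J i < lo f K i \<and> lo f K i < hi f J i)"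
    using K.lo_props(1)[OF i] K.f_lo[OF i] i by (auto simp: fibre_def dest!: bspec[of _ _ "lo f K i"])
  moreover have "\<not> hi f J i \<le> lo f K i"
  proof
    assume "hi f J i \<le> lo f K i"
    then have "f (hi f J i) \<le> f (lo f K i)" using surjectionsD(3)[OF J.f] K.lo_hi_le(1)[OF i] by blast
    then show False using J.f_hi[OF i] K.f_lo[OF i] i by simp
  qed
  ultimately show "lo f K i \<le> lo f J i" by simp
  have "(\<lambda>x. if lo f J i < x \<and> x < hi f J i then i - 1 else f x) \<in> fibre k n K f" using J.vary[OF i] sub by blast
  then have "\<not> (lo f J i < hi f K i \<and> hi f K i < hi f J i)"
    using K.hi_props(1)[OF i] K.f_hi[OF i] i by (auto simp: fibre_def dest!: bspec[of _ _ "hi f K i"])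
  moreover have "\<not> hi f K i \<le> lo f J i"
  proof
    assume "hi f K i \<le> lo f J i"
    then have "f (hi f K i) \<le> f (lo f J i)" using surjectionsD(3)[OF J.f] J.lo_hi_le(1)[OF i] by blast
    then show False using K.f_hi[OF i] J.f_lo[OF i] i by simp
  qed
  ultimately show "hi f J i \<le> hi f K i" by simp
qed

lemma fibre_eq_ends:
  assumes "visible k n f J" "visible k n f K" "fibre k n J f = fibre k n K f"
  shows "box_ends k f J = box_ends k f K"
proof -
  have "lo f J i = lo f K i \<and> hi f J i = hi f K i" if "1 \<le> i" "i \<le> k" for i
    using fibre_ends_le[OF assms(1,2) _ that] fibre_ends_le[OF assms(2,1) _ that] assms(3) by (auto intro: antisym)
  then show ?thesis by (auto simp: box_ends_def)
qed

text \<open>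
  The posets of the higher Segal conditions in question are of the following form, with \<open>Z\<close> empty,
  \<open>{0}\<close> or \<open>{n}\<close>.
\<close>

definition coverable :: "nat \<Rightarrow> nat \<Rightarrow> nat set \<Rightarrow> nat set set" where
  "coverable k n Z = {J. J \<noteq> {} \<and> J \<subseteq> {..n} \<and> pair_cost (J - Z) \<le> k}"

lemma coverable_down: "\<lbrakk>K \<in> coverable k n Z; J \<subseteq> K; J \<noteq> {}\<rbrakk> \<Longrightarrow> J \<in> coverable k n Z"
  using pair_cost_mono[of "K - Z" "J - Z"]
  by (auto simp: coverable_def intro: finite_subset[of K "{..n}"] le_trans)

text \<open>The box ends of the full set suffice: each box then has ends \<open>x\<close> and
  \<open>Suc x\<close>, so one pair per jump covers them.\<close>

lemma ex_unit_fibre: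
  assumes k: "1 \<le> k" and f: "f \<in> surjections k n"
  shows "\<exists>J \<in> coverable k n Z. f ` J = {..k} \<and> fibre k n J f = {f}"
proof -
  interpret visible k n f "{..n}" using k f surjectionsD(4)[OF f] by unfold_locales auto
  let ?J = "box_ends k f {..n}"
  have hi_eq: "hi f {..n} i = Suc (lo f {..n} i)" if i: "1 \<le> i" "i \<le> k" for i
  proof (rule ccontr)
    assume "hi f {..n} i \<noteq> Suc (lo f {..n} i)"
    then have "Suc (lo f {..n} i) < hi f {..n} i" using lo_less_hi[OF i] by simp
    moreover from this have "Suc (lo f {..n} i) \<in> {..n}" using lo_hi_le(2)[OF i] by simp
    ultimately show False using outside[OF i, of "Suc (lo f {..n} i)"] by simp
  qed
  have "pair_cost (?J - Z) \<le> card (lo f {..n} ` {1..k})"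
    using hi_eq by (intro pair_cost_le) (auto simp: box_ends_def)
  also have "\<dots> \<le> k" using card_image_le[of "{1..k}" "lo f {..n}"] by simp
  finally have "?J \<in> coverable k n Z"
    using box_ends_sub k by (auto simp: coverable_def box_ends_def)
  then show ?thesis using onto_box_ends fibre_box_ends fibre_all[OF f] by (intro bexI[of _ ?J]) simp_all
qed

text \<open>The least representative of the fibre is the set of box ends, and the members of
  \<open>N\<close> are the coverable sets above it that contain a cut; so connectedness of
  \<open>N\<close> follows from that of the cuts.\<close>

lemma coverable_refinement:
  assumes k: "1 \<le> k" and f: "f \<in> surjections k n" and JP: "J \<in> coverable k n Z" and onto: "f ` J = {..k}"
  defines "L \<equiv> box_ends k f J"
    and "N \<equiv> {K \<in> coverable k n Z. box_ends k f J \<subseteq> K \<and> fibre k n K f \<noteq> fibre k n J f}"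
  shows "L \<in> coverable k n Z" "f ` L = {..k}" "fibre k n L f = fibre k n J f"
    "\<And>K. \<lbrakk>K \<in> coverable k n Z; f ` K = {..k}; fibre k n K f = fibre k n J f\<rbrakk> \<Longrightarrow> L \<subseteq> K"
    "fibre k n J f \<noteq> {f} \<Longrightarrow> N \<noteq> {}"
    "\<And>K K'. \<lbrakk>fibre k n J f \<noteq> {f}; K \<in> N; K' \<in> N\<rbrakk>
      \<Longrightarrow> (K, K') \<in> {(X, Y). X \<in> N \<and> Y \<in> N \<and> (X \<subseteq> Y \<or> Y \<subseteq> X)}\<^sup>*"
proof -
  have vis: "visible k n f K" if "K \<in> coverable k n Z" "f ` K = {..k}" for K
    using that k f by unfold_locales (auto simp: coverable_def)
  interpret visible k n f J by (rule vis[OF JP onto])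
  show "f ` L = {..k}" "fibre k n L f = fibre k n J f"
    using onto_box_ends fibre_box_ends by (auto simp: L_def)
  have "L \<noteq> {}" using k by (auto simp: L_def box_ends_def)
  then show LP: "L \<in> coverable k n Z" using coverable_down[OF JP] box_ends_sub by (simp add: L_def)
  show "L \<subseteq> K" if K: "K \<in> coverable k n Z" "f ` K = {..k}" and eq: "fibre k n K f = fibre k n J f" for K
    using fibre_eq_ends[OF vis[OF K] visible_axioms eq] visible.box_ends_sub[OF vis[OF K]] by (simp add: L_def)
  have fin_n: "finite A" if "A \<subseteq> {..n}" for A :: "nat set" using that finite_subset by blast
  interpret chain: box_chain "lo f J" "hi f J" k "\<lambda>A. pair_cost (A - Z)"
  proof unfold_locales
    show "pair_cost (A - Z) \<le> 1" if "A \<subseteq> {x, Suc x}" for A x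
      using that pair_cost_pair[of "A - Z" x] by blast
    show "pair_cost (A - Z) + pair_cost (B - Z) \<le> pair_cost (A \<union> B - Z)"
      if "finite A" "finite B" "\<And>x y. \<lbrakk>x \<in> A; y \<in> B\<rbrakk> \<Longrightarrow> Suc x < y" for A B
      using that pair_cost_separated[of "A - Z" "B - Z"] by (simp add: Un_Diff)
    show "pair_cost (A \<union> B - Z) \<le> pair_cost (A - Z) + pair_cost (B - Z)" if "finite A" "finite B" for A B
      using that pair_cost_Un[of "A - Z" "B - Z"] by (simp add: Un_Diff)
    show "pair_cost (A - Z) \<le> pair_cost (B - Z)" if "finite B" "A \<subseteq> B" for A B
      using that by (intro pair_cost_mono) auto
  qed (use lo_less_hi hi_le_lo in auto)
  have ends: "chain.ends = L" by (simp add: chain.ends_def L_def box_ends_def)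
  interpret chain: coverable_box_chain "lo f J" "hi f J" k "\<lambda>A. pair_cost (A - Z)"
    by unfold_locales (use LP ends in \<open>simp add: coverable_def\<close>)
  have cut_N: "A \<in> N"
    if m: "m \<in> chain.cuts" and A: "insert m L \<subseteq> A" "A \<in> coverable k n Z" for m A
  proof -
    obtain i where i: "1 \<le> i" "i \<le> k" "lo f J i < m" "m < hi f J i" using m by (auto simp: chain.cuts_def)
    \<comment> \<open>Within the fibre of \<open>J\<close> the interior point \<open>m\<close> can
      take both values \<open>i - 1\<close> and \<open>i\<close>; the one different from
      \<open>f m\<close> is excluded by \<open>A\<close>, so the fibre shrinks.\<close>
    have "\<exists>v. (v = i - 1 \<or> v = i) \<and> v \<noteq> f m"
      using i by (intro exI[of _ "if f m = i then i - 1 else i"]) auto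
    then obtain v where v: "v = i - 1 \<or> v = i" "v \<noteq> f m" by blast
    have "(\<lambda>x. if lo f J i < x \<and> x < hi f J i then v else f x) \<notin> fibre k n A f"
      using i v(2) A(1) by (auto simp: fibre_def)
    then have "fibre k n A f \<noteq> fibre k n J f" using vary[OF i(1,2) v(1)] by blast
    then show ?thesis using A by (auto simp: N_def L_def)
  qed
  have N_cut: "\<exists>m \<in> chain.cuts. insert m L \<subseteq> K" if K: "K \<in> N" for K
  proof -
    have KP: "K \<in> coverable k n Z" and LK: "L \<subseteq> K" and ne: "fibre k n K f \<noteq> fibre k n J f"
      using K by (auto simp: N_def L_def)
    have Kn: "K \<subseteq> {..n}" using KP by (simp add: coverable_def)
    have "\<exists>m \<in> K. \<exists>i. 1 \<le> i \<and> i \<le> k \<and> lo f J i < m \<and> m < hi f J i"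
    proof (rule ccontr)
      assume no: "\<not> (\<exists>m \<in> K. \<exists>i. 1 \<le> i \<and> i \<le> k \<and> lo f J i < m \<and> m < hi f J i)"
      have "fibre k n K f = fibre k n J f"
      proof (rule fibre_unsplit[OF Kn])
        show "box_ends k f J \<subseteq> K" using LK by (simp add: L_def)
        fix x i assume x: "x \<in> K" and i: "1 \<le> i" "i \<le> k"
        show "x \<le> lo f J i \<or> hi f J i \<le> x"
        proof (rule ccontr)
          assume "\<not> (x \<le> lo f J i \<or> hi f J i \<le> x)"
          then have "1 \<le> i \<and> i \<le> k \<and> lo f J i < x \<and> x < hi f J i" using i by simp
          then have "\<exists>i. 1 \<le> i \<and> i \<le> k \<and> lo f J i < x \<and> x < hi f J i" by (rule exI)
          then have "\<exists>m \<in> K. \<exists>i. 1 \<le> i \<and> i \<le> k \<and> lo f J i < m \<and> m < hi f J i" using x by (rule bexI)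
          with no show False by (rule notE)
        qed
      qed
      with ne show False by (rule notE)
    qed
    then obtain m i where m: "m \<in> K" "1 \<le> i" "i \<le> k" "lo f J i < m" "m < hi f J i" by blast
    have "insert m L \<in> coverable k n Z" using coverable_down[OF KP, of "insert m L"] m(1) LK by auto
    then have "m \<in> chain.cuts" using m ends by (auto simp: chain.cuts_def coverable_def)
    then show ?thesis using m(1) LK by blast
  qed
  have cut_P: "insert m L \<in> coverable k n Z" if m: "m \<in> chain.cuts" for m
  proof -
    obtain i where i: "1 \<le> i" "i \<le> k" "m < hi f J i" and "pair_cost (insert m L - Z) \<le> k"
      using m ends by (auto simp: chain.cuts_def)
    then show ?thesis using lo_hi_le(2)[OF i(1,2)] LP by (auto simp: coverable_def)
  qed
  show "N \<noteq> {}" if ne: "fibre k n J f \<noteq> {f}"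
  proof -
    \<comment> \<open>If all boxes were narrow, the whole of \<open>{..n}\<close> would avoid their
      interiors and the fibre of \<open>J\<close> would be \<open>{f}\<close>.\<close>
    have "\<exists>i. chain.wide i"
    proof (rule ccontr)
      assume "\<nexists>i. chain.wide i"
      then have narrow: "hi f J i \<le> Suc (lo f J i)" if "1 \<le> i" "i \<le> k" for i
        using that by (auto simp: chain.wide_def not_less)
      have "fibre k n {..n} f = fibre k n J f"
      proof (rule fibre_unsplit)
        show "box_ends k f J \<subseteq> {..n}" using box_ends_sub J by blast
        show "x \<le> lo f J i \<or> hi f J i \<le> x" if "1 \<le> i" "i \<le> k" for x i
          using narrow[OF that] by linarith
      qed simp
      with ne show False using fibre_all[OF f] by simp
    qed
    then obtain m where "m \<in> chain.cuts" using chain.ex_cut by blast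
    then show ?thesis using cut_N[OF _ subset_refl cut_P] by blast
  qed
  let ?R = "{(X, Y). X \<in> N \<and> Y \<in> N \<and> (X \<subseteq> Y \<or> Y \<subseteq> X)}"
  have link: "(insert m L, insert m' L) \<in> ?R\<^sup>*" if "(m, m') \<in> chain.linked\<^sup>*" "m \<in> chain.cuts" for m m'
    using that
  proof (induction rule: rtrancl_induct)
    case (step x y)
    have xy: "x \<in> chain.cuts" "y \<in> chain.cuts" "pair_cost (insert x (insert y L) - Z) \<le> k"
      using step.hyps(2) ends by (auto simp: chain.linked_def)
    have both: "insert x (insert y L) \<in> coverable k n Z"
      using cut_P[OF xy(1)] cut_P[OF xy(2)] xy(3) by (auto simp: coverable_def)
    \<comment> \<open>A link between cuts becomes a zigzag of two inclusions through the common
      refinement.\<close>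
    have "(insert x L, insert x (insert y L)) \<in> ?R"
      using cut_N[OF xy(1) subset_refl cut_P[OF xy(1)]] cut_N[OF xy(1) _ both] by auto
    moreover have "(insert x (insert y L), insert y L) \<in> ?R"
      using cut_N[OF xy(2) subset_refl cut_P[OF xy(2)]] cut_N[OF xy(1) _ both] by auto
    ultimately show ?case using step.IH[OF step.prems] by (meson rtrancl.rtrancl_into_rtrancl)
  qed simp
  show "(K, K') \<in> ?R\<^sup>*" if K: "K \<in> N" and K': "K' \<in> N" for K K'
  proof -
    obtain m m' where m: "m \<in> chain.cuts" "insert m L \<subseteq> K" and m': "m' \<in> chain.cuts" "insert m' L \<subseteq> K'"
      using N_cut[OF K] N_cut[OF K'] by blast
    have "(K, insert m L) \<in> ?R" "(insert m' L, K') \<in> ?R"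
      using K K' m m' cut_N[OF m(1) subset_refl cut_P[OF m(1)]] cut_N[OF m'(1) subset_refl cut_P[OF m'(1)]] by auto
    then show ?thesis
      using link[OF chain.cuts_connected[OF m(1) m'(1)] m(1)]
      by (meson converse_rtrancl_into_rtrancl rtrancl.rtrancl_into_rtrancl)
  qed
qed

section \<open>The posets of the Segal conditions\<close>

text \<open>Parity pairs up \<open>I\<close> from the top: if an even number of elements of
  \<open>I\<close> lie above \<open>x > 0\<close> in \<open>I\<close>, then \<open>x - 1\<close> is
  in \<open>I\<close>, as otherwise it would be a gap with an odd number above. Only
  \<open>0\<close> can stay single, and then \<open>card I\<close> is odd.\<close>

lemma even_subset_cover:
  assumes I: "even_subset n I"
  obtains C where "finite C" "2 * card C \<le> card I" "I - {0} \<subseteq> C \<union> Suc ` C" "even (card I) \<longrightarrow> I \<subseteq> C \<union> Suc ` C"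
proof -
  have In: "I \<subseteq> {..n}" and gap: "\<And>j. \<lbrakk>j \<le> n; j \<notin> I\<rbrakk> \<Longrightarrow> even (card {i \<in> I. i > j})"
    using I by (auto simp: even_subset_def)
  have fin: "finite I" using In finite_subset by blast
  define C where "C = {x \<in> I. odd (card {y \<in> I. y > x})}"
  have pred: "x \<in> Suc ` C" if x: "x \<in> I" "even (card {y \<in> I. y > x})" "0 < x" for x
  proof -
    have "{i \<in> I. i > x - 1} = insert x {i \<in> I. i > x}" using x by auto
    then have "odd (card {i \<in> I. i > x - 1})" using x(2) fin by simp
    moreover have "x - 1 \<le> n" using x(1) In by auto
    ultimately have "x - 1 \<in> C" using gap[of "x - 1"] by (auto simp: C_def)
    then show ?thesis using x(3) by (intro image_eqI[of _ _ "x - 1"]) auto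
  qed
  have cov: "I - {0} \<subseteq> C \<union> Suc ` C" using pred by (auto simp: C_def)
  have "I \<subseteq> C \<union> Suc ` C" if "even (card I)"
  proof -
    have "0 \<in> C" if "0 \<in> I"
    proof -
      have "I = insert 0 {y \<in> I. y > 0}" using that by auto
      then have "card I = Suc (card {y \<in> I. y > 0})"
        using fin card_insert_disjoint[of "{y \<in> I. y > 0}" 0] by simp
      then show ?thesis using \<open>even (card I)\<close> that by (simp add: C_def)
    qed
    then show ?thesis using cov by blast
  qed
  moreover have "2 * card C \<le> card I"
  proof -
    \<comment> \<open>The upper partner of a lower element lies in \<open>I\<close> but not in
      \<open>C\<close>, so \<open>C\<close> is at most half of \<open>I\<close>.\<close>
    have "Suc x \<in> I - C" if x: "x \<in> C" for x
    proof -
      have xI: "x \<in> I" and o: "odd (card {y \<in> I. y > x})" using x by (auto simp: C_def)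
      then have "{y \<in> I. y > x} \<noteq> {}" by (metis card.empty even_zero)
      then have n: "Suc x \<le> n" using In by fastforce
      have SI: "Suc x \<in> I"
      proof (rule ccontr)
        assume "Suc x \<notin> I"
        moreover from this have "{y \<in> I. y > Suc x} = {y \<in> I. y > x}" by (auto intro: Suc_lessI)
        ultimately show False using gap[OF n] o by simp
      qed
      then have "{y \<in> I. y > x} = insert (Suc x) {y \<in> I. y > Suc x}" by (auto intro: Suc_lessI)
      then have "even (card {y \<in> I. y > Suc x})" using o fin by simp
      then show ?thesis using SI by (simp add: C_def)
    qed
    then have "card (Suc ` C) \<le> card (I - C)" using fin by (intro card_mono) auto
    moreover have "card (Suc ` C) = card C" by (simp add: card_image)
    moreover have "C \<subseteq> I" by (auto simp: C_def)
    then have "card (I - C) = card I - card C" "card C \<le> card I"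
      using fin by (auto intro: card_Diff_subset finite_subset card_mono)
    ultimately show ?thesis by linarith
  qed
  moreover have "finite C" using fin by (simp add: C_def)
  ultimately show thesis using that[of C] cov by simp
qed

text \<open>Induction from the top. If \<open>n\<close> is in \<open>J\<close>, the pair
  \<open>{n - 1, n}\<close> is spent on it and \<open>k - 1\<close> pairs remain for the part up to
  \<open>n - 2\<close>; otherwise \<open>n\<close> becomes a gap with nothing above it. Adding a
  whole pair at the top keeps the parity at all gaps below.\<close>

lemma ex_even_subset:
  assumes "pair_cost J \<le> k" "J \<subseteq> {..n}" "2 * k \<le> Suc n"
  shows "\<exists>I. even_subset n I \<and> card I = 2 * k \<and> J \<subseteq> I"
  using assms
proof (induction n arbitrary: k J rule: less_induct)
  case (less n)
  have "finite J" using less.prems(2) finite_subset by blast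
  then obtain C where C: "finite C" "card C = pair_cost J" "J \<subseteq> C \<union> Suc ` C" by (rule pair_cost_cover)
  consider (zero) "k = 0" | (all) "2 * k = Suc n" | (step) "1 \<le> k" "2 * k \<le> n" using less.prems(3) by linarith
  then show ?case
  proof cases
    case zero
    then have "J = {}" using C less.prems(1) by auto
    then show ?thesis using zero by (intro exI[of _ "{}"]) (simp add: even_subset_def)
  next
    case all
    then show ?thesis using less.prems(2) by (intro exI[of _ "{..n}"]) (simp add: even_subset_def)
  next
    case step
    show ?thesis
    proof (cases "n \<in> J")
      case False
      have "J \<subseteq> {..n - 1}"
      proof
        fix x assume "x \<in> J"
        then have "x \<le> n" "x \<noteq> n" using less.prems(2) False by auto
        then show "x \<in> {..n - 1}" by simp
      qed
      then obtain I where I: "even_subset (n - 1) I" "card I = 2 * k" "J \<subseteq> I"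
        using less.IH[of "n - 1" J k] less.prems(1) step by auto
      have "even (card {i \<in> I. i > j})" if j: "j \<in> {..n} - I" for j
      proof (cases "j = n")
        case True
        then have "{i \<in> I. i > j} = {}" using I(1) by (force simp: even_subset_def)
        then show ?thesis by (simp only: card.empty even_zero)
      next
        case False
        then have "j \<in> {..n - 1} - I" using j by auto
        then show ?thesis using I(1) by (simp add: even_subset_def)
      qed
      moreover have "I \<subseteq> {..n}" using I(1) by (auto simp: even_subset_def)
      ultimately show ?thesis using I by (auto simp: even_subset_def)
    next
      case True
      have n2: "2 \<le> n" using step by simp
      \<comment> \<open>The pair covering \<open>n\<close> contains nothing up to
        \<open>n - 2\<close>; dropping it lowers the cost of the remaining part.\<close>
      have "n \<in> C \<or> n - 1 \<in> C" using C(3) True by auto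
      then have "\<exists>x \<in> C. x \<notin> {..n - 2}" using n2 by (auto intro: bexI[of _ n] bexI[of _ "n - 1"])
      then have "C \<inter> {..n - 2} \<subset> C" by blast
      then have "card (C \<inter> {..n - 2}) < card C" using C(1) by (intro psubset_card_mono)
      moreover have "pair_cost (J \<inter> {..n - 2}) \<le> card (C \<inter> {..n - 2})"
        using C by (intro pair_cost_le) auto
      ultimately have cost: "pair_cost (J \<inter> {..n - 2}) \<le> k - 1" using C(2) less.prems(1) by linarith
      have "2 * (k - 1) \<le> Suc (n - 2)" using step by linarith
      then obtain I where I: "even_subset (n - 2) I" "card I = 2 * (k - 1)" "J \<inter> {..n - 2} \<subseteq> I"
        using less.IH[of "n - 2" "J \<inter> {..n - 2}" "k - 1"] cost n2 step by auto
      have In: "I \<subseteq> {..n - 2}" and fin: "finite I" using I(1) finite_subset by (auto simp: even_subset_def)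
      let ?I = "insert (n - 1) (insert n I)"
      have notin: "n - 1 \<notin> insert n I" "n \<notin> I" using In n2 by auto
      then have "card ?I = Suc (Suc (card I))" using fin by simp
      then have card: "card ?I = 2 * k" using I(2) step(1) by simp
      have "even (card {i \<in> ?I. i > j})" if j: "j \<in> {..n} - ?I" for j
      proof -
        have j': "j \<in> {..n - 2} - I" using j by auto
        have "{i \<in> ?I. i > j} = insert (n - 1) (insert n {i \<in> I. i > j})" using j' n2 by auto
        then have "card {i \<in> ?I. i > j} = Suc (Suc (card {i \<in> I. i > j}))" using notin fin by simp
        then show ?thesis using I(1) j' by (simp add: even_subset_def)
      qed
      moreover have "?I \<subseteq> {..n}" using In by auto
      moreover have "J \<subseteq> ?I"
      proof
        fix x assume x: "x \<in> J"
        then have "x \<le> n" using less.prems(2) by auto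
        then consider "x \<le> n - 2" | "x = n - 1" | "x = n" by linarith
        then show "x \<in> ?I" using x I(3) by cases auto
      qed
      ultimately show ?thesis using card by (intro exI[of _ ?I]) (simp add: even_subset_def)
    qed
  qed
qed

text \<open>Here the even subsets have \<open>2 * k\<close> elements, so no element stays
  unpaired.\<close>

lemma lower_poset_odd:
  assumes "1 \<le> k" "2 * k - 1 \<le> n"
  shows "lower_poset n (2 * k - 1) = coverable k n {}"
proof -
  have "J \<in> coverable k n {}" if J: "J \<noteq> {}" "J \<subseteq> I" and I: "even_subset n I" "card I = 2 * k" for J I
  proof -
    obtain C where C: "finite C" "2 * card C \<le> card I" "I - {0} \<subseteq> C \<union> Suc ` C"
      "even (card I) \<longrightarrow> I \<subseteq> C \<union> Suc ` C"
      using I(1) by (rule even_subset_cover)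
    have "pair_cost J \<le> card C" using C(1,4) I(2) J(2) by (intro pair_cost_le) auto
    then have "pair_cost J \<le> k" using C(2) I(2) by linarith
    moreover have "J \<subseteq> {..n}" using I(1) J(2) by (auto simp: even_subset_def)
    ultimately show ?thesis using J(1) by (simp add: coverable_def)
  qed
  moreover have "\<exists>I. even_subset n I \<and> card I = 2 * k \<and> J \<subseteq> I" if "J \<in> coverable k n {}" for J
    using that assms by (intro ex_even_subset) (auto simp: coverable_def)
  moreover have "2 * k - 1 + 1 = 2 * k" using assms(1) by simp
  ultimately show ?thesis by (auto simp: lower_poset_def) (auto simp: coverable_def)
qed

text \<open>An even subset with \<open>2 * k + 1\<close> elements is \<open>0\<close> together with
  \<open>k\<close> pairs, so \<open>0\<close> is covered for free. Conversely,
  \<open>J - {0}\<close> is shifted down by one, completed to \<open>2 * k\<close> elements, shifted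
  back, and \<open>0\<close> is added.\<close>

lemma lower_poset_even:
  assumes "2 * k \<le> n" "1 \<le> k"
  shows "lower_poset n (2 * k) = coverable k n {0}"
proof -
  have "J \<in> coverable k n {0}" if J: "J \<noteq> {}" "J \<subseteq> I" and I: "even_subset n I" "card I = 2 * k + 1" for J I
  proof -
    obtain C where C: "finite C" "2 * card C \<le> card I" "I - {0} \<subseteq> C \<union> Suc ` C"
      using I(1) by (rule even_subset_cover)
    have "pair_cost (J - {0}) \<le> card C" using C(1,3) J(2) by (intro pair_cost_le) auto
    then have "pair_cost (J - {0}) \<le> k" using C(2) I(2) by linarith
    moreover have "J \<subseteq> {..n}" using I(1) J(2) by (auto simp: even_subset_def)
    ultimately show ?thesis using J(1) by (simp add: coverable_def)
  qed
  moreover have "\<exists>I. even_subset n I \<and> card I = 2 * k + 1 \<and> J \<subseteq> I" if J: "J \<in> coverable k n {0}" for J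
  proof -
    have Jn: "J \<subseteq> {..n}" and cost: "pair_cost (J - {0}) \<le> k" using J by (auto simp: coverable_def)
    have "finite (J - {0})" using Jn finite_subset by blast
    then obtain C where C: "finite C" "card C = pair_cost (J - {0})" "J - {0} \<subseteq> C \<union> Suc ` C" by (rule pair_cost_cover)
    let ?p = "\<lambda>x. x - 1 :: nat"
    have "?p ` (J - {0}) \<subseteq> ?p ` C \<union> Suc ` ?p ` C"
    proof
      fix y assume "y \<in> ?p ` (J - {0})"
      then obtain x where x: "x \<in> J - {0}" "y = x - 1" by blast
      then consider "x \<in> C" | c where "c \<in> C" "x = Suc c" using C(3) by blast
      then show "y \<in> ?p ` C \<union> Suc ` ?p ` C"
      proof cases
        case 2
        \<comment> \<open>For \<open>c = 0\<close> truncated subtraction gives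
          \<open>x - 1 = 0 = c - 1\<close>, so \<open>y\<close> lies in the first set
          already.\<close>
        then show ?thesis using x(2) by (cases c) (auto intro: rev_image_eqI)
      qed (use x in auto)
    qed
    then have "pair_cost (?p ` (J - {0})) \<le> card (?p ` C)" using C(1) by (intro pair_cost_le) auto
    also have "\<dots> \<le> k" using card_image_le[OF C(1), of ?p] C(2) cost by simp
    finally have "pair_cost (?p ` (J - {0})) \<le> k" .
    moreover have "?p ` (J - {0}) \<subseteq> {..n - 1}" using Jn by (auto intro: diff_le_mono)
    moreover have "2 * k \<le> Suc (n - 1)" using assms by simp
    ultimately obtain I where I: "even_subset (n - 1) I" "card I = 2 * k" "?p ` (J - {0}) \<subseteq> I"
      using ex_even_subset[of "?p ` (J - {0})" k "n - 1"] by blast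
    let ?I = "insert 0 (Suc ` I)"
    have In: "I \<subseteq> {..n - 1}" and fin: "finite I" using I(1) finite_subset by (auto simp: even_subset_def)
    have "card ?I = 2 * k + 1" using fin I(2) by (simp add: card_image)
    moreover have "even (card {i \<in> ?I. i > j})" if j: "j \<in> {..n} - ?I" for j
    proof -
      obtain j' where j': "j = Suc j'" using j by (cases j) auto
      then have "j' \<in> {..n - 1} - I" using j by auto
      moreover have "{i \<in> ?I. i > j} = Suc ` {i \<in> I. i > j'}" using j' by auto
      ultimately show ?thesis using I(1) by (simp add: card_image even_subset_def)
    qed
    moreover have "?I \<subseteq> {..n}" using In assms by fastforce
    moreover have "J \<subseteq> ?I"
    proof
      fix x assume "x \<in> J"
      then show "x \<in> ?I" using I(3) by (cases x) auto
    qed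
    ultimately show ?thesis by (intro exI[of _ ?I]) (simp add: even_subset_def)
  qed
  ultimately show ?thesis by (auto simp: lower_poset_def) (auto simp: coverable_def)
qed

text \<open>Nothing lies above \<open>n\<close>, so \<open>n\<close> cannot be a gap of an odd
  subset. Removing it flips the parity at every gap and leaves an even subset of
  \<open>{..n - 1}\<close> with \<open>2 * k\<close> elements.\<close>

lemma upper_poset_even:
  assumes "2 * k \<le> n" "1 \<le> k"
  shows "upper_poset n (2 * k) = coverable k n {n}"
proof -
  have n: "1 \<le> n" using assms by simp
  have "J \<in> coverable k n {n}" if J: "J \<noteq> {}" "J \<subseteq> I" and I: "odd_subset n I" "card I = 2 * k + 1" for J I
  proof -
    have In: "I \<subseteq> {..n}" and fin: "finite I" using I(1) finite_subset by (auto simp: odd_subset_def)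
    have "{i \<in> I. i > n} = {}" using In by auto
    then have "even (card {i \<in> I. i > n})" by (simp only: card.empty even_zero)
    then have nI: "n \<in> I" using I(1) by (auto simp: odd_subset_def)
    have "even (card {i \<in> I - {n}. i > j})" if j: "j \<in> {..n - 1} - (I - {n})" for j
    proof -
      have j': "j \<in> {..n} - I" "j < n" using j n by auto
      have "{i \<in> I. i > j} = insert n {i \<in> I - {n}. i > j}" using nI j' by auto
      then have "card {i \<in> I. i > j} = Suc (card {i \<in> I - {n}. i > j})" using fin by simp
      moreover have "odd (card {i \<in> I. i > j})" using I(1) j'(1) by (simp add: odd_subset_def)
      ultimately show ?thesis by simp
    qed
    moreover have "I - {n} \<subseteq> {..n - 1}"
    proof
      fix x assume "x \<in> I - {n}"
      then have "x \<le> n" "x \<noteq> n" using In by auto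
      then show "x \<in> {..n - 1}" by simp
    qed
    ultimately have "even_subset (n - 1) (I - {n})" by (simp add: even_subset_def)
    then obtain C where C: "finite C" "2 * card C \<le> card (I - {n})" "I - {n} - {0} \<subseteq> C \<union> Suc ` C"
      "even (card (I - {n})) \<longrightarrow> I - {n} \<subseteq> C \<union> Suc ` C"
      by (rule even_subset_cover)
    have card: "card (I - {n}) = 2 * k" using I(2) nI fin by simp
    have "pair_cost (J - {n}) \<le> card C" using C(1,4) card J(2) by (intro pair_cost_le) auto
    then have "pair_cost (J - {n}) \<le> k" using C(2) card by linarith
    moreover have "J \<subseteq> {..n}" using In J(2) by auto
    ultimately show ?thesis using J(1) by (simp add: coverable_def)
  qed
  moreover have "\<exists>I. odd_subset n I \<and> card I = 2 * k + 1 \<and> J \<subseteq> I" if J: "J \<in> coverable k n {n}" for J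
  proof -
    have Jn: "J \<subseteq> {..n}" and cost: "pair_cost (J - {n}) \<le> k" using J by (auto simp: coverable_def)
    have "J - {n} \<subseteq> {..n - 1}"
    proof
      fix x assume "x \<in> J - {n}"
      then have "x \<le> n" "x \<noteq> n" using Jn by auto
      then show "x \<in> {..n - 1}" by simp
    qed
    then obtain I where I: "even_subset (n - 1) I" "card I = 2 * k" "J - {n} \<subseteq> I"
      using ex_even_subset[OF cost, of "n - 1"] assms n by auto
    have In: "I \<subseteq> {..n - 1}" and fin: "finite I" using I(1) finite_subset by (auto simp: even_subset_def)
    have nI: "n \<notin> I" using In n by auto
    have "odd (card {i \<in> insert n I. i > j})" if j: "j \<in> {..n} - insert n I" for j
    proof -
      have j': "j \<in> {..n - 1} - I" "j < n" using j by auto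
      have "{i \<in> insert n I. i > j} = insert n {i \<in> I. i > j}" using j' by auto
      then have "card {i \<in> insert n I. i > j} = Suc (card {i \<in> I. i > j})" using nI fin by simp
      then show ?thesis using I(1) j'(1) by (simp add: even_subset_def)
    qed
    moreover have "insert n I \<subseteq> {..n}" using In by auto
    moreover have "card (insert n I) = 2 * k + 1" using nI fin I(2) by simp
    moreover have "J \<subseteq> insert n I" using I(3) by auto
    ultimately show ?thesis by (intro exI[of _ "insert n I"]) (simp add: odd_subset_def)
  qed
  ultimately show ?thesis by (auto simp: upper_poset_def) (auto simp: coverable_def)
qed

section \<open>The simplicial sphere\<close>

lemma category_Delta: "category Delta"
  by (rule categoryI)
    (auto simp: Delta_def hom_def compose_def PiE_iff extensional_def restrict_def fun_eq_iff mono_on_def)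

lemma Delta_simps [simp]:
  "Obj Delta = UNIV" "Dom Delta (m, n, \<theta>) = m" "Cod Delta (m, n, \<theta>) = n"
  "(m, n, \<theta>) \<in> Arr Delta \<longleftrightarrow> \<theta> \<in> {..m} \<rightarrow>\<^sub>E {..n} \<and> mono_on {..m} \<theta>"
  "Ident Delta n = (n, n, restrict id {..n})"
  "Comp Delta (m', n, \<theta>) (l, m, \<phi>) = (l, n, compose {..l} \<theta> \<phi>)"
  by (auto simp: Delta_def)

lemma collapse_eq: "f \<in> simplices k n \<Longrightarrow> collapse k n f = (if f \<in> surjections k n then Some f else None)"
  by (auto simp: collapse_def boundary_simplices_def surjections_def)

lemma sphere_cells_eq: "sphere_cells k n = (insert None (Some ` surjections k n), None)"
  by (auto simp: sphere_cells_def collapse_def boundary_simplices_def surjections_def image_iff)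

lemma finite_surjections: "finite (surjections k n)"
  by (rule finite_subset[of _ "{..n} \<rightarrow>\<^sub>E {..k}"]) (auto simp: surjections_def simplices_def intro: finite_PiE)

lemma sphere_cells_obj: "sphere_cells k n \<in> Obj FinSet_ptd"
  by (simp add: sphere_cells_eq FinSet_ptd_def finite_surjections)

lemma compose_simplex:
  assumes "f \<in> simplices k n" "(m, n, \<theta>) \<in> Arr Delta"
  shows "compose {..m} f \<theta> \<in> simplices k m"
  using assms by (auto simp: simplices_def compose_def PiE_iff mono_on_def)

lemma sphere_map_None: "sphere_map k (m, n, \<theta>) None = None"
  by (simp add: sphere_map_def sphere_cells_eq)

lemma sphere_map_Some:
  assumes f: "f \<in> surjections k n" and \<theta>: "(m, n, \<theta>) \<in> Arr Delta"
  shows "sphere_map k (m, n, \<theta>) (Some f) =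
    (if compose {..m} f \<theta> \<in> surjections k m then Some (compose {..m} f \<theta>) else None)"
proof -
  have "f \<in> simplices k n" using f by (simp add: surjections_def)
  then show ?thesis
    using f by (simp add: sphere_map_def sphere_cells_eq collapse_eq[OF compose_simplex[OF _ \<theta>]])
qed

lemma sphere_map_fun:
  assumes "(m, n, \<theta>) \<in> Arr Delta"
  shows "sphere_map k (m, n, \<theta>) \<in> fst (sphere_cells k n) \<rightarrow>\<^sub>E fst (sphere_cells k m)"
proof
  fix s assume "s \<in> fst (sphere_cells k n)"
  then show "sphere_map k (m, n, \<theta>) s \<in> fst (sphere_cells k m)"
    using assms by (auto simp: sphere_cells_eq sphere_map_None sphere_map_Some simp del: Delta_simps)
qed (simp add: sphere_map_def)

text \<open>Used contrapositively: a collapsed cell stays collapsed under further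
  restriction.\<close>

lemma compose_surjection:
  assumes "compose {..m} f \<theta> \<in> surjections k m" "f \<in> simplices k n" "(m, n, \<theta>) \<in> Arr Delta"
  shows "f \<in> surjections k n"
proof -
  have "{..k} = compose {..m} f \<theta> ` {..m}" using assms(1) by (simp add: surjections_def)
  also have "\<dots> \<subseteq> f ` {..n}" using assms(3) by (auto simp: compose_def)
  finally show ?thesis using assms(2) by (auto simp: surjections_def simplices_def)
qed

lemma sphere_map_compose:
  assumes u: "(l, m, \<phi>) \<in> Arr Delta" and v: "(m, n, \<theta>) \<in> Arr Delta"
  shows "sphere_map k (l, n, compose {..l} \<theta> \<phi>) =
    compose (fst (sphere_cells k n)) (sphere_map k (l, m, \<phi>)) (sphere_map k (m, n, \<theta>))"
proof (rule extensionalityI[of _ "fst (sphere_cells k n)"])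
  have uv: "(l, n, compose {..l} \<theta> \<phi>) \<in> Arr Delta"
    using category.comp_hom[OF category_Delta, of "(l, m, \<phi>)" l m "(m, n, \<theta>)" n] u v by (simp add: hom_def)
  show "sphere_map k (l, n, compose {..l} \<theta> \<phi>) \<in> extensional (fst (sphere_cells k n))"
    using sphere_map_fun[OF uv] by (simp add: PiE_def)
  fix s assume s: "s \<in> fst (sphere_cells k n)"
  show "sphere_map k (l, n, compose {..l} \<theta> \<phi>) s =
      compose (fst (sphere_cells k n)) (sphere_map k (l, m, \<phi>)) (sphere_map k (m, n, \<theta>)) s"
  proof (cases s)
    case None
    then show ?thesis using s by (simp add: compose_eq sphere_map_None)
  next
    case (Some f)
    then have f: "f \<in> surjections k n" using s by (auto simp: sphere_cells_eq)
    have fs: "compose {..m} f \<theta> \<in> simplices k m" using compose_simplex[OF _ v] f by (simp add: surjections_def)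
    have assoc: "compose {..l} f (compose {..l} \<theta> \<phi>) = compose {..l} (compose {..m} f \<theta>) \<phi>"
      using u by (auto simp: compose_def fun_eq_iff PiE_iff)
    show ?thesis
    proof (cases "compose {..m} f \<theta> \<in> surjections k m")
      case True
      then show ?thesis
        using s Some by (simp add: compose_eq sphere_map_Some[OF f uv] sphere_map_Some[OF f v] sphere_map_Some[OF True u] assoc)
    next
      case False
      then have "compose {..l} (compose {..m} f \<theta>) \<phi> \<notin> surjections k l" using compose_surjection[OF _ fs u] by blast
      then show ?thesis
        using s Some False by (simp add: compose_eq sphere_map_Some[OF f uv] sphere_map_Some[OF f v] sphere_map_None assoc)
    qed
  qed
qed (simp add: compose_def)

lemma is_functor_sphere: "is_functor (op_cat Delta) FinSet_ptd (sphere k)"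
proof (rule is_functorI)
  show "omap (sphere k) n \<in> Obj FinSet_ptd" for n by (simp add: sphere_def sphere_cells_obj)
  fix u assume u: "u \<in> Arr (op_cat Delta)"
  obtain m n \<theta> where u': "u = (m, n, \<theta>)" by (cases u)
  have u: "(m, n, \<theta>) \<in> Arr Delta" using u u' by simp
  have am: "amap (sphere k) (m, n, \<theta>) = (sphere_cells k n, sphere_cells k m, sphere_map k (m, n, \<theta>))"
    if "(m, n, \<theta>) \<in> Arr Delta" for m n \<theta>
    unfolding sphere_def using that by (simp del: Delta_simps(4))
  show "amap (sphere k) u \<in> hom FinSet_ptd (omap (sphere k) (Dom (op_cat Delta) u)) (omap (sphere k) (Cod (op_cat Delta) u))"
    using am[OF u] sphere_map_fun[OF u, of k] sphere_cells_obj[of k m] sphere_cells_obj[of k n]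
    by (simp add: u' FinSet_ptd_hom sphere_def) (simp add: FinSet_ptd_def sphere_cells_eq sphere_map_None)
  fix v assume v: "v \<in> Arr (op_cat Delta)" "Dom (op_cat Delta) v = Cod (op_cat Delta) u"
  then obtain l \<phi> where v': "v = (l, m, \<phi>)" using u' by (cases v) auto
  have v: "(l, m, \<phi>) \<in> Arr Delta" using v v' by simp
  have uv: "(l, n, compose {..l} \<theta> \<phi>) \<in> Arr Delta"
    using category.comp_hom[OF category_Delta, of "(l, m, \<phi>)" l m "(m, n, \<theta>)" n] u v by (simp add: hom_def)
  show "amap (sphere k) (Comp (op_cat Delta) v u) = Comp FinSet_ptd (amap (sphere k) v) (amap (sphere k) u)"
    using sphere_map_compose[OF v u, of k] by (simp add: u' v' am[OF u] am[OF v] am[OF uv] FinSet_ptd_def)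
next
  fix n :: nat
  have "(n, n, restrict id {..n}) \<in> Arr Delta" by (auto simp: mono_on_def)
  then have i: "(n, n, restrict id {..n}) \<in> Arr Delta" and
    "amap (sphere k) (n, n, restrict id {..n}) = (sphere_cells k n, sphere_cells k n, sphere_map k (n, n, restrict id {..n}))"
    by (simp_all add: sphere_def del: Delta_simps(4))
  moreover have "sphere_map k (n, n, restrict id {..n}) = restrict id (fst (sphere_cells k n))"
  proof (rule extensionalityI[of _ "fst (sphere_cells k n)"])
    show "sphere_map k (n, n, restrict id {..n}) \<in> extensional (fst (sphere_cells k n))"
      using sphere_map_fun[OF i] by (simp add: PiE_def)
    fix s assume s: "s \<in> fst (sphere_cells k n)"
    have "compose {..n} f (restrict id {..n}) = f" if "f \<in> surjections k n" for f
      using surjectionsD(1)[OF that] by (auto simp: compose_def fun_eq_iff extensional_def)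
    then show "sphere_map k (n, n, restrict id {..n}) s = restrict id (fst (sphere_cells k n)) s"
      using s by (cases s) (auto simp: sphere_map_None sphere_map_Some[OF _ i] sphere_cells_eq)
  qed simp
  ultimately show "amap (sphere k) (Ident (op_cat Delta) n) = Ident FinSet_ptd (omap (sphere k) n)"
    by (simp add: sphere_def FinSet_ptd_def)
qed (auto simp: sphere_def category_op[OF category_Delta] category_FinSet_ptd)

text \<open>Enumerating a finite set in increasing order and counting smaller elements are inverse
  to each other; \<open>face_arrow\<close> combines the two.\<close>

lemma
  assumes J: "finite J"
  shows nth_sorted_in: "i < card J \<Longrightarrow> sorted_list_of_set J ! i \<in> J"
    and nth_sorted_image: "(\<lambda>i. sorted_list_of_set J ! i) ` {..<card J} = J"
    and card_less_nth: "i < card J \<Longrightarrow> card {y \<in> J. y < sorted_list_of_set J ! i} = i"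
    and nth_sorted_less: "\<lbrakk>i < j; j < card J\<rbrakk> \<Longrightarrow> sorted_list_of_set J ! i < sorted_list_of_set J ! j"
proof -
  let ?e = "\<lambda>i. sorted_list_of_set J ! i"
  have len: "length (sorted_list_of_set J) = card J" by simp
  show less: "?e i < ?e j" if "i < j" "j < card J" for i j
    using that sorted_wrt_nth_less[OF strict_sorted_list_of_set, of i j J] len by simp
  show im: "?e ` {..<card J} = J"
    using set_conv_nth[of "sorted_list_of_set J"] J by (auto simp: image_def)
  then show "i < card J \<Longrightarrow> ?e i \<in> J" by blast
  assume i: "i < card J"
  have "{y \<in> J. y < ?e i} = ?e ` {..<i}"
  proof
    show "?e ` {..<i} \<subseteq> {y \<in> J. y < ?e i}" using im less i by force
    show "{y \<in> J. y < ?e i} \<subseteq> ?e ` {..<i}"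
    proof
      fix y assume y: "y \<in> {y \<in> J. y < ?e i}"
      then obtain j where j: "j < card J" "y = ?e j" using im by blast
      have "\<not> i \<le> j" using less[of i j] j y by (cases "i = j") auto
      then show "y \<in> ?e ` {..<i}" using j by auto
    qed
  qed
  moreover have "inj_on ?e {..<i}"
    by (rule linorder_inj_onI) (use less i in \<open>auto simp: less_imp_neq\<close>)
  ultimately show "card {y \<in> J. y < ?e i} = i" by (simp add: card_image)
qed

lemma nth_card_less:
  assumes "finite K" "x \<in> K"
  shows "sorted_list_of_set K ! card {y \<in> K. y < x} = x"
proof -
  obtain i where "i < card K" "x = sorted_list_of_set K ! i"
    using nth_sorted_image[OF assms(1)] assms(2) by blast
  then show ?thesis using card_less_nth[OF assms(1)] by simp
qed

lemma face_arrow_in: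
  assumes "finite K" "J \<subseteq> K" "J \<noteq> {}"
  shows "face_arrow J K \<in> Arr Delta"
proof -
  have J: "finite J" using assms finite_subset by blast
  have cJ: "i < card J" if "i \<le> card J - 1" for i
    using that assms(3) J by (cases "card J") auto
  let ?e = "\<lambda>i. sorted_list_of_set J ! i"
  have "card {y \<in> K. y < ?e i} \<le> card K - 1" if "i \<le> card J - 1" for i
  proof -
    have "?e i \<in> K" using nth_sorted_in[OF J cJ[OF that]] assms(2) by blast
    then have "{y \<in> K. y < ?e i} \<subset> K" by blast
    from psubset_card_mono[OF assms(1) this] show ?thesis by linarith
  qed
  moreover have "card {y \<in> K. y < ?e i} \<le> card {y \<in> K. y < ?e j}" if "i \<le> j" "j \<le> card J - 1" for i j
  proof -
    have "?e i \<le> ?e j" using nth_sorted_less[OF J, of i j] cJ[OF that(2)] that(1) by (cases "i = j") auto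
    then show ?thesis using assms(1) by (intro card_mono) auto
  qed
  ultimately show ?thesis by (auto simp: face_arrow_def mono_on_def)
qed

lemma face_arrow_Dom_Cod [simp]: "Dom Delta (face_arrow J K) = card J - 1" "Cod Delta (face_arrow J K) = card K - 1"
  by (simp_all add: face_arrow_def)

lemma face_arrow_comp:
  assumes "finite L" "K \<subseteq> L" "J \<subseteq> K" "J \<noteq> {}"
  shows "Comp Delta (face_arrow K L) (face_arrow J K) = face_arrow J L"
proof -
  have K: "finite K" by (rule finite_subset[OF assms(2,1)])
  have J: "finite J" by (rule finite_subset[OF assms(3) K])
  have "card {y \<in> L. y < sorted_list_of_set K ! card {y \<in> K. y < sorted_list_of_set J ! i}}
      = card {y \<in> L. y < sorted_list_of_set J ! i}" if "i \<le> card J - 1" for i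
  proof -
    have "i < card J" using that assms(4) J by (cases "card J") auto
    then have "sorted_list_of_set J ! i \<in> K" using nth_sorted_in[OF J] assms(3) by blast
    then show ?thesis using nth_card_less[OF K] by simp
  qed
  moreover have "card {y \<in> K. y < sorted_list_of_set J ! i} \<le> card K - 1" if "i \<le> card J - 1" for i
    using face_arrow_in[OF K assms(3,4)] that by (auto simp: face_arrow_def PiE_iff)
  ultimately show ?thesis by (auto simp: face_arrow_def compose_def fun_eq_iff)
qed

lemma face_arrow_id:
  assumes "finite J" "J \<noteq> {}"
  shows "face_arrow J J = Ident Delta (card J - 1)"
proof -
  have "i < card J" if "i \<le> card J - 1" for i using that assms by (cases "card J") auto
  then show ?thesis using card_less_nth[OF assms(1)] by (auto simp: face_arrow_def fun_eq_iff)
qed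

lemma is_functor_face_fctr:
  assumes P: "\<And>J. J \<in> P \<Longrightarrow> finite J \<and> J \<noteq> {}"
  shows "is_functor (op_cat (subset_cat P)) (op_cat Delta) (face_fctr P)"
proof (rule is_functorI)
  fix u assume u: "u \<in> Arr (op_cat (subset_cat P))"
  obtain J K where u': "u = (J, K)" by (cases u)
  show "amap (face_fctr P) u \<in> hom (op_cat Delta) (omap (face_fctr P) (Dom (op_cat (subset_cat P)) u))
      (omap (face_fctr P) (Cod (op_cat (subset_cat P)) u))"
    using u face_arrow_in[of K J] P by (simp add: u' face_fctr_def hom_def del: Delta_simps)
  fix v assume v: "v \<in> Arr (op_cat (subset_cat P))" "Dom (op_cat (subset_cat P)) v = Cod (op_cat (subset_cat P)) u"
  then obtain I where v': "v = (I, J)" using u' by (cases v) auto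
  have "I \<subseteq> K" using u v by (auto simp: u' v')
  then show "amap (face_fctr P) (Comp (op_cat (subset_cat P)) v u)
      = Comp (op_cat Delta) (amap (face_fctr P) v) (amap (face_fctr P) u)"
    using u v P face_arrow_comp[of K J I] by (simp add: u' v' face_fctr_def)
qed (use P face_arrow_id in \<open>auto simp: face_fctr_def category_op category_subset_cat category_Delta simp del: Delta_simps\<close>,
  auto simp: op_cat_def)

lemma simplicial_segal_construction:
  assumes "category D"
  shows "simplicial_category (segal_construction k D)"
  unfolding simplicial_category_def segal_construction_def
  using is_functor_comp[OF is_functor_sphere is_functor_Sh_fctr[OF assms]] .

lemma segal_construction_simps:
  "omap (segal_construction k D) m = Sh D (sphere_cells k m)"
  "u \<in> Arr Delta \<Longrightarrow> fctr_of (amap (segal_construction k D) u)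
    = sheaf_push D (sphere_cells k (Cod Delta u)) (sphere_cells k (Dom Delta u)) (sphere_map k u)"
proof -
  show "omap (segal_construction k D) m = Sh D (sphere_cells k m)"
    using sphere_cells_obj[of k m] by (simp add: segal_construction_def Sh_fctr_def sphere_def)
  assume u: "u \<in> Arr Delta"
  then have "amap (sphere k) u \<in> Arr FinSet_ptd"
    using is_functorD(6)[OF is_functor_sphere, of u "Cod Delta u" "Dom Delta u" k] by (simp add: hom_def)
  then show "fctr_of (amap (segal_construction k D) u)
      = sheaf_push D (sphere_cells k (Cod Delta u)) (sphere_cells k (Dom Delta u)) (sphere_map k u)"
    using u by (simp add: segal_construction_def Sh_fctr_def sphere_def del: Delta_simps)
qed

section \<open>Restriction to faces\<close>

text \<open>In \<open>{..n}\<close> an element is its own rank, so \<open>face_arrow J {..n}\<close>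
  is just the enumeration of \<open>J\<close>.\<close>

lemma restriction_Some:
  assumes f: "f \<in> surjections k n" and J: "J \<subseteq> {..n}" "J \<noteq> {}"
  shows "sphere_map k (face_arrow J {..n}) (Some f) =
    (if f ` J = {..k} then Some (\<lambda>i \<in> {..card J - 1}. f (sorted_list_of_set J ! i)) else None)"
proof -
  have fin: "finite J" using finite_subset[OF J(1)] by simp
  define m where "m = card J - 1"
  have m: "card J = Suc m" using fin J(2) by (cases "card J") (auto simp: m_def)
  have range: "{..<card J} = {..m}" using m by auto
  let ?e = "\<lambda>i. sorted_list_of_set J ! i"
  have en: "?e i \<le> n" if "i \<le> m" for i using nth_sorted_in[OF fin, of i] that m J(1) by auto
  have "card {y \<in> {..n}. y < ?e i} = ?e i" if "i \<le> m" for i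
  proof -
    have "{y \<in> {..n}. y < ?e i} = {..<?e i}" using en[OF that] by auto
    then show ?thesis by simp
  qed
  then have fa: "face_arrow J {..n} = (m, n, \<lambda>i \<in> {..m}. ?e i)"
    by (auto simp: face_arrow_def m_def fun_eq_iff)
  have in_Delta: "(m, n, \<lambda>i \<in> {..m}. ?e i) \<in> Arr Delta" using face_arrow_in[of "{..n}" J] J fa by simp
  have comp: "compose {..m} f (\<lambda>i \<in> {..m}. ?e i) = (\<lambda>i \<in> {..m}. f (?e i))"
    by (auto simp: compose_def)
  have "(\<lambda>i \<in> {..m}. f (?e i)) \<in> simplices k m"
    using compose_simplex[OF _ in_Delta, of f k] f comp by (simp add: surjections_def)
  moreover have "(\<lambda>i \<in> {..m}. f (?e i)) ` {..m} = f ` ?e ` {..m}"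
    unfolding image_image by (rule image_cong) simp_all
  then have "(\<lambda>i \<in> {..m}. f (?e i)) ` {..m} = f ` J"
    using nth_sorted_image[OF fin] unfolding range by simp
  ultimately have "(\<lambda>i \<in> {..m}. f (?e i)) \<in> surjections k m \<longleftrightarrow> f ` J = {..k}"
    by (simp add: surjections_def)
  then show ?thesis
    unfolding fa sphere_map_Some[OF f in_Delta] comp by (simp add: m_def)
qed

lemma restriction_eq_iff:
  assumes f: "f \<in> surjections k n" and g: "g \<in> surjections k n" and J: "J \<subseteq> {..n}" "J \<noteq> {}"
    and onto: "f ` J = {..k}"
  shows "sphere_map k (face_arrow J {..n}) (Some g) = sphere_map k (face_arrow J {..n}) (Some f) \<longleftrightarrow> (\<forall>x \<in> J. g x = f x)"
proof -
  have fin: "finite J" using finite_subset[OF J(1)] by simp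
  let ?F = "\<lambda>h. \<lambda>i \<in> {..card J - 1}. h (sorted_list_of_set J ! i)"
  note rf = restriction_Some[OF f J] and rg = restriction_Some[OF g J]
  have e_in: "sorted_list_of_set J ! i \<in> J" if "i \<le> card J - 1" for i
    using nth_sorted_in[OF fin, of i] J(2) fin that by (cases "card J") auto
  show ?thesis
  proof
    assume "sphere_map k (face_arrow J {..n}) (Some g) = sphere_map k (face_arrow J {..n}) (Some f)"
    then have eq: "?F g = ?F f" using onto by (simp add: rf rg split: if_splits)
    show "\<forall>x \<in> J. g x = f x"
    proof
      fix x assume "x \<in> J"
      then obtain i where i: "i < card J" "x = sorted_list_of_set J ! i" using nth_sorted_image[OF fin] by blast
      then have "i \<le> card J - 1" by simp
      then show "g x = f x" using fun_cong[OF eq, of i] i(2) by simp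
    qed
  next
    assume eq: "\<forall>x \<in> J. g x = f x"
    then have "g ` J = f ` J" by simp
    moreover have "?F g = ?F f" using eq e_in by (intro restrict_ext) simp
    ultimately show "sphere_map k (face_arrow J {..n}) (Some g) = sphere_map k (face_arrow J {..n}) (Some f)"
      by (simp add: rf rg)
  qed
qed

text \<open>A cell on the face extends to \<open>{..n}\<close> by being held constant from each
  element of \<open>J\<close> up to the next.\<close>

lemma restriction_surj:
  assumes J: "J \<subseteq> {..n}" "J \<noteq> {}"
  shows "sphere_map k (face_arrow J {..n}) ` fst (sphere_cells k n) = fst (sphere_cells k (card J - 1))"
proof
  have fa: "face_arrow J {..n} \<in> Arr Delta" using face_arrow_in J by simp
  obtain \<theta> where \<theta>: "face_arrow J {..n} = (card J - 1, n, \<theta>)" by (simp add: face_arrow_def)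
  show "sphere_map k (face_arrow J {..n}) ` fst (sphere_cells k n) \<subseteq> fst (sphere_cells k (card J - 1))"
    using sphere_map_fun[of "card J - 1" n \<theta> k] fa \<theta> by (auto simp del: Delta_simps)
  have fin: "finite J" using finite_subset[OF J(1)] by simp
  define m where "m = card J - 1"
  have m: "card J = Suc m" using fin J(2) by (cases "card J") (auto simp: m_def)
  have "Some g \<in> sphere_map k (face_arrow J {..n}) ` fst (sphere_cells k n)" if g: "g \<in> surjections k m" for g
  proof -
    \<comment> \<open>\<open>?p x\<close> is the position of the last element of \<open>J\<close>
      that is at most \<open>x\<close>; before the first one, truncated subtraction gives
      \<open>0\<close>.\<close>
    let ?e = "\<lambda>i. sorted_list_of_set J ! i" and ?p = "\<lambda>x. card {y \<in> J. y \<le> x} - 1"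
    let ?f = "\<lambda>x \<in> {..n}. g (?p x)"
    have p_le: "?p x \<le> m" for x
      using card_mono[OF fin, of "{y \<in> J. y \<le> x}"] m by auto
    have p_mono: "?p x \<le> ?p y" if "x \<le> y" for x y
      by (intro diff_le_mono card_mono) (use fin that in auto)
    have p_e: "?p (?e i) = i" if "i \<le> m" for i
    proof -
      have i: "i < card J" using that m by simp
      have "{y \<in> J. y \<le> ?e i} = insert (?e i) {y \<in> J. y < ?e i}" using nth_sorted_in[OF fin i] by auto
      then show ?thesis using card_less_nth[OF fin i] fin by simp
    qed
    have e_n: "?e i \<le> n" if "i \<le> m" for i using nth_sorted_in[OF fin, of i] that m J(1) by auto
    have f_e: "?f (?e i) = g i" if "i \<le> m" for i using p_e[OF that] e_n[OF that] by simp
    have e_J: "?e ` {..m} = J" using nth_sorted_image[OF fin] m by (simp add: lessThan_Suc_atMost)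
    have "?f ` ?e ` {..m} = g ` {..m}" unfolding image_image by (rule image_cong[OF refl], rule f_e) simp
    then have onto: "?f ` J = {..k}" using surjectionsD(4)[OF g] unfolding e_J by simp
    have "?f \<in> surjections k n"
    proof (rule surjectionsI)
      show "?f x \<le> k" if "x \<le> n" for x using that surjectionsD(2)[OF g p_le] by simp
      show "?f x \<le> ?f y" if "x \<le> y" "y \<le> n" for x y
        using that surjectionsD(3)[OF g p_mono[OF that(1)] p_le] by simp
      show "{..k} \<subseteq> ?f ` {..n}" using onto J(1) by blast
    qed simp
    moreover from this have "sphere_map k (face_arrow J {..n}) (Some ?f) = Some g"
    proof -
      have "(\<lambda>i \<in> {..m}. ?f (?e i)) = g"
        by (rule extensionalityI[of _ "{..m}"]) (use f_e surjectionsD(1)[OF g] in auto)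
      then show ?thesis
        using restriction_Some[OF \<open>?f \<in> surjections k n\<close> J] onto unfolding m_def by simp
    qed
    ultimately show ?thesis by (intro image_eqI[of _ _ "Some ?f"]) (auto simp: sphere_cells_eq)
  qed
  moreover have "None \<in> sphere_map k (face_arrow J {..n}) ` fst (sphere_cells k n)"
    unfolding \<theta> by (rule image_eqI[of _ _ None]) (auto simp: sphere_map_None sphere_cells_eq)
  ultimately show "fst (sphere_cells k (card J - 1)) \<subseteq> sphere_map k (face_arrow J {..n}) ` fst (sphere_cells k n)"
    by (auto simp: sphere_cells_eq m_def)
qed

lemma restriction_comp:
  assumes "J \<subseteq> K" "K \<subseteq> {..n}" "J \<noteq> {}"
  shows "compose (fst (sphere_cells k n)) (sphere_map k (face_arrow J K)) (sphere_map k (face_arrow K {..n}))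
    = sphere_map k (face_arrow J {..n})"
proof -
  obtain \<theta> where \<theta>: "face_arrow K {..n} = (card K - 1, n, \<theta>)" by (simp add: face_arrow_def)
  obtain \<phi> where \<phi>: "face_arrow J K = (card J - 1, card K - 1, \<phi>)" by (simp add: face_arrow_def)
  have "K \<noteq> {}" "finite K" using assms finite_subset[OF assms(2)] by auto
  then have "face_arrow K {..n} \<in> Arr Delta" "face_arrow J K \<in> Arr Delta"
    using assms by (auto intro!: face_arrow_in simp del: Delta_simps)
  then have "sphere_map k (Comp Delta (face_arrow K {..n}) (face_arrow J K))
      = compose (fst (sphere_cells k n)) (sphere_map k (face_arrow J K)) (sphere_map k (face_arrow K {..n}))"
    using sphere_map_compose[of "card J - 1" "card K - 1" \<phi> n \<theta> k] unfolding \<theta> \<phi> by simp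
  then show ?thesis using face_arrow_comp[of "{..n}" K J] assms by simp
qed

text \<open>The bridge between the abstract cover and the combinatorics of jumps: blocks away from
  the base point are fibres.\<close>

lemma restriction_block:
  assumes f: "f \<in> surjections k n" and J: "J \<subseteq> {..n}" "J \<noteq> {}" and onto: "f ` J = {..k}"
  shows "{s \<in> fst (sphere_cells k n). sphere_map k (face_arrow J {..n}) s = sphere_map k (face_arrow J {..n}) (Some f)}
    = Some ` fibre k n J f"
proof -
  obtain \<theta> where \<theta>: "face_arrow J {..n} = (card J - 1, n, \<theta>)" by (simp add: face_arrow_def)
  have None: "sphere_map k (face_arrow J {..n}) None = None" unfolding \<theta> by (rule sphere_map_None)
  have "sphere_map k (face_arrow J {..n}) (Some f) \<noteq> None" using restriction_Some[OF f J] onto by simp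
  then show ?thesis
    using restriction_eq_iff[OF f _ J onto] None by (auto simp: sphere_cells_eq fibre_def)
qed

text \<open>One criterion for all three posets: the faces in \<open>coverable k n Z\<close> form a
  contractible cover of the \<open>n\<close>-cells of the sphere, to which \<open>descent\<close>
  applies.\<close>

lemma segal_condition_coverable:
  assumes k: "1 \<le> k" and D: "category D" and fp: "has_finite_products D"
  shows "segal_condition (segal_construction k D) n (coverable k n Z)"
proof -
  let ?P = "coverable k n Z" and ?X = "segal_construction k D"
  let ?r0 = "\<lambda>J. sphere_map k (face_arrow J {..n})" and ?A = "fst (sphere_cells k n)"
  have P: "J \<subseteq> {..n}" "J \<noteq> {}" "finite J" if "J \<in> ?P" for J
    using that finite_subset[of J "{..n}"] by (auto simp: coverable_def)
  have arr: "face_arrow J K \<in> Arr Delta" if "K \<in> ?P" "J \<subseteq> K" "J \<in> ?P" for J K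
    by (rule face_arrow_in[OF P(3)[OF that(1)] that(2) P(2)[OF that(3)]])
  have arr_n: "face_arrow J {..n} \<in> Arr Delta" if "J \<in> ?P" for J
    by (rule face_arrow_in[OF finite_atMost P(1)[OF that] P(2)[OF that]])
  have None: "sphere_map k (face_arrow J K) None = None" for J K
    unfolding face_arrow_def by (rule sphere_map_None)
  have comp: "compose ?A (sphere_map k (face_arrow J K)) (?r0 K) = ?r0 J" if "J \<in> ?P" "K \<in> ?P" "J \<subseteq> K" for J K
    using that P by (intro restriction_comp) auto
  interpret D: category D by (rule D)
  interpret cover: contractible_cover ?P ?A "snd (sphere_cells k n)" ?r0
  proof
    show "finite ?A" "snd (sphere_cells k n) \<in> ?A" by (simp_all add: sphere_cells_eq finite_surjections)
    fix J K s t assume JK: "J \<in> ?P" "K \<in> ?P" "J \<subseteq> K" and st: "s \<in> ?A" "t \<in> ?A" and eq: "?r0 K s = ?r0 K t"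
    then show "?r0 J s = ?r0 J t"
      using fun_cong[OF comp[OF JK], of s] fun_cong[OF comp[OF JK], of t] by (simp add: compose_eq)
  next
    fix t assume "t \<in> ?A" "t \<noteq> snd (sphere_cells k n)"
    then obtain f where t: "t = Some f" and f: "f \<in> surjections k n" by (auto simp: sphere_cells_eq)
    obtain J where J: "J \<in> ?P" "f ` J = {..k}" "fibre k n J f = {f}" using ex_unit_fibre[OF k f] by blast
    then show "\<exists>J \<in> ?P. {s \<in> ?A. ?r0 J s = ?r0 J t} = {t}"
      using restriction_block[OF f P(1,2)[OF J(1)] J(2)] unfolding t by (intro bexI[of _ J]) auto
  next
    fix J t assume J: "J \<in> ?P" and "t \<in> ?A" and ne: "?r0 J t \<noteq> ?r0 J (snd (sphere_cells k n))"
    then obtain f where t: "t = Some f" and f: "f \<in> surjections k n" using None by (auto simp: sphere_cells_eq)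
    have snd: "snd (sphere_cells k n) = None" by (simp add: sphere_cells_eq)
    have onto: "f ` J = {..k}"
      using ne restriction_Some[OF f P(1,2)[OF J]] None by (auto simp: t snd split: if_splits)
    let ?B = "\<lambda>K. {s \<in> ?A. ?r0 K s = ?r0 K t}"
    have block: "?B K = Some ` fibre k n K f" if "K \<in> ?P" "f ` K = {..k}" for K
      using restriction_block[OF f P(1,2)[OF that(1)] that(2)] unfolding t .
    \<comment> \<open>If \<open>f\<close> is not onto on \<open>K\<close>, its block over
      \<open>K\<close> contains the base point \<open>None\<close>, which its block over
      \<open>J\<close> does not.\<close>
    have onto_if: "f ` K = {..k}" if K: "K \<in> ?P" and sub: "?B K \<subseteq> ?B J" for K
    proof (rule ccontr)
      assume "f ` K \<noteq> {..k}"
      then have "?r0 K t = None" using restriction_Some[OF f P(1,2)[OF K]] by (simp add: t)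
      then have "None \<in> ?B K" using None by (simp add: sphere_cells_eq)
      then show False using sub block[OF J onto] by auto
    qed
    note R = coverable_refinement[OF k f J onto]
    define L where "L = box_ends k f J"
    define N where "N = {K \<in> ?P. L \<subseteq> K \<and> ?B K \<noteq> ?B L}"
    have L: "L \<in> ?P" "f ` L = {..k}" "fibre k n L f = fibre k n J f" using R(1-3) by (simp_all add: L_def)
    have BL: "?B L = ?B J" using block[OF L(1,2)] block[OF J onto] L(3) by simp
    have above: "f ` K = {..k}" if "K \<in> ?P" "L \<subseteq> K" for K
      using L(2) that(2) P(1)[OF that(1)] surjectionsD(4)[OF f] by blast
    have B_iff: "?B K \<noteq> ?B L \<longleftrightarrow> fibre k n K f \<noteq> fibre k n J f" if K: "K \<in> ?P" "L \<subseteq> K" for K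
      unfolding block[OF K(1) above[OF K]] block[OF L(1,2)] L(3) by (simp add: inj_image_eq_iff)
    have "N = {K \<in> ?P. box_ends k f J \<subseteq> K \<and> fibre k n K f \<noteq> fibre k n J f}"
      unfolding N_def L_def[symmetric] using B_iff by (intro Collect_cong) (metis (no_types, lifting))
    note R' = R(5,6)[folded this]
    have single: "?B J \<noteq> {t} \<Longrightarrow> fibre k n J f \<noteq> {f}" using block[OF J onto] by (auto simp: t)
    have least: "L \<subseteq> K" if K: "K \<in> ?P" and eq: "?B K = ?B J" for K
    proof -
      have onto_K: "f ` K = {..k}" by (rule onto_if[OF K equalityD1[OF eq]])
      have "Some ` fibre k n K f = Some ` fibre k n J f"
        unfolding block[OF K onto_K, symmetric] block[OF J onto, symmetric] by (rule eq)
      then have "fibre k n K f = fibre k n J f" by (simp add: inj_image_eq_iff)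
      then show ?thesis using R(4)[OF K onto_K] by (simp add: L_def)
    qed
    have "?B L = ?B J \<and> (\<forall>K \<in> ?P. ?B K = ?B J \<longrightarrow> L \<subseteq> K) \<and>
        (?B J \<noteq> {t} \<longrightarrow> N \<noteq> {} \<and> (\<forall>K \<in> N. \<forall>K' \<in> N. (K, K') \<in> {(X, Y). X \<in> N \<and> Y \<in> N \<and> (X \<subseteq> Y \<or> Y \<subseteq> X)}\<^sup>*))"
      by (intro conjI ballI impI) (fact BL, erule (1) least, (rule R'; (rule single)?; assumption)+)
    then show "\<exists>L \<in> ?P. ?B L = ?B J \<and> (\<forall>K \<in> ?P. ?B K = ?B J \<longrightarrow> L \<subseteq> K) \<and>
        (?B J \<noteq> {t} \<longrightarrow> (let N = {K \<in> ?P. L \<subseteq> K \<and> ?B K \<noteq> ?B L}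
          in N \<noteq> {} \<and> (\<forall>K \<in> N. \<forall>K' \<in> N. (K, K') \<in> {(X, Y). X \<in> N \<and> Y \<in> N \<and> (X \<subseteq> Y \<or> Y \<subseteq> X)}\<^sup>*)))"
      unfolding Let_def N_def using L(1) by (rule bexI)
  qed
  interpret sheaf_cover ?P "sphere_cells k n" ?r0 D "\<lambda>J. sphere_cells k (card J - 1)" "\<lambda>J K. sphere_map k (face_arrow J K)"
  proof
    show "has_finite_products D" by (rule fp)
    fix J assume J: "J \<in> ?P"
    show "snd (sphere_cells k (card J - 1)) \<in> fst (sphere_cells k (card J - 1))" by (simp add: sphere_cells_eq)
    show "?r0 J \<in> ?A \<rightarrow>\<^sub>E fst (sphere_cells k (card J - 1))"
    proof -
      obtain \<theta> where \<theta>: "face_arrow J {..n} = (card J - 1, n, \<theta>)" by (simp add: face_arrow_def)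
      show ?thesis using sphere_map_fun[of "card J - 1" n \<theta> k] arr_n[OF J] unfolding \<theta> .
    qed
    show "?r0 J (snd (sphere_cells k n)) = snd (sphere_cells k (card J - 1))" using None by (simp add: sphere_cells_eq)
    show "?r0 J ` ?A = fst (sphere_cells k (card J - 1))" by (rule restriction_surj[OF P(1,2)[OF J]])
    fix K assume "K \<in> ?P" "J \<subseteq> K"
    then show "sphere_map k (face_arrow J K) (snd (sphere_cells k (card K - 1))) = snd (sphere_cells k (card J - 1))"
      "compose ?A (sphere_map k (face_arrow J K)) (?r0 K) = ?r0 J"
      using None comp[OF J] by (simp_all add: sphere_cells_eq)
  qed
  let ?I = "op_cat (subset_cat ?P)"
  let ?G = "comp_fctr ?I ?X (face_fctr ?P)"
  have G: "is_functor ?I Cat ?G"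
    by (rule is_functor_comp[OF is_functor_face_fctr])
      (use P simplicial_segal_construction[OF D] in \<open>auto simp: simplicial_category_def\<close>)
  have "is_equivalence (Sh D (sphere_cells k n)) (pseudo_limit ?I ?G)
      (pslim_comparison ?I ?G (Sh D (sphere_cells k n)) (\<lambda>J. fctr_of (amap ?X (face_arrow J {..n}))))"
  proof (rule descent[OF G])
    show "omap ?G J = Sh D (sphere_cells k (card J - 1))" if "J \<in> ?P" for J
      using that by (simp add: face_fctr_def segal_construction_simps)
    show "fctr_of (amap ?G (J, K))
        = sheaf_push D (sphere_cells k (card K - 1)) (sphere_cells k (card J - 1)) (sphere_map k (face_arrow J K))"
      if "J \<in> ?P" "K \<in> ?P" "J \<subseteq> K" for J K
      using that segal_construction_simps(2)[OF arr[OF that(2,3,1)]] by (simp add: face_fctr_def)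
    show "fctr_of (amap ?X (face_arrow J {..n}))
        = sheaf_push D (sphere_cells k n) (sphere_cells k (card J - 1)) (sphere_map k (face_arrow J {..n}))"
      if "J \<in> ?P" for J
      using segal_construction_simps(2)[OF arr_n[OF that]] by simp
  qed
  then show ?thesis by (simp add: segal_condition_def Let_def segal_construction_simps)
qed

theorem theorem3p3:
  fixes D :: "('o, 'a) cat" and k :: nat
  assumes "k \<ge> 1"
    and "category D"
    and "finitely_cocomplete D"
    and "pointed_category D"
    and "has_finite_products D"
  shows "lower_segal_category (2 * k - 1) (segal_construction k D) \<and>
         fully_segal_category (2 * k) (segal_construction k D)"
proof -
  note segal = segal_condition_coverable[OF assms(1,2,5)] and simp = simplicial_segal_construction[OF assms(2)]
  have "lower_segal_category (2 * k - 1) (segal_construction k D)"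
    using segal simp lower_poset_odd[OF assms(1)] by (simp add: lower_segal_category_def)
  \<comment> \<open>Both conditions in degree \<open>2 * k\<close> come directly from the criterion,
    with \<open>Z\<close> equal to \<open>{0}\<close> or \<open>{n}\<close>, and are not deduced
    from the odd case.\<close>
  moreover have "lower_segal_category (2 * k) (segal_construction k D)"
    using segal simp lower_poset_even[OF _ assms(1)] by (simp add: lower_segal_category_def)
  moreover have "upper_segal_category (2 * k) (segal_construction k D)"
    using segal simp upper_poset_even[OF _ assms(1)] by (simp add: upper_segal_category_def)
  ultimately show ?thesis by (simp add: fully_segal_category_def)
qed

end
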